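(* (i) Let $\Delta\subset\mathbb{R}^2$ be any triangle with centroid at the origin and let $T=\mathrm{conv}(J\Delta\cup(-J\Delta+t))$ with $t\in -J(\partial\Delta)$. Then $\mathrm{int}(\Delta)\times\mathrm{int}(T)$ is symplectomorphic to an open Euclidean ball in $\mathbb{R}^4$. (ii) Let $\square\subset\mathbb{R}^2$ be any square with sides parallel to the coordinate axes. Then for all $a_1,a_2\in[0,1]$, $\mathrm{int}(\square)\times\mathrm{int}(\diamondsuit(a_1,a_2))$ is symplectomorphic to an open Euclidean ball in $\mathbb{R}^4$. (iii) Let $Q\subset\mathbb{R}^2$ be a trapezoid which is neither a triangle nor a parallelogram, written $Q=M(\diamondsuit(a_1,a_2))+c$ with $M\in GL_2(\mathbb{R})$, $c\in\mathbb{R}^2$, $a_1,a_2\in[0,1]$, and let $P=(M^T)^{-1}([0,1]^2)$. Then $\mathrm{int}(Q)\times\mathrm{int}(P)$ is symplectomorphic to an open Euclidean ball in $\mathbb{R}^4$.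
   Context: $\mathbb{R}^4=\mathbb{R}^2(x)\times\mathbb{R}^2(y)$ carries the standard symplectic form $\omega=dx_1\wedge dy_1+dx_2\wedge dy_2$; a symplectomorphism between open sets is a diffeomorphism pulling back $\omega$ to $\omega$. On $\mathbb{R}^2$, $J$ denotes the linear map $J(a,b)=(b,-a)$. For $a_1,a_2\in[0,1]$, $\diamondsuit(a_1,a_2)=\mathrm{conv}(([0,1]\times\{a_2\})\cup(\{a_1\}\times[0,1]))$. A trapezoid is a convex quadrilateral with at least one pair of parallel sides (triangles counted as degenerate trapezoids). *)

theory Defs
  imports "HOL-Analysis.Analysis"
begin

text \<open>R^2 is real^2; R^4 = R^2(x) \<times> R^2(y) is the product type (real^2) \<times> (real^2),
  whose norm is the Euclidean norm of R^4.\<close>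

coinductive smooth_on :: "'a::euclidean_space set \<Rightarrow> ('a \<Rightarrow> 'b::euclidean_space) \<Rightarrow> bool"
  for U :: "'a set" where
  "f differentiable_on U \<Longrightarrow>
   (\<forall>b\<in>Basis. smooth_on U (\<lambda>x. frechet_derivative f (at x) b)) \<Longrightarrow> smooth_on U f"

text \<open>Standard symplectic form dx1/\dy1 + dx2/\dy2 on R^4 = R^2(x) \<times> R^2(y).\<close>
definition omega :: "((real^2) \<times> (real^2)) \<Rightarrow> ((real^2) \<times> (real^2)) \<Rightarrow> real" where
  "omega v w = (fst v \<bullet> snd w) - (fst w \<bullet> snd v)"

definition symplectomorphic :: "((real^2) \<times> (real^2)) set \<Rightarrow> ((real^2) \<times> (real^2)) set \<Rightarrow> bool" where
  "symplectomorphic U V \<longleftrightarrow> open U \<and> open V \<and>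
     (\<exists>f g. (\<forall>x\<in>U. f x \<in> V \<and> g (f x) = x) \<and> (\<forall>y\<in>V. g y \<in> U \<and> f (g y) = y) \<and>
        smooth_on U f \<and> smooth_on V g \<and>
        (\<forall>x\<in>U. \<forall>v w. omega (frechet_derivative f (at x) v) (frechet_derivative f (at x) w)
                       = omega v w))"

definition J :: "real^2 \<Rightarrow> real^2" where
  "J v = vector [v$2, - (v$1)]"

definition diamond :: "real \<Rightarrow> real \<Rightarrow> (real^2) set" where
  "diamond a1 a2 = convex hull ({v. 0 \<le> v$1 \<and> v$1 \<le> 1 \<and> v$2 = a2} \<union>
                                 {v. v$1 = a1 \<and> 0 \<le> v$2 \<and> v$2 \<le> 1})"

definition parallel2 :: "real^2 \<Rightarrow> real^2 \<Rightarrow> bool" where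
  "parallel2 u v \<longleftrightarrow> u$1 * v$2 - u$2 * v$1 = 0"

definition is_triangle :: "(real^2) set \<Rightarrow> bool" where
  "is_triangle S \<longleftrightarrow> (\<exists>a b c. \<not> collinear {a, b, c} \<and> S = convex hull {a, b, c})"

text \<open>p1 p2 p3 p4 are the vertices, in cyclic order, of a (non-degenerate) convex
  quadrilateral: no three collinear and the diagonals p1p3, p2p4 meet.\<close>
definition convex_quad :: "real^2 \<Rightarrow> real^2 \<Rightarrow> real^2 \<Rightarrow> real^2 \<Rightarrow> bool" where
  "convex_quad p1 p2 p3 p4 \<longleftrightarrow>
     \<not> collinear {p1, p2, p3} \<and> \<not> collinear {p1, p2, p4} \<and>
     \<not> collinear {p1, p3, p4} \<and> \<not> collinear {p2, p3, p4} \<and>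
     closed_segment p1 p3 \<inter> closed_segment p2 p4 \<noteq> {}"

definition is_trapezoid :: "(real^2) set \<Rightarrow> bool" where
  "is_trapezoid S \<longleftrightarrow> is_triangle S \<or>
     (\<exists>p1 p2 p3 p4. convex_quad p1 p2 p3 p4 \<and> S = convex hull {p1, p2, p3, p4} \<and>
        (parallel2 (p2 - p1) (p3 - p4) \<or> parallel2 (p3 - p2) (p4 - p1)))"

definition is_parallelogram :: "(real^2) set \<Rightarrow> bool" where
  "is_parallelogram S \<longleftrightarrow>
     (\<exists>p1 p2 p3 p4. convex_quad p1 p2 p3 p4 \<and> S = convex hull {p1, p2, p3, p4} \<and>
        parallel2 (p2 - p1) (p3 - p4) \<and> parallel2 (p3 - p2) (p4 - p1))"

definition symp_ball :: "((real^2) \<times> (real^2)) set \<Rightarrow> bool" where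
  "symp_ball S \<longleftrightarrow> (\<exists>c r. r > 0 \<and> symplectomorphic S (ball c r))"

end

theory Submission
  imports Defs
begin

text \<open>
  Let \<open>e\<close> be the second coordinate of the diamond and \<open>t\<close> its conjugate coordinate. The product of a
  square and a diamond fibres over the \<open>(t, e)\<close>-square with fibre a rectangle of size \<open>1 \<times> c e\<close>,
  which the axis divides in the ratio \<open>a : 1 - a\<close>. Two facts allow to change \<open>a\<close> to \<open>0\<close>.
  Excision: removing an arc from each fibre which runs out to the boundary does not change the
  symplectic type; one pushes the domain outwards along the arcs, with a displacement that is damped
  near the boundary of the \<open>(t, e)\<close>-square. Folding: under an area-preserving version of the squaring
  map, the rectangles divided in the ratios \<open>a : 1 - a\<close> and \<open>0 : 1\<close> become the complements of the
  positive and of the negative half-axis in one and the same domain, so both are excisions of it.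
  Exchanging the two pairs of conjugate coordinates removes the second parameter of the diamond in
  the same way. What remains is the product of a square and a standard triangle, which in polar
  coordinates is the excision of a ray from each fibre of the ball. The three statements concern
  linear images of this product.
\<close>

section \<open>Smooth maps\<close>

text \<open>All maps are explicit, so that no flow has to be integrated. Three obstacles shape them.
  (1) If an arc depends on \<open>e\<close>, straightening it moves the conjugate coordinate
  \<open>t\<close>, which must stay between 0 and 1. The \<open>(t, e)\<close>-square is therefore
  traded for a disc of area 1 by the area-preserving \<open>kap\<close>. A damping that is radial in
  the disc produces an error proportional to the radial differential, and rotating the disc by a
  variable angle cancels this error exactly. High powers of the damping beat slopes of arcs that
  blow up as \<open>e\<close> tends to 0 or 1. (2) The squaring map identifies \<open>X\<close> with
  \<open>- X\<close>, so the two parts of the side to be folded must first get equal lengths. The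
  area-preserving map \<open>gn\<close> does this; it is linear near both parts, hence stays
  compatible with the gluing. (3) The width of a diamond is a minimum of two affine functions of
  \<open>e\<close> and has a corner, whereas the arcs must be smooth in \<open>e\<close>. Only their
  end point may have the corner: they run through the smaller root of a quadratic equation whose
  discriminant vanishes at most in the limit.\<close>

fun Cn :: "nat \<Rightarrow> 'a::euclidean_space set \<Rightarrow> ('a \<Rightarrow> 'b::euclidean_space) \<Rightarrow> bool" where
  "Cn 0 U f = True"
| "Cn (Suc n) U f \<longleftrightarrow> f differentiable_on U \<and>
     (\<forall>b\<in>Basis. Cn n U (\<lambda>x. frechet_derivative f (at x) b))"

lemma smooth_on_imp_Cn: "smooth_on U f \<Longrightarrow> Cn n U f"
proof (induction n arbitrary: f)
  case (Suc n)
  from Suc.prems show ?case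
    by (cases rule: smooth_on.cases) (auto intro: Suc.IH)
qed simp

text \<open>Product and chain rule turn one function into a sum of several, so direct coinduction
  would have to be carried out up to sums and products. Grading by the order makes each closure
  property an ordinary induction.\<close>

lemma smooth_on_iff_Cn: "smooth_on U f \<longleftrightarrow> (\<forall>n. Cn n U f)"
proof
  assume "\<forall>n. Cn n U f"
  then show "smooth_on U f"
  proof (coinduction arbitrary: f)
    case (smooth_on f)
    then have "Cn (Suc 0) U f" "\<And>n. Cn (Suc n) U f" by blast+
    then show ?case by auto
  qed
qed (auto intro: smooth_on_imp_Cn)

lemma smooth_onI: "(\<And>n. Cn n U f) \<Longrightarrow> smooth_on U f"
  by (simp add: smooth_on_iff_Cn)

lemma Cn_D:
  assumes "open U" "Cn (Suc n) U f" "x \<in> U"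
  shows "(f has_derivative frechet_derivative f (at x)) (at x)"
  using assms
  by (simp add: differentiable_on_eq_differentiable_at frechet_derivative_works [symmetric])

lemma Cn_mono: "Cn (Suc n) U f \<Longrightarrow> Cn n U f"
proof (induction n arbitrary: f)
  case (Suc n)
  then have "f differentiable_on U"
    "\<And>b. b \<in> Basis \<Longrightarrow> Cn (Suc n) U (\<lambda>x. frechet_derivative f (at x) b)" by (simp_all del: Cn.simps add: Cn.simps(2)[of "Suc n"])
  then show ?case using Suc.IH by simp
qed simp

lemma Cn_cong:
  assumes "open U"
  shows "Cn n U f \<Longrightarrow> (\<And>x. x \<in> U \<Longrightarrow> f x = g x) \<Longrightarrow> Cn n U g"
proof (induction n arbitrary: f g)
  case (Suc n)
  have D: "(g has_derivative frechet_derivative f (at x)) (at x)" if "x \<in> U" for x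
    by (rule has_derivative_transform_within_open
          [OF Cn_D [OF assms Suc.prems(1) that] assms that]) (use Suc.prems(2) in auto)
  have "frechet_derivative f (at x) = frechet_derivative g (at x)" if "x \<in> U" for x
    using frechet_derivative_at [OF D [OF that]] .
  moreover have "g differentiable_on U"
    using D by (auto simp: differentiable_on_eq_differentiable_at [OF assms] differentiable_def)
  ultimately show ?case
    using Suc.prems(1) by (auto intro: Suc.IH)
qed simp

lemma Cn_SucI:
  assumes "open U"
    and D: "\<And>x. x \<in> U \<Longrightarrow> (f has_derivative f' x) (at x)"
    and "\<And>b. b \<in> Basis \<Longrightarrow> Cn n U (\<lambda>x. f' x b)"
  shows "Cn (Suc n) U f"
proof -
  have "f differentiable_on U"
    using D by (auto simp: differentiable_on_eq_differentiable_at [OF assms(1)] differentiable_def)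
  moreover have "Cn n U (\<lambda>x. frechet_derivative f (at x) b)" if "b \<in> Basis" for b
    by (rule Cn_cong [OF assms(1) assms(3) [OF that]]) (simp add: frechet_derivative_at [OF D])
  ultimately show ?thesis by simp
qed

lemma Cn_derivative:
  assumes "open U" "Cn (Suc n) U f" "b \<in> Basis"
  shows "Cn n U (\<lambda>x. frechet_derivative f (at x) b)"
  using assms by simp

lemma Cn_const: "open U \<Longrightarrow> Cn n U (\<lambda>x. c)"
proof (induction n arbitrary: c)
  case (Suc n)
  show ?case
    by (rule Cn_SucI [OF Suc.prems has_derivative_const]) (use Suc in auto)
qed simp

lemma Cn_linear:
  assumes "open U" "bounded_linear f"
  shows "Cn n U f"
proof (cases n)
  case (Suc m)
  show ?thesis unfolding Suc
    by (rule Cn_SucI [OF assms(1) bounded_linear_imp_has_derivative [OF assms(2)]])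
      (rule Cn_const [OF assms(1)])
qed simp

lemma Cn_add:
  assumes "open U"
  shows "Cn n U f \<Longrightarrow> Cn n U g \<Longrightarrow> Cn n U (\<lambda>x. f x + g x)"
proof (induction n arbitrary: f g)
  case (Suc n)
  show ?case
    by (rule Cn_SucI [OF assms has_derivative_add [OF Cn_D Cn_D]])
      (use Suc assms in auto)
qed simp

lemma Cn_sum:
  assumes "open U" "finite I" "\<And>i. i \<in> I \<Longrightarrow> Cn n U (f i)"
  shows "Cn n U (\<lambda>x. \<Sum>i\<in>I. f i x)"
  using assms(2,3)
  by (induction I rule: finite_induct) (auto intro: Cn_const Cn_add assms(1))

lemma Cn_linear_compose:
  assumes "open U" "bounded_linear L"
  shows "Cn n U f \<Longrightarrow> Cn n U (\<lambda>x. L (f x))"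
proof (induction n arbitrary: f)
  case (Suc n)
  show ?case
    by (rule Cn_SucI [OF assms(1) bounded_linear.has_derivative [OF assms(2) Cn_D]])
      (use Suc assms in auto)
qed simp

lemma Cn_bilinear:
  fixes prod :: "'b::euclidean_space \<Rightarrow> 'c::euclidean_space \<Rightarrow> 'd::euclidean_space"
  assumes "open U" and "bounded_bilinear prod"
  shows "Cn n U f \<Longrightarrow> Cn n U g \<Longrightarrow> Cn n U (\<lambda>x. prod (f x) (g x))"
proof (induction n arbitrary: f g)
  case (Suc n)
  show ?case
    by (rule Cn_SucI [OF assms(1) bounded_bilinear.FDERIV [OF assms(2) Cn_D Cn_D]])
      (use Suc assms in \<open>auto intro!: Cn_add intro: Suc.IH Cn_mono simp del: Cn.simps
        simp: Cn_derivative\<close>)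
qed simp

lemma derivative_eq_sum_Basis:
  assumes "(f has_derivative f') F"
  shows "f' v = (\<Sum>i\<in>Basis. (v \<bullet> i) *\<^sub>R f' i)"
proof -
  interpret bounded_linear f' by (rule has_derivative_bounded_linear [OF assms])
  have "f' v = f' (\<Sum>i\<in>Basis. (v \<bullet> i) *\<^sub>R i)" by (simp add: euclidean_representation)
  also have "\<dots> = (\<Sum>i\<in>Basis. (v \<bullet> i) *\<^sub>R f' i)" by (simp add: sum scaleR)
  finally show ?thesis .
qed

text \<open>The derivative of the composition is expanded in the basis of the middle space. The
  derivative of \<open>f\<close> at \<open>g x\<close> is then seen only through its values on basis
  vectors, and to these functions of \<open>g x\<close> the induction hypothesis applies.\<close>

lemma Cn_compose:
  assumes "open U" "open V"
  shows "Cn n V f \<Longrightarrow> Cn n U g \<Longrightarrow> (\<And>x. x \<in> U \<Longrightarrow> g x \<in> V) \<Longrightarrow> Cn n U (\<lambda>x. f (g x))"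
proof (induction n arbitrary: f g)
  case (Suc n)
  have D: "((\<lambda>x. f (g x)) has_derivative
      (\<lambda>v. \<Sum>i\<in>Basis. (frechet_derivative g (at x) v \<bullet> i) *\<^sub>R frechet_derivative f (at (g x)) i))
      (at x)" if "x \<in> U" for x
    using has_derivative_compose [OF Cn_D [OF assms(1) Suc.prems(2) that]
        Cn_D [OF assms(2) Suc.prems(1) Suc.prems(3) [OF that]]]
    by (subst (asm) derivative_eq_sum_Basis [OF Cn_D [OF assms(2) Suc.prems(1) Suc.prems(3) [OF that]]])
  show ?case
  proof (rule Cn_SucI [OF assms(1) D])
    fix b :: 'a assume b: "b \<in> Basis"
    show "Cn n U (\<lambda>x. \<Sum>i\<in>Basis. (frechet_derivative g (at x) b \<bullet> i) *\<^sub>R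
        frechet_derivative f (at (g x)) i)"
    proof (intro Cn_sum Cn_bilinear [OF assms(1) bounded_bilinear_scaleR] assms(1) finite_Basis)
      fix i :: 'b assume i: "i \<in> Basis"
      show "Cn n U (\<lambda>x. frechet_derivative g (at x) b \<bullet> i)"
        using Suc.prems(2) b
        by (auto intro!: Cn_linear_compose [OF assms(1) bounded_linear_inner_left])
      show "Cn n U (\<lambda>x. frechet_derivative f (at (g x)) i)"
        by (rule Suc.IH [OF _ Cn_mono [OF Suc.prems(2)] Suc.prems(3)])
          (use Suc.prems(1) i in auto)
    qed
  qed
qed simp

lemma smooth_on_has_derivative:
  assumes "open U" "smooth_on U f" "x \<in> U"
  shows "(f has_derivative frechet_derivative f (at x)) (at x)"
  using Cn_D [OF assms(1) smooth_on_imp_Cn [OF assms(2), of "Suc 0"] assms(3)] .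

lemma smooth_on_continuous_on:
  assumes "open U" "smooth_on U f"
  shows "continuous_on U f"
  using has_derivative_continuous [OF smooth_on_has_derivative [OF assms]]
  by (simp add: continuous_on_eq_continuous_at [OF assms(1)])

lemma smooth_on_cong:
  "open U \<Longrightarrow> smooth_on U f \<Longrightarrow> (\<And>x. x \<in> U \<Longrightarrow> f x = g x) \<Longrightarrow> smooth_on U g"
  by (auto simp: smooth_on_iff_Cn intro: Cn_cong)

lemma smooth_on_subset:
  assumes "smooth_on U f" "V \<subseteq> U"
  shows "smooth_on V f"
proof (rule smooth_onI)
  have "Cn n U f \<Longrightarrow> V \<subseteq> U \<Longrightarrow> Cn n V f" for n
    by (induction n arbitrary: f) (auto intro: differentiable_on_subset)
  then show "Cn n V f" for n using assms by (auto simp: smooth_on_iff_Cn)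
qed

lemma Cn_Un:
  assumes "open U" "open V"
  shows "Cn n U f \<Longrightarrow> Cn n V f \<Longrightarrow> Cn n (U \<union> V) f"
proof (induction n arbitrary: f)
  case (Suc n)
  then show ?case
    using assms
    by (auto simp: differentiable_on_eq_differentiable_at open_Un)
qed simp

lemma smooth_on_Un:
  "open U \<Longrightarrow> open V \<Longrightarrow> smooth_on U f \<Longrightarrow> smooth_on V f \<Longrightarrow> smooth_on (U \<union> V) f"
  by (auto simp: smooth_on_iff_Cn intro: Cn_Un)

lemma smooth_on_compose:
  assumes "open U" "open V" "smooth_on V f" "smooth_on U g" "\<And>x. x \<in> U \<Longrightarrow> g x \<in> V"
  shows "smooth_on U (\<lambda>x. f (g x))"
  using assms by (auto simp: smooth_on_iff_Cn intro: Cn_compose)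

lemma smooth_on_linear: "open U \<Longrightarrow> bounded_linear f \<Longrightarrow> smooth_on U f"
  by (auto simp: smooth_on_iff_Cn intro: Cn_linear)

lemma smooth_on_linear_compose:
  "open U \<Longrightarrow> bounded_linear L \<Longrightarrow> smooth_on U f \<Longrightarrow> smooth_on U (\<lambda>x. L (f x))"
  by (auto simp: smooth_on_iff_Cn intro: Cn_linear_compose)

lemma smooth_on_bilinear:
  "open U \<Longrightarrow> bounded_bilinear h \<Longrightarrow> smooth_on U f \<Longrightarrow> smooth_on U g \<Longrightarrow>
    smooth_on U (\<lambda>x. h (f x) (g x))"
  by (auto simp: smooth_on_iff_Cn intro: Cn_bilinear)

named_theorems smooth_intros

lemma smooth_on_const [smooth_intros]: "open U \<Longrightarrow> smooth_on U (\<lambda>x. c)"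
  by (auto simp: smooth_on_iff_Cn intro: Cn_const)

lemma smooth_on_id [smooth_intros]: "open U \<Longrightarrow> smooth_on U (\<lambda>x. x)"
  by (rule smooth_on_linear [OF _ bounded_linear_ident])

lemma smooth_on_add [smooth_intros]:
  "open U \<Longrightarrow> smooth_on U f \<Longrightarrow> smooth_on U g \<Longrightarrow> smooth_on U (\<lambda>x. f x + g x)"
  by (auto simp: smooth_on_iff_Cn intro: Cn_add)

lemma smooth_on_uminus [smooth_intros]:
  "open U \<Longrightarrow> smooth_on U f \<Longrightarrow> smooth_on U (\<lambda>x. - f x)"
  by (rule smooth_on_linear_compose [OF _ bounded_linear_minus [OF bounded_linear_ident]])

lemma smooth_on_diff [smooth_intros]:
  "open U \<Longrightarrow> smooth_on U f \<Longrightarrow> smooth_on U g \<Longrightarrow> smooth_on U (\<lambda>x. f x - g x)"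
  using smooth_on_add [of U f "\<lambda>x. - g x"] smooth_on_uminus [of U g] by simp

lemma smooth_on_mult [smooth_intros]:
  fixes f g :: "'a::euclidean_space \<Rightarrow> real"
  shows "open U \<Longrightarrow> smooth_on U f \<Longrightarrow> smooth_on U g \<Longrightarrow> smooth_on U (\<lambda>x. f x * g x)"
  by (rule smooth_on_bilinear [OF _ bounded_bilinear_mult])

lemma smooth_on_scaleR [smooth_intros]:
  "open U \<Longrightarrow> smooth_on U f \<Longrightarrow> smooth_on U g \<Longrightarrow> smooth_on U (\<lambda>x. f x *\<^sub>R g x)"
  by (rule smooth_on_bilinear [OF _ bounded_bilinear_scaleR])

lemma smooth_on_power [smooth_intros]:
  fixes f :: "'a::euclidean_space \<Rightarrow> real"
  shows "open U \<Longrightarrow> smooth_on U f \<Longrightarrow> smooth_on U (\<lambda>x. f x ^ n)"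
  by (induction n) (auto intro!: smooth_intros)

lemma smooth_on_fst [smooth_intros]:
  "open U \<Longrightarrow> smooth_on U f \<Longrightarrow> smooth_on U (\<lambda>x. fst (f x))"
  by (rule smooth_on_linear_compose [OF _ bounded_linear_fst])

lemma smooth_on_snd [smooth_intros]:
  "open U \<Longrightarrow> smooth_on U f \<Longrightarrow> smooth_on U (\<lambda>x. snd (f x))"
  by (rule smooth_on_linear_compose [OF _ bounded_linear_snd])

lemma smooth_on_Pair [smooth_intros]:
  assumes "open U" "smooth_on U f" "smooth_on U g"
  shows "smooth_on U (\<lambda>x. (f x, g x))"
proof -
  have "smooth_on U (\<lambda>x. (f x, 0) + (0, g x))"
    by (intro smooth_on_add assms
        smooth_on_linear_compose [OF _ bounded_linear_Pair [OF bounded_linear_ident bounded_linear_zero]]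
        smooth_on_linear_compose [OF _ bounded_linear_Pair [OF bounded_linear_zero bounded_linear_ident]])
  then show ?thesis by simp
qed

text \<open>If the derivative is a smooth function of the point and of the value, each order of
  differentiability of \<open>f\<close> yields the next one. This gives smoothness of
  \<open>exp\<close>, \<open>sqrt\<close>, \<open>cos\<close>, \<open>sin\<close> and of inverse
  maps.\<close>

lemma Cn_bootstrap:
  assumes "open U" "open V"
    and D: "\<And>x. x \<in> U \<Longrightarrow> (f has_derivative f' x) (at x)"
    and G: "\<And>b. b \<in> Basis \<Longrightarrow> smooth_on V (G b)"
    and V: "\<And>x. x \<in> U \<Longrightarrow> (x, f x) \<in> V"
    and eq: "\<And>x b. x \<in> U \<Longrightarrow> b \<in> Basis \<Longrightarrow> f' x b = G b (x, f x)"
  shows "Cn n U f"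
proof (induction n)
  case (Suc n)
  have *: "Cn n U (\<lambda>x. (x, f x))"
  proof -
    have "Cn n U (\<lambda>x. (x, 0::'b) + (0::'a, f x))"
      by (intro Cn_add assms(1) Suc
        Cn_linear [OF _ bounded_linear_Pair [OF bounded_linear_ident bounded_linear_zero]]
        Cn_linear_compose [OF _ bounded_linear_Pair [OF bounded_linear_zero bounded_linear_ident]])
    then show ?thesis by simp
  qed
  show ?case
  proof (rule Cn_SucI [OF assms(1) D])
    fix b :: 'a assume b: "b \<in> Basis"
    have "Cn n U (\<lambda>x. G b (x, f x))"
      by (rule Cn_compose [OF assms(1,2) smooth_on_imp_Cn [OF G [OF b]] * V])
    then show "Cn n U (\<lambda>x. f' x b)"
      by (rule Cn_cong [OF assms(1)]) (simp add: eq b)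
  qed
qed simp

lemma smooth_on_bootstrap:
  assumes "open U" "open V"
    and "\<And>x. x \<in> U \<Longrightarrow> (f has_derivative f' x) (at x)"
    and "\<And>b. b \<in> Basis \<Longrightarrow> smooth_on V (G b)"
    and "\<And>x. x \<in> U \<Longrightarrow> (x, f x) \<in> V"
    and "\<And>x b. x \<in> U \<Longrightarrow> b \<in> Basis \<Longrightarrow> f' x b = G b (x, f x)"
  shows "smooth_on U f"
  by (rule smooth_onI, rule Cn_bootstrap [OF assms])

lemma smooth_on_derivative:
  assumes "open U" "\<And>x. x \<in> U \<Longrightarrow> (f has_derivative f' x) (at x)"
    "\<And>b. b \<in> Basis \<Longrightarrow> smooth_on U (\<lambda>x. f' x b)"
  shows "smooth_on U f"
proof (rule smooth_onI)
  fix n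
  have "Cn (Suc n) U f"
    by (rule Cn_SucI [OF assms(1,2)]) (auto intro: smooth_on_imp_Cn assms(3))
  then show "Cn n U f" by (rule Cn_mono)
qed

lemma smooth_on_real_derivative:
  fixes f :: "real \<Rightarrow> real"
  assumes "open U" "\<And>x. x \<in> U \<Longrightarrow> (f has_real_derivative f' x) (at x)" "smooth_on U f'"
  shows "smooth_on U f"
  by (rule smooth_on_derivative [OF assms(1) assms(2) [unfolded has_field_derivative_def]])
     (use assms in auto)

lemma smooth_on_real_bootstrap:
  fixes f :: "real \<Rightarrow> real"
  assumes "open U" "open V" "\<And>x. x \<in> U \<Longrightarrow> (f has_real_derivative G (f x)) (at x)"
    "smooth_on V G" "\<And>x. x \<in> U \<Longrightarrow> f x \<in> V"
  shows "smooth_on U f"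
proof (rule smooth_on_bootstrap [OF assms(1) open_Times [OF open_UNIV assms(2)]
      assms(3) [unfolded has_field_derivative_def], where G = "\<lambda>b p. G (snd p)"])
  show "smooth_on (UNIV \<times> V) (\<lambda>p::real \<times> real. G (snd p))"
    by (rule smooth_on_compose [OF _ assms(2,4)]) (auto intro!: smooth_intros open_Times assms)
qed (use assms in auto)

lemma smooth_on_inverse_real: "smooth_on (- {0}) (inverse :: real \<Rightarrow> real)"
  by (rule smooth_on_real_bootstrap [where V = UNIV and G = "\<lambda>y. - (y * y)"])
    (auto intro!: smooth_intros derivative_eq_intros simp: power2_eq_square)

lemma smooth_on_exp_real: "smooth_on UNIV (exp :: real \<Rightarrow> real)"
  by (rule smooth_on_real_bootstrap [where V = UNIV and G = "\<lambda>y. y"])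
    (auto intro!: smooth_intros)

lemma smooth_on_divide [smooth_intros]:
  fixes f g :: "'a::euclidean_space \<Rightarrow> real"
  assumes "open U" "smooth_on U f" "smooth_on U g" "\<And>x. x \<in> U \<Longrightarrow> g x \<noteq> 0"
  shows "smooth_on U (\<lambda>x. f x / g x)"
proof -
  have "smooth_on U (\<lambda>x. inverse (g x))"
    by (rule smooth_on_compose [OF assms(1) _ smooth_on_inverse_real assms(3)])
      (use assms(4) in auto)
  from smooth_on_mult [OF assms(1,2) this] show ?thesis by (simp add: field_simps)
qed

lemma smooth_on_sqrt_real: "smooth_on {0<..} sqrt"
  by (rule smooth_on_real_bootstrap [where V = "{0<..}" and G = "\<lambda>y. 1 / (2 * y)"])
    (auto intro!: smooth_intros derivative_eq_intros simp: field_simps)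

lemma smooth_on_sqrt [smooth_intros]:
  assumes "open U" "smooth_on U f" "\<And>x. x \<in> U \<Longrightarrow> 0 < f x"
  shows "smooth_on U (\<lambda>x. sqrt (f x))"
  by (rule smooth_on_compose [OF assms(1) _ smooth_on_sqrt_real assms(2)]) (use assms in auto)

lemma smooth_on_exp [smooth_intros]:
  assumes "open U" "smooth_on U f"
  shows "smooth_on U (\<lambda>x. exp (f x :: real))"
  by (rule smooth_on_compose [OF assms(1) _ smooth_on_exp_real assms(2)]) auto

lemma smooth_on_cos_sin: "smooth_on UNIV (\<lambda>x. (cos x, sin x :: real))"
proof (rule smooth_on_bootstrap [where V = UNIV and G = "\<lambda>b p. b *\<^sub>R (- snd (snd p), fst (snd p))"
      and f' = "\<lambda>x v. (v * (- sin x), v * cos x)"])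
  show "((\<lambda>x. (cos x, sin x)) has_derivative (\<lambda>v. (v * - sin x, v * cos x))) (at x)" for x :: real
    by (auto intro!: derivative_eq_intros)
qed (auto intro!: smooth_intros)

lemma smooth_on_cos [smooth_intros]:
  assumes "open U" "smooth_on U f" shows "smooth_on U (\<lambda>x. cos (f x :: real))"
  using smooth_on_fst [OF assms(1) smooth_on_compose [OF assms(1) _ smooth_on_cos_sin assms(2)]] by simp

lemma smooth_on_sin [smooth_intros]:
  assumes "open U" "smooth_on U f" shows "smooth_on U (\<lambda>x. sin (f x :: real))"
  using smooth_on_snd [OF assms(1) smooth_on_compose [OF assms(1) _ smooth_on_cos_sin assms(2)]] by simp

text \<open>Invariance of domain makes the image open. The derivative of \<open>g\<close> at
  \<open>y\<close> is \<open>g' (g y)\<close>, which depends on \<open>y\<close> only through the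
  value \<open>g y\<close>, so the bootstrap applies.\<close>

lemma smooth_on_left_inverse:
  fixes f :: "'a::euclidean_space \<Rightarrow> 'a"
  assumes "open U" "smooth_on U f" "\<And>x. x \<in> U \<Longrightarrow> g (f x) = x"
    and f': "\<And>x. x \<in> U \<Longrightarrow> (f has_derivative f' x) (at x)"
    and g': "\<And>x v. x \<in> U \<Longrightarrow> f' x (g' x v) = v"
    and smooth: "\<And>b. b \<in> Basis \<Longrightarrow> smooth_on U (\<lambda>x. g' x b)"
  shows "open (f ` U)" "smooth_on (f ` U) g"
proof -
  have inj: "inj_on f U" using assms(3) by (metis inj_on_inverseI)
  show op: "open (f ` U)"
    by (rule invariance_of_domain [OF smooth_on_continuous_on [OF assms(1,2)] assms(1) inj])
  have D: "(g has_derivative g' x) (at (f x))" if "x \<in> U" for x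
    by (rule has_derivative_inverse_on [OF assms(1) f' assms(3) _ that]) (use g' that in auto)
  show "smooth_on (f ` U) g"
  proof (rule smooth_on_bootstrap [where V = "UNIV \<times> U" and G = "\<lambda>b p. g' (snd p) b"
        and f' = "\<lambda>y. g' (g y)"])
    show "smooth_on (UNIV \<times> U) (\<lambda>p::'a \<times> 'a. g' (snd p) b)" if "b \<in> Basis" for b
      by (rule smooth_on_compose [OF _ assms(1) smooth [OF that]])
        (auto intro!: smooth_intros open_Times assms(1))
  qed (use D op assms in \<open>auto intro!: open_Times\<close>)
qed

section \<open>Symplectic maps of four-space\<close>

type_synonym r2 = "real \<times> real"
type_synonym r4 = "r2 \<times> r2"

declare split_paired_All [simp del] split_paired_Ex [simp del] split_paired_all [simp del]

definition area :: "r2 \<Rightarrow> r2 \<Rightarrow> real" where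
  "area v w = fst v * snd w - fst w * snd v"

text \<open>Conjugate coordinates are grouped together, so that the form is a sum over two planes
  and a map of one plane is symplectic as soon as it preserves area. \<open>Lv\<close> regroups them
  at the end.\<close>

definition om :: "r4 \<Rightarrow> r4 \<Rightarrow> real" where
  "om v w = area (fst v) (fst w) + area (snd v) (snd w)"

definition sympl_on :: "r4 set \<Rightarrow> (r4 \<Rightarrow> r4) \<Rightarrow> bool" where
  "sympl_on U f \<longleftrightarrow>
     (\<forall>x\<in>U. \<exists>f'. (f has_derivative f') (at x) \<and> (\<forall>v w. om (f' v) (f' w) = om v w))"

definition symp :: "r4 set \<Rightarrow> r4 set \<Rightarrow> bool" where
  "symp U V \<longleftrightarrow> open U \<and> (\<exists>f. smooth_on U f \<and> sympl_on U f \<and> inj_on f U \<and> f ` U = V)"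

lemma sympl_onD:
  assumes "sympl_on U f" "x \<in> U" "(f has_derivative f') (at x)"
  shows "om (f' v) (f' w) = om v w"
proof -
  obtain g' where "(f has_derivative g') (at x)" "\<forall>v w. om (g' v) (g' w) = om v w"
    using assms(1,2) unfolding sympl_on_def by blast
  then show ?thesis using has_derivative_unique [OF assms(3)] by metis
qed

lemma sympl_onI:
  assumes "\<And>x. x \<in> U \<Longrightarrow> ((\<lambda>x. f1 x) has_derivative d1 x) (at x)"
    "\<And>x. x \<in> U \<Longrightarrow> ((\<lambda>x. f2 x) has_derivative d2 x) (at x)"
    "\<And>x. x \<in> U \<Longrightarrow> ((\<lambda>x. f3 x) has_derivative d3 x) (at x)"
    "\<And>x. x \<in> U \<Longrightarrow> ((\<lambda>x. f4 x) has_derivative d4 x) (at x)"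
    "\<And>x v w. x \<in> U \<Longrightarrow>
      d1 x v * d2 x w - d1 x w * d2 x v + (d3 x v * d4 x w - d3 x w * d4 x v) = om v w"
  shows "sympl_on U (\<lambda>x. ((f1 x, f2 x), (f3 x, f4 x)))"
  unfolding sympl_on_def
proof
  fix x assume x: "x \<in> U"
  have "((\<lambda>x. ((f1 x, f2 x), (f3 x, f4 x))) has_derivative
      (\<lambda>v. ((d1 x v, d2 x v), (d3 x v, d4 x v)))) (at x)"
    by (intro has_derivative_Pair assms x)
  moreover have "om ((d1 x v, d2 x v), (d3 x v, d4 x v)) ((d1 x w, d2 x w), (d3 x w, d4 x w)) = om v w"
    for v w
    using assms(5) [OF x, of v w] by (simp add: om_def area_def)
  ultimately show "\<exists>f'. ((\<lambda>x. ((f1 x, f2 x), (f3 x, f4 x))) has_derivative f') (at x) \<and>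
      (\<forall>v w. om (f' v) (f' w) = om v w)" by blast
qed

lemma sympl_on_cong:
  assumes "open U" "sympl_on U f" "\<And>x. x \<in> U \<Longrightarrow> f x = g x"
  shows "sympl_on U g"
  unfolding sympl_on_def
proof
  fix x assume x: "x \<in> U"
  then obtain f' where f': "(f has_derivative f') (at x)" "\<forall>v w. om (f' v) (f' w) = om v w"
    using assms(2) unfolding sympl_on_def by blast
  have "(g has_derivative f') (at x)"
    by (rule has_derivative_transform_within_open [OF f'(1) assms(1) x]) (use assms(3) in auto)
  with f' show "\<exists>f'. (g has_derivative f') (at x) \<and> (\<forall>v w. om (f' v) (f' w) = om v w)" by blast
qed

lemma sympl_on_Un: "sympl_on U f \<Longrightarrow> sympl_on V f \<Longrightarrow> sympl_on (U \<union> V) f"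
  by (auto simp: sympl_on_def)

lemma sympl_on_subset: "sympl_on U f \<Longrightarrow> V \<subseteq> U \<Longrightarrow> sympl_on V f"
  by (auto simp: sympl_on_def)

lemma sympl_on_compose:
  assumes "sympl_on V f" "sympl_on U g" "\<And>x. x \<in> U \<Longrightarrow> g x \<in> V"
  shows "sympl_on U (\<lambda>x. f (g x))"
  unfolding sympl_on_def
proof
  fix x assume x: "x \<in> U"
  then obtain g' where g': "(g has_derivative g') (at x)" "\<forall>v w. om (g' v) (g' w) = om v w"
    using assms(2) unfolding sympl_on_def by blast
  obtain f' where f': "(f has_derivative f') (at (g x))" "\<forall>v w. om (f' v) (f' w) = om v w"
    using assms(1,3) x unfolding sympl_on_def by blast
  show "\<exists>f'. ((\<lambda>x. f (g x)) has_derivative f') (at x) \<and> (\<forall>v w. om (f' v) (f' w) = om v w)"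
    using has_derivative_compose [OF g'(1) f'(1)] g'(2) f'(2) by auto
qed

lemma sympl_on_id: "sympl_on U (\<lambda>x. x)"
  unfolding sympl_on_def by (auto intro!: exI [of _ "\<lambda>v. v"])

text \<open>The inverse of a linear symplectic map \<open>f'\<close>, read off from
  \<open>om (inverse b) e = om b (f' e)\<close> for basis vectors \<open>e\<close>; it is linear in the entries
  of \<open>f'\<close>, which is what makes inverses of symplectic maps smooth.\<close>

definition symp_inv :: "(r4 \<Rightarrow> r4) \<Rightarrow> r4 \<Rightarrow> r4" where
  "symp_inv f' b = ((om b (f' ((0, 1), 0)), - om b (f' ((1, 0), 0))),
                    (om b (f' (0, (0, 1))), - om b (f' (0, (1, 0)))))"

lemma symp_inv:
  assumes lin: "linear f'" and om: "\<And>v w. om (f' v) (f' w) = om v w"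
  shows "f' (symp_inv f' b) = b"
proof -
  have inv: "symp_inv f' (f' v) = v" for v
    by (cases v, cases "fst v", cases "snd v") (simp add: symp_inv_def om, simp add: om_def area_def)
  then have "inj f'" by (metis injI)
  then have "surj f'" by (rule linear_injective_imp_surjective [OF lin _ refl])
  then obtain v where "b = f' v" by (metis surjD)
  then show ?thesis using inv by simp
qed

lemma smooth_on_om [smooth_intros]:
  "open U \<Longrightarrow> smooth_on U f \<Longrightarrow> smooth_on U g \<Longrightarrow> smooth_on U (\<lambda>x. om (f x) (g x))"
  unfolding om_def area_def by (intro smooth_intros)

lemma smooth_on_frechet_derivative:
  assumes "open U" "smooth_on U f"
  shows "smooth_on U (\<lambda>x. frechet_derivative f (at x) b)"
proof -
  have "smooth_on U (\<lambda>x. frechet_derivative f (at x) i)" if "i \<in> Basis" for i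
    using assms(2) that by (cases rule: smooth_on.cases) auto
  then have "smooth_on U (\<lambda>x. \<Sum>i\<in>Basis. (b \<bullet> i) *\<^sub>R frechet_derivative f (at x) i)"
    unfolding smooth_on_iff_Cn
    by (intro allI Cn_sum Cn_linear_compose [OF assms(1) bounded_linear_scaleR_right] assms(1)) auto
  then show ?thesis
    by (rule smooth_on_cong [OF assms(1)])
      (rule derivative_eq_sum_Basis [symmetric, OF smooth_on_has_derivative [OF assms]])
qed

lemma
  assumes "open U" "smooth_on U f" "sympl_on U f" "\<And>x. x \<in> U \<Longrightarrow> g (f x) = x"
  shows sympl_open_image: "open (f ` U)"
    and sympl_inverse_smooth: "smooth_on (f ` U) g"
    and sympl_inverse: "sympl_on (f ` U) g"
proof -
  let ?f' = "\<lambda>x. frechet_derivative f (at x)"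
  have D: "(f has_derivative ?f' x) (at x)" if "x \<in> U" for x
    by (rule smooth_on_has_derivative [OF assms(1,2) that])
  have omf: "om (?f' x v) (?f' x w) = om v w" if "x \<in> U" for x v w
    by (rule sympl_onD [OF assms(3) that D [OF that]])
  have inv: "?f' x (symp_inv (?f' x) v) = v" if "x \<in> U" for x v
    by (rule symp_inv [OF has_derivative_linear [OF D [OF that]] omf [OF that]])
  have sm: "smooth_on U (\<lambda>x. symp_inv (?f' x) b)" for b
    unfolding symp_inv_def
    by (intro smooth_intros smooth_on_frechet_derivative assms(1,2))
  note * = smooth_on_left_inverse [OF assms(1,2,4) D inv sm]
  show "open (f ` U)" "smooth_on (f ` U) g" using * by auto
  show "sympl_on (f ` U) g"
    unfolding sympl_on_def
  proof
    fix y assume "y \<in> f ` U"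
    then obtain x where x: "x \<in> U" and y: "y = f x" by blast
    have "(g has_derivative symp_inv (?f' x)) (at (f x))"
      by (rule has_derivative_inverse_on [OF assms(1) D assms(4) _ x]) (use inv x in \<open>auto simp: fun_eq_iff\<close>)
    moreover have "om (symp_inv (?f' x) v) (symp_inv (?f' x) w) = om v w" for v w
      using omf [OF x, of "symp_inv (?f' x) v" "symp_inv (?f' x) w"] by (simp add: inv [OF x])
    ultimately show "\<exists>g'. (g has_derivative g') (at y) \<and> (\<forall>v w. om (g' v) (g' w) = om v w)"
      unfolding y by blast
  qed
qed

lemma sympI:
  assumes "open U" "smooth_on U f" "sympl_on U f" "inj_on f U" "f ` U = V"
  shows "symp U V"
  using assms unfolding symp_def by blast

lemma symp_open: "symp U V \<Longrightarrow> open U" "symp U V \<Longrightarrow> open V"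
  unfolding symp_def by (auto intro: sympl_open_image inv_into_f_f)

lemma symp_refl: "open U \<Longrightarrow> symp U U"
  by (rule sympI [where f = "\<lambda>x. x"]) (auto intro: smooth_intros sympl_on_id)

lemma symp_sym:
  assumes "symp U V" shows "symp V U"
proof -
  obtain f where f: "open U" "smooth_on U f" "sympl_on U f" "inj_on f U" "f ` U = V"
    using assms unfolding symp_def by blast
  let ?g = "inv_into U f"
  have g: "?g (f x) = x" if "x \<in> U" for x using f(4) that by simp
  show ?thesis
  proof (rule sympI)
    show "open V" "smooth_on V ?g" "sympl_on V ?g"
      using sympl_open_image [OF f(1-3) g] sympl_inverse_smooth [OF f(1-3) g]
        sympl_inverse [OF f(1-3) g] f(5) by auto
    show "inj_on ?g V" using f(5) inj_on_inv_into [of V f U] by simp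
    show "?g ` V = U" using f(4,5) by force
  qed
qed

lemma symp_trans [trans]:
  assumes "symp U V" "symp V W" shows "symp U W"
proof -
  obtain f where f: "open U" "smooth_on U f" "sympl_on U f" "inj_on f U" "f ` U = V"
    using assms(1) unfolding symp_def by blast
  obtain g where g: "open V" "smooth_on V g" "sympl_on V g" "inj_on g V" "g ` V = W"
    using assms(2) unfolding symp_def by blast
  show ?thesis
  proof (rule sympI)
    show "smooth_on U (\<lambda>x. g (f x))" by (rule smooth_on_compose [OF f(1) g(1,2) f(2)]) (use f in auto)
    show "sympl_on U (\<lambda>x. g (f x))" by (rule sympl_on_compose [OF g(3) f(3)]) (use f in auto)
    show "inj_on (\<lambda>x. g (f x)) U"
      using comp_inj_on [OF f(4), of g] f(5) g(4) by (simp add: comp_def)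
    show "(\<lambda>x. g (f x)) ` U = W" using f g by auto
  qed (rule f)
qed

lemma symp_fst_map:
  fixes \<phi> :: "r2 \<Rightarrow> r2"
  assumes W: "open W" "smooth_on W \<phi>" "inj_on \<phi> W"
    and area: "\<And>x. x \<in> W \<Longrightarrow>
      \<exists>\<phi>'. (\<phi> has_derivative \<phi>') (at x) \<and> (\<forall>v w. area (\<phi>' v) (\<phi>' w) = area v w)"
    and U: "open U" "\<And>p. p \<in> U \<Longrightarrow> fst p \<in> W"
  shows "symp U ((\<lambda>p. (\<phi> (fst p), snd p)) ` U)"
proof (rule sympI [OF U(1) _ _ _ refl])
  show "smooth_on U (\<lambda>p. (\<phi> (fst p), snd p))"
    by (intro smooth_on_Pair smooth_on_compose [OF U(1) W(1,2)] smooth_intros U)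
  show "inj_on (\<lambda>p. (\<phi> (fst p), snd p)) U"
    using W(3) U(2) by (auto simp: inj_on_def prod_eq_iff)
  show "sympl_on U (\<lambda>p. (\<phi> (fst p), snd p))"
    unfolding sympl_on_def
  proof
    fix p assume p: "p \<in> U"
    obtain \<phi>' where \<phi>': "(\<phi> has_derivative \<phi>') (at (fst p))"
        "\<forall>v w. area (\<phi>' v) (\<phi>' w) = area v w"
      using area U(2) [OF p] by blast
    have "((\<lambda>p. (\<phi> (fst p), snd p)) has_derivative (\<lambda>v. (\<phi>' (fst v), snd v))) (at p)"
      by (intro has_derivative_Pair has_derivative_compose [where g = \<phi> and f = fst, OF _ \<phi>'(1)]
          has_derivative_fst has_derivative_snd has_derivative_ident)
    then show "\<exists>f'. ((\<lambda>p. (\<phi> (fst p), snd p)) has_derivative f') (at p) \<and>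
        (\<forall>v w. om (f' v) (f' w) = om v w)"
      using \<phi>'(2) by (auto simp: om_def)
  qed
qed

text \<open>A local excision \<open>e\<close>, which is the identity off \<open>K\<close>, extends by the identity once
  \<open>K\<close> sits in \<open>M\<close> as a relatively closed set.\<close>

lemma transplant_bij:
  fixes j :: "'a \<Rightarrow> 'b"
  assumes inj: "inj_on j O'" and K: "K \<subseteq> O'" "j ` K \<subseteq> M" and Z: "Z \<subseteq> K"
    and e: "inj_on e (O' - Z)" "e ` (O' - Z) = O'" "\<And>x. x \<in> O' - K \<Longrightarrow> e x = x"
    and i: "\<And>x. x \<in> O' \<Longrightarrow> i (j x) = x"
    and F: "\<And>m. F m = (if m \<in> j ` K then j (e (i m)) else m)"
  shows "M - j ` Z = M \<inter> j ` (O' - Z) \<union> (M - j ` K)"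
    and "bij_betw F (M - j ` Z) M"
    and "\<And>m. m \<in> j ` (O' - Z) \<Longrightarrow> j (e (i m)) = F m"
proof -
  \<comment> \<open>\<open>e\<close> is injective and fixes every point off \<open>K\<close>, so it
    cannot carry a point of \<open>K - Z\<close> out of \<open>K\<close>.\<close>
  have eK: "e ` (K - Z) = K"
  proof
    show "e ` (K - Z) \<subseteq> K"
    proof clarify
      fix x assume x: "x \<in> K" "x \<notin> Z"
      show "e x \<in> K"
      proof (rule ccontr)
        assume "e x \<notin> K"
        moreover have "e x \<in> O'" using e(2) x K by blast
        ultimately have "e (e x) = e x" "e x \<in> O' - Z" using e(3) Z by auto
        then have "e x = x" using e(1) x K by (auto simp: inj_on_def)
        with x \<open>e x \<notin> K\<close> show False by simp
      qed
    qed
    show "K \<subseteq> e ` (K - Z)"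
    proof
      fix y assume y: "y \<in> K"
      then obtain x where x: "x \<in> O' - Z" "e x = y" using e(2) K by (metis imageE subsetD)
      then have "x \<in> K" using e(3) [of x] y by (metis Diff_iff)
      then show "y \<in> e ` (K - Z)" using x by blast
    qed
  qed
  have jnZ: "j y \<notin> j ` Z" if "y \<in> O' - Z" for y
    using that inj Z K by (auto simp: inj_on_def)
  show "M - j ` Z = M \<inter> j ` (O' - Z) \<union> (M - j ` K)"
  proof -
    have "j ` Z \<subseteq> j ` K" using Z by (rule image_mono)
    moreover have "j ` (O' - Z) \<inter> j ` Z = {}" using jnZ by auto
    moreover have "m \<in> j ` (O' - Z)" if "m \<in> j ` K" "m \<notin> j ` Z" for m using that K(1) by auto
    ultimately show ?thesis by auto
  qed
  show "j (e (i m)) = F m" if m: "m \<in> j ` (O' - Z)" for m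
  proof -
    obtain x where x: "m = j x" "x \<in> O' - Z" using m by blast
    show ?thesis
    proof (cases "x \<in> K")
      case False
      then have "m \<notin> j ` K" using inj x K(1) by (auto simp: inj_on_def)
      then show ?thesis using e(3) [of x] x False by (simp add: F i)
    qed (simp add: F x)
  qed
  have eA: "e x \<in> O'" if "x \<in> O' - Z" for x using that e(2) by blast
  have FK: "F (j x) = j (e x)" if "x \<in> K" for x using that K by (auto simp: F i)
  have F_id: "F m = m" if "m \<notin> j ` K" for m using that by (simp add: F)
  have inj': "inj_on (\<lambda>x. j (e x)) (K - Z)"
  proof (rule inj_onI)
    fix x y assume xy: "x \<in> K - Z" "y \<in> K - Z" "j (e x) = j (e y)"
    have "e x = e y" by (rule inj_onD [OF inj xy(3)]) (use xy K(1) eA in auto)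
    then show "x = y" by (rule inj_onD [OF e(1)]) (use xy K(1) in auto)
  qed
  have b1: "bij_betw F (j ` (K - Z)) (j ` K)"
    unfolding bij_betw_def
  proof
    have "inj_on (F \<circ> j) (K - Z)"
      using inj' by (rule inj_on_cong [THEN iffD1, rotated]) (simp add: FK)
    then show "inj_on F (j ` (K - Z))" by (rule inj_on_imageI)
    have "F ` j ` (K - Z) = j ` e ` (K - Z)"
      unfolding image_image by (rule image_cong) (simp_all add: FK)
    then show "F ` j ` (K - Z) = j ` K" using eK by simp
  qed
  have b2: "bij_betw F (M - j ` K) (M - j ` K)"
    using F_id by (auto simp: bij_betw_def inj_on_def image_iff)
  have "bij_betw F (j ` (K - Z) \<union> (M - j ` K)) (j ` K \<union> (M - j ` K))"
    by (rule bij_betw_combine [OF b1 b2]) auto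
  moreover have "j ` (K - Z) = j ` K - j ` Z"
    using inj_on_image_set_diff [OF inj, of K Z] K Z by auto
  then have "j ` (K - Z) \<union> (M - j ` K) = M - j ` Z" using K Z by auto
  moreover have "j ` K \<union> (M - j ` K) = M" using K by blast
  ultimately show "bij_betw F (M - j ` Z) M" by simp
qed

lemma symp_transplant:
  assumes M: "open M" and O: "open O'" "smooth_on O' j" "sympl_on O' j" "inj_on j O'"
    and K: "K \<subseteq> O'" "j ` K \<subseteq> M" "open (M - j ` K)"
    and Z: "Z \<subseteq> K" "open (O' - Z)"
    and e: "smooth_on (O' - Z) e" "sympl_on (O' - Z) e" "inj_on e (O' - Z)" "e ` (O' - Z) = O'"
      "\<And>x. x \<in> O' - K \<Longrightarrow> e x = x"
  shows "symp (M - j ` Z) M"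
proof -
  define i where "i = inv_into O' j"
  have i: "i (j x) = x" if "x \<in> O'" for x using O(4) that by (simp add: i_def)
  note ji = sympl_inverse_smooth [OF O(1-3) i] and js = sympl_inverse [OF O(1-3) i]
  define F where "F m = (if m \<in> j ` K then j (e (i m)) else m)" for m
  have tb1: "M - j ` Z = M \<inter> j ` (O' - Z) \<union> (M - j ` K)"
    by (rule transplant_bij(1) [OF O(4) K(1,2) Z(1) e(3,4) _ _ F_def]) (fact e(5), fact i)
  have tb2: "bij_betw F (M - j ` Z) M"
    by (rule transplant_bij(2) [OF O(4) K(1,2) Z(1) e(3,4) _ _ F_def]) (fact e(5), fact i)
  have FA: "j (e (i m)) = F m" if m: "m \<in> j ` (O' - Z)" for m
    by (rule transplant_bij(3) [OF O(4) K(1,2) Z(1) e(3,4) _ _ F_def m]) (fact e(5), fact i)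
  have jOZ: "open (j ` (O' - Z))"
    by (rule sympl_open_image [OF Z(2) smooth_on_subset [OF O(2)] sympl_on_subset [OF O(3)] i]) auto
  let ?A = "M \<inter> j ` (O' - Z)" and ?B = "M - j ` K"
  have A: "open ?A" using M jOZ by auto
  have FB: "m = F m" if "m \<in> ?B" for m using that by (simp add: F_def)
  have iA: "i m \<in> O' - Z" if m: "m \<in> ?A" for m
  proof -
    obtain x where x: "m = j x" "x \<in> O' - Z" using m by blast
    then have "i m = x" using i by simp
    then show ?thesis using x(2) by simp
  qed
  have eA: "e x \<in> O'" if "x \<in> O' - Z" for x using that e(4) by (metis imageI)
  have sub: "?A \<subseteq> j ` O'" by blast
  show ?thesis
  proof (rule sympI [where f = F])
    show "open (M - j ` Z)" using A K(3) by (subst tb1) (rule open_Un)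
    have "smooth_on ?A (\<lambda>m. j (e (i m)))"
      by (intro smooth_on_compose [OF A O(1,2)] smooth_on_compose [OF A Z(2) e(1)]
          smooth_on_subset [OF ji sub] eA iA)
    then have "smooth_on ?A F" by (rule smooth_on_cong [OF A]) (rule FA, blast)
    moreover have "smooth_on ?B F"
      by (rule smooth_on_cong [OF K(3) smooth_on_id [OF K(3)]]) (rule FB)
    ultimately show "smooth_on (M - j ` Z) F"
      by (subst tb1) (intro smooth_on_Un A K)
    have "sympl_on ?A (\<lambda>m. j (e (i m)))"
      by (intro sympl_on_compose [OF O(3)] sympl_on_compose [OF e(2)]
          sympl_on_subset [OF js sub] eA iA)
    then have "sympl_on ?A F" by (rule sympl_on_cong [OF A]) (rule FA, blast)
    moreover have "sympl_on ?B F"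
      by (rule sympl_on_cong [OF K(3) sympl_on_id]) (rule FB)
    ultimately show "sympl_on (M - j ` Z) F"
      by (subst tb1) (rule sympl_on_Un)
  qed (use tb2 in \<open>simp_all add: bij_betw_def\<close>)
qed

section \<open>A model excision\<close>

text \<open>The negative powers are included because the derivative of \<open>flat n\<close> is a
  linear combination of \<open>flat (n + 2)\<close> and \<open>flat (n + 1)\<close>: smoothness of
  all members is then one induction over the order.\<close>

definition flat :: "nat \<Rightarrow> real \<Rightarrow> real" where
  "flat n y = (if y > 0 then exp (- 1 / y) / y ^ n else 0)"

lemma flat_tendsto_0: "(flat n \<longlongrightarrow> 0) (at 0)"
proof -
  have "((\<lambda>y. (1 / y) ^ n / exp (1 / y)) \<longlongrightarrow> (0::real)) (at_right 0)"
    by (rule filterlim_compose [OF tendsto_power_div_exp_0])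
      (use filterlim_inverse_at_top_right in \<open>simp add: inverse_eq_divide\<close>)
  moreover have "\<forall>\<^sub>F y in at_right 0. (1 / y) ^ n / exp (1 / y) = flat n y"
    by (rule eventually_at_right_less [THEN eventually_mono])
      (simp add: flat_def exp_minus field_simps)
  ultimately have "(flat n \<longlongrightarrow> 0) (at_right 0)" by (rule Lim_transform_eventually)
  moreover have "(flat n \<longlongrightarrow> 0) (at_left 0)"
    by (rule tendsto_eventually) (auto simp: flat_def eventually_at_left_field intro: exI [of _ "-1"])
  ultimately show ?thesis by (simp add: filterlim_at_split)
qed

lemma flat_deriv: "(flat n has_real_derivative (flat (n + 2) y - n * flat (n + 1) y)) (at y)"
proof (cases y "0::real" rule: linorder_cases)
  case less
  have "(flat n has_real_derivative 0) (at y)"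
    by (rule DERIV_cong_ev [THEN iffD2, OF refl _ refl, of _ "\<lambda>_. 0"])
      (use less in \<open>auto simp: flat_def intro!: eventually_mono [OF eventually_nhds_in_open [of "{..<0}"]]\<close>)
  then show ?thesis using less by (simp add: flat_def)
next
  case equal
  have "(\<lambda>h. (flat n (0 + h) - flat n 0) / h) \<midarrow>0\<rightarrow> 0"
    by (rule Lim_transform_eventually [OF flat_tendsto_0 [of "n + 1"]])
      (auto simp: flat_def eventually_at_filter)
  then show ?thesis using equal by (simp add: DERIV_def flat_def)
next
  case greater
  have "((\<lambda>y. exp (- 1 / y) / y ^ n) has_real_derivative (flat (n + 2) y - n * flat (n + 1) y)) (at y)"
    using greater
    by (auto intro!: derivative_eq_intros simp: flat_def field_simps power2_eq_square)
      (cases n; simp add: field_simps)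
  then show ?thesis
    by (rule DERIV_cong_ev [THEN iffD1, OF refl _ refl, rotated])
      (use greater in \<open>auto simp: flat_def intro!: eventually_mono [OF eventually_nhds_in_open [of "{0<..}"]]\<close>)
qed

lemma smooth_on_flat_real: "smooth_on UNIV (flat n)"
proof (rule smooth_onI)
  fix k show "Cn k UNIV (flat n)"
  proof (induction k arbitrary: n)
    case (Suc k)
    show ?case
    proof (rule Cn_SucI [OF open_UNIV flat_deriv [unfolded has_field_derivative_def]])
      fix b :: real assume "b \<in> Basis"
      have "Cn k UNIV (\<lambda>y. flat (n + 2) y + (- real n) *\<^sub>R flat (n + 1) y)"
        by (intro Cn_add Cn_linear_compose [OF open_UNIV bounded_linear_scaleR_right] Suc open_UNIV)
      then show "Cn k UNIV (\<lambda>y. (flat (n + 2) y - n * flat (n + 1) y) * b)"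
        using \<open>b \<in> Basis\<close> by simp
    qed
  qed simp
qed

lemma smooth_on_real_compose:
  fixes h :: "real \<Rightarrow> real"
  assumes "smooth_on UNIV h" "open U" "smooth_on U f"
  shows "smooth_on U (\<lambda>x. h (f x))"
  by (rule smooth_on_compose [OF assms(2) open_UNIV assms(1,3)]) simp

lemmas smooth_on_flat [smooth_intros] = smooth_on_real_compose [OF smooth_on_flat_real]

lemma flat_nonneg: "0 \<le> flat n y" by (simp add: flat_def)

lemma flat_0_mono: "x < y \<Longrightarrow> 0 < y \<Longrightarrow> flat 0 x < flat 0 y"
  by (auto simp: flat_def field_simps)

text \<open>The factor \<open>exp 1\<close> makes the value at 0 equal to 1. This value fixes where
  the ray removed by the model excision begins.\<close>

definition bump :: "real \<Rightarrow> real" where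
  "bump s = exp 1 * flat 0 (1 - s\<^sup>2)"

definition bump' :: "real \<Rightarrow> real" where
  "bump' s = - 2 * s * exp 1 * flat 2 (1 - s\<^sup>2)"

lemma bump_deriv: "(bump has_real_derivative bump' s) (at s)"
proof -
  have "((\<lambda>s. exp 1 * flat 0 (1 - s\<^sup>2)) has_real_derivative bump' s) (at s)"
    by (auto intro!: derivative_eq_intros DERIV_chain2 [OF flat_deriv] simp: bump'_def numeral_eq_Suc)
  then show ?thesis by (simp add: bump_def [abs_def])
qed

lemma smooth_on_bump [smooth_intros]:
  "open U \<Longrightarrow> smooth_on U f \<Longrightarrow> smooth_on U (\<lambda>x. bump (f x))"
  unfolding bump_def by (intro smooth_intros)

lemma smooth_on_bump' [smooth_intros]:
  "open U \<Longrightarrow> smooth_on U f \<Longrightarrow> smooth_on U (\<lambda>x. bump' (f x))"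
  unfolding bump'_def by (intro smooth_intros)

lemma bump_0: "bump 0 = 1" by (simp add: bump_def flat_def flip: exp_add)

lemma bump_nonneg: "0 \<le> bump s" by (simp add: bump_def flat_nonneg)

lemma bump_le_1: "bump s \<le> 1"
proof (cases "1 - s\<^sup>2 > 0")
  case True
  then have "1 \<le> 1 / (1 - s\<^sup>2)" by (simp add: field_simps)
  then show ?thesis using True by (simp add: bump_def flat_def flip: exp_add)
qed (simp add: bump_def flat_def)

lemma bump_outside: "\<bar>s\<bar> \<ge> 1 \<Longrightarrow> bump s = 0"
  by (simp add: bump_def flat_def not_less) (metis one_power2 abs_le_square_iff abs_one)

lemma s_bump'_nonpos: "s * bump' s \<le> 0"
proof -
  have "s * bump' s = - (2 * s\<^sup>2 * exp 1 * flat 2 (1 - s\<^sup>2))"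
    by (simp add: bump'_def power2_eq_square)
  then show ?thesis by (simp add: flat_nonneg)
qed

text \<open>The support of \<open>bump\<close> begins at -1; the lower limit -2 leaves a margin, so
  that every \<open>s \<ge> -1\<close> is interior to the range of integration.\<close>

definition bump_int :: "real \<Rightarrow> real" where
  "bump_int s = integral {-2..s} bump"

lemma continuous_on_bump: "continuous_on S bump"
  using bump_deriv by (meson DERIV_continuous continuous_at_imp_continuous_on)

lemma bump_int_left: assumes "s \<le> -1" shows "bump_int s = 0"
proof -
  have "integral {-2..s} bump = integral {-2..s} (\<lambda>_. 0)"
    by (rule integral_cong) (use assms in \<open>auto intro: bump_outside\<close>)
  then show ?thesis by (simp add: bump_int_def)
qed

lemma bump_int_deriv: "(bump_int has_real_derivative bump s) (at s)"
proof (cases "s < -1")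
  case True
  have "(bump_int has_real_derivative 0) (at s)"
    by (rule DERIV_cong_ev [THEN iffD2, OF refl _ refl, of _ "\<lambda>_. 0"])
      (use True in \<open>auto intro: bump_int_left intro!: eventually_mono [OF eventually_nhds_in_open [of "{..<-1}"]]\<close>)
  then show ?thesis using True by (simp add: bump_outside)
next
  case False
  have "((\<lambda>x. integral {-2..x} bump) has_real_derivative bump s) (at s within {-2..s+1})"
    by (rule integral_has_real_derivative [OF continuous_on_bump]) (use False in auto)
  moreover have "at s within {-2..s+1} = at s"
    by (rule at_within_interior) (use False in auto)
  ultimately show ?thesis by (simp add: bump_int_def [abs_def])
qed

lemma smooth_on_bump_int [smooth_intros]:
  assumes "open U" "smooth_on U f" shows "smooth_on U (\<lambda>x. bump_int (f x))"
  by (rule smooth_on_real_compose [OF smooth_on_real_derivative [OF open_UNIV bump_int_deriv] assms])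
    (intro smooth_intros open_UNIV)

lemma bump_int_right: assumes "1 \<le> s" shows "bump_int s = bump_int 1"
proof -
  have "\<exists>c. \<forall>x\<in>{1..}. bump_int x = c"
  proof (rule has_field_derivative_zero_constant)
    show "(bump_int has_real_derivative 0) (at x within {1..})" if "x \<in> {1..}" for x
      using that has_field_derivative_at_within [OF bump_int_deriv [of x]] by (simp add: bump_outside)
  qed simp
  then show ?thesis using assms by auto
qed

text \<open>It arises as a derivative in \<open>p\<close>: that of
  \<open>dl p * bump_int (s / dl p)\<close> is \<open>dl' p * kk (s / dl p)\<close>.\<close>

definition kk :: "real \<Rightarrow> real" where "kk s = bump_int s - s * bump s"

lemma kk_deriv: "(kk has_real_derivative (- s * bump' s)) (at s)"
  unfolding kk_def [abs_def]
  by (auto intro!: derivative_eq_intros bump_int_deriv bump_deriv simp: algebra_simps)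

lemma smooth_on_kk [smooth_intros]:
  "open U \<Longrightarrow> smooth_on U f \<Longrightarrow> smooth_on U (\<lambda>x. kk (f x))"
  unfolding kk_def by (intro smooth_intros)

lemma
  assumes "1 \<le> \<bar>s\<bar>" "0 < d" "d \<le> 1"
  shows kk_outside: "kk (s / d) = bump_int s"
    and bump_outside_div: "bump (s / d) = 0"
proof -
  have *: "1 \<le> \<bar>s / d\<bar>" using assms by (simp add: field_simps)
  then show "bump (s / d) = 0" by (rule bump_outside)
  have "bump_int (s / d) = bump_int s"
  proof (cases "s \<ge> 0")
    case True
    then show ?thesis using assms * bump_int_right [of s] bump_int_right [of "s / d"] by auto
  next
    case False
    then have "s / d \<le> 0" using assms by (simp add: field_simps)
    then show ?thesis using False assms * bump_int_left [of s] bump_int_left [of "s / d"] by auto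
  qed
  then show "kk (s / d) = bump_int s" using * by (simp add: kk_def bump_outside)
qed

text \<open>The width of a bump that gets thinner along the ray: 1 up to \<open>p = -1\<close>, then
  decreasing to 0 at \<open>p = 1\<close>, where \<open>flat 0 2 = exp (- 1/2)\<close> is cancelled
  by the factor \<open>exp (1/2)\<close>.\<close>

definition dl :: "real \<Rightarrow> real" where "dl p = 1 - exp (1/2) * flat 0 (p + 1)"
definition dl' :: "real \<Rightarrow> real" where "dl' p = - exp (1/2) * flat 2 (p + 1)"
definition dl'' :: "real \<Rightarrow> real" where "dl'' p = - exp (1/2) * (flat 4 (p + 1) - 2 * flat 3 (p + 1))"

lemma dl_deriv: "(dl has_real_derivative dl' p) (at p)"
  unfolding dl_def [abs_def] dl'_def
  by (auto intro!: derivative_eq_intros DERIV_chain2 [OF flat_deriv] simp: numeral_eq_Suc)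

lemma dl'_deriv: "(dl' has_real_derivative dl'' p) (at p)"
  unfolding dl'_def [abs_def] dl''_def
  by (auto intro!: derivative_eq_intros DERIV_chain2 [OF flat_deriv] simp: algebra_simps numeral_eq_Suc)

lemma smooth_on_dl [smooth_intros]:
  "open U \<Longrightarrow> smooth_on U f \<Longrightarrow> smooth_on U (\<lambda>x. dl (f x))"
  unfolding dl_def by (intro smooth_intros)

lemma smooth_on_dl' [smooth_intros]:
  "open U \<Longrightarrow> smooth_on U f \<Longrightarrow> smooth_on U (\<lambda>x. dl' (f x))"
  unfolding dl'_def by (intro smooth_intros)

lemma dl_left: "p \<le> -1 \<Longrightarrow> dl p = 1" "p \<le> -1 \<Longrightarrow> dl' p = 0"
  by (simp_all add: dl_def dl'_def flat_def)

lemma dl_1: "dl 1 = 0" by (simp add: dl_def flat_def flip: exp_add)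

lemma dl_le_1: "dl p \<le> 1" by (simp add: dl_def flat_nonneg)

lemma dl_pos: assumes "p < 1" shows "0 < dl p"
proof -
  have "flat 0 (p + 1) < flat 0 2" by (rule flat_0_mono) (use assms in auto)
  then show ?thesis
    by (simp add: dl_def) (simp add: flat_def exp_minus field_simps)
qed

lemma dl'_nonpos: "dl' p \<le> 0" by (simp add: dl'_def flat_nonneg)

text \<open>With \<open>w = 1 / (p + 1)\<close> the claim is \<open>w^2 * exp (1/2 - w) < 1\<close>.
  The left side is largest at \<open>w = 2\<close>, with value \<open>4 * exp (- 3/2)\<close>. The
  bound makes \<open>ex_N\<close> positive and hence the model excision well defined.\<close>

lemma dl'_gt: "- 1 < dl' p"
proof (cases "p + 1 > 0")
  case True
  define w where "w = 1 / (p + 1)"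
  have w: "w > 0" using True by (simp add: w_def)
  have "2 < exp (3/4 :: real)"
  proof -
    have "1 + 3/4 + (3/4)\<^sup>2 / 2 \<le> exp (3/4::real)" by (rule exp_lower_Taylor_quadratic) simp
    then show ?thesis by (simp add: power2_eq_square)
  qed
  \<comment> \<open>The linear bound for \<open>exp\<close> touches at \<open>w = 2\<close>, where
    the maximum lies; together with \<open>2 < exp (3/4)\<close> it gives the square root of the
    claim.\<close>
  moreover have "w / 2 \<le> exp ((w - 2) / 2)"
    using exp_ge_add_one_self [of "(w - 2) / 2"] by (simp add: field_simps)
  ultimately have "2 * (w / 2) < exp (3/4) * exp ((w - 2) / 2)"
    using w by (intro mult_less_le_imp_less) auto
  also have "\<dots> = exp ((w - 1/2) / 2)" by (simp flip: exp_add) (simp add: field_simps)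
  finally have "w\<^sup>2 < (exp ((w - 1/2) / 2))\<^sup>2"
    using w by (intro power_strict_mono) auto
  also have "\<dots> = exp (w - 1/2)" by (simp add: power2_eq_square flip: exp_add)
  finally have "w\<^sup>2 * exp (1/2) * exp (- w) < exp (w - 1/2) * exp (1/2) * exp (- w)" by simp
  also have "\<dots> = 1" by (simp flip: exp_add)
  finally show ?thesis using True by (simp add: dl'_def flat_def w_def power_divide field_simps)
qed (simp add: dl'_def flat_def)

text \<open>For a map that is given implicitly: \<open>\<alpha>\<close> parametrises its source and
  \<open>\<gamma>\<close> its target by the same set. It is symplectic as soon as both
  parametrisations pull the form back to the same form, which need not be the standard one.\<close>

lemma
  fixes \<alpha> \<gamma> :: "r4 \<Rightarrow> r4"
  assumes \<Omega>: "open \<Omega>" and \<alpha>: "smooth_on \<Omega> \<alpha>" and \<gamma>: "smooth_on \<Omega> \<gamma>"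
    and g: "\<And>x. x \<in> \<Omega> \<Longrightarrow> g (\<alpha> x) = x"
    and \<alpha>': "\<And>x. x \<in> \<Omega> \<Longrightarrow> (\<alpha> has_derivative \<alpha>' x) (at x)"
    and \<gamma>': "\<And>x. x \<in> \<Omega> \<Longrightarrow> (\<gamma> has_derivative \<gamma>' x) (at x)"
    and inv: "\<And>x v. x \<in> \<Omega> \<Longrightarrow> \<alpha>' x (\<alpha>i x v) = v"
    and inv_smooth: "\<And>b. b \<in> Basis \<Longrightarrow> smooth_on \<Omega> (\<lambda>x. \<alpha>i x b)"
    and om: "\<And>x v w. x \<in> \<Omega> \<Longrightarrow> om (\<gamma>' x v) (\<gamma>' x w) = om (\<alpha>' x v) (\<alpha>' x w)"
  shows sympl_via_open: "open (\<alpha> ` \<Omega>)"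
    and sympl_via_smooth: "smooth_on (\<alpha> ` \<Omega>) (\<lambda>y. \<gamma> (g y))"
    and sympl_via_sympl: "sympl_on (\<alpha> ` \<Omega>) (\<lambda>y. \<gamma> (g y))"
proof -
  have *: "open (\<alpha> ` \<Omega>)" "smooth_on (\<alpha> ` \<Omega>) g"
    by (rule smooth_on_left_inverse [OF \<Omega> \<alpha>]; fact g \<alpha>' inv inv_smooth)+
  show "open (\<alpha> ` \<Omega>)" by (rule *)
  show "smooth_on (\<alpha> ` \<Omega>) (\<lambda>y. \<gamma> (g y))"
    by (rule smooth_on_compose [OF *(1) \<Omega> \<gamma> *(2)], erule imageE, simp add: g)
  show "sympl_on (\<alpha> ` \<Omega>) (\<lambda>y. \<gamma> (g y))"
    unfolding sympl_on_def
  proof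
    fix y assume "y \<in> \<alpha> ` \<Omega>"
    then obtain x where x: "x \<in> \<Omega>" "y = \<alpha> x" by (metis imageE)
    have "(g has_derivative \<alpha>i x) (at (\<alpha> x))"
      by (rule has_derivative_inverse_on [OF \<Omega> \<alpha>' g _ x(1)]) (use inv x in \<open>auto simp: fun_eq_iff\<close>)
    then have "((\<lambda>y. \<gamma> (g y)) has_derivative (\<lambda>v. \<gamma>' x (\<alpha>i x v))) (at y)"
      unfolding x(2)
      by (rule has_derivative_compose) (simp add: g \<gamma>' x)
    moreover have "om (\<gamma>' x (\<alpha>i x v)) (\<gamma>' x (\<alpha>i x w)) = om v w" for v w
      by (simp add: om [OF x(1)] inv [OF x(1)])
    ultimately show "\<exists>f'. ((\<lambda>y. \<gamma> (g y)) has_derivative f') (at y) \<and> (\<forall>v w. om (f' v) (f' w) = om v w)"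
      by (intro exI [of _ "\<lambda>v. \<gamma>' x (\<alpha>i x v)"]) simp
  qed
qed

text \<open>The model excision sends \<open>(ex_p p s, s)\<close> to \<open>(p, ex_q p s)\<close>, with the second coordinates scaled by
  \<open>wd\<close>; a rotation of the disc by a multiple of \<open>ex_h p s\<close> compensates for this scaling.\<close>

definition ex_p :: "real \<Rightarrow> real \<Rightarrow> real" where
  "ex_p p s = p - bump (s / dl p) + dl p * bump s"
definition ex_q :: "real \<Rightarrow> real \<Rightarrow> real" where
  "ex_q p s = s - dl' p * (kk (s / dl p) - bump_int s)"
definition ex_h :: "real \<Rightarrow> real \<Rightarrow> real" where
  "ex_h p s = dl p * (kk s - kk (s / dl p))"
text \<open>All these functions come from one generating function
  \<open>W = p * s + dl p * (bump_int s - bump_int (s / dl p))\<close>: \<open>ex_p\<close> is its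
  derivative in \<open>s\<close>, \<open>ex_q\<close> its derivative in \<open>p\<close>, and
  \<open>ex_N\<close>, \<open>ex_ps\<close>, \<open>ex_qp\<close> are its second derivatives (mixed,
  in \<open>s\<close>, in \<open>p\<close>). \<open>ex_h\<close> is \<open>W - s * ex_p\<close>, so
  that \<open>d ex_h = ex_q dp - s d ex_p\<close>.\<close>

definition ex_N :: "real \<Rightarrow> real \<Rightarrow> real" where
  "ex_N p s = 1 + s * bump' (s / dl p) * dl' p / (dl p)\<^sup>2 + dl' p * bump s"
definition ex_ps :: "real \<Rightarrow> real \<Rightarrow> real" where
  "ex_ps p s = dl p * bump' s - bump' (s / dl p) / dl p"
definition ex_qp :: "real \<Rightarrow> real \<Rightarrow> real" where
  "ex_qp p s = - dl'' p * (kk (s / dl p) - bump_int s) - (dl' p)\<^sup>2 * s\<^sup>2 * bump' (s / dl p) / (dl p) ^ 3"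

lemmas real_FDERIV [derivative_intros] =
  bump_deriv [THEN DERIV_compose_FDERIV] bump_int_deriv [THEN DERIV_compose_FDERIV]
  kk_deriv [THEN DERIV_compose_FDERIV] dl_deriv [THEN DERIV_compose_FDERIV]
  dl'_deriv [THEN DERIV_compose_FDERIV]

lemmas real_DERIV [derivative_intros] =
  bump_deriv [THEN DERIV_chain2] bump_int_deriv [THEN DERIV_chain2]
  kk_deriv [THEN DERIV_chain2] dl_deriv [THEN DERIV_chain2] dl'_deriv [THEN DERIV_chain2]

lemma ex_p_FDERIV:
  fixes P S :: "r4 \<Rightarrow> real"
  assumes "P x < 1" "(P has_derivative P') (at x)" "(S has_derivative S') (at x)"
  shows "((\<lambda>x. ex_p (P x) (S x)) has_derivative
    (\<lambda>v. ex_N (P x) (S x) * P' v + ex_ps (P x) (S x) * S' v)) (at x)"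
  unfolding ex_p_def
  by (rule derivative_eq_intros refl assms | use dl_pos [OF assms(1)] in force)+
    (use dl_pos [OF assms(1)] in \<open>simp add: fun_eq_iff ex_N_def ex_ps_def field_simps power2_eq_square\<close>)

lemma ex_q_FDERIV:
  fixes P S :: "r4 \<Rightarrow> real"
  assumes "P x < 1" "(P has_derivative P') (at x)" "(S has_derivative S') (at x)"
  shows "((\<lambda>x. ex_q (P x) (S x)) has_derivative
    (\<lambda>v. ex_N (P x) (S x) * S' v + ex_qp (P x) (S x) * P' v)) (at x)"
  unfolding ex_q_def
  by (rule derivative_eq_intros refl assms | use dl_pos [OF assms(1)] in force)+
    (use dl_pos [OF assms(1)] in
      \<open>simp add: fun_eq_iff ex_N_def ex_qp_def field_simps power2_eq_square power3_eq_cube\<close>)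

lemma ex_h_FDERIV:
  fixes P S :: "r4 \<Rightarrow> real"
  assumes "P x < 1" "(P has_derivative P') (at x)" "(S has_derivative S') (at x)"
  shows "((\<lambda>x. ex_h (P x) (S x)) has_derivative
    (\<lambda>v. ex_q (P x) (S x) * P' v -
      S x * (ex_N (P x) (S x) * P' v + ex_ps (P x) (S x) * S' v))) (at x)"
  unfolding ex_h_def
  by (rule derivative_eq_intros refl assms | use dl_pos [OF assms(1)] in force)+
    (use dl_pos [OF assms(1)] in
      \<open>simp add: fun_eq_iff ex_N_def ex_ps_def ex_q_def field_simps power2_eq_square kk_def\<close>)

text \<open>The first correction is nonnegative, since \<open>s * bump' s\<close> and
  \<open>dl'\<close> are nonpositive; the second is at least \<open>dl' p > -1\<close>. Hence
  \<open>ex_p\<close> increases in \<open>p\<close> and \<open>ex_q\<close> increases in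
  \<open>s\<close>.\<close>

lemma ex_N_pos: assumes "p < 1" shows "0 < ex_N p s"
proof -
  have d: "0 < dl p" by (rule dl_pos [OF assms])
  have "s / dl p * bump' (s / dl p) * (dl' p / dl p) \<ge> 0"
    by (intro mult_nonpos_nonpos s_bump'_nonpos divide_nonpos_pos dl'_nonpos d)
  moreover have "s / dl p * bump' (s / dl p) * (dl' p / dl p) = s * bump' (s / dl p) * dl' p / (dl p)\<^sup>2"
    by (simp add: power2_eq_square)
  moreover have "dl' p * bump s \<ge> dl' p * 1"
    by (rule mult_left_mono_neg [OF bump_le_1 dl'_nonpos])
  ultimately show ?thesis using dl'_gt [of p] unfolding ex_N_def by linarith
qed

lemma ex_p_deriv: "p < 1 \<Longrightarrow> ((\<lambda>p. ex_p p s) has_real_derivative ex_N p s) (at p)"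
  unfolding ex_p_def ex_N_def
  by (auto intro!: derivative_eq_intros dest: dl_pos
      simp: power2_eq_square)

lemma ex_q_deriv: "p < 1 \<Longrightarrow> ((\<lambda>s. ex_q p s) has_real_derivative ex_N p s) (at s)"
  unfolding ex_q_def ex_N_def
  using dl_pos [of p]
  by (auto intro!: derivative_eq_intros
      simp: power2_eq_square algebra_simps)

lemma ex_p_mono: assumes "p1 < p2" "p2 < 1" shows "ex_p p1 s < ex_p p2 s"
  by (rule DERIV_pos_imp_increasing [OF assms(1)])
    (use assms ex_p_deriv ex_N_pos in \<open>meson le_less_trans\<close>)

lemma ex_q_mono: assumes "s1 < s2" "p < 1" shows "ex_q p s1 < ex_q p s2"
  by (rule DERIV_pos_imp_increasing [OF assms(1)]) (use assms ex_q_deriv ex_N_pos in blast)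

lemma ex_outside:
  assumes "p < 1" "p < - 1 \<or> 1 \<le> \<bar>s\<bar>"
  shows "ex_q p s = s" "ex_h p s = 0"
    and "ex_p p s = p"
proof -
  have d: "0 < dl p" "dl p \<le> 1" using dl_pos assms dl_le_1 by auto
  have "p < - 1 \<Longrightarrow> dl p = 1 \<and> dl' p = 0" using dl_left by auto
  moreover have "kk s = bump_int s" if "1 \<le> \<bar>s\<bar>" using that by (simp add: kk_def bump_outside)
  ultimately show "ex_q p s = s" "ex_h p s = 0" "ex_p p s = p"
    using assms(2) kk_outside [OF _ d] bump_outside_div [OF _ d] bump_outside [of s]
    by (auto simp: ex_q_def ex_h_def ex_p_def)
qed

lemma dl_bound: assumes "p < 1" "0 \<le> c" "c \<le> 1" shows "p + dl p * c < 1"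
proof -
  have "p + dl p * c < 1 + dl 1 * c"
  proof (rule DERIV_pos_imp_increasing [OF assms(1)])
    fix x
    have "dl' x * c \<ge> dl' x * 1" by (rule mult_left_mono_neg [OF assms(3) dl'_nonpos])
    then have "1 + dl' x * c > 0" using dl'_gt [of x] by linarith
    moreover have "((\<lambda>p. p + dl p * c) has_real_derivative 1 + dl' x * c) (at x)"
      by (auto intro!: derivative_eq_intros dl_deriv)
    ultimately show "\<exists>y. ((\<lambda>p. p + dl p * c) has_real_derivative y) (at x) \<and> 0 < y" by blast
  qed
  then show ?thesis by (simp add: dl_1)
qed

text \<open>On the line \<open>s = 0\<close> the value is \<open>p - 1 + dl p\<close>, which
  increases to 0 as \<open>p\<close> tends to 1: this is why exactly the ray from 0 on is
  missed.\<close>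

lemma ex_p_range:
  assumes "- 2 < p" "p < 1"
  shows "- 2 < ex_p p s" "ex_p p s < 1" "s = 0 \<Longrightarrow> ex_p p s < 0"
proof -
  have "ex_p p s \<le> p + dl p * bump s" using bump_nonneg by (simp add: ex_p_def)
  then show "ex_p p s < 1" using dl_bound [OF assms(2) bump_nonneg bump_le_1] by (rule le_less_trans)
  show "s = 0 \<Longrightarrow> ex_p p s < 0"
    using dl_bound [OF assms(2), of 1] by (simp add: ex_p_def bump_0)
  have left: "ex_p x s = x" if "x < -1" for x using that ex_outside(3) [of x s] by simp
  show "- 2 < ex_p p s"
  proof (cases "p < -1")
    case False
    then have "ex_p (-3/2) s < ex_p p s" using assms by (intro ex_p_mono) auto
    then show ?thesis by (simp add: left)
  qed (use assms left in simp)
qed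

text \<open>Intermediate value theorem. On the left \<open>ex_p\<close> is the identity, whence the
  point \<open>-3/2\<close>. On the right, for \<open>s \<noteq> 0\<close> the width
  \<open>dl p\<close> drops below \<open>\<bar>s\<bar>\<close>, which switches off the negative
  term; for \<open>s = 0\<close> the limit 0 exceeds the given negative value.\<close>

lemma ex_p_solve:
  assumes "- 2 < p" "p < 1" "s \<noteq> 0 \<or> p < 0"
  obtains p' where "- 2 < p'" "p' < 1" "ex_p p' s = p"
proof -
  define p1 where "p1 = min p (-3/2)"
  have p1: "- 2 < p1" "p1 \<le> p" "p1 < -1" "p1 < 1" using assms by (auto simp: p1_def)
  have "ex_p p1 s = p1" using p1 by (intro ex_outside) auto
  moreover have "\<exists>p2. p1 \<le> p2 \<and> p2 < 1 \<and> p \<le> ex_p p2 s"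
  proof (cases "s = 0")
    case False
    have "isCont dl 1" using dl_deriv by (rule DERIV_isCont)
    then have "eventually (\<lambda>x. dl x < \<bar>s\<bar>) (at_left 1)"
      using False by (intro order_tendstoD(2) [of _ "dl 1"]) (auto simp: dl_1 isCont_def filterlim_at_split)
    moreover have "eventually (\<lambda>x. x \<in> {max p p1<..<1}) (at_left 1)"
      by (rule eventually_at_left_real) (use assms p1 in auto)
    ultimately obtain x where x: "dl x < \<bar>s\<bar>" "max p p1 < x" "x < 1"
      using eventually_happens [OF eventually_conj] by force
    have "bump (s / dl x) = 0"
      by (rule bump_outside) (use x dl_pos [of x] in \<open>simp add: field_simps\<close>)
    then have "p \<le> ex_p x s" using x bump_nonneg [of s] dl_pos [of x] by (simp add: ex_p_def add_increasing2)
    then show ?thesis using x by (intro exI [of _ x]) auto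
  next
    case True
    have "isCont (\<lambda>x. ex_p x 0) 1"
      by (simp add: ex_p_def bump_0) (intro continuous_intros DERIV_isCont [OF dl_deriv])
    then have "eventually (\<lambda>x. p < ex_p x 0) (at_left 1)"
      using True assms by (intro order_tendstoD(1) [of _ "ex_p 1 0"])
        (auto simp: dl_1 ex_p_def bump_0 isCont_def filterlim_at_split)
    moreover have "eventually (\<lambda>x. x \<in> {p1<..<1}) (at_left 1)"
      by (rule eventually_at_left_real) (use assms p1 in auto)
    ultimately obtain x where x: "p < ex_p x 0" "p1 < x" "x < 1"
      using eventually_happens [OF eventually_conj] by force
    then show ?thesis using True by (intro exI [of _ x]) auto
  qed
  then obtain p2 where p2: "p1 \<le> p2" "p2 < 1" "p \<le> ex_p p2 s" by blast
  have "\<exists>x\<ge>p1. x \<le> p2 \<and> ex_p x s = p"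
  proof (rule IVT')
    show "continuous_on {p1..p2} (\<lambda>x. ex_p x s)"
      by (rule DERIV_continuous_on [where D = "\<lambda>x. ex_N x s"])
        (use p2 in \<open>auto intro!: has_field_derivative_at_within ex_p_deriv\<close>)
  qed (use p1 p2 calculation in auto)
  then obtain x where "p1 \<le> x" "x \<le> p2" "ex_p x s = p" by blast
  then show ?thesis using that [of x] p1 p2 by linarith
qed

lemma ex_q_solve:
  assumes "p < 1" obtains s where "ex_q p s = q"
proof -
  define M where "M = \<bar>q\<bar> + 1"
  have "\<exists>x\<ge>- M. x \<le> M \<and> ex_q p x = q"
  proof (rule IVT')
    show "continuous_on {- M..M} (ex_q p)"
      by (rule DERIV_continuous_on [where D = "\<lambda>x. ex_N p x"])
        (use assms in \<open>auto intro!: has_field_derivative_at_within ex_q_deriv\<close>)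
  qed (use assms ex_outside(1) [of p M] ex_outside(1) [of p "-M"] in \<open>auto simp: M_def\<close>)
  then show ?thesis using that by blast
qed

lemma smooth_on_ex [smooth_intros]:
  assumes "open U" "smooth_on U P" "smooth_on U S" "\<And>x. x \<in> U \<Longrightarrow> P x < 1"
  shows "smooth_on U (\<lambda>x. ex_p (P x) (S x))" "smooth_on U (\<lambda>x. ex_q (P x) (S x))"
    "smooth_on U (\<lambda>x. ex_h (P x) (S x))" "smooth_on U (\<lambda>x. ex_N (P x) (S x))"
    "smooth_on U (\<lambda>x. ex_ps (P x) (S x))"
proof -
  have d: "dl (P x) \<noteq> 0" if "x \<in> U" for x using dl_pos [OF assms(4) [OF that]] by simp
  show "smooth_on U (\<lambda>x. ex_p (P x) (S x))" "smooth_on U (\<lambda>x. ex_q (P x) (S x))"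
    "smooth_on U (\<lambda>x. ex_h (P x) (S x))" "smooth_on U (\<lambda>x. ex_N (P x) (S x))"
    "smooth_on U (\<lambda>x. ex_ps (P x) (S x))"
    unfolding ex_p_def ex_q_def ex_h_def ex_N_def ex_ps_def
    by (intro smooth_intros assms(1-3) power_not_zero d; assumption)+
qed

section \<open>The model excision on the product of a strip and the disc of area 1\<close>

definition nz :: "r2 \<Rightarrow> real" where "nz z = (fst z)\<^sup>2 + (snd z)\<^sup>2"

definition disc :: "r2 set" where "disc = {z. pi * nz z < 1}"

text \<open>The damping depends on \<open>z\<close> only through \<open>nz z\<close>, so its
  differential is a multiple of the radial one, which rotations can compensate. \<open>wd'\<close>
  below is the derivative with respect to \<open>nz z\<close>.\<close>

definition wd :: "real \<Rightarrow> nat \<Rightarrow> r2 \<Rightarrow> real" where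
  "wd \<epsilon> n z = \<epsilon> * (1 - pi * nz z) ^ Suc n"

definition wd' :: "real \<Rightarrow> nat \<Rightarrow> r2 \<Rightarrow> real" where
  "wd' \<epsilon> n z = - \<epsilon> * pi * Suc n * (1 - pi * nz z) ^ n"

definition rot :: "real \<Rightarrow> r2 \<Rightarrow> r2" where
  "rot \<theta> z = (cos \<theta> * fst z - sin \<theta> * snd z, sin \<theta> * fst z + cos \<theta> * snd z)"

lemma nz_rot [simp]: "nz (rot \<theta> z) = nz z"
proof -
  have "(c * x - s * y)\<^sup>2 + (s * x + c * y)\<^sup>2 = (s\<^sup>2 + c\<^sup>2) * (x\<^sup>2 + y\<^sup>2)" for c s x y :: real
    by (simp add: algebra_simps power2_eq_square)
  then show ?thesis by (simp add: nz_def rot_def)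
qed

lemma rot_disc [simp]: "rot \<theta> z \<in> disc \<longleftrightarrow> z \<in> disc" by (simp add: disc_def)

lemma wd_rot [simp]: "wd \<epsilon> n (rot \<theta> z) = wd \<epsilon> n z" by (simp add: wd_def)

lemma wd'_rot [simp]: "wd' \<epsilon> n (rot \<theta> z) = wd' \<epsilon> n z" by (simp add: wd'_def)

lemma rot_0 [simp]: "rot 0 z = z" by (simp add: rot_def)

lemma rot_rot: "rot (- \<theta>) (rot \<theta> z) = z" "rot \<theta> (rot (- \<theta>) z) = z"
proof -
  have *: "c * (c * x - s * y) + s * (s * x + c * y) = (s\<^sup>2 + c\<^sup>2) * x"
    "c * (s * x + c * y) - s * (c * x - s * y) = (s\<^sup>2 + c\<^sup>2) * y" for c s x y :: real
    by (simp_all add: algebra_simps power2_eq_square)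
  have "rot (- \<theta>) (rot \<theta> z) = z" for \<theta>
    using *(1) [of "cos \<theta>" "fst z" "sin \<theta>" "snd z"] *(2) [of "cos \<theta>" "sin \<theta>" "fst z" "snd z"] by (simp add: rot_def prod_eq_iff)
  from this [of \<theta>] this [of "- \<theta>"]
  show "rot (- \<theta>) (rot \<theta> z) = z" "rot \<theta> (rot (- \<theta>) z) = z" by simp_all
qed

lemma wd_pos: "0 < \<epsilon> \<Longrightarrow> z \<in> disc \<Longrightarrow> 0 < wd \<epsilon> n z"
  by (simp add: wd_def disc_def)

lemma open_disc: "open disc"
  unfolding disc_def nz_def by (intro open_Collect_less continuous_intros)

lemma smooth_on_nz [smooth_intros]:
  "open U \<Longrightarrow> smooth_on U f \<Longrightarrow> smooth_on U (\<lambda>x. nz (f x))"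
  unfolding nz_def by (intro smooth_intros)

lemma smooth_on_wd [smooth_intros]:
  "open U \<Longrightarrow> smooth_on U f \<Longrightarrow> smooth_on U (\<lambda>x. wd \<epsilon> n (f x))"
  "open U \<Longrightarrow> smooth_on U f \<Longrightarrow> smooth_on U (\<lambda>x. wd' \<epsilon> n (f x))"
  unfolding wd_def wd'_def by (intro smooth_intros; assumption)+

lemma smooth_on_rot [smooth_intros]:
  "open U \<Longrightarrow> smooth_on U \<theta> \<Longrightarrow> smooth_on U f \<Longrightarrow> smooth_on U (\<lambda>x. rot (\<theta> x) (f x))"
  unfolding rot_def by (intro smooth_intros)

lemma nz_FDERIV:
  assumes "(f has_derivative f') (at x)"
  shows "((\<lambda>x. nz (f x)) has_derivative
    (\<lambda>v. 2 * (fst (f x) * fst (f' v) + snd (f x) * snd (f' v)))) (at x)"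
  unfolding nz_def by (auto intro!: derivative_eq_intros assms)

lemma wd_FDERIV:
  assumes "(f has_derivative f') (at x)"
  shows "((\<lambda>x. wd \<epsilon> n (f x)) has_derivative
    (\<lambda>v. 2 * wd' \<epsilon> n (f x) * (fst (f x) * fst (f' v) + snd (f x) * snd (f' v)))) (at x)"
  unfolding wd_def wd'_def
  by (rule derivative_eq_intros nz_FDERIV assms refl)+ (simp add: fun_eq_iff algebra_simps)

lemma wd'_FDERIV:
  assumes "(f has_derivative f') (at x)"
  shows "\<exists>c. ((\<lambda>x. wd' \<epsilon> n (f x)) has_derivative
    (\<lambda>v. c * (fst (f x) * fst (f' v) + snd (f x) * snd (f' v)))) (at x)"
  unfolding wd'_def
  by (rule exI [of _ "2 * \<epsilon> * pi * pi * Suc n * n * (1 - pi * nz (f x)) ^ (n - 1)"],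
      (rule derivative_eq_intros nz_FDERIV assms refl)+) (simp add: fun_eq_iff algebra_simps)

lemma rot_FDERIV:
  assumes "(\<theta> has_derivative \<theta>') (at x)" "(f has_derivative f') (at x)"
  shows "((\<lambda>x. rot (\<theta> x) (f x)) has_derivative
    (\<lambda>v. rot (\<theta> x) (f' v) + \<theta>' v *\<^sub>R rot (\<theta> x) (- snd (f x), fst (f x)))) (at x)"
  unfolding rot_def
  by (rule derivative_eq_intros assms refl)+ (simp add: fun_eq_iff algebra_simps)

lemma area_rot:
  "area (rot \<theta> a + s *\<^sub>R rot \<theta> (- snd z, fst z)) (rot \<theta> b + t *\<^sub>R rot \<theta> (- snd z, fst z)) =
   area a b + (fst z * fst a + snd z * snd a) * t - (fst z * fst b + snd z * snd b) * s"
proof -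
  have "(c * a1 - s * a2 + u * (c * - z2 - s * z1)) * (s * b1 + c * b2 + v * (s * - z2 + c * z1)) -
      (c * b1 - s * b2 + v * (c * - z2 - s * z1)) * (s * a1 + c * a2 + u * (s * - z2 + c * z1)) =
     (s\<^sup>2 + c\<^sup>2) * (a1 * b2 - b1 * a2 + (z1 * a1 + z2 * a2) * v - (z1 * b1 + z2 * b2) * u)"
    for c s a1 a2 b1 b2 z1 z2 u v :: real
    by (simp add: algebra_simps power2_eq_square)
  from this [of "cos \<theta>" "fst a" "sin \<theta>" "snd a" s "snd z" "fst z" "fst b" "snd b" t]
  show ?thesis by (simp add: area_def rot_def)
qed

text \<open>The strip starts at -2 whereas the tube \<open>ex_K\<close> starts at -1, which leaves a
  margin on which nothing moves.\<close>

definition ex_O :: "r4 set" where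
  "ex_O = {x. - 2 < fst (fst x) \<and> fst (fst x) < 1 \<and> snd x \<in> disc}"
definition ex_K :: "real \<Rightarrow> nat \<Rightarrow> r4 set" where
  "ex_K \<epsilon> n = {x \<in> ex_O. - 1 \<le> fst (fst x) \<and> \<bar>snd (fst x)\<bar> \<le> wd \<epsilon> n (snd x)}"
definition ex_Z :: "r4 set" where
  "ex_Z = {x \<in> ex_O. 0 \<le> fst (fst x) \<and> snd (fst x) = 0}"

lemma open_ex_O: "open ex_O"
proof -
  have *: "ex_O = ({-2<..<1} \<times> UNIV) \<times> disc" by (auto simp: ex_O_def)
  show ?thesis unfolding * by (intro open_Times open_disc open_UNIV open_greaterThanLessThan)
qed

lemma local_excision:
  assumes \<epsilon>: "0 < \<epsilon>"
  obtains e where "open (ex_O - ex_Z)" "smooth_on (ex_O - ex_Z) e" "sympl_on (ex_O - ex_Z) e"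
    "inj_on e (ex_O - ex_Z)" "e ` (ex_O - ex_Z) = ex_O"
    "\<And>x. x \<in> ex_O - ex_K \<epsilon> n \<Longrightarrow> e x = x"
proof -
  let ?A = "wd \<epsilon> n" and ?A' = "wd' \<epsilon> n"
  define P where "P x = fst (fst x)" for x :: r4
  define S where "S x = snd (fst x)" for x :: r4
  define al where "al x = ((ex_p (P x) (S x), ?A (snd x) * S x), snd x)" for x
  define th where "th x = 2 * ?A' (snd x) * ex_h (P x) (S x)" for x
  define ga where "ga x = ((P x, ?A (snd x) * ex_q (P x) (S x)), rot (th x) (snd x))" for x
  have O: "- 2 < P x" "P x < 1" "snd x \<in> disc" "0 < ?A (snd x)" if "x \<in> ex_O" for x
    using that wd_pos [OF \<epsilon>] by (auto simp: ex_O_def P_def)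
  have OI: "x \<in> ex_O" if "- 2 < P x" "P x < 1" "snd x \<in> disc" for x
    using that by (simp add: ex_O_def P_def)
  note smPS = open_ex_O smooth_on_id [OF open_ex_O] smooth_on_fst [OF open_ex_O] smooth_on_snd [OF open_ex_O]
  have smP: "smooth_on ex_O P" "smooth_on ex_O S" unfolding P_def S_def by (intro smPS)+
  have sm_al: "smooth_on ex_O al" unfolding al_def by (intro smooth_intros smPS smP O)
  have sm_ga: "smooth_on ex_O ga" unfolding ga_def th_def by (intro smooth_intros smPS smP O)
  define dz where "dz x v = fst (snd x) * fst (snd v) + snd (snd x) * snd (snd v)" for x v :: r4
  \<comment> \<open>The inverse of the derivative of \<open>al\<close>, which is triangular: first
    the \<open>s\<close>-component, then the \<open>p\<close>-component.\<close>
  define ai where "ai x v = (let s = (snd (fst v) - S x * (2 * ?A' (snd x) * dz x v)) / ?A (snd x) in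
      (((fst (fst v) - ex_ps (P x) (S x) * s) / ex_N (P x) (S x), s), snd v))" for x v
  have ne: "ex_N (P x) (S x) \<noteq> 0" "?A (snd x) \<noteq> 0" if "x \<in> ex_O" for x
    using ex_N_pos [OF O(2) [OF that], of "S x"] O(4) [OF that] by auto
  have sm_ai: "smooth_on ex_O (\<lambda>x. ai x b)" for b
    unfolding ai_def Let_def dz_def
    by (rule smPS smP smooth_intros | erule O(2) ne)+
  have PD: "(P has_derivative (\<lambda>v. fst (fst v))) (at x)" for x
    unfolding P_def by (auto intro!: derivative_eq_intros)
  have SD: "(S has_derivative (\<lambda>v. snd (fst v))) (at x)" for x
    unfolding S_def by (auto intro!: derivative_eq_intros)
  have zD: "(snd has_derivative snd) (at x)" for x :: r4
    by (auto intro!: derivative_eq_intros)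
  define al1 where "al1 x v = ex_N (P x) (S x) * fst (fst v) + ex_ps (P x) (S x) * snd (fst v)" for x v :: r4
  define dA where "dA x v = 2 * ?A' (snd x) * dz x v" for x v
  have AD: "((\<lambda>x. ?A (snd x)) has_derivative dA x) (at x)" for x
    using wd_FDERIV [OF zD, of \<epsilon> n x] by (simp add: dA_def [abs_def] dz_def)
  have al_D: "(al has_derivative
      (\<lambda>v. ((al1 x v, ?A (snd x) * snd (fst v) + dA x v * S x), snd v))) (at x)" if "x \<in> ex_O" for x
    unfolding al_def al1_def
    by (intro has_derivative_Pair has_derivative_mult AD ex_p_FDERIV PD SD zD O that)
  define dq where "dq x v = ex_N (P x) (S x) * snd (fst v) + ex_qp (P x) (S x) * fst (fst v)" for x v :: r4
  define dh where "dh x v = ex_q (P x) (S x) * fst (fst v) - S x * al1 x v" for x v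
  have hD: "((\<lambda>x. ex_h (P x) (S x)) has_derivative dh x) (at x)" if "x \<in> ex_O" for x
    using ex_h_FDERIV [OF O(2) [OF that] PD SD] by (simp add: dh_def [abs_def] al1_def)
  \<comment> \<open>The factor \<open>c\<close> may stay unspecified: it multiplies the radial
    differential, which is wedged with itself and drops out.\<close>
  have "\<forall>x. \<exists>c. ((\<lambda>x. ?A' (snd x)) has_derivative (\<lambda>v. c * dz x v)) (at x)"
    unfolding dz_def by (intro allI wd'_FDERIV zD)
  from choice [OF this] obtain c
    where "\<forall>x. ((\<lambda>x. ?A' (snd x)) has_derivative (\<lambda>v. c x * dz x v)) (at x)" ..
  then have c: "((\<lambda>x. ?A' (snd x)) has_derivative (\<lambda>v. c x * dz x v)) (at x)" for x ..
  have thD: "(th has_derivative (\<lambda>v. 2 * (?A' (snd x) * dh x v + c x * dz x v * ex_h (P x) (S x)))) (at x)"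
    if "x \<in> ex_O" for x
    using has_derivative_mult_right [OF has_derivative_mult [OF c hD [OF that]], of 2]
    by (simp add: th_def [abs_def] mult.assoc)
  have ga_D: "(ga has_derivative (\<lambda>v. ((fst (fst v),
       ?A (snd x) * dq x v + dA x v * ex_q (P x) (S x)),
       rot (th x) (snd v) + (2 * (?A' (snd x) * dh x v + c x * dz x v * ex_h (P x) (S x))) *\<^sub>R
         rot (th x) (- snd (snd x), fst (snd x))))) (at x)" if "x \<in> ex_O" for x
    unfolding ga_def dq_def
    by (intro has_derivative_Pair has_derivative_mult AD ex_q_FDERIV rot_FDERIV thD PD SD zD O that)
  have inv: "((al1 x (ai x v), ?A (snd x) * snd (fst (ai x v)) + dA x (ai x v) * S x), snd (ai x v)) = v"
    if "x \<in> ex_O" for x v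
  proof -
    have "dA x (ai x v) = dA x v" by (simp add: dA_def dz_def ai_def Let_def)
    then show ?thesis
      using ne [OF that] by (simp add: prod_eq_iff al1_def ai_def Let_def flip: dA_def)
  qed
  have om: "om ((fst (fst v), ?A (snd x) * dq x v + dA x v * ex_q (P x) (S x)),
       rot (th x) (snd v) + (2 * (?A' (snd x) * dh x v + c x * dz x v * ex_h (P x) (S x))) *\<^sub>R
         rot (th x) (- snd (snd x), fst (snd x)))
     ((fst (fst w), ?A (snd x) * dq x w + dA x w * ex_q (P x) (S x)),
       rot (th x) (snd w) + (2 * (?A' (snd x) * dh x w + c x * dz x w * ex_h (P x) (S x))) *\<^sub>R
         rot (th x) (- snd (snd x), fst (snd x))) =
     om ((al1 x v, ?A (snd x) * snd (fst v) + dA x v * S x), snd v)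
        ((al1 x w, ?A (snd x) * snd (fst w) + dA x w * S x), snd w)" for x v w :: r4
  proof -
    have "v1 * (A * (N * w2 + Qp * w1) + 2 * A' * dw * Q) - w1 * (A * (N * v2 + Qp * v1) + 2 * A' * dv * Q) +
        (a + dv * (2 * (A' * (Q * w1 - s * (N * w1 + E * w2)) + c * dw * h)) -
          dw * (2 * (A' * (Q * v1 - s * (N * v1 + E * v2)) + c * dv * h))) =
       (N * v1 + E * v2) * (A * w2 + 2 * A' * dw * s) - (N * w1 + E * w2) * (A * v2 + 2 * A' * dv * s) + a"
      for v1 v2 w1 w2 A A' N E Q Qp s h c a dv dw :: real
      by (simp add: algebra_simps)
    note ident = this
    have area_rot': "area (rot (th x) (snd v) + s *\<^sub>R rot (th x) (- snd (snd x), fst (snd x)))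
          (rot (th x) (snd w) + t *\<^sub>R rot (th x) (- snd (snd x), fst (snd x))) =
        area (snd v) (snd w) + dz x v * t - dz x w * s" for s t
      unfolding dz_def by (rule area_rot)
    show ?thesis
      unfolding om_def fst_conv snd_conv area_rot' dq_def dA_def dh_def al1_def
      unfolding area_def [of "(_, _)"] fst_conv snd_conv
      by (rule ident)
  qed
  have inj_al: "inj_on al ex_O"
  proof (rule inj_onI)
    fix x y assume xy: "x \<in> ex_O" "y \<in> ex_O" "al x = al y"
    then have z: "snd x = snd y" and s: "S x = S y" using O(4) [OF xy(1)] by (auto simp: al_def)
    have "P x = P y"
    proof (rule ccontr)
      assume "P x \<noteq> P y"
      then show False
        using ex_p_mono [OF _ O(2) [OF xy(1)], of "P y" "S y"]
          ex_p_mono [OF _ O(2) [OF xy(2)], of "P x" "S y"] xy(3) s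
        by (auto simp: al_def neq_iff)
    qed
    then show "x = y" using z s by (simp add: prod_eq_iff P_def S_def)
  qed
  have al_img: "al ` ex_O = ex_O - ex_Z"
  proof (intro subset_antisym subsetI)
    fix y assume "y \<in> al ` ex_O"
    then obtain x where x: "x \<in> ex_O" "y = al x" by (metis imageE)
    then show "y \<in> ex_O - ex_Z"
      using O [OF x(1)] ex_p_range [of "P x" "S x"] by (auto simp: ex_O_def ex_Z_def al_def)
  next
    fix y assume y: "y \<in> ex_O - ex_Z"
    have yO: "- 2 < P y" "P y < 1" "snd y \<in> disc" "0 < ?A (snd y)" using O y by auto
    define s where "s = S y / ?A (snd y)"
    have "s \<noteq> 0 \<or> P y < 0" using y yO by (auto simp: s_def ex_Z_def P_def S_def)
    then obtain p where p: "- 2 < p" "p < 1" "ex_p p s = P y" using ex_p_solve [OF yO(1,2)] by metis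
    have "al ((p, s), snd y) = y"
      using yO p by (simp add: al_def P_def S_def s_def prod_eq_iff)
    moreover have "((p, s), snd y) \<in> ex_O" using p yO by (simp add: ex_O_def)
    ultimately show "y \<in> al ` ex_O" by (metis imageI)
  qed
  have inj_ga: "inj_on ga ex_O"
  proof (rule inj_onI)
    fix x y assume xy: "x \<in> ex_O" "y \<in> ex_O" "ga x = ga y"
    have p: "P x = P y" and r: "rot (th x) (snd x) = rot (th y) (snd y)"
      using xy by (auto simp: ga_def)
    have A: "?A (snd x) = ?A (snd y)" "?A' (snd x) = ?A' (snd y)" using r by (metis wd_rot, metis wd'_rot)
    then have q: "ex_q (P y) (S x) = ex_q (P y) (S y)" using xy(3) p O(4) [OF xy(2)] by (simp add: ga_def)
    have s: "S x = S y"
    proof (rule ccontr)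
      assume "S x \<noteq> S y"
      then show False
        using ex_q_mono [OF _ O(2) [OF xy(2)], of "S x" "S y"]
          ex_q_mono [OF _ O(2) [OF xy(2)], of "S y" "S x"] q by (auto simp: neq_iff)
    qed
    have "th x = th y" by (simp add: th_def p s A)
    then have "snd x = snd y" using r by (metis rot_rot(1))
    then show "x = y" using p s by (simp add: prod_eq_iff P_def S_def)
  qed
  have ga_img: "ga ` ex_O = ex_O"
  proof (intro subset_antisym subsetI)
    fix y assume "y \<in> ga ` ex_O"
    then obtain x where x: "x \<in> ex_O" "y = ga x" by (metis imageE)
    then show "y \<in> ex_O" using O [OF x(1)] by (auto simp: ex_O_def ga_def)
  next
    fix y assume y: "y \<in> ex_O"
    obtain s where s: "ex_q (P y) s = S y / ?A (snd y)" using ex_q_solve [OF O(2) [OF y]] by metis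
    define \<theta> where "\<theta> = 2 * ?A' (snd y) * ex_h (P y) s"
    define x where "x = ((P y, s), rot (- \<theta>) (snd y))"
    have "th x = \<theta>" by (simp add: th_def x_def P_def S_def \<theta>_def)
    then have "ga x = y" using s O(4) [OF y] by (simp add: ga_def x_def rot_rot P_def S_def prod_eq_iff)
    moreover have "x \<in> ex_O" using O [OF y] by (simp add: x_def ex_O_def)
    ultimately show "y \<in> ga ` ex_O" by (metis imageI)
  qed
  define g where "g = inv_into ex_O al"
  have g: "g (al x) = x" if "x \<in> ex_O" for x using inj_al that by (simp add: g_def)
  have main: "open (al ` ex_O)" "smooth_on (al ` ex_O) (\<lambda>y. ga (g y))" "sympl_on (al ` ex_O) (\<lambda>y. ga (g y))"
    by ((rule sympl_via_open [OF open_ex_O sm_al sm_ga] sympl_via_smooth [OF open_ex_O sm_al sm_ga]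
        sympl_via_sympl [OF open_ex_O sm_al sm_ga]);
      (erule g al_D ga_D inv | rule sm_ai om))+
  show thesis
  proof (rule that)
    show "open (ex_O - ex_Z)" "smooth_on (ex_O - ex_Z) (\<lambda>y. ga (g y))"
      "sympl_on (ex_O - ex_Z) (\<lambda>y. ga (g y))" using main by (simp_all add: al_img)
    have g_bij: "bij_betw g (ex_O - ex_Z) ex_O"
      using bij_betw_inv_into [of al ex_O "ex_O - ex_Z"] inj_al al_img by (simp add: bij_betw_def g_def)
    have "bij_betw ga ex_O ex_O" using inj_ga ga_img by (simp add: bij_betw_def)
    from bij_betw_trans [OF g_bij this] have "bij_betw (\<lambda>y. ga (g y)) (ex_O - ex_Z) ex_O"
      by (simp add: comp_def)
    then show "inj_on (\<lambda>y. ga (g y)) (ex_O - ex_Z)" "(\<lambda>y. ga (g y)) ` (ex_O - ex_Z) = ex_O"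
      by (simp_all add: bij_betw_def)
    fix x assume x: "x \<in> ex_O - ex_K \<epsilon> n"
    then have xO: "x \<in> ex_O" by simp
    define s where "s = S x / ?A (snd x)"
    have out: "P x < - 1 \<or> 1 \<le> \<bar>s\<bar>"
      using x O(4) [OF xO] by (auto simp: ex_K_def s_def P_def S_def field_simps)
    define x' where "x' = ((P x, s), snd x)"
    have x': "P x' = P x" "S x' = s" "snd x' = snd x" by (simp_all add: x'_def P_def S_def)
    note E = ex_outside [OF O(2) [OF xO] out]
    have As: "?A (snd x) * s = S x" using O(4) [OF xO] by (simp add: s_def)
    have "((P x, S x), snd x) = x" by (simp add: P_def S_def)
    then have "al x' = x" "ga x' = x" by (simp_all add: al_def ga_def th_def x' E As)
    moreover have "x' \<in> ex_O" by (rule OI) (use O [OF xO] x' in auto)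
    ultimately show "ga (g x) = x" using g by metis
  qed
qed

section \<open>Symmetry of second derivatives, area-preserving coordinates on the disc, cotangent
  lifts\<close>

lemma symmetric_partials:
  fixes f fp fe a b b' c :: "r2 \<Rightarrow> real"
  assumes U: "open U" "x \<in> U"
    and f: "\<And>y. y \<in> U \<Longrightarrow> (f has_derivative (\<lambda>v. fp y * fst v + fe y * snd v)) (at y)"
    and fp: "\<And>y. y \<in> U \<Longrightarrow> (fp has_derivative (\<lambda>v. a y * fst v + b y * snd v)) (at y)"
    and fe: "\<And>y. y \<in> U \<Longrightarrow> (fe has_derivative (\<lambda>v. b' y * fst v + c y * snd v)) (at y)"
    and cont: "continuous_on U b" "continuous_on U b'"
  shows "b x = b' x"
proof (rule ccontr)
  assume ne: "b x \<noteq> b' x"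
  define \<epsilon> where "\<epsilon> = \<bar>b x - b' x\<bar> / 2"
  have \<epsilon>: "\<epsilon> > 0" using ne by (simp add: \<epsilon>_def)
  have "isCont b x" "isCont b' x" using cont U by (auto simp: continuous_on_eq_continuous_at)
  then have "\<forall>\<^sub>F y in nhds x. y \<in> U \<and> dist (b y) (b x) < \<epsilon> \<and> dist (b' y) (b' x) < \<epsilon>"
    using \<epsilon> U unfolding continuous_within
    by (intro eventually_conj eventually_nhds_in_open tendstoD) (auto simp: tendsto_at_iff_tendsto_nhds)
  then obtain d where d: "d > 0" and near: "\<And>y. dist y x < d \<Longrightarrow>
      y \<in> U \<and> dist (b y) (b x) < \<epsilon> \<and> dist (b' y) (b' x) < \<epsilon>"
    unfolding eventually_nhds_metric by blast
  define h where "h = d / 3"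
  have h: "h > 0" using d by (simp add: h_def)
  obtain p e where x: "x = (p, e)" by (cases x)
  have near': "dist (p + s, e + r) x < d" if "0 \<le> s" "s \<le> h" "0 \<le> r" "r \<le> h" for s r
  proof -
    have "dist (p + s, e + r) x \<le> dist (p + s) p + dist (e + r) e"
      unfolding x dist_Pair_Pair by (rule sqrt_sum_squares_le_sum) simp_all
    then show ?thesis using that d by (simp add: dist_real_def h_def)
  qed
  note U' = near' [THEN near, THEN conjunct1]
  have Dp: "((\<lambda>s. g (p + s, e + r)) has_real_derivative gp (p + s, e + r)) (at s)"
    and De: "((\<lambda>r. g (p + s, e + r)) has_real_derivative ge (p + s, e + r)) (at r)"
    if "(g has_derivative (\<lambda>v. gp (p + s, e + r) * fst v + ge (p + s, e + r) * snd v)) (at (p + s, e + r))"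
    for g gp ge :: "r2 \<Rightarrow> real" and s r
  proof -
    have "((\<lambda>s. (p + s, e + r)) has_derivative (\<lambda>v. (v, 0))) (at s)"
      "((\<lambda>r. (p + s, e + r)) has_derivative (\<lambda>v. (0, v))) (at r)"
      by (auto intro!: derivative_eq_intros)
    from this [THEN has_derivative_compose, OF that]
    show "((\<lambda>s. g (p + s, e + r)) has_real_derivative gp (p + s, e + r)) (at s)"
      "((\<lambda>r. g (p + s, e + r)) has_real_derivative ge (p + s, e + r)) (at r)"
      by (simp_all add: has_field_derivative_def mult.commute [of "gp _"] mult.commute [of "ge _"]
          mult_commute_abs)
  qed
  have f_p: "((\<lambda>s. f (p + s, e + r)) has_real_derivative fp (p + s, e + r)) (at s)"
    and f_e: "((\<lambda>r. f (p + s, e + r)) has_real_derivative fe (p + s, e + r)) (at r)"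
    and fp_e: "((\<lambda>r. fp (p + s, e + r)) has_real_derivative b (p + s, e + r)) (at r)"
    and fe_p: "((\<lambda>s. fe (p + s, e + r)) has_real_derivative b' (p + s, e + r)) (at s)"
    if "0 \<le> s" "s \<le> h" "0 \<le> r" "r \<le> h" for s r
    using Dp [where g = f and gp = fp and ge = fe, OF f [OF U' [OF that]]]
      De [where g = f and gp = fp and ge = fe, OF f [OF U' [OF that]]]
      De [where g = fp and gp = a and ge = b, OF fp [OF U' [OF that]]]
      Dp [where g = fe and gp = b' and ge = c, OF fe [OF U' [OF that]]] by auto
  \<comment> \<open>The second difference over a small square, evaluated by the mean value theorem
    in both orders; continuity of the mixed derivatives then contradicts their assumed
    difference.\<close>
  let ?\<Delta> = "f (p + h, e + h) - f (p + h, e) - (f (p, e + h) - f (p, e))"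
  have "\<exists>z>0. z < h \<and> (f (p + h, e + h) - f (p + h, e + 0)) - (f (p + 0, e + h) - f (p + 0, e + 0)) =
      (h - 0) * (fp (p + z, e + h) - fp (p + z, e + 0))"
    by (rule MVT2 [OF h]) (intro DERIV_diff f_p; use h in simp)
  then obtain s where s: "0 < s" "s < h" "?\<Delta> = h * (fp (p + s, e + h) - fp (p + s, e + 0))" by auto
  have "\<exists>z>0. z < h \<and> fp (p + s, e + h) - fp (p + s, e + 0) = (h - 0) * b (p + s, e + z)"
    by (rule MVT2 [OF h]) (intro fp_e; use h s in simp)
  then obtain r where r: "0 < r" "r < h" "?\<Delta> = h * h * b (p + s, e + r)" using s(3) by auto
  have "\<exists>z>0. z < h \<and> (f (p + h, e + h) - f (p + 0, e + h)) - (f (p + h, e + 0) - f (p + 0, e + 0)) =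
      (h - 0) * (fe (p + h, e + z) - fe (p + 0, e + z))"
    by (rule MVT2 [OF h]) (intro DERIV_diff f_e; use h in simp)
  then obtain r' where r': "0 < r'" "r' < h" "?\<Delta> = h * (fe (p + h, e + r') - fe (p + 0, e + r'))"
    by (auto simp: algebra_simps)
  have "\<exists>z>0. z < h \<and> fe (p + h, e + r') - fe (p + 0, e + r') = (h - 0) * b' (p + z, e + r')"
    by (rule MVT2 [OF h]) (intro fe_p; use h r' in simp)
  then obtain s' where s': "0 < s'" "s' < h" "?\<Delta> = h * h * b' (p + s', e + r')" using r'(3) by auto
  have "b (p + s, e + r) = b' (p + s', e + r')" using r(3) s'(3) h by simp
  moreover have "dist (b (p + s, e + r)) (b x) < \<epsilon>" "dist (b' (p + s', e + r')) (b' x) < \<epsilon>"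
    using near [OF near' [of s r]] near [OF near' [of s' r']] s(1,2) r(1,2) s'(1,2) r'(1,2) by auto
  ultimately show False by (auto simp: \<epsilon>_def dist_real_def abs_if field_simps split: if_splits)
qed

text \<open>\<open>slab x\<close> is the area of the part of the disc to the left of the abscissa \<open>x\<close>.\<close>

definition rad :: real where "rad = 1 / sqrt pi"
definition wid :: "real \<Rightarrow> real" where "wid x = sqrt (1 / pi - x\<^sup>2)"
definition slab :: "real \<Rightarrow> real" where "slab x = 1/2 + x * wid x + arcsin (sqrt pi * x) / pi"
definition kap :: "r2 \<Rightarrow> r2" where
  "kap z = (slab (fst z), 1/2 + snd z / (2 * wid (fst z)))"

lemma rad: "0 < rad" "rad\<^sup>2 = 1 / pi" "sqrt pi * rad = 1"
  by (simp_all add: rad_def power_divide)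

lemma abs_less_iff_power2: "0 < (r::real) \<Longrightarrow> \<bar>x\<bar> < r \<longleftrightarrow> x\<^sup>2 < r\<^sup>2"
  using abs_le_square_iff [of r x] by auto

lemma abs_less_rad: "\<bar>x\<bar> < rad \<longleftrightarrow> pi * x\<^sup>2 < 1"
  unfolding abs_less_iff_power2 [OF rad(1)] by (simp add: rad(2) field_simps)

lemma wid_pos: "\<bar>x\<bar> < rad \<Longrightarrow> 0 < wid x" and wid_sq: "\<bar>x\<bar> < rad \<Longrightarrow> (wid x)\<^sup>2 = 1 / pi - x\<^sup>2"
  by (auto simp: wid_def abs_less_rad field_simps)

lemma wid_deriv: "\<bar>x\<bar> < rad \<Longrightarrow> (wid has_real_derivative - x / wid x) (at x)"
  unfolding wid_def [abs_def]
  by (auto intro!: derivative_eq_intros simp: abs_less_rad field_simps)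

lemma slab_deriv:
  assumes "\<bar>x\<bar> < rad" shows "(slab has_real_derivative 2 * wid x) (at x)"
proof -
  have x: "\<bar>sqrt pi * x\<bar> < 1" using assms rad(3) by (simp add: abs_mult rad_def field_simps)
  have s: "sqrt (1 - (sqrt pi * x)\<^sup>2) = sqrt pi * wid x"
    by (simp add: wid_def power_mult_distrib algebra_simps flip: real_sqrt_mult)
  have "(slab has_real_derivative
      (wid x + x * (- x / wid x) + inverse (sqrt (1 - (sqrt pi * x)\<^sup>2)) * sqrt pi / pi)) (at x)"
    unfolding slab_def [abs_def] using x
    by (auto intro!: derivative_eq_intros wid_deriv assms)
  moreover have "wid x + x * (- x / wid x) + inverse (sqrt (1 - (sqrt pi * x)\<^sup>2)) * sqrt pi / pi = 2 * wid x"
    unfolding s using wid_pos [OF assms] wid_sq [OF assms]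
    by (simp add: field_simps power2_eq_square)
  ultimately show ?thesis by (rule DERIV_cong)
qed

lemma slab_ends: "slab rad = 1" "slab (- rad) = 0"
proof -
  have "wid rad = 0" "wid (- rad) = 0" by (simp_all add: wid_def rad(2))
  then show "slab rad = 1" "slab (- rad) = 0"
    using rad(3) by (simp_all add: slab_def)
qed

lemma continuous_on_slab: "continuous_on {- rad..rad} slab"
proof -
  have "\<bar>sqrt pi * x\<bar> \<le> 1" if "x \<in> {- rad..rad}" for x
    using that mult_left_mono [of "\<bar>x\<bar>" rad "sqrt pi"] rad(3) by (simp add: abs_mult abs_le_iff)
  then show ?thesis unfolding slab_def [abs_def] wid_def
    by (intro continuous_intros) (auto simp: abs_le_iff)
qed

lemma slab_mono: assumes "- rad \<le> x" "x < y" "y \<le> rad" shows "slab x < slab y"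
proof (rule DERIV_pos_imp_increasing_open [OF assms(2)])
  show "\<exists>d. (slab has_real_derivative d) (at z) \<and> 0 < d" if "x < z" "z < y" for z
    using slab_deriv [of z] wid_pos [of z] that assms by (intro exI [of _ "2 * wid z"]) auto
  show "continuous_on {x..y} slab"
    by (rule continuous_on_subset [OF continuous_on_slab]) (use assms in auto)
qed

lemma slab_range: "\<bar>x\<bar> < rad \<Longrightarrow> 0 < slab x \<and> slab x < 1"
  using slab_mono [of "- rad" x] slab_mono [of x rad] slab_ends by auto

text \<open>Both sides vanish at \<open>- rad\<close>, and their difference has derivative
  \<open>4 * pi * (w + x * pi * w^2)\<close> with \<open>w = wid x\<close>, which is nonnegative
  because \<open>pi * \<bar>x\<bar> * w \<le> 1\<close>. So two factors \<open>1 - pi * x^2\<close>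
  of the damping control the distance of \<open>t\<close> from 0.\<close>

lemma slab_lower: assumes "\<bar>x\<bar> < rad" shows "(1 - pi * x\<^sup>2)\<^sup>2 \<le> 2 * pi * slab x"
proof -
  have "2 * pi * slab (- rad) - (1 - pi * (- rad)\<^sup>2)\<^sup>2 \<le> 2 * pi * slab x - (1 - pi * x\<^sup>2)\<^sup>2"
  proof (rule DERIV_nonneg_imp_increasing_open [where f = "\<lambda>x. 2 * pi * slab x - (1 - pi * x\<^sup>2)\<^sup>2"])
    fix z assume z: "- rad < z" "z < x"
    then have z': "\<bar>z\<bar> < rad" using assms by auto
    have "((\<lambda>x. 2 * pi * slab x - (1 - pi * x\<^sup>2)\<^sup>2) has_real_derivative
        4 * pi * wid z + 4 * pi * z * (1 - pi * z\<^sup>2)) (at z)"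
      by (auto intro!: derivative_eq_intros slab_deriv z' simp: power2_eq_square algebra_simps)
    moreover have "4 * pi * wid z + 4 * pi * z * (1 - pi * z\<^sup>2) \<ge> 0"
    proof -
      have w: "1 - pi * z\<^sup>2 = pi * (wid z)\<^sup>2" by (simp add: wid_sq [OF z'] field_simps)
      have "(wid z)\<^sup>2 \<le> rad\<^sup>2" by (simp add: wid_sq [OF z'] rad(2))
      then have wr: "wid z \<le> rad" by (rule power2_le_imp_le [OF _ less_imp_le [OF rad(1)]])
      have "\<bar>z\<bar> * wid z \<le> rad * rad" using z' wr wid_pos [OF z'] by (intro mult_mono) auto
      also have "\<dots> = 1 / pi" using rad(2) by (simp add: power2_eq_square)
      finally have "\<bar>z\<bar> * wid z * pi \<le> 1" by (simp add: field_simps)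
      then have "\<bar>z\<bar> * (pi * (wid z)\<^sup>2) \<le> wid z"
        using mult_right_mono [of "\<bar>z\<bar> * wid z * pi" 1 "wid z"] wid_pos [OF z']
        by (simp add: power2_eq_square mult_ac)
      moreover have "- (z * (pi * (wid z)\<^sup>2)) \<le> \<bar>z\<bar> * (pi * (wid z)\<^sup>2)"
        by (rule order_trans [OF abs_ge_minus_self]) (simp add: abs_mult)
      ultimately have "0 \<le> wid z + z * (pi * (wid z)\<^sup>2)" by linarith
      then have "0 \<le> 4 * pi * (wid z + z * (pi * (wid z)\<^sup>2))" by simp
      then show ?thesis by (simp add: w algebra_simps)
    qed
    ultimately show "\<exists>y. ((\<lambda>x. 2 * pi * slab x - (1 - pi * x\<^sup>2)\<^sup>2) has_real_derivative y) (at z) \<and> 0 \<le> y"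
      by blast
  next
    have "continuous_on {- rad..x} slab"
      by (rule continuous_on_subset [OF continuous_on_slab]) (use assms in auto)
    then show "continuous_on {- rad..x} (\<lambda>x. 2 * pi * slab x - (1 - pi * x\<^sup>2)\<^sup>2)"
      by (intro continuous_intros)
  qed (use assms in auto)
  then show ?thesis by (simp add: slab_ends rad(2))
qed

lemma slab_minus: "slab (- x) = 1 - slab x" if "\<bar>x\<bar> < rad"
proof -
  have "\<bar>sqrt pi * x\<bar> < 1"
    using that mult_strict_left_mono [of "\<bar>x\<bar>" rad "sqrt pi"] rad(3) by (simp add: abs_mult)
  then have "arcsin (- (sqrt pi * x)) = - arcsin (sqrt pi * x)"
    by (intro arcsin_minus) linarith+
  then show ?thesis by (simp add: slab_def wid_def)
qed

lemma disc_imp_rad: "z \<in> disc \<Longrightarrow> \<bar>fst z\<bar> < rad"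
  unfolding abs_less_rad disc_def nz_def
  by (simp add: distrib_left) (smt (verit) pi_gt_zero zero_le_mult_iff zero_le_power2)

lemma disc_iff: "z \<in> disc \<longleftrightarrow> \<bar>fst z\<bar> < rad \<and> \<bar>snd z\<bar> < wid (fst z)"
proof -
  have "z \<in> disc \<longleftrightarrow> (snd z)\<^sup>2 < (wid (fst z))\<^sup>2" if "\<bar>fst z\<bar> < rad"
    by (simp add: disc_def nz_def wid_sq [OF that] field_simps)
  moreover have "(snd z)\<^sup>2 < (wid (fst z))\<^sup>2 \<longleftrightarrow> \<bar>snd z\<bar> < wid (fst z)" if "\<bar>fst z\<bar> < rad"
    using abs_less_iff_power2 [OF wid_pos [OF that]] by simp
  ultimately show ?thesis using disc_imp_rad by blast
qed

lemma kap_range: "z \<in> disc \<Longrightarrow> kap z \<in> {0<..<1} \<times> {0<..<1}"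
  using slab_range [of "fst z"] wid_pos [of "fst z"]
  by (auto simp: kap_def disc_iff abs_less_iff field_simps)

text \<open>Since \<open>snd z = (2 * e - 1) * wid (fst z)\<close>, the radial damping splits into a
  function of the abscissa, hence of \<open>t\<close>, and a function of \<open>e\<close>.\<close>

lemma kap_nz: assumes "z \<in> disc"
  shows "1 - pi * nz z = (1 - pi * (fst z)\<^sup>2) * (4 * (snd (kap z) * (1 - snd (kap z))))"
proof -
  define e where "e = snd (kap z)"
  have r: "\<bar>fst z\<bar> < rad" using assms by (rule disc_imp_rad)
  have "snd z = (2 * e - 1) * wid (fst z)"
    using wid_pos [OF r] by (simp add: e_def kap_def field_simps)
  then have "pi * (snd z)\<^sup>2 = (2 * e - 1)\<^sup>2 * (pi * (wid (fst z))\<^sup>2)"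
    by (simp add: power_mult_distrib)
  moreover have "pi * (wid (fst z))\<^sup>2 = 1 - pi * (fst z)\<^sup>2" by (simp add: wid_sq [OF r] field_simps)
  ultimately have "pi * (snd z)\<^sup>2 = (2 * e - 1)\<^sup>2 * (1 - pi * (fst z)\<^sup>2)" by simp
  then show ?thesis
    unfolding e_def [symmetric] by (simp add: nz_def algebra_simps power2_eq_square)
qed

lemma kap_bij: "bij_betw kap disc ({0<..<1} \<times> {0<..<1})"
  unfolding bij_betw_def
proof
  show "inj_on kap disc"
  proof (rule inj_onI)
    fix z z' assume z: "z \<in> disc" "z' \<in> disc" "kap z = kap z'"
    note r = disc_imp_rad [OF z(1)] disc_imp_rad [OF z(2)]
    have x: "fst z = fst z'"
    proof (rule ccontr)
      assume "fst z \<noteq> fst z'"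
      then show False using slab_mono [of "fst z" "fst z'"] slab_mono [of "fst z'" "fst z"] r z(3)
        by (auto simp: kap_def neq_iff abs_less_iff)
    qed
    then show "z = z'" using z(3) wid_pos [OF r(1)] by (auto simp: kap_def prod_eq_iff)
  qed
  show "kap ` disc = {0<..<1} \<times> {0<..<1}"
  proof (intro subset_antisym subsetI)
    fix y :: r2 assume y: "y \<in> {0<..<1} \<times> {0<..<1}"
    then have y': "0 < fst y" "fst y < 1" "0 < snd y" "snd y < 1" by (auto simp: mem_Times_iff)
    have "\<exists>x\<ge>- rad. x \<le> rad \<and> slab x = fst y"
      by (rule IVT' [OF _ _ _ continuous_on_slab]) (use y' rad slab_ends in auto)
    then obtain x where x: "- rad \<le> x" "x \<le> rad" "slab x = fst y" by blast
    then have "x \<noteq> - rad" "x \<noteq> rad" using y' slab_ends by auto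
    then have r: "\<bar>x\<bar> < rad" using x by auto
    define z where "z = (x, (2 * snd y - 1) * wid x)"
    have "kap z = y" using x(3) wid_pos [OF r] by (simp add: kap_def z_def prod_eq_iff field_simps)
    moreover have "z \<in> disc"
      unfolding disc_iff using r wid_pos [OF r] y' by (simp add: z_def abs_mult abs_less_iff)
    ultimately show "y \<in> kap ` disc" by blast
  qed (use kap_range in blast)
qed

lemma smooth_on_wid: "smooth_on {-rad<..<rad} wid"
  unfolding wid_def [abs_def]
  by (intro smooth_intros) (auto simp: abs_less_rad [symmetric] abs_less_iff field_simps)

lemma smooth_on_slab: "smooth_on {-rad<..<rad} slab"
  by (rule smooth_on_real_derivative [where f' = "\<lambda>x. 2 * wid x"])
    (auto intro!: slab_deriv smooth_intros smooth_on_wid)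

lemma smooth_on_kap [smooth_intros]:
  assumes "open U" "smooth_on U f" "\<And>x. x \<in> U \<Longrightarrow> f x \<in> disc"
  shows "smooth_on U (\<lambda>x. kap (f x))"
proof -
  have r: "fst (f x) \<in> {-rad<..<rad}" "wid (fst (f x)) \<noteq> 0" if "x \<in> U" for x
    using disc_imp_rad [OF assms(3) [OF that]] wid_pos [of "fst (f x)"] by auto
  have "smooth_on U (\<lambda>x. slab (fst (f x)))" "smooth_on U (\<lambda>x. wid (fst (f x)))"
    by (rule smooth_on_compose [OF assms(1) _ smooth_on_slab]
        smooth_on_compose [OF assms(1) _ smooth_on_wid]; use r in \<open>auto intro!: smooth_intros assms\<close>)+
  then show ?thesis unfolding kap_def
    by (intro smooth_intros assms) (use r in auto)
qed

lemmas slab_FDERIV [derivative_intros] =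
  slab_deriv [THEN DERIV_compose_FDERIV] wid_deriv [THEN DERIV_compose_FDERIV]

lemma kap_FDERIV:
  assumes "(f has_derivative f') (at x)" "f x \<in> disc"
  defines "w \<equiv> wid (fst (f x))"
  shows "((\<lambda>x. fst (kap (f x))) has_derivative (\<lambda>v. 2 * w * fst (f' v))) (at x)"
    "((\<lambda>x. snd (kap (f x))) has_derivative
       (\<lambda>v. snd (f' v) / (2 * w) + snd (f x) * fst (f x) / (2 * w ^ 3) * fst (f' v))) (at x)"
proof -
  have r: "\<bar>fst (f x)\<bar> < rad" by (rule disc_imp_rad [OF assms(2)])
  have w: "w > 0" using wid_pos [OF r] by (simp add: w_def)
  have w0: "2 * wid (fst (f x)) \<noteq> 0" using w by (simp add: w_def)
  show "((\<lambda>x. fst (kap (f x))) has_derivative (\<lambda>v. 2 * w * fst (f' v))) (at x)"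
    unfolding kap_def fst_conv w_def
    by (rule derivative_eq_intros assms r refl)+ (simp add: fun_eq_iff)
  show "((\<lambda>x. snd (kap (f x))) has_derivative
       (\<lambda>v. snd (f' v) / (2 * w) + snd (f x) * fst (f x) / (2 * w ^ 3) * fst (f' v))) (at x)"
    unfolding kap_def snd_conv
    by (rule derivative_eq_intros assms r w0 refl)+
      (use w in \<open>simp add: fun_eq_iff divide_simps power3_eq_cube flip: w_def\<close>)
qed

lemma open_diff_sequential:
  fixes M S :: "'a::metric_space set"
  assumes "open M" "\<And>x l. (\<And>n. x n \<in> S) \<Longrightarrow> x \<longlonglongrightarrow> l \<Longrightarrow> l \<in> M \<Longrightarrow> l \<in> S"
  shows "open (M - S)"
proof -
  have "l \<in> S" if "l \<in> M" "l \<in> closure S" for l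
    using that assms(2) unfolding closure_sequential by metis
  then have "M - S = M - closure S" using closure_subset [of S] by blast
  then show ?thesis using assms(1) by (metis closed_closure open_Diff)
qed

text \<open>Of the \<open>m + 2\<close> factors of \<open>1 - pi * nz z\<close>, \<open>m\<close>
  keep their part in \<open>e\<close>, to beat the slope of the arcs, and two keep their part in the
  abscissa, to keep the shifted \<open>t\<close> between 0 and 1. All other factors are at most
  1.\<close>

lemma kap_wd_bound:
  assumes "z \<in> disc" "0 < \<epsilon>"
  defines "t \<equiv> fst (kap z)" and "e \<equiv> snd (kap z)"
  shows "wd \<epsilon> (Suc m) z \<le> \<epsilon> * (4 * (e * (1 - e))) ^ m"
    and "wd \<epsilon> (Suc m) z \<le> 2 * pi * \<epsilon> * (4 * (e * (1 - e))) ^ m * min t (1 - t)"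
proof -
  define a where "a = 1 - pi * (fst z)\<^sup>2"
  define b where "b = 4 * (e * (1 - e))"
  have r: "\<bar>fst z\<bar> < rad" by (rule disc_imp_rad [OF assms(1)])
  have a: "0 < a" "a \<le> 1" using r by (auto simp: a_def abs_less_rad)
  have e: "0 < e" "e < 1" using kap_range [OF assms(1)] by (auto simp: e_def mem_Times_iff)
  have "0 \<le> (1 - 2 * e)\<^sup>2" by simp
  then have b: "0 < b" "b \<le> 1" using e by (auto simp: b_def power2_eq_square algebra_simps)
  have "wd \<epsilon> (Suc m) z = \<epsilon> * (a\<^sup>2 * b ^ m * (a ^ m * b\<^sup>2))"
    unfolding wd_def kap_nz [OF assms(1)] e_def [symmetric] a_def [symmetric] b_def [symmetric]
    by (simp add: power_mult_distrib power2_eq_square)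
  also have "\<dots> \<le> \<epsilon> * (a\<^sup>2 * b ^ m * 1)"
    using a b assms(2) by (intro mult_left_mono mult_le_one power_le_one zero_le_power mult_nonneg_nonneg) auto
  finally have *: "wd \<epsilon> (Suc m) z \<le> \<epsilon> * b ^ m * a\<^sup>2" by (simp add: mult_ac)
  also have "\<dots> \<le> \<epsilon> * b ^ m * 1"
    using a b assms(2) by (intro mult_left_mono power_le_one) auto
  finally show "wd \<epsilon> (Suc m) z \<le> \<epsilon> * (4 * (e * (1 - e))) ^ m" by (simp add: b_def)
  have "a\<^sup>2 \<le> 2 * pi * t" using slab_lower [OF r] by (simp add: a_def t_def kap_def)
  moreover have "a\<^sup>2 \<le> 2 * pi * (1 - t)"
    using slab_lower [of "- fst z"] slab_minus [OF r] r by (simp add: a_def t_def kap_def)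
  ultimately have "a\<^sup>2 \<le> 2 * pi * min t (1 - t)" by (simp add: min_def)
  then have "\<epsilon> * b ^ m * a\<^sup>2 \<le> \<epsilon> * b ^ m * (2 * pi * min t (1 - t))"
    using b assms(2) by (intro mult_left_mono) auto
  with * show "wd \<epsilon> (Suc m) z \<le> 2 * pi * \<epsilon> * (4 * (e * (1 - e))) ^ m * min t (1 - t)"
    by (simp add: b_def mult_ac)
qed

lemma linear_r2:
  fixes f :: "r2 \<Rightarrow> real"
  assumes "(f has_derivative f') F"
  shows "f' v = f' (1, 0) * fst v + f' (0, 1) * snd v"
proof -
  interpret bounded_linear f' by (rule has_derivative_bounded_linear [OF assms])
  have "f' v = f' (fst v *\<^sub>R (1, 0) + snd v *\<^sub>R (0, 1))" by simp
  then show ?thesis unfolding add scaleR by simp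
qed

lemma smooth_partials:
  fixes f :: "r2 \<Rightarrow> real"
  assumes "open U" "smooth_on U f"
  obtains a b where "\<And>y. y \<in> U \<Longrightarrow> (f has_derivative (\<lambda>v. a y * fst v + b y * snd v)) (at y)"
    "continuous_on U a" "continuous_on U b"
proof
  let ?f' = "\<lambda>y. frechet_derivative f (at y)"
  show "(f has_derivative (\<lambda>v. ?f' y (1, 0) * fst v + ?f' y (0, 1) * snd v)) (at y)" if "y \<in> U" for y
    using smooth_on_has_derivative [OF assms that]
    by (rule has_derivative_eq_rhs) (rule ext, rule linear_r2 [OF smooth_on_has_derivative [OF assms that]])
  show "continuous_on U (\<lambda>y. ?f' y (1, 0))" "continuous_on U (\<lambda>y. ?f' y (0, 1))"
    by (rule smooth_on_continuous_on [OF assms(1) smooth_on_frechet_derivative [OF assms]])+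
qed

text \<open>This is the cotangent lift of \<open>(p, e) \<mapsto> (w p e, e)\<close>: it preserves
  the one-form \<open>q dp - t de\<close>. It carries the straight ray of the model to arcs
  depending on \<open>e\<close>, at the price of shifting \<open>t\<close> proportionally to
  \<open>q\<close>.\<close>

lemma cot_lift:
  fixes w wp we :: "real \<Rightarrow> real \<Rightarrow> real" and I J :: "real set"
  assumes IJ: "open I" "open J"
    and D: "\<And>y. y \<in> I \<times> J \<Longrightarrow> ((\<lambda>y. w (fst y) (snd y)) has_derivative
        (\<lambda>v. wp (fst y) (snd y) * fst v + we (fst y) (snd y) * snd v)) (at y)"
    and sm: "smooth_on (I \<times> J) (\<lambda>y. wp (fst y) (snd y))" "smooth_on (I \<times> J) (\<lambda>y. we (fst y) (snd y))"
    and pos: "\<And>p e. p \<in> I \<Longrightarrow> e \<in> J \<Longrightarrow> 0 < wp p e"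
  defines "D1 \<equiv> {x::r4. fst (fst x) \<in> I \<and> snd (snd x) \<in> J}"
    and "j \<equiv> (\<lambda>x::r4. case x of ((p, q), (t, e)) \<Rightarrow> ((w p e, q / wp p e), (t + q * we p e / wp p e, e)))"
  shows "open D1" "smooth_on D1 j" "sympl_on D1 j"
proof -
  have oIJ: "open (I \<times> J)" using IJ by (rule open_Times)
  define pr where "pr x = (fst (fst x), snd (snd x))" for x :: r4
  have lin: "bounded_linear pr" unfolding pr_def
    by (intro bounded_linear_Pair bounded_linear_compose [OF bounded_linear_fst bounded_linear_fst]
        bounded_linear_compose [OF bounded_linear_snd bounded_linear_snd])
  have "D1 = pr -` (I \<times> J)" by (auto simp: D1_def pr_def)
  moreover have "continuous_on UNIV pr" unfolding pr_def by (intro continuous_intros)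
  ultimately show oD: "open D1" using oIJ by (metis open_vimage)
  have prD: "pr x \<in> I \<times> J" if "x \<in> D1" for x using that by (simp add: D1_def pr_def)
  define W Wp We where "W y = w (fst y) (snd y)" and "Wp y = wp (fst y) (snd y)"
    and "We y = we (fst y) (snd y)" for y
  have j: "j = (\<lambda>x. ((W (pr x), snd (fst x) / Wp (pr x)),
      (fst (snd x) + snd (fst x) / Wp (pr x) * We (pr x), snd (snd x))))"
    by (auto simp: j_def W_def Wp_def We_def pr_def fun_eq_iff split: prod.split)
  note sm' = sm [folded Wp_def We_def]
  have DW: "(W has_derivative (\<lambda>v. Wp y * fst v + We y * snd v)) (at y)" if "y \<in> I \<times> J" for y
    using D [OF that] by (simp add: W_def [abs_def] Wp_def We_def)
  have smW: "smooth_on (I \<times> J) W"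
    by (rule smooth_on_derivative [OF oIJ DW]) (assumption, intro smooth_intros oIJ sm')
  have Wp0: "Wp (pr x) \<noteq> 0" "0 < Wp (pr x)" if "x \<in> D1" for x
    using pos prD [OF that] by (auto simp: Wp_def mem_Times_iff less_imp_neq [symmetric])
  have smpr: "smooth_on D1 pr" by (rule smooth_on_linear [OF oD lin])
  show "smooth_on D1 j" unfolding j
    by (intro smooth_intros oD smooth_on_compose [OF oD oIJ smW smpr prD]
        smooth_on_compose [OF oD oIJ sm'(1) smpr prD] smooth_on_compose [OF oD oIJ sm'(2) smpr prD] Wp0)
  obtain a b where ab: "\<And>y. y \<in> I \<times> J \<Longrightarrow> (Wp has_derivative (\<lambda>v. a y * fst v + b y * snd v)) (at y)"
    and cb: "continuous_on (I \<times> J) b" using smooth_partials [OF oIJ sm'(1)] by metis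
  obtain b' c where bc: "\<And>y. y \<in> I \<times> J \<Longrightarrow> (We has_derivative (\<lambda>v. b' y * fst v + c y * snd v)) (at y)"
    and cb': "continuous_on (I \<times> J) b'" using smooth_partials [OF oIJ sm'(2)] by metis
  \<comment> \<open>The second derivatives of \<open>w\<close> cancel in the form only because the
    two mixed ones coincide.\<close>
  have bb': "b y = b' y" if "y \<in> I \<times> J" for y
    by (rule symmetric_partials [OF oIJ that DW ab bc cb cb'])
  have prF: "(pr has_derivative pr) (at x)" for x by (rule bounded_linear_imp_has_derivative [OF lin])
  note comp = has_derivative_compose [OF prF]
  define Qd where "Qd x v = (snd (fst v) - snd (fst x) / Wp (pr x) *
      (a (pr x) * fst (fst v) + b (pr x) * snd (snd v))) / Wp (pr x)" for x v :: r4
  have QD: "((\<lambda>x. snd (fst x) / Wp (pr x)) has_derivative Qd x) (at x)" if x: "x \<in> D1" for x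
  proof -
    have "((\<lambda>x. snd (fst x) / Wp (pr x)) has_derivative
      (\<lambda>v. (snd (fst v) * Wp (pr x) - snd (fst x) * (a (pr x) * fst (pr v) + b (pr x) * snd (pr v))) /
        (Wp (pr x) * Wp (pr x)))) (at x)"
      by (intro has_derivative_divide' has_derivative_snd has_derivative_fst has_derivative_ident
          comp [OF ab [OF prD [OF x]]] Wp0 [OF x])
    then show ?thesis
      by (rule has_derivative_eq_rhs) (use Wp0 [OF x] in \<open>simp add: fun_eq_iff Qd_def pr_def field_simps\<close>)
  qed
  show "sympl_on D1 j" unfolding j
  proof (rule sympl_onI)
    fix x assume x: "x \<in> D1"
    show "((\<lambda>x. W (pr x)) has_derivative
        (\<lambda>v. Wp (pr x) * fst (pr v) + We (pr x) * snd (pr v))) (at x)"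
      by (rule comp [OF DW [OF prD [OF x]]])
    show "((\<lambda>x. snd (fst x) / Wp (pr x)) has_derivative Qd x) (at x)" by (rule QD [OF x])
    show "((\<lambda>x. fst (snd x) + snd (fst x) / Wp (pr x) * We (pr x)) has_derivative
      (\<lambda>v. fst (snd v) + (snd (fst x) / Wp (pr x) * (b' (pr x) * fst (pr v) + c (pr x) * snd (pr v)) +
         Qd x v * We (pr x)))) (at x)"
      by (intro has_derivative_add has_derivative_mult QD [OF x] comp [OF bc [OF prD [OF x]]]
          has_derivative_fst has_derivative_snd has_derivative_ident)
    show "((\<lambda>x. snd (snd x)) has_derivative (\<lambda>v. snd (snd v))) (at x)"
      by (intro has_derivative_snd has_derivative_ident)
    fix v u :: r4
    have key: "Wp (pr x) * Qd x v = snd (fst v) - snd (fst x) / Wp (pr x) *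
      (a (pr x) * fst (fst v) + b' (pr x) * snd (snd v))" for v
      using Wp0 [OF x] bb' [OF prD [OF x]] by (simp add: Qd_def)
    have "(W1 * v1 + W2 * v4) * Qu - (W1 * u1 + W2 * u4) * Qv +
      ((v3 + (Q * (B * v1 + C * v4) + Qv * W2)) * u4 - (u3 + (Q * (B * u1 + C * u4) + Qu * W2)) * v4) =
      v1 * u2 - u1 * v2 + (v3 * u4 - u3 * v4)"
      if "W1 * Qv = v2 - Q * (A * v1 + B * v4)" "W1 * Qu = u2 - Q * (A * u1 + B * u4)"
      for W1 W2 v1 v2 v3 v4 u1 u2 u3 u4 Qv Qu Q A B C :: real
    proof -
      have "(W1 * v1 + W2 * v4) * Qu - (W1 * u1 + W2 * u4) * Qv +
        ((v3 + (Q * (B * v1 + C * v4) + Qv * W2)) * u4 - (u3 + (Q * (B * u1 + C * u4) + Qu * W2)) * v4) =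
        v1 * (W1 * Qu) - u1 * (W1 * Qv) + Q * B * (v1 * u4 - u1 * v4) + (v3 * u4 - u3 * v4)"
        by (simp add: algebra_simps)
      then show ?thesis unfolding that by (simp add: algebra_simps)
    qed
    from this [OF key [of v] key [of u]]
    show "(Wp (pr x) * fst (pr v) + We (pr x) * snd (pr v)) * Qd x u -
      (Wp (pr x) * fst (pr u) + We (pr x) * snd (pr u)) * Qd x v +
      ((fst (snd v) + (snd (fst x) / Wp (pr x) * (b' (pr x) * fst (pr v) + c (pr x) * snd (pr v)) +
         Qd x v * We (pr x))) * snd (snd u) -
       (fst (snd u) + (snd (fst x) / Wp (pr x) * (b' (pr x) * fst (pr u) + c (pr x) * snd (pr u)) +
         Qd x u * We (pr x))) * snd (snd v)) = om v u"
      by (simp add: om_def area_def pr_def)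
  qed
qed

text \<open>The derivative of \<open>kap\<close> is triangular with diagonal \<open>2 * wid\<close>
  and \<open>1 / (2 * wid)\<close>.\<close>

lemma kap_symp:
  shows "smooth_on ex_O (\<lambda>x. (fst x, kap (snd x)))" "sympl_on ex_O (\<lambda>x. (fst x, kap (snd x)))"
proof -
  have d: "snd x \<in> disc" if "x \<in> ex_O" for x using that by (simp add: ex_O_def)
  show "smooth_on ex_O (\<lambda>x. (fst x, kap (snd x)))"
    by (intro smooth_intros open_ex_O d)
  have "sympl_on ex_O (\<lambda>x. ((fst (fst x), snd (fst x)), (fst (kap (snd x)), snd (kap (snd x)))))"
  proof (rule sympl_onI)
    fix x assume x: "x \<in> ex_O"
    show "((\<lambda>x. fst (fst x)) has_derivative (\<lambda>v. fst (fst v))) (at x)"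
      "((\<lambda>x. snd (fst x)) has_derivative (\<lambda>v. snd (fst v))) (at x)"
      by (auto intro!: derivative_eq_intros)
    note kap_FDERIV [OF has_derivative_snd [OF has_derivative_ident] d [OF x]]
    then show "((\<lambda>x. fst (kap (snd x))) has_derivative (\<lambda>v. 2 * wid (fst (snd x)) * fst (snd v))) (at x)"
      "((\<lambda>x. snd (kap (snd x))) has_derivative (\<lambda>v. snd (snd v) / (2 * wid (fst (snd x))) +
          snd (snd x) * fst (snd x) / (2 * wid (fst (snd x)) ^ 3) * fst (snd v))) (at x)" by auto
    have "wid (fst (snd x)) \<noteq> 0" using wid_pos [OF disc_imp_rad [OF d [OF x]]] by simp
    then show "fst (fst v) * snd (fst u) - fst (fst u) * snd (fst v) +
       (2 * wid (fst (snd x)) * fst (snd v) * (snd (snd u) / (2 * wid (fst (snd x))) +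
          snd (snd x) * fst (snd x) / (2 * wid (fst (snd x)) ^ 3) * fst (snd u)) -
        2 * wid (fst (snd x)) * fst (snd u) * (snd (snd v) / (2 * wid (fst (snd x))) +
          snd (snd x) * fst (snd x) / (2 * wid (fst (snd x)) ^ 3) * fst (snd v))) = om v u" for v u
      by (simp add: om_def area_def distrib_left)
  qed
  then show "sympl_on ex_O (\<lambda>x. (fst x, kap (snd x)))" by simp
qed

section \<open>Excision of rays\<close>

text \<open>The coordinate \<open>t = fst (snd x)\<close> conjugate to \<open>e = snd (snd x)\<close> is not constrained by \<open>G\<close>.\<close>

definition slabs :: "(r2 \<Rightarrow> real \<Rightarrow> bool) \<Rightarrow> r4 set" where
  "slabs G = {x. 0 < fst (snd x) \<and> fst (snd x) < 1 \<and> 0 < snd (snd x) \<and> snd (snd x) < 1 \<and>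
     G (fst x) (snd (snd x))}"

lemma shift_bounds:
  fixes s t :: real
  assumes "\<bar>s\<bar> \<le> min t (1 - t) / 2" "0 < t" "t < 1"
  shows "0 < t + s \<and> t + s < 1 \<and> t \<ge> 2/3 * (t + s) \<and> 1 - t \<ge> 2/3 * (1 - (t + s))"
  using assms by (auto simp: min_def abs_le_iff split: if_splits)

text \<open>The removed arcs are \<open>p \<mapsto> (w p e, 0)\<close>. The tube around them has width \<open>rr * (e * (1 - e)) ^ m\<close>, which
  by \<open>shift\<close> keeps the correction \<open>q * we p e / wp p e\<close> of the coordinate \<open>t\<close> small; the two limits make
  the tube relatively closed.\<close>

lemma excision:
  fixes w wp we :: "real \<Rightarrow> real \<Rightarrow> real" and hi :: "real \<Rightarrow> real"
  assumes M: "open (slabs G)"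
    and D: "\<And>y. y \<in> {-2<..<1} \<times> {0<..<1} \<Longrightarrow> ((\<lambda>y. w (fst y) (snd y)) has_derivative
        (\<lambda>v. wp (fst y) (snd y) * fst v + we (fst y) (snd y) * snd v)) (at y)"
    and sm: "smooth_on ({-2<..<1} \<times> {0<..<1}) (\<lambda>y. wp (fst y) (snd y))"
       "smooth_on ({-2<..<1} \<times> {0<..<1}) (\<lambda>y. we (fst y) (snd y))"
    and pos: "\<And>p e. p \<in> {-2<..<1} \<Longrightarrow> e \<in> {0<..<1} \<Longrightarrow> 0 < wp p e"
    and shift: "\<And>p e. p \<in> {-1..<1} \<Longrightarrow> e \<in> {0<..<1} \<Longrightarrow> \<bar>we p e / wp p e\<bar> * (e * (1 - e)) ^ m \<le> C"
    and rr: "0 < rr"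
    and G: "\<And>p e q. p \<in> {-1..<1} \<Longrightarrow> e \<in> {0<..<1} \<Longrightarrow> \<bar>q\<bar> \<le> rr * (e * (1 - e)) ^ m \<Longrightarrow>
       G (w p e, q / wp p e) e"
    and hi: "\<And>e. e \<in> {0<..<1} \<Longrightarrow> \<not> G (hi e, 0) e"
    and w_lim: "\<And>e. e \<in> {0<..<1} \<Longrightarrow>
      ((\<lambda>y. w (fst y) (snd y)) \<longlongrightarrow> hi e) (at (1, e) within {-1..<1} \<times> {0<..<1})"
    and wp_lim: "\<And>e. e \<in> {0<..<1} \<Longrightarrow>
      ((\<lambda>y. 1 / wp (fst y) (snd y)) \<longlongrightarrow> 0) (at (1, e) within {-1..<1} \<times> {0<..<1})"
  shows "symp (slabs G - {x. \<exists>p. 0 \<le> p \<and> p < 1 \<and> fst x = (w p (snd (snd x)), 0)}) (slabs G)"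
proof -
  let ?j1 = "\<lambda>x::r4. case x of ((p, q), (t, e)) \<Rightarrow> ((w p e, q / wp p e), (t + q * we p e / wp p e, e))"
  let ?D1 = "{x::r4. fst (fst x) \<in> {-2<..<1} \<and> snd (snd x) \<in> {0<..<1}}"
  define j where "j x = ?j1 (fst x, kap (snd x))" for x
  have oD1: "open ?D1" and smj1: "smooth_on ?D1 ?j1" and syj1: "sympl_on ?D1 ?j1"
    by (rule cot_lift [OF open_greaterThanLessThan open_greaterThanLessThan D sm pos]; assumption)+
  have OD: "(fst x, kap (snd x)) \<in> ?D1" if "x \<in> ex_O" for x
    using that kap_range [of "snd x"] by (auto simp: ex_O_def mem_Times_iff)
  have smj: "smooth_on ex_O j" unfolding j_def
    by (rule smooth_on_compose [OF open_ex_O oD1 smj1 kap_symp(1) OD])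
  have syj: "sympl_on ex_O j" unfolding j_def
    by (rule sympl_on_compose [OF syj1 kap_symp(2) OD])
  have j_eq: "j x = ((w (fst (fst x)) (snd (kap (snd x))), snd (fst x) / wp (fst (fst x)) (snd (kap (snd x)))),
     (fst (kap (snd x)) + snd (fst x) * we (fst (fst x)) (snd (kap (snd x))) / wp (fst (fst x)) (snd (kap (snd x))),
      snd (kap (snd x))))" for x
    by (auto simp: j_def split: prod.split)
  have mono: "w p e < w p' e" if "-2 < p" "p < p'" "p' < 1" "0 < e" "e < 1" for p p' e
  proof (rule DERIV_pos_imp_increasing [OF that(2)])
    fix z assume z: "p \<le> z" "z \<le> p'"
    have "((\<lambda>z. (z, e)) has_derivative (\<lambda>v. (v, 0))) (at z)" by (auto intro!: derivative_eq_intros)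
    from has_derivative_compose [OF this D [of "(z, e)"]] z that
    have "((\<lambda>z. w z e) has_derivative (\<lambda>v. wp z e * v)) (at z)" by simp
    then have "((\<lambda>z. w z e) has_real_derivative wp z e) (at z)"
      by (simp add: has_field_derivative_def mult_commute_abs)
    moreover have "0 < wp z e" using pos z that by auto
    ultimately show "\<exists>y. ((\<lambda>z. w z e) has_real_derivative y) (at z) \<and> 0 < y" by blast
  qed
  have inj: "inj_on j ex_O"
  proof (rule inj_onI)
    fix x y assume xy: "x \<in> ex_O" "y \<in> ex_O" "j x = j y"
    note k = kap_range [of "snd x"] kap_range [of "snd y"]
    have e: "snd (kap (snd x)) = snd (kap (snd y))" using xy(3) by (simp add: j_eq)
    have p: "fst (fst x) = fst (fst y)"
    proof (rule ccontr)
      assume "fst (fst x) \<noteq> fst (fst y)"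
      then show False
        using mono [of "fst (fst x)" "fst (fst y)" "snd (kap (snd x))"]
          mono [of "fst (fst y)" "fst (fst x)" "snd (kap (snd x))"] xy e k
        by (auto simp: j_eq neq_iff ex_O_def mem_Times_iff)
    qed
    have "0 < wp (fst (fst y)) (snd (kap (snd y)))"
      using pos xy(2) k by (auto simp: ex_O_def mem_Times_iff)
    then have q: "snd (fst x) = snd (fst y)" using xy(3) by (simp add: j_eq e p)
    have "kap (snd x) = kap (snd y)" using xy(3) by (simp add: j_eq e p q prod_eq_iff)
    then have "snd x = snd y" using xy kap_bij by (auto simp: bij_betw_def inj_on_def ex_O_def)
    then show "x = y" using p q by (simp add: prod_eq_iff)
  qed
  \<comment> \<open>With this index the damping has the exponent \<open>m + 2\<close> that
    \<open>kap_wd_bound\<close> distributes.\<close>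
  define n where "n = Suc m"
  have C0: "0 \<le> C" using shift [of 0 "1/2"]
    by (rule order_trans [rotated]) auto
  \<comment> \<open>The first bound confines the tube to the prescribed width \<open>rr\<close>, the
    second keeps the shift of \<open>t\<close> below half its distance from 0 and 1.\<close>
  define \<epsilon> where "\<epsilon> = min (rr / 4 ^ m) (1 / (4 * pi * 4 ^ m * (C + 1)))"
  have \<epsilon>: "0 < \<epsilon>" "\<epsilon> * 4 ^ m \<le> rr" "2 * pi * \<epsilon> * 4 ^ m * C \<le> 1 / 2"
  proof -
    show "0 < \<epsilon>" using rr C0 by (simp add: \<epsilon>_def)
    have "\<epsilon> \<le> rr / 4 ^ m" by (simp add: \<epsilon>_def)
    then show "\<epsilon> * 4 ^ m \<le> rr" by (simp add: field_simps)
    have "\<epsilon> \<le> 1 / (4 * pi * 4 ^ m * (C + 1))" by (simp add: \<epsilon>_def)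
    moreover have "0 < 4 * pi * 4 ^ m * (C + 1)" using C0 by simp
    ultimately have "\<epsilon> * (4 * pi * 4 ^ m * (C + 1)) \<le> 1" by (simp only: pos_le_divide_eq)
    moreover have "\<epsilon> * (4 * pi * 4 ^ m * (C + 1)) = 2 * (2 * pi * \<epsilon> * 4 ^ m * (C + 1))" by simp
    ultimately have "2 * pi * \<epsilon> * 4 ^ m * (C + 1) \<le> 1 / 2" by linarith
    moreover have "2 * pi * \<epsilon> * 4 ^ m * C \<le> 2 * pi * \<epsilon> * 4 ^ m * (C + 1)"
      using \<open>0 < \<epsilon>\<close> by (intro mult_left_mono) auto
    ultimately show "2 * pi * \<epsilon> * 4 ^ m * C \<le> 1 / 2" by linarith
  qed
  let ?K = "ex_K \<epsilon> n"
  have Kprops: "0 < t" "t < 1" "0 < e" "e < 1" "p \<in> {-1..<1}" "\<bar>q\<bar> \<le> rr * (e * (1 - e)) ^ m"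
      "\<bar>q * we p e / wp p e\<bar> \<le> min t (1 - t) / 2" "\<bar>q\<bar> \<le> \<epsilon>" "z \<in> disc"
    if x: "((p, q), z) \<in> ?K" and te: "kap z = (t, e)" for p q z t e
  proof -
    show z: "z \<in> disc" and p: "p \<in> {-1..<1}" using x by (auto simp: ex_K_def ex_O_def)
    have q: "\<bar>q\<bar> \<le> wd \<epsilon> n z" using x by (simp add: ex_K_def)
    show t: "0 < t" "t < 1" and e: "0 < e" "e < 1" using kap_range [OF z] te by auto
    note b = kap_wd_bound [OF z \<epsilon>(1), of m, folded n_def, unfolded te fst_conv snd_conv]
    have ee: "0 < e * (1 - e)" "e * (1 - e) \<le> 1" using e by (auto intro: mult_le_one)
    have bb: "(4 * (e * (1 - e))) ^ m = 4 ^ m * (e * (1 - e)) ^ m" by (rule power_mult_distrib)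
    have "\<bar>q\<bar> \<le> \<epsilon> * 4 ^ m * (e * (1 - e)) ^ m"
      using q b(1) unfolding bb by (simp only: mult.assoc)
    also have "\<dots> \<le> rr * (e * (1 - e)) ^ m" using \<epsilon> ee by (intro mult_right_mono) auto
    finally show "\<bar>q\<bar> \<le> rr * (e * (1 - e)) ^ m" .
    have "0 \<le> 1 - pi * nz z" "1 - pi * nz z \<le> 1" using z by (auto simp: disc_def nz_def)
    then have "wd \<epsilon> n z \<le> \<epsilon> * 1" using \<epsilon>(1) unfolding wd_def
      by (intro mult_left_mono power_le_one) auto
    then show "\<bar>q\<bar> \<le> \<epsilon>" using q by simp
    have "\<bar>q * we p e / wp p e\<bar> = \<bar>q\<bar> * \<bar>we p e / wp p e\<bar>" by (simp add: abs_mult)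
    also have "\<dots> \<le> (2 * pi * \<epsilon> * (4 * (e * (1 - e))) ^ m * min t (1 - t)) * \<bar>we p e / wp p e\<bar>"
      using q b(2) by (intro mult_right_mono) auto
    also have "\<dots> = (2 * pi * \<epsilon> * 4 ^ m * min t (1 - t)) * (\<bar>we p e / wp p e\<bar> * (e * (1 - e)) ^ m)"
      unfolding bb by (simp only: mult_ac)
    also have "\<dots> \<le> (2 * pi * \<epsilon> * 4 ^ m * min t (1 - t)) * C"
      using shift [OF p, of e] e t \<epsilon>(1) by (intro mult_left_mono) auto
    also have "\<dots> = (2 * pi * \<epsilon> * 4 ^ m * C) * min t (1 - t)" by (simp add: mult_ac)
    also have "\<dots> \<le> 1 / 2 * min t (1 - t)" using \<epsilon>(3) t by (intro mult_right_mono) auto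
    finally show "\<bar>q * we p e / wp p e\<bar> \<le> min t (1 - t) / 2" by simp
  qed
  have KO: "?K \<subseteq> ex_O" by (auto simp: ex_K_def)
  have jK: "j ` ?K \<subseteq> slabs G"
  proof
    fix y assume "y \<in> j ` ?K"
    then obtain x where x: "x \<in> ?K" "y = j x" by (metis imageE)
    obtain p q z t e where pq: "x = ((p, q), z)" "kap z = (t, e)" by (metis surj_pair)
    note k = Kprops [OF x(1) [unfolded pq(1)] pq(2)]
    have "0 < t + q * we p e / wp p e" "t + q * we p e / wp p e < 1"
      using shift_bounds [OF k(7,1,2)] by blast+
    then show "y \<in> slabs G"
      using G [of p e q] k(3-6) by (simp add: x(2) j_eq pq slabs_def)
  qed
  \<comment> \<open>Let points of the tube converge in the domain; their parameters subconverge. As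
    the shift of \<open>t\<close> is at most half the distance to the ends, the unshifted
    \<open>t\<close> stays away from 0 and 1, so the point of the disc does not escape. Only
    \<open>p\<close> can leave the parameter set, by tending to 1.\<close>
  have closed: "open (slabs G - j ` ?K)"
  proof (rule open_diff_sequential [OF M])
    fix X :: "nat \<Rightarrow> r4" and l
    assume X: "\<And>n. X n \<in> j ` ?K" "X \<longlonglongrightarrow> l" and l: "l \<in> slabs G"
    have "\<forall>n. \<exists>y. y \<in> ?K \<and> X n = j y" using X(1) by blast
    then obtain Y where Y: "\<And>n. Y n \<in> ?K" "\<And>n. X n = j (Y n)" by metis
    have "bounded (range Y)"
    proof -
      have "norm (Y n) \<le> (2 + \<epsilon>) + 2 * rad" for n
      proof -
        obtain p q z t e where pq: "Y n = ((p, q), z)" "kap z = (t, e)" by (metis surj_pair)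
        note k = Kprops [OF Y(1) [of n, unfolded pq(1)] pq(2)]
        have "\<bar>snd z\<bar> \<le> rad"
        proof -
          have "(snd z)\<^sup>2 \<le> 1 / pi" using k(9) by (simp add: disc_def nz_def field_simps)
              (smt (verit) mult_nonneg_nonneg pi_ge_zero zero_le_power2)
          then have "\<bar>snd z\<bar>\<^sup>2 \<le> rad\<^sup>2" by (simp add: rad(2))
          then show ?thesis using rad(1) by (rule power2_le_imp_le [OF _ less_imp_le])
        qed
        moreover have "norm (Y n) \<le> (\<bar>p\<bar> + \<bar>q\<bar>) + (\<bar>fst z\<bar> + \<bar>snd z\<bar>)"
          unfolding pq(1) using norm_Pair_le [of "(p, q)" z] norm_Pair_le [of p q] norm_Pair_le [of "fst z" "snd z"]
          by simp
        ultimately show ?thesis using k(5,8) disc_imp_rad [OF k(9)] by auto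
      qed
      then show ?thesis by (auto simp: bounded_iff)
    qed
    then obtain y r where r: "strict_mono r" and y: "(Y \<circ> r) \<longlonglongrightarrow> y"
      using bounded_imp_convergent_subsequence by blast
    define p q z where "p n = fst (fst (Y (r n)))" and "q n = snd (fst (Y (r n)))"
      and "z n = snd (Y (r n))" for n
    define t e where "t n = fst (kap (z n))" and "e n = snd (kap (z n))" for n
    have Yr: "Y (r n) = ((p n, q n), z n)" "kap (z n) = (t n, e n)" for n
      by (simp_all add: p_def q_def z_def t_def e_def)
    have "((p i, q i), z i) \<in> ?K" for i using Y(1) [of "r i"] by (simp add: Yr(1))
    note k = Kprops [OF this Yr(2)]
    have lim: "p \<longlonglongrightarrow> fst (fst y)" "q \<longlonglongrightarrow> snd (fst y)" "z \<longlonglongrightarrow> snd y"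
      using y unfolding p_def [abs_def] q_def [abs_def] z_def [abs_def] comp_def
      by (auto intro!: tendsto_intros)
    have Xr: "(\<lambda>n. j (Y (r n))) \<longlonglongrightarrow> l"
      using LIMSEQ_subseq_LIMSEQ [OF X(2) r] by (simp add: comp_def Y(2))
    have Xlim: "(\<lambda>n. w (p n) (e n)) \<longlonglongrightarrow> fst (fst l)" "(\<lambda>n. q n / wp (p n) (e n)) \<longlonglongrightarrow> snd (fst l)"
      "(\<lambda>n. t n + q n * we (p n) (e n) / wp (p n) (e n)) \<longlonglongrightarrow> fst (snd l)" "e \<longlonglongrightarrow> snd (snd l)"
      using tendsto_fst [OF tendsto_fst [OF Xr]] tendsto_snd [OF tendsto_fst [OF Xr]]
        tendsto_fst [OF tendsto_snd [OF Xr]] tendsto_snd [OF tendsto_snd [OF Xr]]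
      by (simp_all add: j_eq Yr)
    have l': "0 < fst (snd l)" "fst (snd l) < 1" "0 < snd (snd l)" "snd (snd l) < 1"
      "G (fst l) (snd (snd l))" using l by (auto simp: slabs_def)
    have zr: "\<bar>fst (z n)\<bar> < rad" for n using disc_imp_rad k(9) by blast
    have x1: "(\<lambda>n. fst (z n)) \<longlonglongrightarrow> fst (snd y)" using lim(3) by (rule tendsto_fst)
    have xr: "fst (snd y) \<in> {- rad..rad}"
      using Lim_bounded [OF x1, of 0 rad] Lim_bounded2 [OF x1, of 0 "- rad"] zr
      by (auto simp: abs_less_iff less_imp_le)
        (metis less_imp_le minus_less_iff)+
    have t_lim: "t \<longlonglongrightarrow> slab (fst (snd y))"
    proof -
      have "(\<lambda>n. slab (fst (z n))) \<longlonglongrightarrow> slab (fst (snd y))"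
        by (rule continuous_on_tendsto_compose [OF continuous_on_slab x1 xr])
          (use zr in \<open>auto simp: abs_less_iff less_imp_le intro!: always_eventually\<close>,
            metis less_imp_le minus_less_iff)
      then show ?thesis by (simp add: t_def [abs_def] kap_def)
    qed
    have t_bd: "t n \<ge> 2/3 * (t n + q n * we (p n) (e n) / wp (p n) (e n))"
      "1 - t n \<ge> 2/3 * (1 - (t n + q n * we (p n) (e n) / wp (p n) (e n)))" for n
      using shift_bounds [OF k(7,1,2)] by blast+
    have b1: "2/3 * fst (snd l) \<le> slab (fst (snd y))"
      by (rule LIMSEQ_le [OF tendsto_mult [OF tendsto_const Xlim(3)] t_lim])
        (intro exI allI impI t_bd(1))
    have b2: "2/3 * (1 - fst (snd l)) \<le> 1 - slab (fst (snd y))"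
      by (rule LIMSEQ_le [OF tendsto_mult [OF tendsto_const tendsto_diff [OF tendsto_const Xlim(3)]]
            tendsto_diff [OF tendsto_const t_lim]]) (intro exI allI impI t_bd(2))
    have "slab (fst (snd y)) > 0" using b1 l' by linarith
    moreover have "0 < 2/3 * (1 - fst (snd l))" using l'(2) by simp
    then have "slab (fst (snd y)) < 1" using b2 by linarith
    ultimately have "fst (snd y) \<noteq> rad" "fst (snd y) \<noteq> - rad" using slab_ends by auto
    then have r': "\<bar>fst (snd y)\<bar> < rad" using xr by auto
    have yd: "snd y \<in> disc"
    proof -
      have "isCont wid (fst (snd y))" using wid_deriv [OF r'] by (rule DERIV_isCont)
      then have "(\<lambda>n. wid (fst (z n))) \<longlonglongrightarrow> wid (fst (snd y))" using x1 by (rule isCont_tendsto_compose)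
      then have "(\<lambda>n. 1/2 + snd (z n) / (2 * wid (fst (z n)))) \<longlonglongrightarrow> 1/2 + snd (snd y) / (2 * wid (fst (snd y)))"
        using wid_pos [OF r'] lim(3) by (intro tendsto_intros) auto
      then have "e \<longlonglongrightarrow> 1/2 + snd (snd y) / (2 * wid (fst (snd y)))" by (simp add: e_def [abs_def] kap_def)
      then have "snd (snd l) = 1/2 + snd (snd y) / (2 * wid (fst (snd y)))"
        using Xlim(4) LIMSEQ_unique by blast
      then have "snd (snd y) = (2 * snd (snd l) - 1) * wid (fst (snd y))"
        using wid_pos [OF r'] by (simp add: field_simps)
      then have "\<bar>snd (snd y)\<bar> = \<bar>2 * snd (snd l) - 1\<bar> * wid (fst (snd y))"
        using wid_pos [OF r'] by (simp add: abs_mult)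
      also have "\<dots> < 1 * wid (fst (snd y))"
        using wid_pos [OF r'] l'(3,4) by (intro mult_strict_right_mono) auto
      finally show ?thesis unfolding disc_iff using r' by simp
    qed
    have p1: "fst (fst y) \<le> 1" "-1 \<le> fst (fst y)"
      by (rule Lim_bounded [OF lim(1)] Lim_bounded2 [OF lim(1)]; use k(5) in \<open>auto simp: less_imp_le\<close>)+
    show "l \<in> j ` ?K"
    proof (cases "fst (fst y) < 1")
      case True
      then have yO: "y \<in> ex_O" using p1 yd by (simp add: ex_O_def)
      have "isCont j y" using smooth_on_continuous_on [OF open_ex_O smj] yO
        by (simp add: continuous_on_eq_continuous_at open_ex_O)
      then have "(\<lambda>n. j (Y (r n))) \<longlonglongrightarrow> j y" using y unfolding comp_def by (rule isCont_tendsto_compose)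
      then have "l = j y" using Xr LIMSEQ_unique by blast
      moreover have "\<bar>snd (fst y)\<bar> \<le> wd \<epsilon> n (snd y)"
      proof (rule LIMSEQ_le)
        show "(\<lambda>n. \<bar>q n\<bar>) \<longlonglongrightarrow> \<bar>snd (fst y)\<bar>" by (intro tendsto_intros lim)
        show "(\<lambda>k. wd \<epsilon> n (z k)) \<longlonglongrightarrow> wd \<epsilon> n (snd y)"
          unfolding wd_def nz_def by (intro tendsto_intros lim)
        show "\<exists>N. \<forall>k\<ge>N. \<bar>q k\<bar> \<le> wd \<epsilon> n (z k)" using Y(1) by (auto simp: ex_K_def q_def z_def)
      qed
      ultimately show ?thesis using yO p1 by (auto simp: ex_K_def)
    next
      case False
      \<comment> \<open>Here \<open>q\<close> stays bounded, so by the two limit hypotheses the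
        fibre point tends to \<open>(hi e, 0)\<close>, which lies outside the domain.\<close>
      then have "fst (fst y) = 1" using p1 by simp
      then have pe: "(\<lambda>n. (p n, e n)) \<longlonglongrightarrow> (1, snd (snd l))"
        using lim(1) Xlim(4) by (auto intro!: tendsto_Pair)
      have pein: "(p n, e n) \<in> {-1..<1} \<times> {0<..<1} - {(1, snd (snd l))}" for n
        using k(3,4,5) [of n] by auto
      have at: "filterlim (\<lambda>n. (p n, e n)) (at (1, snd (snd l)) within {-1..<1} \<times> {0<..<1}) sequentially"
        unfolding filterlim_at
        by (intro conjI pe always_eventually allI) (use pein in \<open>blast+\<close>)
      have eI: "snd (snd l) \<in> {0<..<1}" using l' by simp
      from filterlim_compose [OF w_lim [OF eI] at] have "(\<lambda>n. w (p n) (e n)) \<longlonglongrightarrow> hi (snd (snd l))" by simp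
      then have 1: "fst (fst l) = hi (snd (snd l))" using Xlim(1) LIMSEQ_unique by blast
      from filterlim_compose [OF wp_lim [OF eI] at] have "(\<lambda>n. 1 / wp (p n) (e n)) \<longlonglongrightarrow> 0" by simp
      from tendsto_mult [OF lim(2) this] have "(\<lambda>n. q n / wp (p n) (e n)) \<longlonglongrightarrow> 0" by simp
      then have "snd (fst l) = 0" using Xlim(2) LIMSEQ_unique by blast
      with 1 have "fst l = (hi (snd (snd l)), 0)" by (simp add: prod_eq_iff)
      then show ?thesis using hi [OF eI] l' by simp
    qed
  qed
  have ZK: "ex_Z \<subseteq> ?K" using wd_pos [OF \<epsilon>(1)] by (auto simp: ex_Z_def ex_K_def ex_O_def less_imp_le)
  obtain ee where ee: "open (ex_O - ex_Z)" "smooth_on (ex_O - ex_Z) ee" "sympl_on (ex_O - ex_Z) ee"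
    "inj_on ee (ex_O - ex_Z)" "ee ` (ex_O - ex_Z) = ex_O" "\<And>x. x \<in> ex_O - ?K \<Longrightarrow> ee x = x"
    using local_excision [OF \<epsilon>(1), of n] by metis
  have "symp (slabs G - j ` ex_Z) (slabs G)"
    by (rule symp_transplant [OF M open_ex_O smj syj inj KO jK closed ZK ee]) assumption
  moreover have "slabs G - j ` ex_Z = slabs G - {x. \<exists>p. 0 \<le> p \<and> p < 1 \<and> fst x = (w p (snd (snd x)), 0)}"
  proof -
    have "x \<in> j ` ex_Z \<longleftrightarrow> (\<exists>p. 0 \<le> p \<and> p < 1 \<and> fst x = (w p (snd (snd x)), 0))" if "x \<in> slabs G" for x
    proof
      assume "x \<in> j ` ex_Z"
      then obtain y where "y \<in> ex_Z" "x = j y" by (metis imageE)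
      then show "\<exists>p. 0 \<le> p \<and> p < 1 \<and> fst x = (w p (snd (snd x)), 0)"
        by (intro exI [of _ "fst (fst y)"]) (auto simp: ex_Z_def ex_O_def j_eq)
    next
      assume "\<exists>p. 0 \<le> p \<and> p < 1 \<and> fst x = (w p (snd (snd x)), 0)"
      then obtain p where p: "0 \<le> p" "p < 1" "fst x = (w p (snd (snd x)), 0)" by blast
      have "snd x \<in> {0<..<1} \<times> {0<..<1}" using that by (auto simp: slabs_def mem_Times_iff)
      then obtain z where z: "z \<in> disc" "kap z = snd x" using kap_bij by (metis bij_betw_def imageE)
      have "j ((p, 0), z) = x" using p z by (simp add: j_eq prod_eq_iff)
      moreover have "((p, 0), z) \<in> ex_Z" using p z by (simp add: ex_Z_def ex_O_def)
      ultimately show "x \<in> j ` ex_Z" by (metis imageI)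
    qed
    then show ?thesis by blast
  qed
  ultimately show ?thesis by simp
qed

section \<open>The ball and the triangle\<close>

definition ball4 :: "r4 set" where "ball4 = {x. pi * nz (fst x) + pi * nz (snd x) < 1}"

lemma symp_ball_slabs: "symp ball4 (slabs (\<lambda>w e. pi * nz w < 1 - e))"
proof -
  define A where "A x = 1 - pi * nz (fst x)" for x :: r4
  define ze where "ze x = snd x /\<^sub>R sqrt (A x)" for x
  define th where "th x = - pi * (slab (fst (ze x)) + fst (ze x) * snd (ze x))" for x
  define f where "f x = (rot (th x) (fst x), (fst (kap (ze x)), A x * snd (kap (ze x))))" for x
  have A: "0 < A x" if "x \<in> ball4" for x
  proof -
    have "0 \<le> pi * nz (snd x)" by (simp add: nz_def)
    then show ?thesis using that by (simp add: ball4_def A_def)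
  qed
  have nze: "nz (ze x) = nz (snd x) / A x" if "0 < A x" for x
    using that by (simp add: nz_def ze_def power_divide power_mult_distrib field_simps)
  have zd: "ze x \<in> disc" if "x \<in> ball4" for x
  proof -
    have "pi * nz (snd x) < A x" using that by (simp add: ball4_def A_def)
    then have "pi * nz (snd x) / A x < 1" using A [OF that] by simp
    then show ?thesis using nze [OF A [OF that]] by (simp add: disc_def)
  qed
  have op: "open ball4" unfolding ball4_def nz_def by (intro open_Collect_less continuous_intros)
  note sms = op smooth_on_id [OF op] smooth_on_fst [OF op] smooth_on_snd [OF op]
  have smA: "smooth_on ball4 A" unfolding A_def by (intro smooth_intros sms)
  have smze: "smooth_on ball4 ze"
  proof -
    have "sqrt (A x) \<noteq> 0" if "x \<in> ball4" for x using A [OF that] by simp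
    then have "smooth_on ball4 (\<lambda>x. (1 / sqrt (A x)) *\<^sub>R snd x)"
      by (intro smooth_intros sms smA A)
    then show ?thesis by (simp add: ze_def [abs_def] divide_inverse)
  qed
  have smslab: "smooth_on ball4 (\<lambda>x. slab (fst (ze x)))"
    using smooth_on_fst [OF op smooth_on_kap [OF op smze zd]] by (simp add: kap_def)
  have smf: "smooth_on ball4 f"
    unfolding f_def th_def by (intro smooth_intros sms smA smze smslab zd)
  have syf: "sympl_on ball4 f"
  proof -
    have "\<exists>f'. (f has_derivative f') (at x) \<and> (\<forall>v u. om (f' v) (f' u) = om v u)" if x: "x \<in> ball4" for x
    proof -
      define r where "r = sqrt (A x)"
      define X where "X = fst (ze x)"
      define Y where "Y = snd (ze x)"
      define W where "W = wid X"
      define d where "d v = fst (fst x) * fst (fst v) + snd (fst x) * snd (fst v)" for v :: r4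
      have r: "r > 0" "A x = r * r" using A [OF x] by (simp_all add: r_def)
      have W: "W > 0" using wid_pos [OF disc_imp_rad [OF zd [OF x]]] by (simp add: W_def X_def)
      have sx: "fst (snd x) = r * X" "snd (snd x) = r * Y" using r(1) by (simp_all add: X_def Y_def ze_def flip: r_def)
      have DA: "(A has_derivative (\<lambda>v. - 2 * pi * d v)) (at x)"
        unfolding A_def [abs_def] d_def
        by (rule derivative_eq_intros nz_FDERIV refl)+ (simp add: fun_eq_iff algebra_simps)
      define dX where "dX v = (fst (snd v) + X * pi * d v / r) / r" for v :: r4
      define dY where "dY v = (snd (snd v) + Y * pi * d v / r) / r" for v :: r4
      have Dr: "((\<lambda>x. sqrt (A x)) has_derivative (\<lambda>v. - pi * d v / r)) (at x)"
        by (rule has_derivative_eq_rhs [OF has_derivative_real_sqrt [OF A [OF x] DA]])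
          (simp add: fun_eq_iff field_simps flip: r_def)
      have r0: "sqrt (A x) \<noteq> 0" using A [OF x] by simp
      have D1: "((\<lambda>x. fst (ze x)) has_derivative dX) (at x)" "((\<lambda>x. snd (ze x)) has_derivative dY) (at x)"
      proof -
        have z: "fst (ze x) = fst (snd x) / sqrt (A x)" "snd (ze x) = snd (snd x) / sqrt (A x)" for x
          by (simp_all add: ze_def divide_inverse mult.commute)
        have alg: "(a * r - (r * c) * (- pi * d / r)) / (r * r) = (a + c * pi * d / r) / r" for a c d :: real
          using r(1) by (simp add: field_simps)
        have 1: "((\<lambda>x. fst (snd x)) has_derivative (\<lambda>v. fst (snd v))) (at x)"
          "((\<lambda>x. snd (snd x)) has_derivative (\<lambda>v. snd (snd v))) (at x)"
          by (intro has_derivative_fst has_derivative_snd has_derivative_ident)+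
        note dv = has_derivative_divide' [OF 1(1) Dr r0] has_derivative_divide' [OF 1(2) Dr r0]
        show "((\<lambda>x. fst (ze x)) has_derivative dX) (at x)"
          unfolding z by (rule has_derivative_eq_rhs [OF dv(1)])
            (simp only: dX_def [abs_def] sx alg r_def [symmetric])
        show "((\<lambda>x. snd (ze x)) has_derivative dY) (at x)"
          unfolding z by (rule has_derivative_eq_rhs [OF dv(2)])
            (simp only: dY_def [abs_def] sx alg r_def [symmetric])
      qed
      have Dze: "(ze has_derivative (\<lambda>v. (dX v, dY v))) (at x)"
        using has_derivative_Pair [OF D1] by simp
      note Dk = kap_FDERIV [OF Dze zd [OF x], unfolded fst_conv snd_conv, folded X_def Y_def W_def]
      have Dsl: "((\<lambda>x. slab (fst (ze x))) has_derivative (\<lambda>v. 2 * W * dX v)) (at x)"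
        using Dk(1) by (simp add: kap_def)
      have Dth: "(th has_derivative (\<lambda>v. - pi * (2 * W * dX v + (X * dY v + dX v * Y)))) (at x)"
        unfolding th_def [abs_def]
        by (rule has_derivative_mult_right has_derivative_add Dsl has_derivative_mult D1 
             has_derivative_eq_rhs)+ (simp_all add: X_def Y_def)
      define K where "K = 1/2 + Y / (2 * W)"
      have K: "snd (kap (ze x)) = K" by (simp add: kap_def K_def X_def Y_def W_def)
      define dK where "dK v = dY v / (2 * W) + Y * X / (2 * W ^ 3) * dX v" for v
      have De: "((\<lambda>x. A x * snd (kap (ze x))) has_derivative (\<lambda>v. A x * dK v + - 2 * pi * d v * K)) (at x)"
        using has_derivative_mult [OF DA Dk(2)] by (simp add: K dK_def)
      have Df: "(f has_derivative (\<lambda>v. (rot (th x) (fst v) +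
          (- pi * (2 * W * dX v + (X * dY v + dX v * Y))) *\<^sub>R rot (th x) (- snd (fst x), fst (fst x)),
          (2 * W * dX v, A x * dK v + - 2 * pi * d v * K)))) (at x)"
        unfolding f_def [abs_def]
        by (intro has_derivative_Pair rot_FDERIV Dth Dk(1) De has_derivative_fst has_derivative_ident)
      have ident: "a + dv * (- pi * (2 * W * dXu + (X * dYu + dXu * Y))) - du * (- pi * (2 * W * dXv + (X * dYv + dXv * Y))) +
          (2 * W * dXv * (r * r * dKu + - 2 * pi * du * K) - 2 * W * dXu * (r * r * dKv + - 2 * pi * dv * K)) =
          a + (xv * yu - xu * yv)"
        if "r * dXv = xv + X * pi * dv / r" "r * dXu = xu + X * pi * du / r"
          "r * dYv = yv + Y * pi * dv / r" "r * dYu = yu + Y * pi * du / r"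
          "2 * W * K = W + Y" "2 * W * dKv = dYv + k * dXv" "2 * W * dKu = dYu + k * dXu"
        for a dv du dXv dXu dYv dYu dKv dKu xv xu yv yu k :: real
      proof -
        have x': "xv = r * dXv - X * pi * dv / r" "xu = r * dXu - X * pi * du / r"
          "yv = r * dYv - Y * pi * dv / r" "yu = r * dYu - Y * pi * du / r" using that by auto
        have "xv * yu - xu * yv = r * r * (dXv * dYu - dXu * dYv) - pi * Y * (dXv * du - dXu * dv)
            - pi * X * (dv * dYu - du * dYv)"
          unfolding x' using r by (simp add: algebra_simps) 
        moreover have "2 * W * dXv * (r * r * dKu + - 2 * pi * du * K) - 2 * W * dXu * (r * r * dKv + - 2 * pi * dv * K)
           = r * r * (dXv * (2 * W * dKu) - dXu * (2 * W * dKv)) - 2 * pi * (2 * W * K) * (dXv * du - dXu * dv)"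
          by (simp add: algebra_simps)
        ultimately show ?thesis unfolding that(5-7) by (simp add: algebra_simps)
      qed
      show ?thesis
      proof (intro exI conjI allI)
        show "(f has_derivative (\<lambda>v. (rot (th x) (fst v) +
          (- pi * (2 * W * dX v + (X * dY v + dX v * Y))) *\<^sub>R rot (th x) (- snd (fst x), fst (fst x)),
          (2 * W * dX v, A x * dK v + - 2 * pi * d v * K)))) (at x)" by (rule Df)
        fix v u :: r4
        have "2 * W * dK v = dY v + Y * X / W\<^sup>2 * dX v" for v
          using W by (simp add: dK_def field_simps power2_eq_square power3_eq_cube)
        moreover have "2 * W * K = W + Y" using W by (simp add: K_def field_simps)
        moreover have "r * dX v = fst (snd v) + X * pi * d v / r" "r * dY v = snd (snd v) + Y * pi * d v / r" for v
          using r by (simp_all add: dX_def dY_def)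
        ultimately show "om (rot (th x) (fst v) +
          (- pi * (2 * W * dX v + (X * dY v + dX v * Y))) *\<^sub>R rot (th x) (- snd (fst x), fst (fst x)),
          (2 * W * dX v, A x * dK v + - 2 * pi * d v * K))
          (rot (th x) (fst u) +
          (- pi * (2 * W * dX u + (X * dY u + dX u * Y))) *\<^sub>R rot (th x) (- snd (fst x), fst (fst x)),
          (2 * W * dX u, A x * dK u + - 2 * pi * d u * K)) = om v u"
          unfolding om_def fst_conv snd_conv area_rot r(2) d_def [symmetric]
          unfolding area_def [of "(_, _)"] area_def [of "snd _"] fst_conv snd_conv
          by (intro ident)
      qed
    qed
    then show ?thesis unfolding sympl_on_def by blast
  qed
  have Arot: "A (rot \<theta> z, y) = A (z, y')" for \<theta> z y y' by (simp add: A_def)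
  have inj: "inj_on f ball4"
  proof (rule inj_onI)
    fix x y assume xy: "x \<in> ball4" "y \<in> ball4" "f x = f y"
    then have r: "rot (th x) (fst x) = rot (th y) (fst y)" by (simp add: f_def)
    then have "nz (fst x) = nz (fst y)" by (metis nz_rot)
    then have AA: "A x = A y" by (simp add: A_def)
    then have "kap (ze x) = kap (ze y)" using xy(3) A [OF xy(1)] A [OF xy(2)] by (simp add: f_def prod_eq_iff)
    then have z: "ze x = ze y" using zd xy kap_bij by (simp add: bij_betw_def inj_on_def)
    then have s: "snd x = snd y" using A [OF xy(2)] AA by (simp add: ze_def)
    have "th x = th y" by (simp add: th_def z)
    then have "fst x = fst y" using r by (metis rot_rot(1))
    with s show "x = y" by (simp add: prod_eq_iff)
  qed
  have img: "f ` ball4 = slabs (\<lambda>w e. pi * nz w < 1 - e)"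
  proof (intro subset_antisym subsetI)
    fix y assume "y \<in> f ` ball4"
    then obtain x where x: "x \<in> ball4" "y = f x" by (metis imageE)
    have k: "0 < fst (kap (ze x))" "fst (kap (ze x)) < 1" "0 < snd (kap (ze x))" "snd (kap (ze x)) < 1"
      using kap_range [OF zd [OF x(1)]] by (auto simp: mem_Times_iff)
    have "A x * snd (kap (ze x)) < A x * 1" using k A [OF x(1)] by (intro mult_strict_left_mono) auto
    moreover have "A x \<le> 1" by (simp add: A_def nz_def)
    moreover have "pi * nz (fst x) = 1 - A x" by (simp add: A_def)
    moreover have "0 < A x * snd (kap (ze x))" using k A [OF x(1)] by simp
    ultimately show "y \<in> slabs (\<lambda>w e. pi * nz w < 1 - e)"
      using k unfolding x(2) f_def slabs_def by simp
  next
    fix y assume y: "y \<in> slabs (\<lambda>w e. pi * nz w < 1 - e)"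
    define a where "a = 1 - pi * nz (fst y)"
    have y': "0 < fst (snd y)" "fst (snd y) < 1" "0 < snd (snd y)" "snd (snd y) < a"
      using y by (auto simp: slabs_def a_def)
    then have "(fst (snd y), snd (snd y) / a) \<in> {0<..<1} \<times> {0<..<1}" by auto
    then obtain z where z: "z \<in> disc" "kap z = (fst (snd y), snd (snd y) / a)"
      using kap_bij by (metis bij_betw_def imageE)
    define \<theta> where "\<theta> = - pi * (slab (fst z) + fst z * snd z)"
    define x where "x = (rot (- \<theta>) (fst y), sqrt a *\<^sub>R z)"
    have Ax: "A x = a" by (simp add: x_def A_def a_def)
    have a: "a > 0" using y' by linarith
    have zx: "ze x = z" unfolding ze_def Ax using a by (simp add: x_def)
    have "th x = \<theta>" by (simp add: th_def zx \<theta>_def)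
    then have "f x = (rot \<theta> (fst x), (fst (kap z), a * snd (kap z)))" by (simp add: f_def zx Ax)
    then have "f x = y" using a z by (simp add: x_def rot_rot prod_eq_iff)
    moreover have "nz (snd x) = a * nz z" using a by (simp add: x_def nz_def power_mult_distrib algebra_simps)
    moreover have "a * (pi * nz z) < a * 1" using z(1) a by (intro mult_strict_left_mono) (auto simp: disc_def)
    ultimately have "f x = y" "x \<in> ball4" using Ax by (auto simp: ball4_def A_def algebra_simps)
    then show "y \<in> f ` ball4" by (metis imageI)
  qed
  show ?thesis by (rule sympI [OF op smf syf inj img])
qed

text \<open>A parameter with infinite slope at \<open>1\<close>, so that \<open>1 / wp\<close> vanishes in the limit.\<close>

definition zt :: "real \<Rightarrow> real" where "zt p = 1 - sqrt (1 - p)"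

lemma zt_deriv: "p < 1 \<Longrightarrow> (zt has_real_derivative 1 / (2 * sqrt (1 - p))) (at p)"
  unfolding zt_def [abs_def] by (auto intro!: derivative_eq_intros simp: field_simps)

lemma smooth_on_zt [smooth_intros]:
  assumes "open U" "smooth_on U f" "\<And>x. x \<in> U \<Longrightarrow> f x < 1"
  shows "smooth_on U (\<lambda>x. zt (f x))"
  unfolding zt_def by (intro smooth_intros assms) (use assms(3) in auto)

text \<open>For these \<open>p\<close> the root is at most \<open>sqrt 2\<close>, and
  \<open>17/12\<close> is a rational upper bound for it.\<close>

lemma zt_bounds:
  assumes "p \<in> {-1..<1}"
  shows "- 5/12 < zt p" "zt p < 1" "sqrt (1 - p) = 1 - zt p"
proof -
  have "sqrt (1 - p) < sqrt ((17/12)\<^sup>2)" using assms by (intro real_sqrt_less_mono) (auto simp: power2_eq_square)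
  then show "- 5/12 < zt p" by (simp add: zt_def)
  show "zt p < 1" "sqrt (1 - p) = 1 - zt p" using assms by (auto simp: zt_def)
qed

lemma open_slabs:
  assumes "open {y::r2 \<times> real. G (fst y) (snd y)}"
  shows "open (slabs G)"
proof -
  have *: "slabs G = {x. 0 < fst (snd x)} \<inter> {x. fst (snd x) < 1} \<inter> {x. 0 < snd (snd x)} \<inter> {x. snd (snd x) < 1} \<inter>
      (\<lambda>x. (fst x, snd (snd x))) -` {y. G (fst y) (snd y)}"
    by (auto simp: slabs_def)
  show ?thesis unfolding *
    by (intro open_Int open_Collect_less open_vimage assms continuous_intros)
qed

text \<open>The radius of the fibre is \<open>s e\<close>, smooth for \<open>e < 1\<close>, so the
  arcs are simply \<open>zt\<close> scaled by \<open>s e\<close>.\<close>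

lemma excise_disc:
  defines "G \<equiv> (\<lambda>w e. pi * nz w < 1 - e)"
  shows "symp (slabs G - {x. 0 \<le> fst (fst x) \<and> snd (fst x) = 0}) (slabs G)"
proof -
  define s where "s e = sqrt ((1 - e) / pi)" for e :: real
  have s: "0 < s e" "s e * s e = (1 - e) / pi" if "e < 1" for e using that by (simp_all add: s_def)
  have "symp (slabs G - {x. \<exists>p. 0 \<le> p \<and> p < 1 \<and> fst x = (s (snd (snd x)) * zt p, 0)}) (slabs G)"
  \<comment> \<open>Here \<open>we / wp = - z * (1 - z) / (1 - e)\<close> with
    \<open>z = zt p\<close>, so one factor \<open>1 - e\<close> suffices. With
    \<open>pi * pi < 10\<close> the width \<open>1/20\<close> turns the contribution of
    \<open>q\<close> into at most \<open>(1 - e) * (1 - z)^2 / 10\<close>.\<close>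
  proof (rule excision [where wp = "\<lambda>p e. s e / (2 * sqrt (1 - p))" and we = "\<lambda>p e. - zt p / (2 * pi * s e)"
        and m = 1 and C = 3 and rr = "1/20" and hi = s])
    show "open (slabs G)" unfolding G_def
      by (rule open_slabs) (auto intro!: open_Collect_less continuous_intros simp: nz_def)
    fix y :: r2 assume y: "y \<in> {-2<..<1} \<times> {0<..<1}"
    then have y': "fst y < 1" "snd y < 1" by (auto simp: mem_Times_iff)
    have "(s has_real_derivative - 1 / (2 * pi * s (snd y))) (at (snd y))"
      unfolding s_def [abs_def] using y' by (auto intro!: derivative_eq_intros simp: field_simps)
    note D = has_derivative_mult [OF DERIV_compose_FDERIV [OF this has_derivative_snd [OF has_derivative_ident]]
        DERIV_compose_FDERIV [OF zt_deriv [OF y'(1)] has_derivative_fst [OF has_derivative_ident]]]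
    show "((\<lambda>y. s (snd y) * zt (fst y)) has_derivative
        (\<lambda>v. s (snd y) / (2 * sqrt (1 - fst y)) * fst v + - zt (fst y) / (2 * pi * s (snd y)) * snd v)) (at y)"
      by (rule has_derivative_eq_rhs [OF D]) (simp add: fun_eq_iff field_simps)
  next
    let ?U = "{-2<..<1} \<times> {0<..<1} :: r2 set"
    have o: "open ?U" by (intro open_Times) auto
    have sm: "smooth_on ?U (\<lambda>y. s (snd y))" unfolding s_def by (intro smooth_intros o) auto
    show "smooth_on ?U (\<lambda>y. s (snd y) / (2 * sqrt (1 - fst y)))"
      by (intro smooth_intros o sm) auto
    show "smooth_on ?U (\<lambda>y. - zt (fst y) / (2 * pi * s (snd y)))"
      by (intro smooth_intros o sm) (auto simp: s_def)
  next
    fix p e :: real assume "p \<in> {-2<..<1}" "e \<in> {0<..<1}"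
    then show "0 < s e / (2 * sqrt (1 - p))" using s by simp
  next
    fix p e :: real assume p: "p \<in> {-1..<1}" and e: "e \<in> {0<..<1}"
    note z = zt_bounds [OF p]
    have se: "0 < s e" "s e * s e = (1 - e) / pi" using s e by auto
    have "- zt p / (2 * pi * s e) / (s e / (2 * sqrt (1 - p))) = - zt p * (1 - zt p) / (pi * (s e * s e))"
      using se(1) by (simp add: z(3) field_simps)
    also have "\<dots> = - (zt p * (1 - zt p)) / (1 - e)" using e by (simp add: se(2))
    finally have *: "- zt p / (2 * pi * s e) / (s e / (2 * sqrt (1 - p))) = - (zt p * (1 - zt p)) / (1 - e)" .
    have "\<bar>zt p\<bar> * (1 - zt p) \<le> 1 * 2" using z by (intro mult_mono) auto
    then have "\<bar>zt p\<bar> * (1 - zt p) * e \<le> 2 * 1" using e z by (intro mult_mono) auto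
    then show "\<bar>- zt p / (2 * pi * s e) / (s e / (2 * sqrt (1 - p)))\<bar> * (e * (1 - e)) ^ 1 \<le> 3"
      unfolding * using e z by (simp add: abs_mult)
    fix q assume q: "\<bar>q\<bar> \<le> 1/20 * (e * (1 - e)) ^ 1"
    define z where "z = zt p"
    have zb: "- 5/12 < z" "z < 1" using z by (simp_all add: z_def)
    have eq: "s e * zt p = s e * z" "q / (s e / (2 * sqrt (1 - p))) = 2 * q * (1 - z) / s e"
      using z by (simp_all add: z_def)
    have "\<bar>q\<bar> \<le> 1/20 * (1 - e)"
    proof (rule order_trans [OF q])
      have "e * (1 - e) \<le> 1 * (1 - e)" using e by (intro mult_right_mono) auto
      then show "1/20 * (e * (1 - e)) ^ 1 \<le> 1/20 * (1 - e)" by simp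
    qed
    then have "\<bar>q\<bar>\<^sup>2 \<le> (1/20 * (1 - e))\<^sup>2" by (rule power_mono) simp
    then have q2: "q\<^sup>2 \<le> (1 - e)\<^sup>2 / 400" by (simp add: power_mult_distrib power_divide)
    have pi2: "pi * pi < 10"
    proof -
      have "pi < 3.15" using pi_less_4 pi_approx by simp
      then have "pi * pi < 3.15 * 3.15" by (intro mult_strict_mono) auto
      then show ?thesis by simp
    qed
    have "pi * ((s e * z)\<^sup>2 + (2 * q * (1 - z) / s e)\<^sup>2) =
        pi * ((s e * s e) * z\<^sup>2 + 4 * q\<^sup>2 * (1 - z)\<^sup>2 / (s e * s e))"
      by (simp add: power_mult_distrib power_divide power2_eq_square)
    also have "\<dots> = (1 - e) * z\<^sup>2 + 4 * (pi * pi) * q\<^sup>2 * (1 - z)\<^sup>2 / (1 - e)"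
      unfolding se(2) using e by (simp add: field_simps)
    also have "\<dots> \<le> (1 - e) * z\<^sup>2 + 4 * 10 * ((1 - e)\<^sup>2 / 400) * (1 - z)\<^sup>2 / (1 - e)"
      using q2 pi2 e by (intro add_mono order_refl divide_right_mono mult_right_mono mult_mono) auto
    also have "\<dots> = (1 - e) * (z\<^sup>2 + (1 - z)\<^sup>2 / 10)" using e by (simp add: field_simps power2_eq_square)
    also have "\<dots> < (1 - e) * 1"
    proof (intro mult_strict_left_mono)
      \<comment> \<open>The gap to the boundary of the disc factors, and \<open>9 + 11 * z\<close>
        is positive because \<open>z > - 5/12 > - 9/11\<close>.\<close>
      have "0 < (1 - z) * (9 + 11 * z)" using zb by (intro mult_pos_pos) auto
      moreover have "z\<^sup>2 + (1 - z)\<^sup>2 / 10 = 1 - (1 - z) * (9 + 11 * z) / 10"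
        by (simp add: power2_eq_square field_simps)
      ultimately show "z\<^sup>2 + (1 - z)\<^sup>2 / 10 < 1" by simp
    qed (use e in auto)
    finally show "G (s e * zt p, q / (s e / (2 * sqrt (1 - p)))) e"
      unfolding eq by (simp add: G_def nz_def)
  next
    fix e :: real assume e: "e \<in> {0<..<1}"
    show "\<not> G (s e, 0) e" using s [of e] e by (simp add: G_def nz_def power2_eq_square)
    let ?F = "at (1::real, e) within {-1..<1} \<times> {0<..<1}"
    have l: "(fst \<longlongrightarrow> 1) ?F" "(snd \<longlongrightarrow> e) ?F"
      using tendsto_fst [OF tendsto_ident_at, of "(1, e)"] tendsto_snd [OF tendsto_ident_at, of "(1, e)"]
      by simp_all
    have "((\<lambda>y::r2. s (snd y) * zt (fst y)) \<longlongrightarrow> s e * zt 1) ?F"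
      unfolding s_def zt_def by (intro tendsto_intros l) simp
    then show "((\<lambda>y::r2. s (snd y) * zt (fst y)) \<longlongrightarrow> s e) ?F"
      by (simp add: zt_def)
    have "((\<lambda>y::r2. 2 * sqrt (1 - fst y) / s (snd y)) \<longlongrightarrow> 2 * sqrt (1 - 1) / s e) ?F"
      using e unfolding s_def by (intro tendsto_intros l) auto
    then show "((\<lambda>y::r2. 1 / (s (snd y) / (2 * sqrt (1 - fst y)))) \<longlongrightarrow> 0) ?F"
      by simp
  qed simp
  moreover have "slabs G - {x. \<exists>p. 0 \<le> p \<and> p < 1 \<and> fst x = (s (snd (snd x)) * zt p, 0)} =
    slabs G - {x. 0 \<le> fst (fst x) \<and> snd (fst x) = 0}"
  proof -
    have "(\<exists>p. 0 \<le> p \<and> p < 1 \<and> fst x = (s (snd (snd x)) * zt p, 0)) \<longleftrightarrow>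
        0 \<le> fst (fst x) \<and> snd (fst x) = 0" if x: "x \<in> slabs G" for x
    proof
      assume "\<exists>p. 0 \<le> p \<and> p < 1 \<and> fst x = (s (snd (snd x)) * zt p, 0)"
      then show "0 \<le> fst (fst x) \<and> snd (fst x) = 0"
        using s [of "snd (snd x)"] x by (auto simp: slabs_def zt_def)
    next
      assume a: "0 \<le> fst (fst x) \<and> snd (fst x) = 0"
      define S where "S = s (snd (snd x))"
      have S: "0 < S" "S * S = (1 - snd (snd x)) / pi" using s x by (auto simp: S_def slabs_def)
      define z where "z = fst (fst x) / S"
      have "pi * (fst (fst x))\<^sup>2 < 1 - snd (snd x)"
        using x a by (simp add: slabs_def G_def nz_def)
      then have "(fst (fst x))\<^sup>2 < (1 - snd (snd x)) / pi" by (simp add: field_simps)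
      then have "(fst (fst x))\<^sup>2 < S\<^sup>2" using S(2) by (simp add: power2_eq_square)
      then have "fst (fst x) < S" using S(1) by (intro power2_less_imp_less [of _ S]) auto
      then have z: "0 \<le> z" "z < 1" using a S by (auto simp: z_def)
      define p where "p = 1 - (1 - z)\<^sup>2"
      have "zt p = z" using z by (simp add: p_def zt_def)
      moreover have "0 \<le> p" "p < 1" using z by (auto simp: p_def power_le_one)
      ultimately show "\<exists>p. 0 \<le> p \<and> p < 1 \<and> fst x = (s (snd (snd x)) * zt p, 0)"
        using a S by (intro exI [of _ p]) (simp add: z_def prod_eq_iff flip: S_def)
    qed
    then show ?thesis by blast
  qed
  ultimately show ?thesis by simp
qed

section \<open>Area-preserving maps of the fibre\<close>

definition area_on :: "r2 set \<Rightarrow> (r2 \<Rightarrow> r2) \<Rightarrow> bool" where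
  "area_on W \<phi> \<longleftrightarrow> (\<forall>x\<in>W. \<exists>\<phi>'. (\<phi> has_derivative \<phi>') (at x) \<and>
     (\<forall>v w. area (\<phi>' v) (\<phi>' w) = area v w))"

lemma area_onI:
  assumes "\<And>x. x \<in> W \<Longrightarrow> (f has_derivative (\<lambda>v. a x * fst v + b x * snd v)) (at x)"
    "\<And>x. x \<in> W \<Longrightarrow> (g has_derivative (\<lambda>v. c x * fst v + d x * snd v)) (at x)"
    "\<And>x. x \<in> W \<Longrightarrow> a x * d x - b x * c x = 1"
  shows "area_on W (\<lambda>x. (f x, g x))"
  unfolding area_on_def
proof
  fix x assume x: "x \<in> W"
  have "(a x * v1 + b x * v2) * (c x * w1 + d x * w2) - (a x * w1 + b x * w2) * (c x * v1 + d x * v2) =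
     (a x * d x - b x * c x) * (v1 * w2 - w1 * v2)" for v1 v2 w1 w2
    by (simp add: algebra_simps)
  then have "area (a x * fst v + b x * snd v, c x * fst v + d x * snd v)
      (a x * fst w + b x * snd w, c x * fst w + d x * snd w) = area v w" for v w :: r2
    by (simp add: area_def assms(3) [OF x])
  with has_derivative_Pair [OF assms(1,2) [OF x]]
  show "\<exists>\<phi>'. ((\<lambda>x. (f x, g x)) has_derivative \<phi>') (at x) \<and> (\<forall>v w. area (\<phi>' v) (\<phi>' w) = area v w)"
    by blast
qed

lemma area_on_compose:
  assumes "area_on V f" "area_on U g" "\<And>x. x \<in> U \<Longrightarrow> g x \<in> V"
  shows "area_on U (\<lambda>x. f (g x))"
  unfolding area_on_def
proof
  fix x assume x: "x \<in> U"
  then obtain g' where g': "(g has_derivative g') (at x)" "\<forall>v w. area (g' v) (g' w) = area v w"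
    using assms(2) unfolding area_on_def by blast
  obtain f' where f': "(f has_derivative f') (at (g x))" "\<forall>v w. area (f' v) (f' w) = area v w"
    using assms(1,3) x unfolding area_on_def by blast
  show "\<exists>\<phi>'. ((\<lambda>x. f (g x)) has_derivative \<phi>') (at x) \<and> (\<forall>v w. area (\<phi>' v) (\<phi>' w) = area v w)"
    using has_derivative_compose [OF g'(1) f'(1)] g'(2) f'(2) by auto
qed

lemma area_on_cong:
  assumes "open U" "area_on U f" "\<And>x. x \<in> U \<Longrightarrow> f x = g x"
  shows "area_on U g"
  unfolding area_on_def
proof
  fix x assume x: "x \<in> U"
  then obtain f' where f': "(f has_derivative f') (at x)" "\<forall>v w. area (f' v) (f' w) = area v w"
    using assms(2) unfolding area_on_def by blast
  have "(g has_derivative f') (at x)"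
    by (rule has_derivative_transform_within_open [OF f'(1) assms(1) x]) (use assms(3) in auto)
  with f' show "\<exists>\<phi>'. (g has_derivative \<phi>') (at x) \<and> (\<forall>v w. area (\<phi>' v) (\<phi>' w) = area v w)" by blast
qed

lemma area_on_subset: "area_on W f \<Longrightarrow> V \<subseteq> W \<Longrightarrow> area_on V f" by (auto simp: area_on_def)

lemma area_on_Un: "area_on U f \<Longrightarrow> area_on V f \<Longrightarrow> area_on (U \<union> V) f" by (auto simp: area_on_def)

text \<open>The same \<open>\<phi>\<close> acts on every fibre, independently of \<open>e\<close>,
  so \<open>t\<close> needs no correction.\<close>

lemma symp_slabs_map:
  fixes \<phi> :: "r2 \<Rightarrow> r2"
  assumes W: "open W" "smooth_on W \<phi>" "inj_on \<phi> W" "area_on W \<phi>"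
    and G: "open (slabs G)" "\<And>w e. G w e \<Longrightarrow> w \<in> W"
    and H: "\<And>w e. 0 < e \<Longrightarrow> e < 1 \<Longrightarrow> H w e \<longleftrightarrow> (\<exists>v. G v e \<and> w = \<phi> v)"
  shows "symp (slabs G) (slabs H)"
proof -
  have "symp (slabs G) ((\<lambda>p. (\<phi> (fst p), snd p)) ` slabs G)"
    by (rule symp_fst_map [OF W(1-3) _ G(1)]) (use W(4) G(2) in \<open>auto simp: area_on_def slabs_def\<close>)
  moreover have "(\<lambda>p. (\<phi> (fst p), snd p)) ` slabs G = slabs H"
  proof (intro subset_antisym subsetI)
    fix y assume "y \<in> slabs H"
    then have y: "0 < snd (snd y)" "snd (snd y) < 1" "0 < fst (snd y)" "fst (snd y) < 1"
      "H (fst y) (snd (snd y))" by (auto simp: slabs_def)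
    then obtain v where "G v (snd (snd y))" "fst y = \<phi> v" using H by blast
    then show "y \<in> (\<lambda>p. (\<phi> (fst p), snd p)) ` slabs G"
      using y by (intro image_eqI [of _ _ "(v, snd y)"]) (auto simp: slabs_def prod_eq_iff)
  next
    fix y assume "y \<in> (\<lambda>p. (\<phi> (fst p), snd p)) ` slabs G"
    then obtain p where p: "p \<in> slabs G" "y = (\<phi> (fst p), snd p)" by blast
    then have b: "0 < snd (snd p)" "snd (snd p) < 1" and "G (fst p) (snd (snd p))" by (auto simp: slabs_def)
    then have "\<exists>v. G v (snd (snd p)) \<and> \<phi> (fst p) = \<phi> v" by blast
    then have "H (\<phi> (fst p)) (snd (snd p))" by (rule H [THEN iffD2, OF b])
    then show "y \<in> slabs H" using p by (simp add: slabs_def)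
  qed
  ultimately show ?thesis by simp
qed

definition bx :: "real \<Rightarrow> (real \<Rightarrow> real) \<Rightarrow> r2 \<Rightarrow> real \<Rightarrow> bool" where
  "bx a c w e \<longleftrightarrow> 0 < fst w \<and> fst w < 1 \<and> - a * c e < snd w \<and> snd w < (1 - a) * c e"

lemma open_bx:
  assumes "continuous_on UNIV c" shows "open (slabs (bx a c))"
proof -
  have "continuous_on UNIV (\<lambda>y::r2 \<times> real. c (snd y))"
    by (rule continuous_on_compose2 [OF assms]) (auto intro: continuous_intros)
  then have *: "open ({y::r2 \<times> real. 0 < fst (fst y)} \<inter> {y. fst (fst y) < 1} \<inter> {y. - a * c (snd y) < snd (fst y)} \<inter>
      {y. snd (fst y) < (1 - a) * c (snd y)})"
    by (intro open_Int open_Collect_less continuous_intros)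
  show ?thesis
    by (rule open_slabs) (use * in \<open>simp add: bx_def Collect_conj_eq Int_assoc\<close>)
qed

text \<open>Action-angle coordinates: the abscissa is the angle in full turns, the ordinate the
  enclosed area \<open>pi * r^2\<close>. The clockwise direction gives the right orientation, and
  the open interval of angles leaves out the ray at angle 0.\<close>

lemma symp_polar:
  "symp (slabs (bx 0 (\<lambda>e. 1 - e)))
     (slabs (\<lambda>w e. pi * nz w < 1 - e) - {x. 0 \<le> fst (fst x) \<and> snd (fst x) = 0})"
proof -
  define W :: "r2 set" where "W = {0<..<1} \<times> {0<..}"
  define \<phi> where "\<phi> x = (sqrt (snd x / pi) * cos (2 * pi * fst x), - sqrt (snd x / pi) * sin (2 * pi * fst x))" for x :: r2
  have W: "open W" unfolding W_def by (intro open_Times) auto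
  have Wx: "0 < fst x" "fst x < 1" "0 < snd x" if "x \<in> W" for x using that by (auto simp: W_def)
  have sm: "smooth_on W \<phi>" unfolding \<phi>_def
    by (intro smooth_intros W) (use Wx in auto)
  have nzp: "pi * nz (\<phi> x) = snd x" if "x \<in> W" for x
  proof -
    have "(r * c)\<^sup>2 + (- r * s)\<^sup>2 = r\<^sup>2 * (s\<^sup>2 + c\<^sup>2)" for r s c :: real
      by (simp add: algebra_simps power2_eq_square)
    then show ?thesis using Wx [OF that] by (simp add: nz_def \<phi>_def)
  qed
  have ar: "area_on W \<phi>" unfolding \<phi>_def
  proof (rule area_onI)
    fix x assume x: "x \<in> W"
    have p: "0 < snd x / pi" using Wx [OF x] by simp
    have r: "((\<lambda>x. sqrt (snd x / pi)) has_derivative (\<lambda>v. snd v / (2 * pi * sqrt (snd x / pi)))) (at x)"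
    proof -
      have "((\<lambda>x::r2. snd x / pi) has_derivative (\<lambda>v. snd v / pi)) (at x)"
        by (auto intro!: derivative_eq_intros)
      from has_derivative_real_sqrt [OF p this] show ?thesis
        by (rule has_derivative_eq_rhs) (simp add: fun_eq_iff inverse_eq_divide)
    qed
    let ?r = "sqrt (snd x / pi)" and ?c = "cos (2 * pi * fst x)" and ?s = "sin (2 * pi * fst x)"
    show "((\<lambda>x. sqrt (snd x / pi) * cos (2 * pi * fst x)) has_derivative
       (\<lambda>v. (- ?r * ?s * 2 * pi) * fst v + ?c / (2 * pi * ?r) * snd v)) (at x)"
      by (rule derivative_eq_intros r refl)+ (simp add: fun_eq_iff)
    show "((\<lambda>x. - sqrt (snd x / pi) * sin (2 * pi * fst x)) has_derivative
       (\<lambda>v. (- ?r * ?c * 2 * pi) * fst v + - ?s / (2 * pi * ?r) * snd v)) (at x)"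
      by (rule derivative_eq_intros r refl)+ (simp add: fun_eq_iff)
    have r0: "?r \<noteq> 0" using Wx(3) [OF x] by simp
    have "(- r * s * 2 * pi) * (- s / (2 * pi * r)) - c / (2 * pi * r) * (- r * c * 2 * pi) = s\<^sup>2 + c\<^sup>2"
      if "r \<noteq> 0" for r s c :: real
      using that by (simp add: power2_eq_square)
    from this [OF r0, of ?s ?c]
    show "- ?r * ?s * 2 * pi * (- ?s / (2 * pi * ?r)) - ?c / (2 * pi * ?r) * (- ?r * ?c * 2 * pi) = 1"
      by simp
  qed
  have inj: "inj_on \<phi> W"
  proof (rule inj_onI)
    fix x y assume xy: "x \<in> W" "y \<in> W" "\<phi> x = \<phi> y"
    have s: "snd x = snd y" using nzp [OF xy(1)] nzp [OF xy(2)] xy(3) by simp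
    have "sqrt (snd y / pi) \<noteq> 0" using Wx [OF xy(2)] by simp
    then have "sin (2 * pi * fst x) = sin (2 * pi * fst y) \<and> cos (2 * pi * fst x) = cos (2 * pi * fst y)"
      using xy(3) by (simp add: \<phi>_def s)
    then obtain n :: int where n: "2 * pi * fst x = 2 * pi * fst y + 2 * pi * n"
      using sin_cos_eq_iff by (metis mult.assoc mult.commute)
    then have "2 * pi * fst x = 2 * pi * (fst y + n)" by (simp add: distrib_left)
    then have n': "fst x = fst y + n" by simp
    then have "-1 < real_of_int n" "real_of_int n < 1" using Wx [OF xy(1)] Wx [OF xy(2)] by linarith+
    then have "n = 0" by linarith
    then show "x = y" using n' s by (simp add: prod_eq_iff)
  qed
  have "symp (slabs (bx 0 (\<lambda>e. 1 - e))) (slabs (\<lambda>w e. pi * nz w < 1 - e \<and> \<not> (0 \<le> fst w \<and> snd w = 0)))"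
  proof (rule symp_slabs_map [OF W sm inj ar])
    show "open (slabs (bx 0 (\<lambda>e. 1 - e)))" by (intro open_bx continuous_intros)
    show "w \<in> W" if "bx 0 (\<lambda>e. 1 - e) w e" for w e using that by (auto simp: bx_def W_def mem_Times_iff)
    fix w e assume e: "0 < e" "e < (1::real)"
    show "(pi * nz w < 1 - e \<and> \<not> (0 \<le> fst w \<and> snd w = 0)) \<longleftrightarrow> (\<exists>v. bx 0 (\<lambda>e. 1 - e) v e \<and> w = \<phi> v)"
    proof
      assume w: "pi * nz w < 1 - e \<and> \<not> (0 \<le> fst w \<and> snd w = 0)"
      define \<rho> where "\<rho> = sqrt (nz w)"
      have "nz w \<noteq> 0" using w by (auto simp: nz_def)
      then have \<rho>: "0 < \<rho>" "\<rho>\<^sup>2 = nz w" by (auto simp: \<rho>_def nz_def sum_power2_gt_zero_iff)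
      have "(fst w / \<rho>)\<^sup>2 + (- snd w / \<rho>)\<^sup>2 = 1"
      proof -
        have "(fst w / \<rho>)\<^sup>2 + (- snd w / \<rho>)\<^sup>2 = nz w / \<rho>\<^sup>2"
          by (simp add: power_divide nz_def add_divide_distrib)
        then show ?thesis using \<rho> \<open>nz w \<noteq> 0\<close> by simp
      qed
      then obtain \<theta> where \<theta>: "0 \<le> \<theta>" "\<theta> < 2 * pi" "fst w / \<rho> = cos \<theta>" "- snd w / \<rho> = sin \<theta>"
        using sincos_total_2pi by metis
      then have wt: "fst w = \<rho> * cos \<theta>" "snd w = - \<rho> * sin \<theta>" using \<rho> by (simp_all add: field_simps)
      have n0: "0 < nz w" using \<rho> by (metis zero_less_power)
      have "\<theta> \<noteq> 0" using w wt \<rho> by auto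
      define v where "v = (\<theta> / (2 * pi), pi * nz w)"
      have "bx 0 (\<lambda>e. 1 - e) v e"
        using \<theta>(1,2) \<open>\<theta> \<noteq> 0\<close> w n0 by (simp add: bx_def v_def)
      moreover have "w = \<phi> v" by (simp add: \<phi>_def v_def wt prod_eq_iff flip: \<rho>_def)
      ultimately show "\<exists>v. bx 0 (\<lambda>e. 1 - e) v e \<and> w = \<phi> v" by blast
    next
      assume "\<exists>v. bx 0 (\<lambda>e. 1 - e) v e \<and> w = \<phi> v"
      then obtain v where v: "bx 0 (\<lambda>e. 1 - e) v e" "w = \<phi> v" by blast
      then have vW: "v \<in> W" by (auto simp: bx_def W_def mem_Times_iff)
      note b = Wx [OF vW]
      have "\<not> (0 \<le> fst w \<and> snd w = 0)"
      proof
        assume a: "0 \<le> fst w \<and> snd w = 0"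
        have s0: "0 < sqrt (snd v / pi)" using b by simp
        have "fst w = sqrt (snd v / pi) * cos (2 * pi * fst v)" "snd w = - sqrt (snd v / pi) * sin (2 * pi * fst v)"
          unfolding v(2) \<phi>_def by simp_all
        then have s: "sin (2 * pi * fst v) = 0" and c: "0 \<le> cos (2 * pi * fst v)"
          using a s0 mult_pos_neg [OF s0, of "cos (2 * pi * fst v)"] by (auto simp: not_le [symmetric])
        then have "cos (2 * pi * fst v) = cos 0"
          using sin_cos_squared_add [of "2 * pi * fst v"] by (simp add: power2_eq_1_iff)
        with s have "sin (2 * pi * fst v) = sin 0 \<and> cos (2 * pi * fst v) = cos 0" by simp
        then obtain n :: int where "2 * pi * fst v = 2 * pi * n"
          unfolding sin_cos_eq_iff by (auto simp: mult_ac)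
        then have "fst v = n" by simp
        then have "0 < n" "n < 1" using b(1,2) by simp_all
        then show False by simp
      qed
      then show "pi * nz w < 1 - e \<and> \<not> (0 \<le> fst w \<and> snd w = 0)"
        using nzp [OF vW] v by (simp add: bx_def)
    qed
  qed
  moreover have "slabs (\<lambda>w e. pi * nz w < 1 - e \<and> \<not> (0 \<le> fst w \<and> snd w = 0)) =
     slabs (\<lambda>w e. pi * nz w < 1 - e) - {x. 0 \<le> fst (fst x) \<and> snd (fst x) = 0}"
    by (auto simp: slabs_def)
  ultimately show ?thesis by simp
qed

lemma symp_triangle_ball: "symp (slabs (bx 0 (\<lambda>e. 1 - e))) ball4"
  using symp_trans [OF symp_polar symp_trans [OF excise_disc symp_sym [OF symp_ball_slabs]]] .

text \<open>The map \<open>z \<mapsto> - z\<^sup>2 / (sqrt 2 * \<bar>z\<bar>)\<close>, which is two-to-one and area-preserving.\<close>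

definition dbl :: "r2 \<Rightarrow> r2" where
  "dbl v = (((snd v)\<^sup>2 - (fst v)\<^sup>2) / (sqrt 2 * sqrt (nz v)), - sqrt 2 * fst v * snd v / sqrt (nz v))"

lemma nz_pos: "v \<noteq> 0 \<Longrightarrow> 0 < nz v"
  by (cases v) (auto simp: nz_def sum_power2_gt_zero_iff zero_prod_def)

lemma nz_dbl: assumes "v \<noteq> 0" shows "nz (dbl v) = nz v / 2"
proof -
  define r where "r = sqrt (nz v)"
  have r: "0 < r" "r * r = nz v" using nz_pos [OF assms] by (simp_all add: r_def)
  have "nz (dbl v) = (((snd v)\<^sup>2 - (fst v)\<^sup>2) / (sqrt 2 * r))\<^sup>2 + (- sqrt 2 * fst v * snd v / r)\<^sup>2"
    by (subst nz_def) (simp add: dbl_def r_def)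
  also have "\<dots> = (((snd v)\<^sup>2 - (fst v)\<^sup>2)\<^sup>2 + 4 * (fst v)\<^sup>2 * (snd v)\<^sup>2) / (2 * (r * r))"
    using r(1) by (simp add: power_divide power_mult_distrib power2_eq_square [of r] field_simps)
  also have "((snd v)\<^sup>2 - (fst v)\<^sup>2)\<^sup>2 + 4 * (fst v)\<^sup>2 * (snd v)\<^sup>2 = nz v * nz v"
    by (simp add: nz_def power2_eq_square algebra_simps)
  finally show ?thesis unfolding r(2) using nz_pos [OF assms] by simp
qed

text \<open>Half-angle formulas: they determine \<open>v\<close> up to sign from its image, and
  translate conditions on \<open>v\<close> into conditions on \<open>dbl v\<close>.\<close>

lemma dbl_eqs: assumes "v \<noteq> 0"
  defines "R \<equiv> sqrt (nz (dbl v))"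
  shows "(snd v)\<^sup>2 = R * (R + fst (dbl v))" "(fst v)\<^sup>2 = R * (R - fst (dbl v))"
    "fst v * snd v = - R * snd (dbl v)" "0 < R"
proof -
  have "0 < nz v" by (rule nz_pos [OF assms(1)])
  define r where "r = sqrt (nz v)"
  have r: "0 < r" "r * r = nz v" using \<open>0 < nz v\<close> by (simp_all add: r_def)
  have R: "R = r / sqrt 2" by (simp add: R_def nz_dbl [OF assms(1)] real_sqrt_divide r_def)
  have RR: "R * R = nz v / 2" using r by (simp add: R)
  have 1: "R * fst (dbl v) = ((snd v)\<^sup>2 - (fst v)\<^sup>2) / 2" "R * snd (dbl v) = - fst v * snd v"
    using r(1) unfolding dbl_def fst_conv snd_conv r_def [symmetric] R by (simp_all add: field_simps)
  show "(snd v)\<^sup>2 = R * (R + fst (dbl v))" "(fst v)\<^sup>2 = R * (R - fst (dbl v))"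
    "fst v * snd v = - R * snd (dbl v)"
    unfolding distrib_left right_diff_distrib 1(1) RR nz_def using 1(2) by (simp_all add: field_simps)
  show "0 < R" using r(1) by (simp add: R)
qed

lemma dbl_eq_iff: assumes "v \<noteq> 0" "w \<noteq> 0" shows "dbl v = dbl w \<longleftrightarrow> v = w \<or> v = - w"
proof
  assume c: "dbl v = dbl w"
  note a = dbl_eqs(1-3) [OF assms(1), unfolded c] dbl_eqs(1-3) [OF assms(2)]
  have e: "(snd v)\<^sup>2 = (snd w)\<^sup>2" "(fst v)\<^sup>2 = (fst w)\<^sup>2" "fst v * snd v = fst w * snd w"
    using a by simp_all
  then show "v = w \<or> v = - w"
    by (auto simp: power2_eq_iff prod_eq_iff)
next
  have "dbl (- w) = dbl w" by (simp add: dbl_def nz_def)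
  then show "v = w \<or> v = - w \<Longrightarrow> dbl v = dbl w" by auto
qed

text \<open>In polar coordinates the angle is doubled and the square of the radius halved.\<close>

lemma area_on_dbl: "area_on (- {0}) dbl"
  unfolding dbl_def
proof (rule area_onI)
  fix v :: r2 assume "v \<in> - {0}"
  then have p: "0 < nz v" by (simp add: nz_pos)
  define X Y r where "X = fst v" and "Y = snd v" and "r = sqrt (nz v)"
  have r: "0 < r" "r * r = X * X + Y * Y" using p by (simp_all add: r_def X_def Y_def nz_def power2_eq_square)
  have D: "((\<lambda>v. sqrt (nz v)) has_derivative (\<lambda>u. (X * fst u + Y * snd u) / r)) (at v)"
  proof -
    have alg: "2 * m * (inverse r / 2) = m / r" for m by (simp add: inverse_eq_divide)
    show ?thesis
      by (rule has_derivative_eq_rhs [OF has_derivative_real_sqrt [OF p nz_FDERIV [OF has_derivative_ident]]])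
        (simp only: alg X_def [symmetric] Y_def [symmetric] r_def [symmetric])
  qed
  have s2: "sqrt 2 * sqrt 2 = (2::real)" by simp
  have q: "sqrt 2 * sqrt (nz v) \<noteq> 0" "sqrt (nz v) \<noteq> 0" using p by auto
  show "((\<lambda>v. ((snd v)\<^sup>2 - (fst v)\<^sup>2) / (sqrt 2 * sqrt (nz v))) has_derivative
     (\<lambda>u. (- X * (X * X + 3 * Y * Y) / (sqrt 2 * r ^ 3)) * fst u + (Y * (3 * X * X + Y * Y) / (sqrt 2 * r ^ 3)) * snd u)) (at v)"
  proof (rule has_derivative_eq_rhs [OF has_derivative_divide' [OF _ has_derivative_mult_right [OF D] q(1)]])
    show "((\<lambda>v. (snd v)\<^sup>2 - (fst v)\<^sup>2) has_derivative (\<lambda>u. 2 * Y * snd u - 2 * X * fst u)) (at v)"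
      unfolding X_def Y_def by (auto intro!: derivative_eq_intros)
    have "((2 * Y * b - 2 * X * a) * (s * r) - (Y\<^sup>2 - X\<^sup>2) * (s * ((X * a + Y * b) / r))) / (s * r * (s * r)) =
        ((2 * Y * b - 2 * X * a) * (r * r) - (Y\<^sup>2 - X\<^sup>2) * (X * a + Y * b)) / (s * r ^ 3)"
      if "s \<noteq> 0" for a b s
    proof -
      have "(n * (s * r) - k * (s * (m / r))) / (s * r * (s * r)) = (n * (r * r) - k * m) / (s * r ^ 3)"
        for n k m :: real
        using r(1) that by (simp add: field_simps power3_eq_cube)
      then show ?thesis .
    qed
    moreover have "((2 * Y * b - 2 * X * a) * (r * r) - (Y\<^sup>2 - X\<^sup>2) * (X * a + Y * b)) =
        - X * (X * X + 3 * Y * Y) * a + Y * (3 * X * X + Y * Y) * b" for a b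
      unfolding r(2) by (simp add: algebra_simps power2_eq_square)
    ultimately show "(\<lambda>h. ((2 * Y * snd h - 2 * X * fst h) * (sqrt 2 * sqrt (nz v)) -
          ((snd v)\<^sup>2 - (fst v)\<^sup>2) * (sqrt 2 * ((X * fst h + Y * snd h) / r))) /
         (sqrt 2 * sqrt (nz v) * (sqrt 2 * sqrt (nz v)))) =
      (\<lambda>u. (- X * (X * X + 3 * Y * Y) / (sqrt 2 * r ^ 3)) * fst u + (Y * (3 * X * X + Y * Y) / (sqrt 2 * r ^ 3)) * snd u)"
      unfolding r_def [symmetric] X_def [symmetric] Y_def [symmetric]
      by (simp add: fun_eq_iff add_divide_distrib diff_divide_distrib)
  qed
  show "((\<lambda>v. - sqrt 2 * fst v * snd v / sqrt (nz v)) has_derivative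
     (\<lambda>u. (- sqrt 2 * Y ^ 3 / r ^ 3) * fst u + (- sqrt 2 * X ^ 3 / r ^ 3) * snd u)) (at v)"
  proof (rule has_derivative_eq_rhs [OF has_derivative_divide' [OF _ D q(2)]])
    show "((\<lambda>v. - sqrt 2 * fst v * snd v) has_derivative (\<lambda>u. - sqrt 2 * (X * snd u + Y * fst u))) (at v)"
      unfolding X_def Y_def by (auto intro!: derivative_eq_intros simp: algebra_simps)
    have e1: "(- s * (X * b + Y * a) * r - - s * X * Y * ((X * a + Y * b) / r)) / (r * r) =
       (- s) * ((X * b + Y * a) * (r * r) - X * Y * (X * a + Y * b)) / r ^ 3" for a b s
    proof -
      have "(- s * n * r - - s * X * Y * (m / r)) / (r * r) = (- s) * (n * (r * r) - X * Y * m) / r ^ 3"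
        for n m :: real
        using r(1) by (simp add: field_simps power3_eq_cube)
      then show ?thesis .
    qed
    have e2: "(X * b + Y * a) * (r * r) - X * Y * (X * a + Y * b) = Y ^ 3 * a + X ^ 3 * b" for a b
      unfolding r(2) by (simp add: algebra_simps power3_eq_cube)
    show "(\<lambda>h. (- sqrt 2 * (X * snd h + Y * fst h) * sqrt (nz v) -
        - sqrt 2 * fst v * snd v * ((X * fst h + Y * snd h) / r)) / (sqrt (nz v) * sqrt (nz v))) =
      (\<lambda>u. (- sqrt 2 * Y ^ 3 / r ^ 3) * fst u + (- sqrt 2 * X ^ 3 / r ^ 3) * snd u)"
      unfolding r_def [symmetric] X_def [symmetric] Y_def [symmetric]
      unfolding e1 e2 by (simp add: fun_eq_iff algebra_simps add_divide_distrib diff_divide_distrib)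
  qed
  have "- X * (X * X + 3 * Y * Y) / (s * r ^ 3) * (- s * X ^ 3 / r ^ 3) -
      Y * (3 * X * X + Y * Y) / (s * r ^ 3) * (- s * Y ^ 3 / r ^ 3) = (X * X + Y * Y) ^ 3 / (r * r) ^ 3"
    if "s \<noteq> 0" for s
  proof -
    have "(X * X + Y * Y) ^ 3 = X * (X * X + 3 * Y * Y) * X ^ 3 + Y * (3 * X * X + Y * Y) * Y ^ 3"
      by (simp add: power3_eq_cube algebra_simps)
    then show ?thesis using that r(1)
      by (simp add: power_mult_distrib add_divide_distrib)
  qed
  from this [of "sqrt 2"] show "- X * (X * X + 3 * Y * Y) / (sqrt 2 * r ^ 3) * (- sqrt 2 * X ^ 3 / r ^ 3) -
      Y * (3 * X * X + Y * Y) / (sqrt 2 * r ^ 3) * (- sqrt 2 * Y ^ 3 / r ^ 3) = 1"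
  proof (rule trans)
    show "(X * X + Y * Y) ^ 3 / (r * r) ^ 3 = 1"
      unfolding r(2) [symmetric] using r(1) by simp
  qed simp
qed

lemma smooth_on_dbl: "smooth_on (- {0}) dbl"
  unfolding dbl_def by (intro smooth_intros) (auto dest: nz_pos)

text \<open>The square root by the half-angle formulas, with the positive choice for the ordinate
  \<open>Y\<close>. Off the nonpositive half-axis \<open>R + fst w\<close> is positive, so dividing
  by \<open>Y\<close> is legitimate.\<close>

lemma dbl_upper:
  assumes "\<not> (snd w = 0 \<and> fst w \<le> 0)"
  obtains v where "0 < snd v" "dbl v = w"
proof -
  define R where "R = sqrt (nz w)"
  have n: "0 < nz w" using assms by (intro nz_pos) (auto simp: zero_prod_def)
  then have R: "0 < R" "R * R = (fst w)\<^sup>2 + (snd w)\<^sup>2" by (simp_all add: R_def nz_def)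
  have pos: "0 < R + fst w"
  proof (rule ccontr)
    assume "\<not> 0 < R + fst w"
    then have a: "R \<le> - fst w" by simp
    then have "R * R \<le> (- fst w) * (- fst w)" using R(1) by (intro mult_mono) auto
    then have "snd w = 0" using R(2) by (simp add: power2_eq_square) (smt (verit) mult_eq_0_iff zero_le_square)
    then show False using assms a R(1) by simp
  qed
  define Y where "Y = sqrt (R * (R + fst w))"
  have Y: "0 < Y" "Y * Y = R * (R + fst w)" using R pos by (simp_all add: Y_def)
  define X where "X = - R * snd w / Y"
  have XY: "X * Y = - R * snd w" using Y by (simp add: X_def)
  have XX: "X * X = R * (R - fst w)"
  proof -
    have "(X * X) * (Y * Y) = (R * snd w) * (R * snd w)" using XY by (metis (no_types) mult.assoc mult.commute mult_minus_left mult_minus_right minus_minus)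
    also have "\<dots> = R * R * (snd w * snd w)" by simp
    also have "snd w * snd w = (R + fst w) * (R - fst w)"
      using R(2) by (simp add: algebra_simps power2_eq_square)
    also have "R * R * ((R + fst w) * (R - fst w)) = (R * (R + fst w)) * (R * (R - fst w))" by simp
    also have "\<dots> = (R * (R - fst w)) * (Y * Y)" by (simp add: Y(2))
    finally have *: "(X * X) * (Y * Y) = (R * (R - fst w)) * (Y * Y)" .
    have "Y * Y \<noteq> 0" using Y(1) by simp
    from mult_right_cancel [OF this] * show ?thesis by blast
  qed
  have nzv: "nz (X, Y) = 2 * (R * R)" using XX Y(2) by (simp add: nz_def power2_eq_square algebra_simps)
  have sq: "sqrt (nz (X, Y)) = sqrt 2 * R" unfolding nzv using R(1) by (simp add: real_sqrt_mult)
  have "dbl (X, Y) = w"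
  proof (rule prod_eqI)
    have "fst (dbl (X, Y)) = (Y * Y - X * X) / (sqrt 2 * (sqrt 2 * R))" by (simp add: dbl_def sq power2_eq_square)
    also have "\<dots> = fst w" unfolding XX Y(2) using R(1) by (simp add: field_simps)
    finally show "fst (dbl (X, Y)) = fst w" .
    have "snd (dbl (X, Y)) = - sqrt 2 * (X * Y) / (sqrt 2 * R)" by (simp add: dbl_def sq)
    also have "\<dots> = snd w" unfolding XY using R(1) by simp
    finally show "snd (dbl (X, Y)) = snd w" .
  qed
  then show thesis using that [of "(X, Y)"] Y by simp
qed

section \<open>Folding\<close>

definition st :: "real \<Rightarrow> real" where "st m = flat 0 m / (flat 0 m + flat 0 (1 - m))"
definition st' :: "real \<Rightarrow> real" where
  "st' m = (flat 2 m * flat 0 (1 - m) + flat 0 m * flat 2 (1 - m)) / (flat 0 m + flat 0 (1 - m))\<^sup>2"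

lemma st_den: "0 < flat 0 m + flat 0 (1 - m)"
  by (cases "0 < m") (auto simp: flat_def intro: add_pos_nonneg add_nonneg_pos)

lemma st_deriv: "(st has_real_derivative st' m) (at m)"
proof -
  have "((\<lambda>m. flat 0 m / (flat 0 m + flat 0 (1 - m))) has_real_derivative st' m) (at m)"
    using st_den [of m]
    by (auto intro!: derivative_eq_intros DERIV_chain2 [OF flat_deriv] simp: st'_def numeral_eq_Suc)
      (simp add: field_simps)
  then show ?thesis by (simp add: st_def [abs_def])
qed

lemma st_bounds: "0 \<le> st m" "st m \<le> 1" "0 \<le> st' m" "0 \<le> m * st' m"
  and st_left: "m \<le> 0 \<Longrightarrow> st m = 0" "m \<le> 0 \<Longrightarrow> st' m = 0"
  and st_right: "1 \<le> m \<Longrightarrow> st m = 1" "1 \<le> m \<Longrightarrow> st' m = 0"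
proof -
  have d: "0 < flat 0 m + flat 0 (1 - m)" by (rule st_den)
  show "0 \<le> st m" "st m \<le> 1" using d flat_nonneg by (auto simp: st_def)
  show *: "0 \<le> st' m" by (auto simp: st'_def flat_nonneg)
  show l: "m \<le> 0 \<Longrightarrow> st m = 0" "m \<le> 0 \<Longrightarrow> st' m = 0" by (simp_all add: st_def st'_def flat_def)
  show "0 \<le> m * st' m" using * l(2) by (cases "m \<le> 0") auto
  show "1 \<le> m \<Longrightarrow> st m = 1" "1 \<le> m \<Longrightarrow> st' m = 0"
    using d by (simp_all add: st_def st'_def flat_def)
qed

lemma smooth_on_st [smooth_intros]:
  assumes "open U" "smooth_on U f"
  shows "smooth_on U (\<lambda>x. st (f x))" "smooth_on U (\<lambda>x. st' (f x))"
proof -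
  have "flat 0 (f x) + flat 0 (1 - f x) \<noteq> 0" for x using st_den [of "f x"] by simp
  then show "smooth_on U (\<lambda>x. st (f x))" "smooth_on U (\<lambda>x. st' (f x))"
    unfolding st_def st'_def by (intro smooth_intros assms power_not_zero; simp)+
qed

lemma open_slabs_vimage:
  assumes "open W" "continuous_on W \<phi>" "open (slabs K)"
  shows "open (slabs (\<lambda>w e. w \<in> W \<and> K (\<phi> w) e))"
proof -
  have "continuous_on (W \<times> UNIV) (\<lambda>p. (\<phi> (fst p), snd p))"
    by (intro continuous_intros continuous_on_compose2 [OF assms(2)]) auto
  from continuous_open_preimage [OF this open_Times [OF assms(1) open_UNIV] assms(3)]
  show ?thesis
    by (rule back_subst [where P = "open"]) (auto simp: slabs_def)
qed

text \<open>The lower side of the rectangle, of length 1, is to be folded at the point dividing it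
  in the ratio \<open>al : be\<close>. The order \<open>al \<le> be\<close> keeps the slope of
  \<open>nu\<close> at least \<open>4 * al^2\<close>.\<close>

locale fold =
  fixes al be :: real and c :: "real \<Rightarrow> real"
  assumes al: "0 < al" and albe: "al \<le> be" and sum: "al + be = 1"
    and c_cont: "continuous_on UNIV c" and c_pos: "\<And>e. 0 < e \<Longrightarrow> e < 1 \<Longrightarrow> 0 < c e"
begin

lemma be: "0 < be" using al albe by simp

text \<open>Slope \<open>4 * al\<^sup>2\<close> on the left and \<open>4 * be\<^sup>2\<close> on the right, so that \<open>gn\<close> is a linear rescaling by \<open>2 * al\<close>
  on the one side and by \<open>2 * be\<close> on the other.\<close>

definition nu :: "real \<Rightarrow> real" where "nu m = 4 * al\<^sup>2 * m + 4 * (be\<^sup>2 - al\<^sup>2) * m * st m"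
definition nu1 :: "real \<Rightarrow> real" where
  "nu1 m = 4 * al\<^sup>2 + 4 * (be\<^sup>2 - al\<^sup>2) * (st m + m * st' m)"

lemma D: "0 \<le> be\<^sup>2 - al\<^sup>2" using al albe by (simp add: power_mono)

lemma nu_deriv: "(nu has_real_derivative nu1 m) (at m)"
  unfolding nu_def [abs_def] nu1_def
  by (auto intro!: derivative_eq_intros st_deriv simp: algebra_simps)

lemma nu1_ge: "4 * al\<^sup>2 + 4 * (be\<^sup>2 - al\<^sup>2) * st m \<le> nu1 m" "4 * al\<^sup>2 \<le> nu1 m" "0 < nu1 m"
proof -
  have "0 \<le> 4 * (be\<^sup>2 - al\<^sup>2) * (m * st' m)" "0 \<le> 4 * (be\<^sup>2 - al\<^sup>2) * st m"
    using mult_nonneg_nonneg [OF _ st_bounds(4)] mult_nonneg_nonneg [OF _ st_bounds(1)] D by simp_all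
  moreover have "nu1 m = 4 * al\<^sup>2 + 4 * (be\<^sup>2 - al\<^sup>2) * st m + 4 * (be\<^sup>2 - al\<^sup>2) * (m * st' m)"
    by (simp add: nu1_def distrib_left)
  moreover have "0 < 4 * al\<^sup>2" using al by simp
  ultimately show "4 * al\<^sup>2 + 4 * (be\<^sup>2 - al\<^sup>2) * st m \<le> nu1 m" "4 * al\<^sup>2 \<le> nu1 m" "0 < nu1 m"
    by linarith+
qed

lemma nu_left: "m \<le> 0 \<Longrightarrow> nu m = 4 * al\<^sup>2 * m" "m \<le> 0 \<Longrightarrow> nu1 m = 4 * al\<^sup>2"
  and nu_right: "1 \<le> m \<Longrightarrow> nu m = 4 * be\<^sup>2 * m" "1 \<le> m \<Longrightarrow> nu1 m = 4 * be\<^sup>2"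
  by (simp_all add: nu_def nu1_def st_left st_right algebra_simps)

lemma nu_mono: "m < m' \<Longrightarrow> nu m < nu m'"
  by (rule DERIV_pos_imp_increasing) (use nu_deriv nu1_ge(3) in blast)+

lemma nu_pos_iff: "0 < nu m \<longleftrightarrow> 0 < m"
  using nu_mono [of 0 m] nu_mono [of m 0] nu_left(1) [of 0] by (cases m "0::real" rule: linorder_cases) auto

lemma nu_surj: obtains m where "nu m = y"
proof -
  define M where "M = (\<bar>y\<bar> + 1) / (4 * al\<^sup>2)"
  have a: "0 < 4 * al\<^sup>2" using al by simp
  have M: "0 < M" using a by (simp add: M_def)
  have aM: "4 * al\<^sup>2 * M = \<bar>y\<bar> + 1" using a by (simp add: M_def)
  have "0 \<le> 4 * (be\<^sup>2 - al\<^sup>2) * M * st M" using D M st_bounds(1) by simp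
  then have "y \<le> nu M" using aM by (simp add: nu_def)
  moreover have "nu (- M) \<le> y" using M aM by (simp add: nu_left)
  moreover have "continuous_on {- M..M} nu"
    by (rule DERIV_continuous_on [OF has_field_derivative_at_within [OF nu_deriv]])
  ultimately show thesis using IVT' [of nu "- M" y M] M that by force
qed

text \<open>\<open>gn\<close> is the area-preserving map, homogeneous of degree 1, that acts on the
  slope \<open>m = X / Y\<close> by \<open>nu\<close>. In the coordinates \<open>m\<close> and
  \<open>Y^2 / 2\<close> area is the standard one, so stretching \<open>m\<close> by
  \<open>nu1\<close> forces \<open>Y^2\<close> to be divided by \<open>nu1\<close>.\<close>

definition GY :: "r2 \<Rightarrow> real" where "GY v = snd v / sqrt (nu1 (fst v / snd v))"
definition GX :: "r2 \<Rightarrow> real" where "GX v = nu (fst v / snd v) * GY v"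
definition gn :: "r2 \<Rightarrow> r2" where "gn v = (GX v, GY v)"

definition H :: "r2 set" where "H = {v. 0 < snd v}"

lemma open_H: "open H" unfolding H_def by (intro open_Collect_less continuous_intros)

lemma smooth_gn: "smooth_on H gn"
proof -
  have s: "snd v \<noteq> 0" if "v \<in> H" for v using that by (simp add: H_def)
  have n: "smooth_on H (\<lambda>v. nu (fst v / snd v))" "smooth_on H (\<lambda>v. nu1 (fst v / snd v))"
    unfolding nu_def nu1_def by (intro smooth_intros open_H s; assumption)+
  have p: "0 < nu1 (fst v / snd v)" "sqrt (nu1 (fst v / snd v)) \<noteq> 0" for v
    using nu1_ge(3) by (simp_all add: less_imp_neq [symmetric])
  show ?thesis unfolding gn_def GX_def GY_def
    by (intro smooth_intros open_H n p)
qed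

lemma area_gn: "area_on H gn"
proof -
  have "smooth_on UNIV nu1" unfolding nu1_def [abs_def] by (intro smooth_intros open_UNIV)
  from smooth_on_has_derivative [OF open_UNIV this UNIV_I]
  have "\<forall>m. \<exists>k. (nu1 has_real_derivative k) (at m)"
    using differentiableI real_differentiable_def by metis
  from choice [OF this] obtain k0 where k0: "\<And>m. (nu1 has_real_derivative k0 m) (at m)" by blast
  show ?thesis
  unfolding gn_def
proof (rule area_onI)
  fix v assume "v \<in> H"
  then have Y: "0 < snd v" by (simp add: H_def)
  define m where "m = fst v / snd v"
  define s where "s = sqrt (nu1 m)"
  have s: "0 < s" "s * s = nu1 m" using nu1_ge(3) [of m] by (simp_all add: s_def)
  define k where "k = k0 m"
  have k: "(nu1 has_real_derivative k) (at m)" unfolding k_def by (rule k0)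
  have m: "((\<lambda>v. fst v / snd v) has_derivative (\<lambda>u. (fst u - m * snd u) / snd v)) (at v)"
    using Y by (auto intro!: derivative_eq_intros simp: fun_eq_iff m_def field_simps)
  have sD: "((\<lambda>v. sqrt (nu1 (fst v / snd v))) has_derivative (\<lambda>u. k / (2 * s) * ((fst u - m * snd u) / snd v))) (at v)"
  proof -
    have "((\<lambda>v. nu1 (fst v / snd v)) has_derivative (\<lambda>u. (fst u - m * snd u) / snd v * k)) (at v)"
      by (rule DERIV_compose_FDERIV [OF _ m]) (use k in \<open>simp add: m_def\<close>)
    from has_derivative_real_sqrt [OF nu1_ge(3) this]
    show ?thesis by (rule has_derivative_eq_rhs) (simp add: fun_eq_iff inverse_eq_divide s_def m_def mult_ac)
  qed
  define p q where "p = - k / (2 * s ^ 3)" and "q = 1 / s + k * m / (2 * s ^ 3)"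
  have s0: "sqrt (nu1 (fst v / snd v)) \<noteq> 0" using s by (simp add: s_def m_def)
  have GYD: "(GY has_derivative (\<lambda>u. p * fst u + q * snd u)) (at v)"
  proof -
    have "(a2 * s - y * (k / (2 * s) * ((a1 - m * a2) / y))) / (s * s) = p * a1 + q * a2" if "y \<noteq> 0" for a1 a2 y
      using s(1) that by (simp add: p_def q_def field_simps power3_eq_cube)
    note alg = this [of "snd v", OF less_imp_neq [OF Y, symmetric]]
    show ?thesis unfolding GY_def [abs_def]
      by (rule has_derivative_eq_rhs [OF has_derivative_divide' [OF has_derivative_snd [OF has_derivative_ident] sD s0]])
        (simp only: m_def [symmetric] s_def [symmetric] alg)
  qed
  have GYv: "GY v = snd v / s" by (simp add: GY_def s_def m_def)
  show "(GX has_derivative (\<lambda>u. (s + nu m * p) * fst u + (- m * s + nu m * q) * snd u)) (at v)"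
  proof -
    have nD: "((\<lambda>v. nu (fst v / snd v)) has_derivative (\<lambda>u. (fst u - m * snd u) / snd v * (s * s))) (at v)"
      by (rule DERIV_compose_FDERIV [OF _ m]) (use nu_deriv s in \<open>simp add: m_def\<close>)
    have "nu m * (p * a1 + q * a2) + (a1 - m * a2) / y * (s * s) * (y / s) =
        (s + nu m * p) * a1 + (- m * s + nu m * q) * a2" if "y \<noteq> 0" for a1 a2 y
      using that s(1) by (simp add: field_simps)
    note alg = this [of "snd v", OF less_imp_neq [OF Y, symmetric]]
    show ?thesis unfolding GX_def [abs_def]
      by (rule has_derivative_eq_rhs [OF has_derivative_mult [OF nD GYD]])
        (simp only: m_def [symmetric] GYv alg)
  qed
  show "(GY has_derivative (\<lambda>u. p * fst u + q * snd u)) (at v)" by (rule GYD)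
  show "(s + nu m * p) * q - (- m * s + nu m * q) * p = 1"
  proof -
    have "(s + nu m * p) * q - (- m * s + nu m * q) * p = s * (q + m * p)" by (simp add: algebra_simps)
    also have "\<dots> = 1" using s(1) by (simp add: p_def q_def distrib_left)
    finally show ?thesis .
  qed
qed
qed

lemma GY_pos: "v \<in> H \<Longrightarrow> 0 < GY v" using nu1_ge(3) by (simp add: GY_def H_def)

lemma gn_bij: "bij_betw gn H H"
  unfolding bij_betw_def
proof
  show "inj_on gn H"
  proof (rule inj_onI)
    fix v w assume vw: "v \<in> H" "w \<in> H" "gn v = gn w"
    have "nu (fst v / snd v) = nu (fst w / snd w)"
    proof -
      have x: "GX v = GX w" and 2: "GY v = GY w" using vw(3) by (simp_all add: gn_def)
      note 1 = x [unfolded GX_def]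
      have "GY w \<noteq> 0" using GY_pos [OF vw(2)] by simp
      with mult_right_cancel [OF this] 1 [unfolded 2] show ?thesis by blast
    qed
    then have m: "fst v / snd v = fst w / snd w"
      using nu_mono by (metis linorder_cases order_less_irrefl)
    have "sqrt (nu1 (fst w / snd w)) \<noteq> 0" using nu1_ge(3) by (simp add: less_imp_neq [symmetric])
    then have "snd v = snd w" using vw(3) by (simp add: gn_def GY_def m)
    then show "v = w" using m vw(2) by (simp add: H_def prod_eq_iff)
  qed
  show "gn ` H = H"
  proof (intro subset_antisym subsetI)
    fix y assume "y \<in> gn ` H" then show "y \<in> H" using GY_pos by (auto simp: gn_def H_def)
  next
    fix y assume y: "y \<in> H"
    obtain m where m: "nu m = fst y / snd y" using nu_surj by metis
    define P where "P = snd y * sqrt (nu1 m)"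
    define v where "v = (m * P, P)"
    have s: "0 < sqrt (nu1 m)" using nu1_ge(3) [of m] by simp
    then have p: "0 < P" using y by (simp add: H_def P_def)
    then have mv: "fst v / snd v = m" by (simp add: v_def)
    have "GY v = snd y" unfolding GY_def mv using s by (simp add: v_def P_def)
    then have "gn v = y" using m y mv by (simp add: gn_def GX_def H_def prod_eq_iff)
    moreover have "v \<in> H" using p by (simp add: H_def v_def)
    ultimately show "y \<in> gn ` H" by blast
  qed
qed

lemma gn_left: assumes "v \<in> H" "fst v \<le> 0" shows "GY v = snd v / (2 * al)" "GX v = 2 * al * fst v"
proof -
  have m: "fst v / snd v \<le> 0" using assms by (simp add: H_def divide_nonpos_pos)
  have "sqrt (4 * al\<^sup>2) = 2 * al" using al by (simp add: real_sqrt_mult)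
  then show 1: "GY v = snd v / (2 * al)" by (simp add: GY_def nu_left [OF m])
  show "GX v = 2 * al * fst v"
    unfolding GX_def 1 nu_left(1) [OF m] using assms al by (simp add: H_def field_simps power2_eq_square)
qed

lemma gn_right: assumes "v \<in> H" "snd v \<le> fst v" shows "GY v = snd v / (2 * be)" "GX v = 2 * be * fst v"
proof -
  have m: "1 \<le> fst v / snd v" using assms by (simp add: H_def)
  have "sqrt (4 * be\<^sup>2) = 2 * be" using be by (simp add: real_sqrt_mult)
  then show 1: "GY v = snd v / (2 * be)" by (simp add: GY_def nu_right [OF m])
  show "GX v = 2 * be * fst v"
    unfolding GX_def 1 nu_right(1) [OF m] using assms be by (simp add: H_def field_simps power2_eq_square)
qed

lemma GX_pos_iff: assumes "v \<in> H" shows "0 < GX v \<longleftrightarrow> 0 < fst v"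
proof -
  have "0 < GX v \<longleftrightarrow> 0 < nu (fst v / snd v)"
    unfolding GX_def using GY_pos [OF assms] by (simp add: zero_less_mult_iff)
  also have "\<dots> \<longleftrightarrow> 0 < fst v / snd v" by (rule nu_pos_iff)
  finally show ?thesis using assms by (simp add: H_def zero_less_divide_iff)
qed

lemma gn_bounds: assumes "v \<in> H"
  shows "GY v \<le> snd v / (2 * al)" "GX v \<le> 2 * be * \<bar>fst v\<bar>" "- (2 * al * \<bar>fst v\<bar>) \<le> GX v"
proof -
  define m where "m = fst v / snd v"
  have Y: "0 < snd v" using assms by (simp add: H_def)
  have s: "sqrt (4 * al\<^sup>2) = 2 * al" using al by (simp add: real_sqrt_mult)
  have "2 * al \<le> sqrt (nu1 m)" using nu1_ge(2) [of m] s by (metis real_sqrt_le_iff)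
  then show "GY v \<le> snd v / (2 * al)" unfolding GY_def m_def using Y al by (simp add: frac_le m_def)
  show "GX v \<le> 2 * be * \<bar>fst v\<bar>"
  proof (cases "fst v \<le> 0")
    case True
    then have "GX v \<le> 0" using gn_left(2) [OF assms True] al by (simp add: mult_nonneg_nonpos)
    moreover have "0 \<le> 2 * be * \<bar>fst v\<bar>" using be by simp
    ultimately show ?thesis by linarith
  next
    case False
    then have m: "0 < m" using Y by (simp add: m_def)
    \<comment> \<open>\<open>nu m = m * S\<close> and \<open>S \<le> nu1 m\<close>, since the term
      with \<open>st'\<close> is nonnegative. So \<open>GX v\<close> is at most
      \<open>fst v * sqrt S\<close>, and \<open>S\<close> is at most
      \<open>(2 * be)^2\<close>.\<close>
    define S where "S = 4 * al\<^sup>2 + 4 * (be\<^sup>2 - al\<^sup>2) * st m"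
    have "4 * (be\<^sup>2 - al\<^sup>2) * st m \<le> 4 * (be\<^sup>2 - al\<^sup>2) * 1"
      using D st_bounds by (intro mult_left_mono) auto
    then have S: "0 < S" "S \<le> (2 * be)\<^sup>2" using al D st_bounds(1) [of m]
      by (auto simp: S_def power_mult_distrib intro: add_pos_nonneg)
    have nuS: "nu m = m * S" by (simp add: nu_def S_def algebra_simps)
    have "GX v = (m * S) * GY v" unfolding GX_def m_def [symmetric] nuS ..
    moreover have "sqrt S \<le> sqrt (nu1 m)" using nu1_ge(1) [of m] by (simp add: S_def)
    then have "GY v \<le> snd v / sqrt S" unfolding GY_def m_def [symmetric] using Y S by (intro frac_le) auto
    then have "(m * S) * GY v \<le> (m * S) * (snd v / sqrt S)" using m S by (intro mult_left_mono) auto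
    moreover have "(m * S) * (snd v / sqrt S) = fst v * sqrt S"
      using S(1) Y by (simp add: m_def field_simps) 
    moreover have "sqrt S \<le> 2 * be" using S(2) be by (intro real_le_lsqrt) auto
    then have "fst v * sqrt S \<le> fst v * (2 * be)" using False by (intro mult_left_mono) auto
    ultimately have "GX v \<le> fst v * (2 * be)" by linarith
    then show ?thesis using False by (simp add: mult_ac)
  qed
  show "- (2 * al * \<bar>fst v\<bar>) \<le> GX v"
  proof (cases "fst v \<le> 0")
    case False
    then have "0 < GX v" using GX_pos_iff [OF assms] by simp
    moreover have "0 \<le> 2 * al * \<bar>fst v\<bar>" using al by simp
    ultimately show ?thesis by linarith
  qed (simp add: gn_left [OF assms])
qed

end

section \<open>The folded domain and the two ways of cutting it open\<close>

context fold
begin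

text \<open>The point \<open>(- hh, 0)\<close> is the common image under \<open>dbl\<close> of the
  ends \<open>(1/2, 0)\<close> and \<open>(- 1/2, 0)\<close> of the side being folded.\<close>

definition hh :: real where "hh = 1 / (2 * sqrt 2)"

text \<open>The preimage under \<open>gn\<close> of a rectangle over the interval from
  \<open>- al\<close> to \<open>be\<close>. In it both parts of the lower side have length
  \<open>1/2\<close>, so \<open>dbl\<close> glues them exactly.\<close>

definition HG :: "r2 \<Rightarrow> real \<Rightarrow> bool" where
  "HG v e \<longleftrightarrow> v \<in> H \<and> GY v < c e \<and> - al < GX v \<and> GX v < be"

text \<open>Without the half-axis \<open>fst w \<le> 0\<close> this is the folded rectangle \<open>bx 0 c\<close>, without \<open>0 \<le> fst w\<close> it is \<open>bx be c\<close>.\<close>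

definition MG :: "r2 \<Rightarrow> real \<Rightarrow> bool" where
  "MG w e \<longleftrightarrow> (\<exists>v. HG v e \<and> w = dbl v) \<or> (snd w = 0 \<and> - hh < fst w \<and> fst w \<le> 0)"

definition MGu :: "r2 \<Rightarrow> real \<Rightarrow> bool" where
  "MGu w e \<longleftrightarrow> MG w e \<and> \<not> (snd w = 0 \<and> fst w \<le> 0)"

definition MGl :: "r2 \<Rightarrow> real \<Rightarrow> bool" where
  "MGl w e \<longleftrightarrow> MG w e \<and> \<not> (snd w = 0 \<and> 0 \<le> fst w)"

lemma gn_surj: assumes "y \<in> H" obtains v where "v \<in> H" "gn v = y"
proof -
  have "y \<in> gn ` H" using assms bij_betw_imp_surj_on [OF gn_bij] by simp
  then show thesis using that by blast
qed

lemma open_slabs_bx: "open (slabs (bx a c))" by (rule open_bx [OF c_cont])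

lemma H_nz: "v \<in> H \<Longrightarrow> v \<noteq> 0" by (auto simp: H_def)

lemma dbl_H: assumes "v \<in> H"
  shows "\<not> (snd (dbl v) = 0 \<and> fst (dbl v) \<le> 0)" "snd (dbl v) = 0 \<longleftrightarrow> fst v = 0"
    "fst v = 0 \<Longrightarrow> snd v = sqrt 2 * fst (dbl v)"
proof -
  note e = dbl_eqs [OF H_nz [OF assms]]
  have Y: "0 < snd v" using assms by (simp add: H_def)
  show s: "snd (dbl v) = 0 \<longleftrightarrow> fst v = 0" using e(3,4) Y by auto
  have "fst v = 0 \<Longrightarrow> dbl v = (snd v / sqrt 2, 0)"
    using Y by (simp add: dbl_def nz_def power2_eq_square)
  then show "fst v = 0 \<Longrightarrow> snd v = sqrt 2 * fst (dbl v)"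
    "\<not> (snd (dbl v) = 0 \<and> fst (dbl v) \<le> 0)"
    using s Y by (auto simp: not_le)
qed

lemma open_HG: "open (slabs HG)"
proof -
  have "continuous_on H gn" by (rule smooth_on_continuous_on [OF open_H smooth_gn])
  then have "continuous_on H (\<lambda>v. (fst (gn v) + al, snd (gn v)))" by (intro continuous_intros)
  then have "continuous_on H (\<lambda>v. (GX v + al, GY v))" by (simp add: gn_def)
  from open_slabs_vimage [OF open_H this open_slabs_bx [of 0]]
  show ?thesis
    by (rule back_subst [where P = "open"])
      (use sum GY_pos in \<open>auto simp: slabs_def HG_def bx_def\<close>)
qed

lemma symp_HG_bx: "symp (slabs HG) (slabs (bx 0 c))"
proof (rule symp_slabs_map [where W = H and \<phi> = "\<lambda>v. (\<lambda>w. (fst w + al, snd w)) (gn v)", OF open_H _ _ _ open_HG])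
  show "smooth_on H (\<lambda>v. (fst (gn v) + al, snd (gn v)))"
    by (intro smooth_intros open_H smooth_gn)
  show "inj_on (\<lambda>v. (fst (gn v) + al, snd (gn v))) H"
  proof (rule inj_onI)
    fix v w assume vw: "v \<in> H" "w \<in> H" "(fst (gn v) + al, snd (gn v)) = (fst (gn w) + al, snd (gn w))"
    then have "gn v = gn w" by (simp add: prod_eq_iff)
    then show "v = w" by (rule inj_onD [OF bij_betw_imp_inj_on [OF gn_bij] _ vw(1,2)])
  qed
  have "area_on UNIV (\<lambda>w. (fst w + al, snd w))"
    by (rule area_onI [where a = "\<lambda>_. 1" and b = "\<lambda>_. 0" and c = "\<lambda>_. 0" and d = "\<lambda>_. 1"])
      (auto intro!: derivative_eq_intros)
  from area_on_compose [OF this area_gn]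
  show "area_on H (\<lambda>v. (fst (gn v) + al, snd (gn v)))" by simp
  show "HG v e \<Longrightarrow> v \<in> H" for v e by (simp add: HG_def)
  fix w e assume e: "0 < e" "e < (1::real)"
  show "bx 0 c w e \<longleftrightarrow> (\<exists>v. HG v e \<and> w = (fst (gn v) + al, snd (gn v)))"
  proof
    assume w: "bx 0 c w e"
    then have "(fst w - al, snd w) \<in> H" by (simp add: bx_def H_def)
    then obtain v where v: "v \<in> H" "gn v = (fst w - al, snd w)" by (metis gn_surj)
    then have "HG v e" using w sum by (auto simp: HG_def bx_def gn_def)
    then show "\<exists>v. HG v e \<and> w = (fst (gn v) + al, snd (gn v))" using v by (auto simp: prod_eq_iff)
  qed (use sum GY_pos in \<open>auto simp: bx_def HG_def gn_def\<close>)
qed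

lemma symp_HG_MGu: "symp (slabs HG) (slabs MGu)"
proof (rule symp_slabs_map [where W = H and \<phi> = dbl, OF open_H _ _ _ open_HG])
  have sub: "H \<subseteq> - {0}"
  proof
    fix v assume "v \<in> H" then show "v \<in> - {0}" using H_nz by simp
  qed
  show "smooth_on H dbl" by (rule smooth_on_subset [OF smooth_on_dbl sub])
  show "area_on H dbl" by (rule area_on_subset [OF area_on_dbl sub])
  show "inj_on dbl H"
  proof (rule inj_onI)
    fix v w assume vw: "v \<in> H" "w \<in> H" "dbl v = dbl w"
    then have "v = w \<or> v = - w" using dbl_eq_iff H_nz by blast
    then show "v = w" using vw by (auto simp: H_def)
  qed
  show "HG v e \<Longrightarrow> v \<in> H" for v e by (simp add: HG_def)
  show "MGu w e \<longleftrightarrow> (\<exists>v. HG v e \<and> w = dbl v)" for w e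
    using dbl_H(1) by (auto simp: MGu_def MG_def HG_def)
qed

text \<open>Cutting the folded domain along the positive axis leaves the part of \<open>HG\<close>
  left of the vertical axis and, turned upside down and glued below it, the part on the right. In
  rescaled coordinates this is \<open>K1\<close>. Above the axis it is already rectangular;
  \<open>Ga\<close> straightens it below, where \<open>gn\<close> need not be linear.\<close>

definition Ga :: "r2 \<Rightarrow> r2" where
  "Ga v = (if 0 \<le> snd v then v
     else (let u = ((1 - fst v) / 2, - 2 * snd v) in (1 - GX u / be, - be * GY u)))"

definition W1 :: "r2 set" where "W1 = {v. fst v < 1}"

definition K1 :: "r2 \<Rightarrow> real \<Rightarrow> bool" where "K1 v e \<longleftrightarrow> v \<in> W1 \<and> bx be c (Ga v) e"

definition lo :: "r2 \<Rightarrow> r2" where "lo v = ((1 - fst v) / 2, - 2 * snd v)"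

lemma open_W1: "open W1" unfolding W1_def by (intro open_Collect_less continuous_intros)

lemma Ga_neg: "snd v < 0 \<Longrightarrow> Ga v = (1 - GX (lo v) / be, - be * GY (lo v))"
  by (simp add: Ga_def lo_def Let_def)

lemma lo_H: "snd v < 0 \<Longrightarrow> lo v \<in> H" by (simp add: lo_def H_def)

text \<open>In this wedge below the axis the slope in \<open>lo v\<close> is at least 1. There
  \<open>gn\<close> is linear and the outer rescaling by \<open>be\<close> undoes it, so the two
  branches of \<open>Ga\<close> overlap on an open set.\<close>

lemma Ga_id: assumes "- (1 - fst v) / 4 \<le> snd v" shows "Ga v = v"
proof (cases "0 \<le> snd v")
  case False
  then have v: "lo v \<in> H" "snd (lo v) \<le> fst (lo v)" using assms by (auto simp: lo_H) (simp add: lo_def)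
  show ?thesis using False be by (simp add: Ga_neg gn_right [OF v] prod_eq_iff) (simp add: lo_def field_simps)
qed (simp add: Ga_def)

lemma Ga_smooth_area: "smooth_on W1 Ga" "area_on W1 Ga"
proof -
  define U1 U2 where "U1 = {v::r2. fst v < 1} \<inter> {v. snd v < 0}"
    and "U2 = {v::r2. fst v < 1} \<inter> {v. - (1 - fst v) / 4 < snd v}"
  have o: "open U1" "open U2" unfolding U1_def U2_def
    by (intro open_Int open_Collect_less continuous_intros; simp)+
  have W: "W1 = U1 \<union> U2" by (auto simp: W1_def U1_def U2_def)
  have 2: "v = Ga v" if "v \<in> U2" for v using Ga_id [of v] that by (simp add: U2_def)
  have 1: "(\<lambda>w. (1 - fst w / be, - be * snd w)) (gn (lo v)) = Ga v" if "v \<in> U1" for v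
    using that by (simp add: U1_def Ga_neg gn_def)
  have loU: "lo v \<in> H" if "v \<in> U1" for v using that by (simp add: U1_def lo_H)
  have sl: "smooth_on U1 lo" unfolding lo_def by (intro smooth_intros o) simp
  have "smooth_on U1 (\<lambda>v. gn (lo v))" by (rule smooth_on_compose [OF o(1) open_H smooth_gn sl loU])
  then have "smooth_on U1 (\<lambda>v. (\<lambda>w. (1 - fst w / be, - be * snd w)) (gn (lo v)))"
    using be by (intro smooth_intros o) auto
  then have s1: "smooth_on U1 Ga" by (rule smooth_on_cong [OF o(1)]) (rule 1)
  have s2: "smooth_on U2 Ga" by (rule smooth_on_cong [OF o(2) smooth_on_id [OF o(2)]]) (rule 2)
  show "smooth_on W1 Ga" unfolding W by (rule smooth_on_Un [OF o s1 s2])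
  have "area_on U1 lo" unfolding lo_def
    by (rule area_onI [where a = "\<lambda>_. -1/2" and b = "\<lambda>_. 0" and c = "\<lambda>_. 0" and d = "\<lambda>_. -2"])
      (auto intro!: derivative_eq_intros)
  from area_on_compose [OF area_gn this loU]
  have "area_on U1 (\<lambda>v. gn (lo v))" by simp
  moreover have "area_on UNIV (\<lambda>w. (1 - fst w / be, - be * snd w))"
    by (rule area_onI [where a = "\<lambda>_. -1/be" and b = "\<lambda>_. 0" and c = "\<lambda>_. 0" and d = "\<lambda>_. -be"])
      (use be in \<open>auto intro!: derivative_eq_intros\<close>)
  ultimately have "area_on U1 (\<lambda>v. (\<lambda>w. (1 - fst w / be, - be * snd w)) (gn (lo v)))"
    using area_on_compose [of UNIV "\<lambda>w. (1 - fst w / be, - be * snd w)" U1 "\<lambda>v. gn (lo v)"] by simp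
  then have a1: "area_on U1 Ga" by (rule area_on_cong [OF o(1)]) (rule 1)
  have "area_on U2 (\<lambda>v. v)" unfolding area_on_def by (auto intro!: exI [of _ "\<lambda>v. v"])
  then have a2: "area_on U2 Ga" by (rule area_on_cong [OF o(2)]) (rule 2)
  show "area_on W1 Ga" unfolding W by (rule area_on_Un [OF a1 a2])
qed

lemma Ga_sgn: assumes "v \<in> W1" shows "snd (Ga v) < 0 \<longleftrightarrow> snd v < 0" "fst (Ga v) < 1"
proof -
  have "0 < GX (lo v)" if "snd v < 0"
    using GX_pos_iff [OF lo_H [OF that]] assms by (simp add: lo_def W1_def)
  then show "snd (Ga v) < 0 \<longleftrightarrow> snd v < 0" "fst (Ga v) < 1"
    using assms be GY_pos [OF lo_H [of v]]
    by (cases "snd v < 0"; simp add: Ga_neg W1_def; simp add: Ga_def)+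
qed

lemma Ga_bij: "bij_betw Ga W1 W1"
  unfolding bij_betw_def
proof
  show "inj_on Ga W1"
  proof (rule inj_onI)
    fix v w assume vw: "v \<in> W1" "w \<in> W1" "Ga v = Ga w"
    have s: "snd v < 0 \<longleftrightarrow> snd w < 0" using Ga_sgn(1) [OF vw(1)] Ga_sgn(1) [OF vw(2)] vw(3) by simp
    show "v = w"
    proof (cases "snd v < 0")
      case True
      then have "gn (lo v) = gn (lo w)" using vw(3) s be by (simp add: Ga_neg gn_def)
      then have "lo v = lo w"
        by (rule inj_onD [OF bij_betw_imp_inj_on [OF gn_bij]]) (use True s lo_H in simp_all)
      then show ?thesis by (simp add: lo_def prod_eq_iff)
    next
      case False
      then show ?thesis using s vw(3) by (simp add: Ga_def not_less)
    qed
  qed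
  show "Ga ` W1 = W1"
  proof (intro subset_antisym subsetI)
    fix y assume "y \<in> Ga ` W1" then show "y \<in> W1" using Ga_sgn(2) by (auto simp: W1_def)
  next
    fix y assume y: "y \<in> W1"
    show "y \<in> Ga ` W1"
    proof (cases "snd y < 0")
      case True
      then have "(be * (1 - fst y), - snd y / be) \<in> H" using be by (simp add: H_def divide_neg_pos)
      then obtain u where u: "u \<in> H" "gn u = (be * (1 - fst y), - snd y / be)"
        by (metis gn_surj)
      define v where "v = (1 - 2 * fst u, - snd u / 2)"
      have lv: "lo v = u" by (simp add: lo_def v_def)
      have "0 < fst u" using GX_pos_iff [OF u(1)] u(2) y be by (simp add: gn_def W1_def)
      then have "v \<in> W1" "snd v < 0" using u(1) by (auto simp: v_def W1_def H_def)
      moreover from this have "Ga v = y" using u(2) be by (simp add: Ga_neg lv gn_def prod_eq_iff)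
      ultimately show ?thesis by blast
    next
      case False
      then have "Ga y = y" by (simp add: Ga_def)
      then show ?thesis using y by (metis imageI)
    qed
  qed
qed

lemma open_K1: "open (slabs K1)"
  unfolding K1_def [abs_def]
  by (rule open_slabs_vimage [OF open_W1 smooth_on_continuous_on [OF open_W1 Ga_smooth_area(1)] open_slabs_bx])

lemma symp_K1_bx: "symp (slabs K1) (slabs (bx be c))"
proof (rule symp_slabs_map [OF open_W1 Ga_smooth_area(1) _ Ga_smooth_area(2) open_K1])
  show "inj_on Ga W1" using Ga_bij by (simp add: bij_betw_def)
  show "K1 w e \<Longrightarrow> w \<in> W1" for w e by (simp add: K1_def)
  show "bx be c w e \<longleftrightarrow> (\<exists>v. K1 v e \<and> w = Ga v)" for w e
  proof
    assume w: "bx be c w e"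
    then have "w \<in> W1" by (simp add: bx_def W1_def)
    then obtain v where "v \<in> W1" "w = Ga v" using bij_betw_imp_surj_on [OF Ga_bij] by blast
    then show "\<exists>v. K1 v e \<and> w = Ga v" using w by (auto simp: K1_def)
  qed (auto simp: K1_def)
qed

definition up :: "r2 \<Rightarrow> r2" where "up v = ((fst v - 1) / 2, 2 * snd v)"

lemma up_lo: "dbl (up v) = dbl (lo v)"
proof -
  have "lo v = - up v" by (simp add: up_def lo_def prod_eq_iff field_simps)
  then show ?thesis by (simp add: dbl_def nz_def)
qed

text \<open>On the left \<open>gn\<close> divides heights by \<open>2 * al\<close>, so the upper
  part of \<open>K1\<close> has height \<open>al * c e = (1 - be) * c e\<close>.\<close>

lemma HG_up: assumes "v \<in> W1" "0 < snd v" "0 < e" "e < 1"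
  shows "HG (up v) e \<longleftrightarrow> K1 v e"
proof -
  have u: "up v \<in> H" "fst (up v) \<le> 0" using assms by (auto simp: up_def H_def W1_def)
  have g: "GY (up v) = snd v / al" "GX (up v) = al * (fst v - 1)"
    using al by (simp_all add: gn_left [OF u]) (simp_all add: up_def)
  have "al * (fst v - 1) < 0" using assms al by (simp add: W1_def mult_pos_neg)
  moreover have "- al < al * (fst v - 1) \<longleftrightarrow> 0 < fst v" 
  proof -
    have "- al < al * (fst v - 1) \<longleftrightarrow> 0 < al * fst v" by (simp add: right_diff_distrib)
    then show ?thesis using al by (simp add: zero_less_mult_iff)
  qed
  moreover have "- be * c e < snd v" using assms be c_pos [of e] by (smt (verit) mult_pos_pos mult_minus_left)
  moreover have "snd v / al < c e \<longleftrightarrow> snd v < (1 - be) * c e" 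
  proof -
    have "1 - be = al" using sum by simp
    then show ?thesis using al by (simp only: pos_divide_less_eq mult.commute)
  qed
  ultimately show ?thesis
    using assms u(1) be by (auto simp: HG_def K1_def bx_def g Ga_def W1_def)
qed

lemma HG_lo: assumes "v \<in> W1" "snd v < 0" "0 < e" "e < 1"
  shows "HG (lo v) e \<longleftrightarrow> K1 v e"
proof -
  have u: "lo v \<in> H" by (rule lo_H [OF assms(2)])
  have p: "0 < GX (lo v)" "0 < GY (lo v)"
    using GX_pos_iff [OF u] GY_pos [OF u] assms(1) by (auto simp: lo_def W1_def)
  have "- be * GY (lo v) < (1 - be) * c e"
  proof -
    have "- be * GY (lo v) < 0" using p be by simp
    also have "0 < (1 - be) * c e" using al sum c_pos assms by simp
    finally show ?thesis .
  qed
  then show ?thesis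
    using assms u p be al by (auto simp: HG_def K1_def bx_def Ga_neg field_simps)
qed

text \<open>\<open>up\<close> maps \<open>W1\<close> to the open left half-plane, on which
  \<open>dbl\<close> is injective with image the complement of the nonnegative axis. Points below
  the axis correspond to the right part of \<open>HG\<close> because \<open>lo v = - up v\<close>
  has the same image under \<open>dbl\<close>.\<close>

lemma symp_K1_MGl: "symp (slabs K1) (slabs MGl)"
proof (rule symp_slabs_map [where W = W1 and \<phi> = "\<lambda>v. dbl (up v)", OF open_W1 _ _ _ open_K1])
  have upnz: "up v \<in> - {0}" if "v \<in> W1" for v using that by (auto simp: up_def W1_def zero_prod_def)
  have su: "smooth_on W1 up" unfolding up_def by (intro smooth_intros open_W1) simp
  show "smooth_on W1 (\<lambda>v. dbl (up v))"
    by (rule smooth_on_compose [OF open_W1 _ smooth_on_dbl su upnz]) auto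
  have "area_on W1 up" unfolding up_def
    by (rule area_onI [where a = "\<lambda>_. 1/2" and b = "\<lambda>_. 0" and c = "\<lambda>_. 0" and d = "\<lambda>_. 2"])
      (auto intro!: derivative_eq_intros)
  from area_on_compose [OF area_on_dbl this upnz] show "area_on W1 (\<lambda>v. dbl (up v))" by simp
  show "inj_on (\<lambda>v. dbl (up v)) W1"
  proof (rule inj_onI)
    fix v w assume vw: "v \<in> W1" "w \<in> W1" "dbl (up v) = dbl (up w)"
    then have "up v = up w \<or> up v = - up w" using dbl_eq_iff upnz by auto
    moreover have "up v \<noteq> - up w"
    proof
      assume "up v = - up w"
      then have "fst v - 1 = - (fst w - 1)" by (simp add: up_def prod_eq_iff field_simps)
      then show False using vw by (simp add: W1_def)
    qed
    ultimately show "v = w" by (auto simp: up_def prod_eq_iff)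
  qed
  show "K1 v e \<Longrightarrow> v \<in> W1" for v e by (simp add: K1_def)
  fix w e assume e: "0 < e" "e < (1::real)"
  have axis: "dbl (up v) = (- (1 - fst v) / (2 * sqrt 2), 0)" if "v \<in> W1" "snd v = 0" for v
  proof -
    have a: "0 < 1 - fst v" using that by (simp add: W1_def)
    have "nz (up v) = ((1 - fst v) / 2)\<^sup>2"
      using that(2) by (simp add: nz_def up_def power2_eq_square field_simps)
    then have s: "sqrt (nz (up v)) = (1 - fst v) / 2" using a by simp
    show ?thesis using a that(2) unfolding dbl_def s
      by (simp add: up_def power2_eq_square field_simps)
  qed
  show "MGl w e \<longleftrightarrow> (\<exists>v. K1 v e \<and> w = dbl (up v))"
  proof
    assume w: "MGl w e"
    then consider u where "HG u e" "w = dbl u" "fst u < 0" | u where "HG u e" "w = dbl u" "0 < fst u" |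
      "snd w = 0" "- hh < fst w" "fst w < 0"
      unfolding MGl_def MG_def HG_def
      using dbl_H by (metis linorder_neqE_linordered_idom not_le order_le_less)
    then show "\<exists>v. K1 v e \<and> w = dbl (up v)"
    proof cases
      case 1
      define v where "v = (1 + 2 * fst u, snd u / 2)"
      have v: "up v = u" "v \<in> W1" "0 < snd v" using 1 by (auto simp: up_def v_def W1_def HG_def H_def)
      then show ?thesis using 1 HG_up [OF v(2,3) e] by auto
    next
      case 2
      define v where "v = (1 - 2 * fst u, - snd u / 2)"
      have v: "lo v = u" "v \<in> W1" "snd v < 0" using 2 by (auto simp: lo_def v_def W1_def HG_def H_def)
      then show ?thesis using 2 HG_lo [OF v(2,3) e] up_lo [of v] by auto
    next
      case 3
      define v where "v = (1 + 2 * sqrt 2 * fst w, 0::real)"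
      have "2 * sqrt 2 * - hh < 2 * sqrt 2 * fst w" using 3 by (intro mult_strict_left_mono) auto
      then have f: "0 < fst v" by (simp add: v_def hh_def)
      have "2 * sqrt 2 * fst w < 0" using 3 by (simp add: mult_pos_neg)
      then have v: "v \<in> W1" "snd v = 0" by (simp_all add: v_def W1_def)
      have "K1 v e" using f v c_pos [OF e] be al sum by (simp add: K1_def bx_def Ga_def W1_def)
      moreover have "w = dbl (up v)" unfolding axis [OF v] using 3(1) by (simp add: v_def prod_eq_iff)
      ultimately show ?thesis by blast
    qed
  next
    assume "\<exists>v. K1 v e \<and> w = dbl (up v)"
    then obtain v where v: "K1 v e" "w = dbl (up v)" by blast
    then have vW: "v \<in> W1" by (simp add: K1_def)
    consider "0 < snd v" | "snd v < 0" | "snd v = 0" by linarith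
    then show "MGl w e"
    proof cases
      case 1
      then have h: "HG (up v) e" using HG_up [OF vW 1 e] v by simp
      then have "snd w \<noteq> 0" using dbl_H(2) [of "up v"] v vW by (auto simp: HG_def up_def W1_def)
      then show ?thesis using h v by (auto simp: MGl_def MG_def)
    next
      case 2
      then have h: "HG (lo v) e" using HG_lo [OF vW 2 e] v by simp
      then have "snd w \<noteq> 0" using dbl_H(2) [of "lo v"] v vW up_lo [of v] by (auto simp: HG_def lo_def W1_def)
      then show ?thesis using h v up_lo [of v] by (auto simp: MGl_def MG_def)
    next
      case 3
      have "0 < fst v" using v 3 by (simp add: K1_def bx_def Ga_def)
      then have "1 / (2 * sqrt 2) * (1 - fst v) < 1 / (2 * sqrt 2) * 1" by (intro mult_strict_left_mono) auto
      moreover define y where "y = (1 - fst v) / (2 * sqrt 2)"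
      ultimately have "y < hh" by (simp add: hh_def)
      moreover have "0 < y" using vW by (simp add: W1_def y_def)
      moreover have "w = (- y, 0)" using axis [OF vW 3] v(2) by (simp add: y_def minus_divide_left)
      ultimately show ?thesis by (simp add: MGl_def MG_def)
    qed
  qed
qed

text \<open>By the half-angle formulas the two inequalities say \<open>snd v < 2 * al * c e\<close>
  and \<open>\<bar>fst v\<bar> < 1/2\<close> for the preimage \<open>v\<close>;
  \<open>gn_bounds\<close> then places \<open>v\<close> in \<open>HG\<close>. Tubes can thus be
  tested without computing \<open>gn\<close>.\<close>

lemma MG_member:
  assumes "0 < c e"
    "sqrt (nz w) * (sqrt (nz w) + fst w) < (2 * al * c e)\<^sup>2" "4 * (sqrt (nz w) * (sqrt (nz w) - fst w)) < 1"
  shows "MG w e"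
proof (cases "snd w = 0 \<and> fst w \<le> 0")
  case True
  then have "sqrt (nz w) = - fst w" by (simp add: nz_def)
  then have "(fst w)\<^sup>2 * 8 < 1" using assms(3) by (simp add: power2_eq_square)
  then have "(- fst w)\<^sup>2 < hh\<^sup>2" by (simp add: hh_def power_divide power_mult_distrib)
  then have "- fst w < hh" by (rule power2_less_imp_less) (simp add: hh_def)
  then show ?thesis using True by (simp add: MG_def)
next
  case False
  then obtain v where v: "0 < snd v" "dbl v = w" using dbl_upper by metis
  then have vH: "v \<in> H" by (simp add: H_def)
  note eq = dbl_eqs [OF H_nz [OF vH], unfolded v(2)]
  have "snd v < 2 * al * c e"
    by (rule power2_less_imp_less) (use eq(1) assms al in auto)
  then have "snd v / (2 * al) < c e" using al by (simp add: field_simps)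
  then have 1: "GY v < c e" using gn_bounds(1) [OF vH] by linarith
  have "\<bar>fst v\<bar>\<^sup>2 < (1/2)\<^sup>2" using eq(2) assms(3) by (simp add: power2_eq_square)
  then have f: "\<bar>fst v\<bar> < 1/2" by (rule power2_less_imp_less) simp
  have "2 * be * \<bar>fst v\<bar> < 2 * be * (1/2)" "2 * al * \<bar>fst v\<bar> < 2 * al * (1/2)"
    using f be al by (intro mult_strict_left_mono; simp)+
  then have "GX v < be" "- al < GX v" using gn_bounds(2,3) [OF vH] by linarith+
  with 1 vH v(2) show ?thesis by (auto simp: MG_def HG_def)
qed

lemma nz_fst: "(sqrt (nz w))\<^sup>2 = (fst w)\<^sup>2 + (snd w)\<^sup>2" "\<bar>fst w\<bar> \<le> sqrt (nz w)"
  by (simp_all add: nz_def)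

lemma MG_member_pos:
  assumes "0 < c e" "0 \<le> fst w" "2 * nz w < (2 * al * c e)\<^sup>2" "4 * (snd w)\<^sup>2 < 1"
  shows "MG w e"
proof (rule MG_member [OF assms(1)])
  define R where "R = sqrt (nz w)"
  have "fst w \<le> R" unfolding R_def using nz_fst(2) [of w] by linarith
  moreover have "R * R = nz w" "0 \<le> R" by (simp_all add: R_def nz_def)
  ultimately have R: "R * R = nz w" "fst w \<le> R" "0 \<le> R" by blast+
  have "R * (R + fst w) \<le> R * (R + R)" using R by (intro mult_left_mono) auto
  then show "sqrt (nz w) * (sqrt (nz w) + fst w) < (2 * al * c e)\<^sup>2"
    using R assms(3) unfolding R_def [symmetric] by (simp add: distrib_left)
  have "R * (R - fst w) \<le> (R + fst w) * (R - fst w)" using R assms(2) by (intro mult_right_mono) auto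
  also have "\<dots> = (snd w)\<^sup>2" using R(1) by (simp add: nz_def algebra_simps power2_eq_square)
  finally show "4 * (sqrt (nz w) * (sqrt (nz w) - fst w)) < 1" using assms(4) by (simp add: R_def)
qed

lemma MG_member_neg:
  assumes "0 < c e" "fst w \<le> 0" "(snd w)\<^sup>2 < (2 * al * c e)\<^sup>2" "8 * nz w < 1"
  shows "MG w e"
proof (rule MG_member [OF assms(1)])
  define R where "R = sqrt (nz w)"
  have "- fst w \<le> R" unfolding R_def using nz_fst(2) [of w] by linarith
  moreover have "R * R = nz w" "0 \<le> R" by (simp_all add: R_def nz_def)
  ultimately have R: "R * R = nz w" "- fst w \<le> R" "0 \<le> R" by blast+
  have "R * (R - fst w) \<le> R * (R + R)" using R by (intro mult_left_mono) auto
  then show "4 * (sqrt (nz w) * (sqrt (nz w) - fst w)) < 1"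
    using R assms(4) unfolding R_def [symmetric] by (simp add: distrib_left)
  have "R * (R + fst w) \<le> (R - fst w) * (R + fst w)" using R assms(2) by (intro mult_right_mono) auto
  also have "\<dots> = (snd w)\<^sup>2" using R(1) by (simp add: nz_def algebra_simps power2_eq_square)
  finally show "sqrt (nz w) * (sqrt (nz w) + fst w) < (2 * al * c e)\<^sup>2" using assms(3) by (simp add: R_def)
qed

text \<open>Off the origin of the fibre each point lies in one of the two slit domains, which are
  open as symplectic images. The set \<open>?N\<close> covers the branch point.\<close>

lemma open_MG: "open (slabs MG)"
proof -
  let ?N = "slabs (\<lambda>w e. 2 * nz w < (2 * al * c e)\<^sup>2 \<and> 8 * nz w < 1)"
  have cc: "continuous_on UNIV (\<lambda>y::r2 \<times> real. c (snd y))"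
    by (rule continuous_on_compose2 [OF c_cont]) (auto intro: continuous_intros)
  have "open ({y::r2 \<times> real. 2 * nz (fst y) < (2 * al * c (snd y))\<^sup>2} \<inter> {y. 8 * nz (fst y) < 1})"
    unfolding nz_def by (intro open_Int open_Collect_less continuous_intros cc)
  then have "open ?N" by (intro open_slabs) (simp add: Collect_conj_eq)
  moreover have "slabs MG = slabs MGu \<union> slabs MGl \<union> ?N"
  proof -
    have "MG w e" if "0 < e" "e < 1" "2 * nz w < (2 * al * c e)\<^sup>2" "8 * nz w < 1" for w e
    proof (cases "0 \<le> fst w")
      case True
      have "4 * (snd w)\<^sup>2 \<le> 8 * nz w" by (simp add: nz_def)
      then show ?thesis by (intro MG_member_pos c_pos that True) (use that in linarith)
    next
      case False
      have "(snd w)\<^sup>2 \<le> 2 * nz w" by (simp add: nz_def)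
      then show ?thesis by (intro MG_member_neg c_pos that) (use that False in linarith)+
    qed
    moreover have "2 * nz w < (2 * al * c e)\<^sup>2 \<and> 8 * nz w < 1"
      if "0 < e" "e < 1" "snd w = 0 \<and> fst w \<le> 0" "snd w = 0 \<and> 0 \<le> fst w" for w e
    proof -
      have "nz w = 0" using that by (simp add: nz_def)
      then show ?thesis using al c_pos [OF that(1,2)] by simp
    qed
    ultimately show ?thesis unfolding MGu_def [abs_def] MGl_def [abs_def] slabs_def by blast
  qed
  ultimately show ?thesis
    using symp_open(2) [OF symp_HG_MGu] symp_open(2) [OF symp_K1_MGl] by auto
qed

text \<open>The positive axis is the image of the vertical half-line \<open>fst v = 0\<close>, on
  which \<open>gn\<close> divides heights by \<open>2 * al\<close>.\<close>

lemma MG_axis_pos: assumes "0 < P" shows "MG (P, 0) e \<longleftrightarrow> P < sqrt 2 * al * c e"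
proof
  assume "MG (P, 0) e"
  then obtain v where v: "HG v e" "dbl v = (P, 0)" using assms by (auto simp: MG_def)
  then have vH: "v \<in> H" by (simp add: HG_def)
  have f: "fst v = 0" using dbl_H(2) [OF vH] v(2) by simp
  then have s: "snd v = sqrt 2 * P" using dbl_H(3) [OF vH f] v(2) by simp
  have "snd v / (2 * al) < c e" using gn_left(1) [OF vH] f v(1) by (simp add: HG_def)
  then have "sqrt 2 * P < 2 * al * c e" using al s by (simp add: field_simps)
  then have "sqrt 2 * (sqrt 2 * P) < sqrt 2 * (2 * al * c e)" by (intro mult_strict_left_mono) auto
  then show "P < sqrt 2 * al * c e" by (simp add: mult_ac)
next
  assume P: "P < sqrt 2 * al * c e"
  have v: "(0, sqrt 2 * P) \<in> H" using assms by (simp add: H_def)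
  have d: "dbl (0, sqrt 2 * P) = (P, 0)" using assms
    by (simp add: dbl_def nz_def power_mult_distrib real_sqrt_mult power2_eq_square)
  have "sqrt 2 * P < sqrt 2 * (sqrt 2 * al * c e)" using P by (intro mult_strict_left_mono) auto
  then have "sqrt 2 * P / (2 * al) < c e" using al by (simp add: field_simps)
  then have "HG (0, sqrt 2 * P) e" using v al be gn_left [OF v] by (simp add: HG_def)
  then show "MG (P, 0) e" unfolding MG_def using d by metis
qed

lemma MG_axis_neg: assumes "P \<le> 0" shows "MG (P, 0) e \<longleftrightarrow> - hh < P"
  using assms dbl_H(1) by (auto simp: MG_def HG_def) (metis fst_conv snd_conv)

end

section \<open>Excision of the negative half-axis from the folded domain\<close>

lemma zt_D: "p < 1 \<Longrightarrow> (zt has_real_derivative 1 / (2 * (1 - zt p))) (at p)"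
  using zt_deriv [of p] by (simp add: zt_def)

lemmas zt_FD = zt_D [THEN DERIV_compose_FDERIV]

lemma zt_less: "p < 1 \<Longrightarrow> zt p < 1" by (simp add: zt_def)

lemma zt_inverse: assumes "0 \<le> z" "z < 1" obtains p where "0 \<le> p" "p < 1" "zt p = z"
proof
  show "zt (1 - (1 - z)\<^sup>2) = z" using assms by (simp add: zt_def)
  have "(1 - z)\<^sup>2 \<le> 1" using assms by (intro power_le_one) auto
  then show "0 \<le> 1 - (1 - z)\<^sup>2" by simp
  show "1 - (1 - z)\<^sup>2 < 1" using assms by simp
qed

lemma zt_nonneg: "0 \<le> p \<Longrightarrow> 0 \<le> zt p" by (simp add: zt_def)

lemma symp_slabs_uminus:
  assumes "open (slabs G)"
  shows "symp (slabs G) (slabs (\<lambda>w. G (- w)))"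
proof (rule symp_slabs_map [where W = UNIV and \<phi> = uminus])
  have "area_on UNIV (\<lambda>w. (- fst w, - snd w))"
    by (rule area_onI [where a = "\<lambda>_. -1" and b = "\<lambda>_. 0" and c = "\<lambda>_. 0" and d = "\<lambda>_. -1"])
      (auto intro!: derivative_eq_intros)
  moreover have "(\<lambda>w::r2. (- fst w, - snd w)) = uminus" by (simp add: fun_eq_iff prod_eq_iff)
  ultimately show "area_on UNIV uminus" by simp
  show "smooth_on UNIV (uminus :: r2 \<Rightarrow> r2)" by (intro smooth_intros open_UNIV)
  show "inj_on (uminus :: r2 \<Rightarrow> r2) UNIV" by simp
  show "G (- w) e \<longleftrightarrow> (\<exists>v. G v e \<and> w = - v)" for w e by (metis minus_minus)
qed (use assms in auto)

context
  fixes la :: real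
  assumes la: "0 < la" "la \<le> 1/8"
begin

text \<open>\<open>D\<close> is the denominator of the Moebius map
  \<open>z \<mapsto> la * z / D\<close>, which fixes 0 and 1 and has slope \<open>la\<close> at
  0.\<close>

lemma interp_bounds:
  assumes "- 5/12 < z" "z < 1"
  defines "D \<equiv> 1 - z + la * z"
  shows "0 < D" "D \<le> 17/12" "0 \<le> z \<Longrightarrow> 1 - z \<le> D" "0 \<le> z \<Longrightarrow> D \<le> 1" "z < 0 \<Longrightarrow> 1 \<le> D"
proof -
  have D: "D = (1 - z) * (1 - la) + la" by (simp add: D_def algebra_simps)
  have "0 < (1 - z) * (1 - la)" using assms la by (intro mult_pos_pos) auto
  then show "0 < D" using la D by linarith
  have "0 \<le> z \<Longrightarrow> 0 \<le> la * z" using la by simp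
  then show "0 \<le> z \<Longrightarrow> 1 - z \<le> D" by (simp add: D_def)
  have D': "D = 1 - z * (1 - la)" by (simp add: D_def algebra_simps)
  have "0 \<le> z \<Longrightarrow> 0 \<le> z * (1 - la)" using la by simp
  then show 1: "0 \<le> z \<Longrightarrow> D \<le> 1" using D' by linarith
  have "z < 0 \<Longrightarrow> z * (1 - la) \<le> 0" using la by (intro mult_nonpos_nonneg) auto
  then show "z < 0 \<Longrightarrow> 1 \<le> D" using D' by linarith
  have "(1 - z) * (1 - la) \<le> 17/12 * (1 - la)" using assms la by (intro mult_right_mono) auto
  then show "D \<le> 17/12" using la D by (simp add: algebra_simps)
qed

text \<open>\<open>Q\<close> is the transverse coordinate of the tube. Both \<open>D\<close> and
  \<open>1 - z\<close> are at most \<open>17/12\<close>, and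
  \<open>(17/12)^6 \<le> 25/3\<close>.\<close>

lemma interp_Q:
  assumes z: "- 5/12 < z" "z < 1" and q: "\<bar>q\<bar> \<le> la\<^sup>2 / 20"
  defines "D \<equiv> 1 - z + la * z"
  defines "Q \<equiv> q / (la / (2 * sqrt 2) / (D\<^sup>2 * (2 * (1 - z))))"
  shows "Q\<^sup>2 \<le> 2/25 * la\<^sup>2 * (D ^ 4 * (1 - z)\<^sup>2)" "Q\<^sup>2 \<le> 2/3 * la\<^sup>2"
proof -
  note D = interp_bounds [OF z, folded D_def]
  have Q: "Q = q * (4 * sqrt 2 * D\<^sup>2 * (1 - z) / la)"
    unfolding Q_def using D(1) z la by (simp add: field_simps)
  have "\<bar>q\<bar>\<^sup>2 \<le> (la\<^sup>2 / 20)\<^sup>2" by (rule power_mono [OF q]) simp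
  then have q2: "q\<^sup>2 \<le> la ^ 4 / 400" by (simp add: power_divide)
  have "Q\<^sup>2 = q\<^sup>2 * (32 * D ^ 4 * (1 - z)\<^sup>2 / la\<^sup>2)"
    unfolding Q by (simp add: power_mult_distrib power_divide)
  also have "\<dots> \<le> la ^ 4 / 400 * (32 * D ^ 4 * (1 - z)\<^sup>2 / la\<^sup>2)"
    using q2 D(1) by (intro mult_right_mono) auto
  also have "\<dots> = 2/25 * la\<^sup>2 * (D ^ 4 * (1 - z)\<^sup>2)" using la by (simp add: field_simps power2_eq_square power4_eq_xxxx)
  finally show 1: "Q\<^sup>2 \<le> 2/25 * la\<^sup>2 * (D ^ 4 * (1 - z)\<^sup>2)" .
  have "D ^ 4 * (1 - z)\<^sup>2 \<le> (17/12) ^ 4 * (17/12)\<^sup>2"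
    using D(1,2) z by (intro mult_mono power_mono) auto
  also have "\<dots> \<le> 25/3" by (simp add: power_divide)
  finally have "2/25 * la\<^sup>2 * (D ^ 4 * (1 - z)\<^sup>2) \<le> 2/25 * la\<^sup>2 * (25/3)" by (intro mult_left_mono) auto
  then show "Q\<^sup>2 \<le> 2/3 * la\<^sup>2" using 1 by simp
qed

text \<open>The Moebius map leaves the gap \<open>s = (1 - z) / D\<close> to the end 1, so its
  square is at most \<open>1 - s\<close>, while \<open>8 * Q^2\<close> is less than
  \<open>1 - z \<le> s\<close>.\<close>

lemma interp_P:
  assumes z: "0 \<le> z" "z < 1" and q: "\<bar>q\<bar> \<le> la\<^sup>2 / 20"
  defines "D \<equiv> 1 - z + la * z"
  defines "Q \<equiv> q / (la / (2 * sqrt 2) / (D\<^sup>2 * (2 * (1 - z))))"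
  shows "(la * z / D)\<^sup>2 + 8 * Q\<^sup>2 < 1"
proof -
  have z': "- 5/12 < z" using z by simp
  note D = interp_bounds [OF z' z(2), folded D_def]
  define s where "s = (1 - z) / D"
  have s: "0 < s" "s \<le> 1" using z D(1,3) by (simp_all add: s_def)
  have t: "la * z / D = 1 - s" using D(1) by (simp add: s_def field_simps) (simp add: D_def)
  have "(la * z / D)\<^sup>2 = 1 - s - s * (1 - s)" unfolding t by (simp add: power2_eq_square algebra_simps)
  moreover have "0 \<le> s * (1 - s)" using s by simp
  moreover have "8 * Q\<^sup>2 < s"
  proof -
    have "D ^ 4 * (1 - z)\<^sup>2 \<le> 1 * (1 - z)"
    proof (rule mult_mono)
      show "D ^ 4 \<le> 1" using D(1,4) z by (intro power_le_one) auto
      show "(1 - z)\<^sup>2 \<le> 1 - z" using z by (simp add: power2_eq_square mult_left_le)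
    qed auto
    moreover have "la\<^sup>2 \<le> 1" using la by (intro power_le_one) auto
    ultimately have "la\<^sup>2 * (D ^ 4 * (1 - z)\<^sup>2) \<le> 1 * (1 - z)" using z D(1) by (intro mult_mono) auto
    then have Q: "8 * Q\<^sup>2 \<le> 16/25 * (1 - z)" using interp_Q(1) [OF z' z(2) q] unfolding D_def Q_def by linarith
    have "1 - z \<le> s" unfolding s_def using D(1,4) z by (simp add: pos_le_divide_eq mult_left_le)
    moreover have "16/25 * (1 - z) < 1 - z" using z by simp
    ultimately show ?thesis using Q by (meson le_less_trans less_le_trans)
  qed
  ultimately show ?thesis by linarith
qed

end

lemma nz_scaled: "nz (x / (2 * sqrt 2), y) = x\<^sup>2 / 8 + y\<^sup>2"
  by (simp add: nz_def power_divide power_mult_distrib)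

context fold
begin

lemma al_half: "al \<le> 1/2" using albe sum by linarith

text \<open>The axis to be removed has the constant length \<open>hh\<close>, but the arcs must
  start on the other side of the origin, where the room is only of order \<open>al * c e\<close>.
  Hence a Moebius map with the small slope \<open>la e\<close> at 0. The half-turn of the fibre lets
  the arcs run in the positive direction.\<close>

lemma symp_MGu_MG:
  assumes c_ge: "\<And>e. e \<in> {0<..<1} \<Longrightarrow> e * (1 - e) \<le> c e"
  shows "symp (slabs MGu) (slabs MG)"
proof -
  define la where "la e = al * (e * (1 - e))" for e :: real
  define D where "D p e = 1 - zt p + la e * zt p" for p e
  define w wp we where "w p e = la e * zt p / D p e / (2 * sqrt 2)"
    and "wp p e = la e / (2 * sqrt 2) / ((D p e)\<^sup>2 * (2 * (1 - zt p)))"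
    and "we p e = zt p * (1 - zt p) / (D p e)\<^sup>2 * (al * (1 - 2 * e)) / (2 * sqrt 2)" for p e
  let ?G = "\<lambda>w. MG (- w)"
  have oG: "open (slabs ?G)" by (rule symp_open(2) [OF symp_slabs_uminus [OF open_MG]])
  have la: "0 < la e" "la e \<le> 1/8" if "e \<in> {0<..<1}" for e
  proof -
    show "0 < la e" using that al by (simp add: la_def)
    have "0 \<le> (1/2 - e)\<^sup>2" by simp
    then have "e * (1 - e) \<le> 1/4" by (simp add: power2_eq_square algebra_simps)
    then have "la e \<le> 1/2 * (1/4)" unfolding la_def using al al_half that by (intro mult_mono) auto
    then show "la e \<le> 1/8" by simp
  qed
  have D_pos: "0 < D p e" if "p < 1" "e \<in> {0<..<1}" for p e
  proof -
    have "0 < (1 - zt p) * (1 - la e)" using zt_less that(1) la [OF that(2)] by (intro mult_pos_pos) auto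
    moreover have "D p e = (1 - zt p) * (1 - la e) + la e" by (simp add: D_def algebra_simps)
    ultimately show ?thesis using la [OF that(2)] by linarith
  qed
  let ?U = "{-2<..<1} \<times> {0<..<1} :: r2 set"
  have o: "open ?U" by (intro open_Times) auto
  have U: "fst y < 1" "snd y \<in> {0<..<1}" if "y \<in> ?U" for y using that by (auto simp: mem_Times_iff)
  have "symp (slabs ?G - {x. \<exists>p. 0 \<le> p \<and> p < 1 \<and> fst x = (w p (snd (snd x)), 0)}) (slabs ?G)"
  \<comment> \<open>Here \<open>we / wp = 2 * z * (1 - z)^2 * (1 - 2 * e) / (e * (1 - e))\<close>,
    and \<open>2 * (17/12)^2 < 5\<close>. The exponent 2 makes the tube as narrow as
    \<open>(la e)^2 / 20\<close>, as \<open>interp_Q\<close> asks.\<close>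
  proof (rule excision [where w = w and wp = wp and we = we
        and m = 2 and C = 5 and rr = "al\<^sup>2 / 20" and hi = "\<lambda>_. hh"])
    show "open (slabs ?G)" by (rule oG)
    fix y assume y: "y \<in> ?U"
    note z = zt_less [OF U(1) [OF y]]
    have Dy: "D (fst y) (snd y) \<noteq> 0" using D_pos U y by (simp add: less_imp_neq [symmetric])
    have L: "((\<lambda>y. la (snd y)) has_derivative (\<lambda>v. al * (1 - 2 * snd y) * snd v)) (at y)"
      unfolding la_def by (auto intro!: derivative_eq_intros simp: fun_eq_iff algebra_simps)
    have Z: "((\<lambda>y. zt (fst y)) has_derivative (\<lambda>v. fst v / (2 * (1 - zt (fst y))))) (at y)"
      using zt_FD [OF U(1) [OF y] has_derivative_fst [OF has_derivative_ident]] by simp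
    have alg: "((l * (f / (2 * (1 - z))) + k * t * z) * (1 - z + l * z) - l * z * (0 - f / (2 * (1 - z)) + (l * (f / (2 * (1 - z))) + k * t * z)))
          / ((1 - z + l * z) * (1 - z + l * z)) / (2 * sqrt 2) =
        l / (2 * sqrt 2) / ((1 - z + l * z)\<^sup>2 * (2 * (1 - z))) * f + z * (1 - z) / (1 - z + l * z)\<^sup>2 * k / (2 * sqrt 2) * t"
      if "1 - z + l * z \<noteq> 0" for l f z k t :: real
    proof -
      define g E where "g = f / (2 * (1 - z))" and "E = 1 - z + l * z"
      have "(l * g + k * t * z) * E - l * z * (0 - g + (l * g + k * t * z)) = l * g + z * (1 - z) * k * t"
        by (simp add: E_def algebra_simps)
      moreover have "l / (2 * sqrt 2) / (E\<^sup>2 * (2 * (1 - z))) * f = l * g / (E * E) / (2 * sqrt 2)"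
        by (simp add: g_def power2_eq_square)
      ultimately show ?thesis
        unfolding g_def [symmetric] E_def [symmetric] by (simp add: power2_eq_square add_divide_distrib)
    qed
    note DD = has_derivative_divide' [OF has_derivative_mult [OF L Z]
       has_derivative_add [OF has_derivative_diff [OF has_derivative_const [of 1] Z] has_derivative_mult [OF L Z]] Dy [unfolded D_def]]
    show "((\<lambda>y. w (fst y) (snd y)) has_derivative
        (\<lambda>v. wp (fst y) (snd y) * fst v + we (fst y) (snd y) * snd v)) (at y)"
      unfolding w_def D_def
      by (rule has_derivative_eq_rhs [OF bounded_linear.has_derivative [OF bounded_linear_divide DD]])
        (simp only: fun_eq_iff wp_def we_def D_def alg [OF Dy [unfolded D_def]], simp)
  next
    have s: "smooth_on ?U (\<lambda>y. zt (fst y))" "smooth_on ?U (\<lambda>y. la (snd y))"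
      unfolding la_def by (intro smooth_intros o; use U in simp)+
    have sD: "smooth_on ?U (\<lambda>y. D (fst y) (snd y))" unfolding D_def by (intro smooth_intros o s)
    have nz: "(D (fst y) (snd y))\<^sup>2 \<noteq> 0" "(D (fst y) (snd y))\<^sup>2 * (2 * (1 - zt (fst y))) \<noteq> 0" if "y \<in> ?U" for y
      using D_pos [of "fst y" "snd y"] zt_less [of "fst y"] U [OF that] by auto
    show "smooth_on ?U (\<lambda>y. wp (fst y) (snd y))" "smooth_on ?U (\<lambda>y. we (fst y) (snd y))"
      unfolding wp_def we_def by (intro smooth_intros o s sD nz; simp)+
  next
    fix p e :: real assume "p \<in> {-2<..<1}" "e \<in> {0<..<1}"
    then show "0 < wp p e" using la [of e] D_pos [of p e] zt_less [of p] by (simp add: wp_def)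
  next
    fix p e :: real assume p: "p \<in> {-1..<1}" and e: "e \<in> {0<..<1}"
    define z where "z = zt p"
    note zb = zt_bounds(1,2) [OF p, folded z_def]
    define d where "d = e * (1 - e)"
    have d: "0 < d" using e by (simp add: d_def)
    have Dp: "0 < D p e" using D_pos p e by auto
    have rat: "we p e / wp p e = 2 * z * (1 - z)\<^sup>2 * (1 - 2 * e) / d"
      using Dp zb al d unfolding we_def wp_def la_def z_def [symmetric] d_def [symmetric]
      by (simp add: field_simps power2_eq_square)
    have "\<bar>z\<bar> * (1 - z)\<^sup>2 * \<bar>1 - 2 * e\<bar> \<le> 1 * (17/12)\<^sup>2 * 1"
      using zb e by (intro mult_mono power_mono) (auto simp: abs_le_iff)
    then have "2 * (\<bar>z\<bar> * (1 - z)\<^sup>2 * \<bar>1 - 2 * e\<bar>) * d \<le> 5 * 1"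
      using d e by (intro mult_mono) (auto simp: power2_eq_square d_def intro!: mult_le_one)
    moreover have "\<bar>we p e / wp p e\<bar> * d\<^sup>2 = 2 * (\<bar>z\<bar> * (1 - z)\<^sup>2 * \<bar>1 - 2 * e\<bar>) * d"
      unfolding rat using d by (simp add: abs_mult power2_eq_square)
    ultimately show "\<bar>we p e / wp p e\<bar> * (e * (1 - e))\<^sup>2 \<le> 5" by (simp add: d_def)
    fix q assume "\<bar>q\<bar> \<le> al\<^sup>2 / 20 * (e * (1 - e))\<^sup>2"
    then have q: "\<bar>q\<bar> \<le> (la e)\<^sup>2 / 20" by (simp add: la_def power_mult_distrib)
    note l = la [OF e]
    define Q where "Q = q / wp p e"
    have Qe: "Q = q / (la e / (2 * sqrt 2) / ((1 - z + la e * z)\<^sup>2 * (2 * (1 - z))))"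
      by (simp add: Q_def wp_def D_def z_def)
    note Q1 = interp_Q(2) [OF l zb q, folded Qe]
    have c0: "0 < c e" using c_pos e by simp
    have "la e \<le> al * c e" unfolding la_def using c_ge [OF e] al by (intro mult_left_mono) auto
    then have "(la e)\<^sup>2 \<le> (al * c e)\<^sup>2" using l by (intro power_mono) auto
    then have lc: "4 * (la e)\<^sup>2 \<le> (2 * al * c e)\<^sup>2" by (simp add: power_mult_distrib)
    have l2: "0 < (la e)\<^sup>2" "(la e)\<^sup>2 \<le> (1/8)\<^sup>2" using l by (simp, intro power_mono) auto
    have l3: "(la e)\<^sup>2 \<le> 1/64" using l2(2) by (simp add: power2_eq_square)
    have Qc: "Q\<^sup>2 < (2 * al * c e)\<^sup>2" using Q1 lc l2(1) by linarith
    define x where "x = la e * z / D p e"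
    have weq: "w p e = x / (2 * sqrt 2)" by (simp add: w_def x_def z_def)
    have "MG (- (w p e, Q)) e"
    proof (cases "0 \<le> z")
      case True
      have "x\<^sup>2 + 8 * Q\<^sup>2 < 1"
        using interp_P [OF l True zb(2) q, folded Qe] by (simp add: x_def D_def z_def)
      moreover have "0 \<le> w p e" using True l Dp unfolding weq x_def by simp
      moreover have "nz (- (w p e, Q)) = x\<^sup>2 / 8 + Q\<^sup>2"
        unfolding weq using nz_scaled [of "- x" "- Q"] by simp
      ultimately show ?thesis using Qc by (intro MG_member_neg c0) auto
    next
      case False
      have "1 \<le> D p e" using interp_bounds(5) [OF l zb] False by (simp add: D_def z_def)
      then have "la e * \<bar>z\<bar> / D p e \<le> la e * 1 / 1" using zb l by (intro frac_le mult_left_mono) auto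
      then have "\<bar>x\<bar> \<le> la e" using Dp l by (simp add: x_def abs_mult)
      then have "\<bar>x\<bar>\<^sup>2 \<le> (la e)\<^sup>2" by (intro power_mono) auto
      moreover have "w p e \<le> 0" using False l Dp unfolding weq x_def by (simp add: mult_nonneg_nonpos divide_nonpos_pos)
      moreover have "nz (- (w p e, Q)) = x\<^sup>2 / 8 + Q\<^sup>2"
        unfolding weq using nz_scaled [of "- x" "- Q"] by simp
      moreover define X where "X = (la e)\<^sup>2"
      ultimately have n: "2 * nz (- (w p e, Q)) \<le> X / 4 + 4/3 * X" using Q1 by simp
      have X: "0 < X" "4 * X \<le> (2 * al * c e)\<^sup>2" "X \<le> 1/64" using l lc l3 by (simp_all add: X_def)
      have "2 * nz (- (w p e, Q)) < (2 * al * c e)\<^sup>2" using n X by linarith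
      then show ?thesis using \<open>w p e \<le> 0\<close> Q1 X(3) by (intro MG_member_pos c0) (auto simp: X_def)
    qed
    then show "MG (- (w p e, q / wp p e)) e" by (simp add: Q_def)
  next
    fix e :: real assume e: "e \<in> {0<..<1}"
    have hp: "0 < hh" by (simp add: hh_def)
    show "\<not> MG (- (hh, 0)) e" using MG_axis_neg [of "- hh" e] hp by simp
    let ?F = "at (1::real, e) within {-1..<1} \<times> {0<..<1}"
    have l: "(fst \<longlongrightarrow> 1) ?F" "(snd \<longlongrightarrow> e) ?F"
      using tendsto_fst [OF tendsto_ident_at, of "(1, e)"] tendsto_snd [OF tendsto_ident_at, of "(1, e)"]
      by simp_all
    have z1: "zt 1 = 1" by (simp add: zt_def)
    have lz: "((\<lambda>y. zt (fst y)) \<longlongrightarrow> 1) ?F"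
    proof -
      have "((\<lambda>y. zt (fst y)) \<longlongrightarrow> zt 1) ?F" unfolding zt_def by (intro tendsto_intros l)
      then show ?thesis by (simp only: z1)
    qed
    have ll: "((\<lambda>y. la (snd y)) \<longlongrightarrow> la e) ?F" unfolding la_def by (intro tendsto_intros l)
    have lD: "((\<lambda>y. D (fst y) (snd y)) \<longlongrightarrow> 1 - 1 + la e * 1) ?F" unfolding D_def
      by (intro tendsto_intros lz ll)
    have nl: "1 - 1 + la e * 1 \<noteq> 0" using la(1) [OF e] by simp
    have "((\<lambda>y. w (fst y) (snd y)) \<longlongrightarrow> la e * 1 / (1 - 1 + la e * 1) / (2 * sqrt 2)) ?F"
      unfolding w_def by (intro tendsto_intros lz ll lD nl) simp
    then show "((\<lambda>y. w (fst y) (snd y)) \<longlongrightarrow> hh) ?F" using nl by (simp add: hh_def)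
    have "((\<lambda>y. 2 * sqrt 2 * ((D (fst y) (snd y))\<^sup>2 * (2 * (1 - zt (fst y)))) / la (snd y)) \<longlongrightarrow>
        2 * sqrt 2 * ((1 - 1 + la e * 1)\<^sup>2 * (2 * (1 - 1))) / la e) ?F"
      by (intro tendsto_intros lz ll lD) (use nl in auto)
    then show "((\<lambda>y. 1 / wp (fst y) (snd y)) \<longlongrightarrow> 0) ?F" by (simp add: wp_def)
  qed (use al in simp)
  moreover have "slabs ?G - {x. \<exists>p. 0 \<le> p \<and> p < 1 \<and> fst x = (w p (snd (snd x)), 0)} =
    slabs (\<lambda>w. MGu (- w))"
  proof -
    have "(\<exists>p. 0 \<le> p \<and> p < 1 \<and> fst x = (w p (snd (snd x)), 0)) \<longleftrightarrow>
        snd (fst x) = 0 \<and> 0 \<le> fst (fst x)" if x: "x \<in> slabs ?G" for x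
    proof
      have e: "snd (snd x) \<in> {0<..<1}" using x by (simp add: slabs_def)
      assume "\<exists>p. 0 \<le> p \<and> p < 1 \<and> fst x = (w p (snd (snd x)), 0)"
      then obtain p where p: "0 \<le> p" "p < 1" "fst x = (w p (snd (snd x)), 0)" by blast
      have "0 \<le> w p (snd (snd x))" using zt_nonneg [OF p(1)] la(1) [OF e] D_pos [OF p(2) e]
        by (simp add: w_def)
      then show "snd (fst x) = 0 \<and> 0 \<le> fst (fst x)" using p(3) by simp
    next
      define e where "e = snd (snd x)"
      define P where "P = fst (fst x)"
      assume a: "snd (fst x) = 0 \<and> 0 \<le> fst (fst x)"
      then have f: "fst x = (P, 0)" "0 \<le> P" by (simp_all add: P_def prod_eq_iff)
      have e: "e \<in> {0<..<1}" using x by (simp add: slabs_def e_def)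
      note l = la [OF e]
      have "MG (- P, 0) e" using x by (simp add: slabs_def f e_def)
      then have "P < hh" using MG_axis_neg [of "- P" e] f by simp
      then have "2 * sqrt 2 * P < 2 * sqrt 2 * hh" by (intro mult_strict_left_mono) auto
      then have y1: "2 * sqrt 2 * P < 1" by (simp add: hh_def)
      define y where "y = 2 * sqrt 2 * P"
      have y: "0 \<le> y" "y < 1" using y1 f by (simp_all add: y_def)
      \<comment> \<open>Solving \<open>y = la * z / (1 - z + la * z)\<close> for \<open>z\<close>
        gives \<open>z = y / E\<close>.\<close>
      define E where "E = la e + (1 - la e) * y"
      have E: "0 < E" unfolding E_def using l y by (intro add_pos_nonneg) auto
      define z where "z = y / E"
      have z1: "1 - z = la e * (1 - y) / E" using E by (simp add: z_def field_simps) (simp add: E_def algebra_simps)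
      have "0 \<le> z" "0 < 1 - z" using E y l by (simp add: z_def) (simp add: z1 E y l)
      then obtain p where p: "0 \<le> p" "p < 1" "zt p = z" using zt_inverse by (metis diff_gt_0_iff_gt)
      have "D p e = la e / E" unfolding D_def p(3) z1 using E by (simp add: z_def field_simps)
      then have "w p e = P" unfolding w_def p(3) using E l by (simp add: z_def y_def)
      then show "\<exists>p. 0 \<le> p \<and> p < 1 \<and> fst x = (w p (snd (snd x)), 0)" using p f by (auto simp: e_def)
    qed
    moreover have "x \<in> slabs (\<lambda>w. MGu (- w)) \<longleftrightarrow>
        x \<in> slabs ?G \<and> \<not> (snd (fst x) = 0 \<and> 0 \<le> fst (fst x))" for x
      by (simp add: slabs_def MGu_def conj_assoc)
    ultimately show ?thesis by (intro set_eqI) (simp only: Diff_iff mem_Collect_eq cong: conj_cong)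
  qed
  ultimately have s: "symp (slabs (\<lambda>w. MGu (- w))) (slabs ?G)" by simp
  have "symp (slabs MGu) (slabs (\<lambda>w. MGu (- w)))"
    by (rule symp_slabs_uminus [OF symp_open(2) [OF symp_HG_MGu]])
  from symp_trans [OF this symp_trans [OF s symp_sym [OF symp_slabs_uminus [OF open_MG]]]]
  show ?thesis .
qed

end

section \<open>Excision of the positive half-axis from the folded domain\<close>

text \<open>\<open>sP l1 l2 z\<close> is the smaller root \<open>x\<close> of \<open>(l1 - x) * (l2 - x) = l1 * l2 * (1 - z)\<close>. It is smooth for \<open>z < 1\<close> and
  tends to \<open>min l1 l2\<close> as \<open>z\<close> tends to \<open>1\<close>.\<close>

definition sS :: "real \<Rightarrow> real \<Rightarrow> real \<Rightarrow> real" where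
  "sS l1 l2 z = sqrt ((l1 + l2)\<^sup>2 - 4 * (l1 * l2) * z)"
definition sP :: "real \<Rightarrow> real \<Rightarrow> real \<Rightarrow> real" where
  "sP l1 l2 z = (l1 + l2 - sS l1 l2 z) / 2"

context
  fixes l1 l2 z :: real
  assumes l: "0 < l1" "0 < l2" and z: "z < 1"
begin

lemma sS_pos: "0 < (l1 + l2)\<^sup>2 - 4 * (l1 * l2) * z" "0 < sS l1 l2 z"
    "sS l1 l2 z * sS l1 l2 z = (l1 + l2)\<^sup>2 - 4 * (l1 * l2) * z" "\<bar>l1 - l2\<bar> \<le> sS l1 l2 z"
proof -
  have e: "(l1 + l2)\<^sup>2 - 4 * (l1 * l2) * z = (l1 - l2)\<^sup>2 + 4 * (l1 * l2) * (1 - z)"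
    by (simp add: power2_eq_square algebra_simps)
  have p: "0 < 4 * (l1 * l2) * (1 - z)" using l z by simp
  show q: "0 < (l1 + l2)\<^sup>2 - 4 * (l1 * l2) * z" unfolding e using p by (simp add: add_nonneg_pos)
  then show "0 < sS l1 l2 z" "sS l1 l2 z * sS l1 l2 z = (l1 + l2)\<^sup>2 - 4 * (l1 * l2) * z"
    by (simp_all add: sS_def)
  have "\<bar>l1 - l2\<bar>\<^sup>2 \<le> (l1 + l2)\<^sup>2 - 4 * (l1 * l2) * z" unfolding e using p by simp
  then show "\<bar>l1 - l2\<bar> \<le> sS l1 l2 z" unfolding sS_def by (rule real_le_rsqrt)
qed

lemma sP_prod: "(l1 - sP l1 l2 z) * (l2 - sP l1 l2 z) = l1 * l2 * (1 - z)"
proof -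
  define S where "S = sS l1 l2 z"
  have "S * S = (l1 + l2)\<^sup>2 - 4 * (l1 * l2) * z" using sS_pos(3) by (simp add: S_def)
  then show ?thesis unfolding sP_def S_def [symmetric]
    by (simp add: field_simps power2_eq_square)
qed

text \<open>The product of the gaps to the minimum and to the maximum is
  \<open>l1 * l2 * (1 - z)\<close>, and the gap to the maximum is at most
  \<open>sS l1 l2 z\<close>.\<close>

lemma sP_gap: "l1 * l2 * (1 - z) / sS l1 l2 z \<le> min l1 l2 - sP l1 l2 z"
proof -
  note S = sS_pos(2,4)
  have "max l1 l2 - sP l1 l2 z = (\<bar>l1 - l2\<bar> + sS l1 l2 z) / 2"
    by (simp add: sP_def max_def abs_if field_simps)
  then have M: "max l1 l2 - sP l1 l2 z \<le> sS l1 l2 z" using S by simp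
  have m: "0 \<le> min l1 l2 - sP l1 l2 z" using S by (auto simp: sP_def min_def)
  have "l1 * l2 * (1 - z) = (min l1 l2 - sP l1 l2 z) * (max l1 l2 - sP l1 l2 z)"
    using sP_prod by (simp add: min_def max_def mult.commute)
  also have "\<dots> \<le> (min l1 l2 - sP l1 l2 z) * sS l1 l2 z" using M m by (intro mult_left_mono)
  finally show ?thesis using S by (simp add: pos_divide_le_eq)
qed

lemma sP_nonneg: assumes "0 \<le> z" shows "0 \<le> sP l1 l2 z"
proof -
  have "0 \<le> 4 * (l1 * l2) * z" using assms l by simp
  then have "sS l1 l2 z \<le> l1 + l2" unfolding sS_def using l by (intro real_le_lsqrt) auto
  then show ?thesis by (simp add: sP_def)
qed

text \<open>With \<open>s = l1 + l2\<close> and \<open>S = sS l1 l2 z\<close> one has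
  \<open>(S - s) * (S + s) = - 4 * l1 * l2 * z\<close>; then \<open>S \<ge> s\<close> and
  \<open>l1 * l2 \<le> min l1 l2 * s\<close> bound \<open>S - s\<close>.\<close>

lemma sP_neg: assumes "z < 0" "- 5/12 < z" shows "sP l1 l2 z \<le> 0" "- (5/12 * min l1 l2) \<le> sP l1 l2 z"
proof -
  define s S where "s = l1 + l2" and "S = sS l1 l2 z"
  have S: "0 < S" "S * S = s\<^sup>2 - 4 * (l1 * l2) * z" using sS_pos by (simp_all add: s_def S_def)
  have s: "0 < s" using l by (simp add: s_def)
  have L: "0 < l1 * l2" using l by simp
  then have "4 * (l1 * l2) * z < 0" using assms by (simp add: mult_pos_neg)
  then have "s\<^sup>2 \<le> (l1 + l2)\<^sup>2 - 4 * (l1 * l2) * z" by (simp add: s_def)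
  then have sS: "s \<le> S" unfolding S_def sS_def by (rule real_le_rsqrt)
  then show "sP l1 l2 z \<le> 0" by (simp add: sP_def s_def S_def)
  have "(S - s) * (S + s) = 4 * (l1 * l2) * (- z)" using S(2) by (simp add: algebra_simps power2_eq_square)
  moreover have "(S - s) * (2 * s) \<le> (S - s) * (S + s)" using sS by (intro mult_left_mono) auto
  moreover have "4 * (l1 * l2) * (- z) \<le> 4 * (l1 * l2) * (5/12)" using L assms by (intro mult_left_mono) auto
  ultimately have "(S - s) * (2 * s) \<le> 4 * (l1 * l2) * (5/12)" by linarith
  also have "l1 * l2 \<le> min l1 l2 * s" using l by (simp add: min_def s_def algebra_simps)
  then have "4 * (l1 * l2) * (5/12) \<le> 4 * (min l1 l2 * s) * (5/12)" by (simp add: mult.commute [of s])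
  finally have "(S - s) * (2 * s) \<le> (5/6 * min l1 l2) * (2 * s)" by simp
  then have "S - s \<le> 5/6 * min l1 l2" using s by simp
  then show "- (5/12 * min l1 l2) \<le> sP l1 l2 z" by (simp add: sP_def s_def S_def field_simps)
qed

lemma sS_le: assumes "- 5/12 < z" "l1 \<le> K" "l2 \<le> K" shows "sS l1 l2 z \<le> 3 * K" "(sS l1 l2 z)\<^sup>2 \<le> 9 * K\<^sup>2"
proof -
  have K: "0 < K" using l assms by simp
  have "(l1 + l2)\<^sup>2 \<le> (2 * K)\<^sup>2" using l assms by (intro power_mono) auto
  then have "(l1 + l2)\<^sup>2 \<le> 4 * K\<^sup>2" by (simp add: power_mult_distrib)
  moreover have "l1 * l2 * (- z) \<le> l1 * l2 * 1" using l assms by (intro mult_left_mono) auto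
  then have "- (4 * (l1 * l2) * z) \<le> 4 * (l1 * l2)" by simp
  moreover have "l1 * l2 \<le> K\<^sup>2" unfolding power2_eq_square using l assms by (intro mult_mono) auto
  moreover have "0 \<le> K\<^sup>2" by simp
  ultimately have "(l1 + l2)\<^sup>2 - 4 * (l1 * l2) * z \<le> 9 * K\<^sup>2" by linarith
  then show *: "(sS l1 l2 z)\<^sup>2 \<le> 9 * K\<^sup>2" unfolding power2_eq_square [of "sS l1 l2 z"] sS_pos(3) .
  have "9 * K\<^sup>2 = (3 * K)\<^sup>2" by (simp only: power_mult_distrib power2_eq_square)
  then have "(sS l1 l2 z)\<^sup>2 \<le> (3 * K)\<^sup>2" using * by simp
  then show "sS l1 l2 z \<le> 3 * K" by (rule power2_le_imp_le) (use K in linarith)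
qed

text \<open>\<open>Q\<close> carries a factor \<open>1 - z\<close>, so \<open>Q^2\<close> is of
  second order at the end of the arc, whereas the room left by \<open>sP_gap\<close> is of first
  order. The power \<open>d ^ 4\<close> pays for the square of \<open>l1 * l2 \<ge> d^2\<close> in
  the denominator of \<open>Q^2\<close>.\<close>

lemma excise_pos_Q:
  fixes al d K q :: real
  assumes b: "d \<le> l1" "d \<le> l2" "l1 \<le> K" "l2 \<le> K" and d: "0 < d" "d \<le> 1" and K: "1 \<le> K"
    and zz: "- 5/12 < z" and al: "0 < al" "al \<le> 1/2" and q: "\<bar>q\<bar> \<le> al\<^sup>2 / (20 * K\<^sup>2) * d ^ 4"
  defines "Q \<equiv> q / (sqrt 2 * al * (l1 * l2 / sS l1 l2 z / (2 * (1 - z))))"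
  shows "Q\<^sup>2 \<le> al\<^sup>2 * d ^ 4 / 8" "0 \<le> z \<Longrightarrow> Q\<^sup>2 < 2 * al\<^sup>2 * (d * (l1 * l2 * (1 - z) / sS l1 l2 z))"
proof -
  define S L where "S = sS l1 l2 z" and "L = l1 * l2"
  have S: "0 < S" "S \<le> 3 * K" "S\<^sup>2 \<le> 9 * K\<^sup>2" using sS_pos sS_le [OF zz b(3,4)] by (simp_all add: S_def)
  have "d * d \<le> L" unfolding L_def using b d by (intro mult_mono) auto
  then have L: "d\<^sup>2 \<le> L" by (simp add: power2_eq_square)
  then have L0: "0 < L" using d zero_less_power [of d 2] by linarith
  have L2: "(d\<^sup>2)\<^sup>2 \<le> L\<^sup>2" using L by (intro power_mono) auto
  have "\<bar>q\<bar>\<^sup>2 \<le> (al\<^sup>2 / (20 * K\<^sup>2) * d ^ 4)\<^sup>2" by (rule power_mono [OF q]) simp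
  then have q2: "q\<^sup>2 \<le> al ^ 4 * d ^ 8 / (400 * K ^ 4)" by (simp add: power_mult_distrib power_divide)
  have Q: "Q = q * (sqrt 2 * S * (1 - z) / (al * L))"
    unfolding Q_def S_def [symmetric] L_def [symmetric] using S L0 al z by (simp add: field_simps)
  have Q2: "Q\<^sup>2 = q\<^sup>2 * (2 * S\<^sup>2 * (1 - z)\<^sup>2 / (al\<^sup>2 * L\<^sup>2))"
    unfolding Q by (simp add: power_mult_distrib power_divide)
  also have "\<dots> \<le> (al ^ 4 * d ^ 8 / (400 * K ^ 4)) * (2 * (9 * K\<^sup>2) * (17/12)\<^sup>2 / (al\<^sup>2 * (d\<^sup>2)\<^sup>2))"
    using z zz S(3) L L2 al d K by (intro mult_mono [OF q2] frac_le mult_mono mult_left_mono power_mono) auto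
  also have "\<dots> = al\<^sup>2 * d ^ 4 / 8 * (289 / 400 / K\<^sup>2)"
    using al d K by (simp add: field_simps flip: power_add power_mult)
  also have "\<dots> \<le> al\<^sup>2 * d ^ 4 / 8 * 1"
  proof (rule mult_left_mono)
    have "289 / 400 / K\<^sup>2 \<le> 1 / 1" using K by (intro frac_le) auto
    then show "289 / 400 / K\<^sup>2 \<le> 1" by simp
  qed simp
  finally show "Q\<^sup>2 \<le> al\<^sup>2 * d ^ 4 / 8" by simp
  assume z0: "0 \<le> z"
  define g where "g = L * (1 - z) / S"
  have g: "0 < g" using L0 z S by (simp add: g_def)
  have "Q\<^sup>2 = 2 * q\<^sup>2 * (S\<^sup>2 * S * (1 - z) / (al\<^sup>2 * (L\<^sup>2 * L))) * g"
    unfolding Q2 g_def using S(1) L0 al by (simp add: field_simps power2_eq_square)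
  also have "\<dots> \<le> 2 * (al ^ 4 * d ^ 8 / (400 * K ^ 4)) * (9 * K\<^sup>2 * (3 * K) * 1 / (al\<^sup>2 * ((d\<^sup>2)\<^sup>2 * d\<^sup>2))) * g"
    using z z0 S L0 L L2 al d K q2 g
    by (intro mult_right_mono mult_mono frac_le mult_left_mono) auto
  also have "\<dots> = 2 * al\<^sup>2 * (d * g) * (27 / 400 * d / K)"
    using al d K by (simp add: field_simps flip: power_add power_mult) (simp add: power_numeral_reduce)
  also have "\<dots> < 2 * al\<^sup>2 * (d * g) * 1"
  proof (rule mult_strict_left_mono)
    have "27 / 400 * d \<le> 27 / 400 * 1" using d by (intro mult_left_mono) auto
    then have "27 / 400 * d < K" using K by linarith
    then show "27 / 400 * d / K < 1" using K by simp
  qed (use al d g in simp)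
  finally show "Q\<^sup>2 < 2 * al\<^sup>2 * (d * (l1 * l2 * (1 - z) / sS l1 l2 z))"
    by (simp add: g_def L_def S_def)
qed

end

text \<open>The removed part of the positive axis has length proportional to \<open>c e\<close>,
  which is not smooth in \<open>e\<close>. Writing \<open>c\<close> as a minimum of two affine
  functions makes it the limit of the smooth roots \<open>sP\<close>.\<close>

locale fold_min = fold +
  fixes u1 v1 u2 v2 K :: real
  assumes c_eq: "\<And>e. e \<in> {0<..<1} \<Longrightarrow> c e = min (u1 + v1 * e) (u2 + v2 * e)"
    and l_ge: "\<And>e. e \<in> {0<..<1} \<Longrightarrow> e * (1 - e) \<le> u1 + v1 * e \<and> e * (1 - e) \<le> u2 + v2 * e"
    and l_le: "\<And>e. e \<in> {0<..<1} \<Longrightarrow> u1 + v1 * e \<le> K \<and> u2 + v2 * e \<le> K"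
    and v_le: "\<bar>v1\<bar> \<le> K" "\<bar>v2\<bar> \<le> K" and K: "1 \<le> K"
    and c_le: "\<And>e. e \<in> {0<..<1} \<Longrightarrow> c e \<le> 1"
begin

lemma symp_MGl_MG: "symp (slabs MGl) (slabs MG)"
proof -
  define l1 l2 where "l1 e = u1 + v1 * e" and "l2 e = u2 + v2 * e" for e :: real
  define S where "S p e = sS (l1 e) (l2 e) (zt p)" for p e
  define w wp we where "w p e = sqrt 2 * al * sP (l1 e) (l2 e) (zt p)"
    and "wp p e = sqrt 2 * al * (l1 e * l2 e / S p e / (2 * (1 - zt p)))"
    and "we p e = sqrt 2 * al * ((v1 + v2 - ((l1 e + l2 e) * (v1 + v2) - 2 * (v1 * l2 e + l1 e * v2) * zt p) / S p e) / 2)"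
    for p e
  have ld: "e * (1 - e) \<le> l1 e" "e * (1 - e) \<le> l2 e" if "e \<in> {0<..<1}" for e
    using l_ge [OF that] by (auto simp: l1_def l2_def)
  have lK: "l1 e \<le> K" "l2 e \<le> K" if "e \<in> {0<..<1}" for e
    using l_le [OF that] by (auto simp: l1_def l2_def)
  have l: "0 < l1 e" "0 < l2 e" if "e \<in> {0<..<1}" for e
  proof -
    have "0 < e * (1 - e)" using that by simp
    then show "0 < l1 e" "0 < l2 e" using ld [OF that] by linarith+
  qed
  have S_pos: "0 < S p e" if "p < 1" "e \<in> {0<..<1}" for p e
    unfolding S_def by (rule sS_pos(2) [OF l [OF that(2)] zt_less [OF that(1)]])
  let ?U = "{-2<..<1} \<times> {0<..<1} :: r2 set"
  have o: "open ?U" by (intro open_Times) auto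
  have U: "fst y < 1" "snd y \<in> {0<..<1}" if "y \<in> ?U" for y using that by (auto simp: mem_Times_iff)
  have "symp (slabs MG - {x. \<exists>p. 0 \<le> p \<and> p < 1 \<and> fst x = (w p (snd (snd x)), 0)}) (slabs MG)"
  \<comment> \<open>In the proof \<open>we / wp\<close> becomes
    \<open>(1 - z) * N / (l1 * l2)\<close>. The bound 21 is \<open>3/2 * 14\<close>, where
    \<open>14 = 6 + 4 + 4\<close> collects the three terms of \<open>N\<close>, and
    \<open>(e * (1 - e)) ^ 4 \<le> l1 * l2\<close>.\<close>
  proof (rule excision [where w = w and wp = wp and we = we
        and m = 4 and C = "21 * K\<^sup>2" and rr = "al\<^sup>2 / (20 * K\<^sup>2)" and hi = "\<lambda>e. sqrt 2 * al * c e"])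
    show "open (slabs MG)" by (rule open_MG)
    fix y assume y: "y \<in> ?U"
    note z = zt_less [OF U(1) [OF y]]
    have Sy: "S (fst y) (snd y) \<noteq> 0" using S_pos U y by (simp add: less_imp_neq [symmetric])
    have L: "((\<lambda>y::r2. l1 (snd y)) has_derivative (\<lambda>v. v1 * snd v)) (at y)"
      "((\<lambda>y::r2. l2 (snd y)) has_derivative (\<lambda>v. v2 * snd v)) (at y)"
      unfolding l1_def l2_def by (auto intro!: derivative_eq_intros)
    have Z: "((\<lambda>y. zt (fst y)) has_derivative (\<lambda>v. fst v / (2 * (1 - zt (fst y))))) (at y)"
      using zt_FD [OF U(1) [OF y] has_derivative_fst [OF has_derivative_ident]] by simp
    have S2: "((\<lambda>y. (l1 (snd y) + l2 (snd y))\<^sup>2 - 4 * (l1 (snd y) * l2 (snd y)) * zt (fst y)) has_derivative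
        (\<lambda>v. 2 * ((l1 (snd y) + l2 (snd y)) * (v1 + v2) - 2 * (v1 * l2 (snd y) + l1 (snd y) * v2) * zt (fst y)) * snd v
            - 4 * (l1 (snd y) * l2 (snd y)) / (2 * (1 - zt (fst y))) * fst v)) (at y)"
      by (rule has_derivative_eq_rhs [OF has_derivative_diff [OF has_derivative_power [OF has_derivative_add [OF L], of 2]
            has_derivative_mult [OF has_derivative_mult [OF has_derivative_const [of 4] has_derivative_mult [OF L]] Z]]])
        (simp add: fun_eq_iff, simp add: algebra_simps)
    note P = sS_pos(1) [OF l [OF U(2) [OF y]] z]
    have SD: "((\<lambda>y. S (fst y) (snd y)) has_derivative
        (\<lambda>v. ((l1 (snd y) + l2 (snd y)) * (v1 + v2) - 2 * (v1 * l2 (snd y) + l1 (snd y) * v2) * zt (fst y)) / S (fst y) (snd y) * snd v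
            - (l1 (snd y) * l2 (snd y)) / S (fst y) (snd y) / (1 - zt (fst y)) * fst v)) (at y)"
      unfolding S_def sS_def
      by (rule has_derivative_eq_rhs [OF has_derivative_real_sqrt [OF P S2]])
        (simp add: fun_eq_iff S_def sS_def [symmetric] inverse_eq_divide, use Sy z in \<open>simp add: S_def field_simps\<close>)
    have "((\<lambda>y. sqrt 2 * al * ((l1 (snd y) + l2 (snd y) - S (fst y) (snd y)) / 2)) has_derivative
        (\<lambda>v. wp (fst y) (snd y) * fst v + we (fst y) (snd y) * snd v)) (at y)"
      by (rule has_derivative_eq_rhs [OF has_derivative_mult_right [OF bounded_linear.has_derivative [OF bounded_linear_divide
             has_derivative_diff [OF has_derivative_add [OF L] SD]]]])
        (simp add: fun_eq_iff wp_def we_def, use Sy z in \<open>simp add: field_simps\<close>)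
    then show "((\<lambda>y. w (fst y) (snd y)) has_derivative
        (\<lambda>v. wp (fst y) (snd y) * fst v + we (fst y) (snd y) * snd v)) (at y)"
      by (simp add: w_def sP_def S_def)
  next
    have s: "smooth_on ?U (\<lambda>y. zt (fst y))" "smooth_on ?U (\<lambda>y. l1 (snd y))" "smooth_on ?U (\<lambda>y. l2 (snd y))"
      unfolding l1_def l2_def by (intro smooth_intros o; use U in simp)+
    have P: "0 < (l1 (snd y) + l2 (snd y))\<^sup>2 - 4 * (l1 (snd y) * l2 (snd y)) * zt (fst y)" if "y \<in> ?U" for y
      by (rule sS_pos(1) [OF l [OF U(2) [OF that]] zt_less [OF U(1) [OF that]]])
    have sS: "smooth_on ?U (\<lambda>y. S (fst y) (snd y))" unfolding S_def sS_def by (intro smooth_intros o s P)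
    have nz: "S (fst y) (snd y) \<noteq> 0" "2 * (1 - zt (fst y)) \<noteq> 0" if "y \<in> ?U" for y
      using S_pos [of "fst y" "snd y"] zt_less [of "fst y"] U [OF that] by auto
    show "smooth_on ?U (\<lambda>y. wp (fst y) (snd y))" "smooth_on ?U (\<lambda>y. we (fst y) (snd y))"
      unfolding wp_def we_def by (intro smooth_intros o s sS nz; simp)+
  next
    fix p e :: real assume "p \<in> {-2<..<1}" "e \<in> {0<..<1}"
    then show "0 < wp p e" using l [of e] S_pos [of p e] zt_less [of p] al by (simp add: wp_def)
  next
    fix p e :: real assume p: "p \<in> {-1..<1}" and e: "e \<in> {0<..<1}"
    define z where "z = zt p"
    note zb = zt_bounds(1,2) [OF p, folded z_def]
    define d where "d = e * (1 - e)"
    have d: "0 < d" using e by (simp add: d_def)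
    have d1: "d \<le> 1" unfolding d_def using e by (intro mult_le_one) auto
    note lb = ld [OF e, folded d_def] lK [OF e]
    define a b where "a = l1 e" and "b = l2 e"
    note ab = l [OF e, folded a_def b_def] lb [folded a_def b_def]
    have Sp: "0 < S p e" using S_pos p e by auto
    have SK: "S p e \<le> 3 * K" unfolding S_def z_def [symmetric] a_def [symmetric] b_def [symmetric]
      by (rule sS_le(1) [OF ab(1,2) zb(2,1) ab(5,6)])
    define N where "N = S p e * (v1 + v2) - ((a + b) * (v1 + v2) - 2 * (v1 * b + a * v2) * z)"
    have rat: "we p e / wp p e = (1 - z) * N / (a * b)"
      using Sp zb al ab(1,2) unfolding we_def wp_def z_def [symmetric] a_def [symmetric] b_def [symmetric] N_def
      by (simp add: field_simps)
    have vv: "\<bar>v1 + v2\<bar> \<le> 2 * K" using v_le by linarith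
    have n1: "\<bar>S p e * (v1 + v2)\<bar> \<le> 3 * K * (2 * K)" unfolding abs_mult
      using SK Sp vv K by (intro mult_mono) auto
    have n2: "\<bar>(a + b) * (v1 + v2)\<bar> \<le> 2 * K * (2 * K)" unfolding abs_mult
      using ab vv K by (intro mult_mono) auto
    have n3: "\<bar>v1 * b\<bar> \<le> K * K" "\<bar>a * v2\<bar> \<le> K * K" unfolding abs_mult
      using ab v_le K by (intro mult_mono; auto)+
    have "\<bar>v1 * b + a * v2\<bar> * \<bar>z\<bar> \<le> (2 * (K * K)) * 1" using n3 zb K by (intro mult_mono) auto
    moreover have "\<bar>2 * (v1 * b + a * v2) * z\<bar> = 2 * (\<bar>v1 * b + a * v2\<bar> * \<bar>z\<bar>)"
      by (simp only: abs_mult mult.assoc abs_numeral)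
    ultimately have n4: "\<bar>2 * (v1 * b + a * v2) * z\<bar> \<le> 4 * (K * K)" by linarith
    have "\<bar>N\<bar> \<le> 14 * (K * K)" unfolding N_def using n1 n2 n4 by linarith
    then have "(1 - z) * \<bar>N\<bar> \<le> 3/2 * (14 * (K * K))" using zb by (intro mult_mono) auto
    then have n: "\<bar>(1 - z) * N\<bar> \<le> 21 * K\<^sup>2" using zb by (simp add: abs_mult power2_eq_square)
    have dd: "d ^ 4 \<le> a * b"
    proof -
      have "d ^ 4 \<le> d\<^sup>2" using d d1 by (intro power_decreasing) auto
      also have "d\<^sup>2 \<le> a * b" unfolding power2_eq_square using ab d by (intro mult_mono) auto
      finally show ?thesis .
    qed
    have "\<bar>we p e / wp p e\<bar> * d ^ 4 = \<bar>(1 - z) * N\<bar> * (d ^ 4 / (a * b))"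
      unfolding rat using ab by (simp add: abs_mult)
    also have "\<dots> \<le> 21 * K\<^sup>2 * 1" using n dd ab d by (intro mult_mono) auto
    finally show "\<bar>we p e / wp p e\<bar> * (e * (1 - e)) ^ 4 \<le> 21 * K\<^sup>2" by (simp add: d_def)
    fix q assume "\<bar>q\<bar> \<le> al\<^sup>2 / (20 * K\<^sup>2) * (e * (1 - e)) ^ 4"
    then have q: "\<bar>q\<bar> \<le> al\<^sup>2 / (20 * K\<^sup>2) * d ^ 4" by (simp add: d_def)
    define Q where "Q = q / wp p e"
    have Qe: "Q = q / (sqrt 2 * al * (a * b / sS a b z / (2 * (1 - z))))"
      by (simp add: Q_def wp_def a_def b_def z_def S_def)
    note Q1 = excise_pos_Q [OF ab(1,2) zb(2) ab(3-6) d d1 K zb(1) al al_half q, folded Qe]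
    have c0: "0 < c e" using c_pos e by simp
    have cm: "c e = min a b" using c_eq [OF e] by (simp add: a_def b_def l1_def l2_def)
    have dc: "d \<le> c e" using ab by (simp add: cm)
    define P where "P = sP a b z"
    have weq: "w p e = sqrt 2 * al * P" by (simp add: w_def P_def a_def b_def z_def)
    have "d ^ 4 \<le> d\<^sup>2" using d d1 by (intro power_decreasing) auto
    also have "d\<^sup>2 \<le> (c e)\<^sup>2" using dc d by (intro power_mono) auto
    finally have "al\<^sup>2 * d ^ 4 \<le> al\<^sup>2 * (c e)\<^sup>2" by (intro mult_left_mono) auto
    moreover have ac: "0 < al\<^sup>2 * (c e)\<^sup>2" using al c0 by simp
    ultimately have Qc: "Q\<^sup>2 < al\<^sup>2 * (c e)\<^sup>2" using Q1(1) by linarith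
    have a2: "al\<^sup>2 \<le> 1/4" using power_mono [of al "1/2" 2] al al_half by (simp add: power2_eq_square)
    have "al\<^sup>2 * d ^ 4 \<le> 1/4 * 1" using a2 d d1 by (intro mult_mono power_le_one) auto
    then have Q3: "Q\<^sup>2 \<le> 1/32" using Q1(1) by linarith
    have nz: "nz (w p e, Q) = 2 * (al\<^sup>2 * P\<^sup>2) + Q\<^sup>2"
      unfolding weq by (simp add: nz_def power_mult_distrib)
    have "MG (w p e, Q) e"
    proof (cases "0 \<le> z")
      case True
      have P0: "0 \<le> P" unfolding P_def by (rule sP_nonneg [OF ab(1,2) zb(2) True])
      define g where "g = a * b * (1 - z) / sS a b z"
      have g: "0 < g" using ab zb sS_pos(2) [OF ab(1,2) zb(2)] by (simp add: g_def)
      have cP: "g \<le> c e - P" unfolding cm g_def P_def by (rule sP_gap [OF ab(1,2) zb(2)])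
      \<comment> \<open>\<open>(c e)^2 - P^2\<close> factors as
        \<open>(c e + P) * (c e - P)\<close>, with first factor at least \<open>d\<close> and second
        at least \<open>g\<close>; this exceeds what \<open>Q\<close> consumes.\<close>
      have "d * g \<le> (c e + P) * (c e - P)" using dc P0 cP g d by (intro mult_mono) auto
      then have "2 * al\<^sup>2 * (d * g) \<le> 2 * al\<^sup>2 * ((c e + P) * (c e - P))" by (intro mult_left_mono) auto
      also have "\<dots> = 2 * al\<^sup>2 * (c e)\<^sup>2 - 2 * al\<^sup>2 * P\<^sup>2" by (simp add: power2_eq_square algebra_simps)
      finally have "Q\<^sup>2 < 2 * al\<^sup>2 * (c e)\<^sup>2 - 2 * al\<^sup>2 * P\<^sup>2" using Q1(2) [OF True] by (simp add: g_def)
      moreover have "0 \<le> w p e" using P0 al by (simp add: weq)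
      ultimately show ?thesis using Q3
        by (intro MG_member_pos c0) (auto simp: nz power_mult_distrib)
    next
      case False
      then have "P \<le> 0" "- (5/12 * c e) \<le> P" using sP_neg [OF ab(1,2) zb(2) _ zb(1)] by (auto simp: P_def cm)
      then have "\<bar>P\<bar> \<le> 5/12" using c_le [OF e] by linarith
      then have "\<bar>P\<bar>\<^sup>2 \<le> (5/12)\<^sup>2" by (intro power_mono) auto
      then have P2: "P\<^sup>2 \<le> 25/144" by (simp add: power2_eq_square)
      have "al\<^sup>2 * P\<^sup>2 \<le> 1/4 * (25/144)" using a2 P2 by (intro mult_mono) auto
      moreover have "w p e \<le> 0" using \<open>P \<le> 0\<close> al by (simp add: weq mult_nonneg_nonpos)
      ultimately show ?thesis using Q3 Qc ac
        by (intro MG_member_neg c0) (auto simp: nz power_mult_distrib)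
    qed
    then show "MG (w p e, q / wp p e) e" by (simp add: Q_def)
  next
    fix e :: real assume e: "e \<in> {0<..<1}"
    have "0 < sqrt 2 * al * c e" using al c_pos e by simp
    then show "\<not> MG (sqrt 2 * al * c e, 0) e" using MG_axis_pos by simp
    let ?F = "at (1::real, e) within {-1..<1} \<times> {0<..<1}"
    have t: "(fst \<longlongrightarrow> 1) ?F" "(snd \<longlongrightarrow> e) ?F"
      using tendsto_fst [OF tendsto_ident_at, of "(1, e)"] tendsto_snd [OF tendsto_ident_at, of "(1, e)"]
      by simp_all
    have z1: "zt 1 = 1" by (simp add: zt_def)
    have lz: "((\<lambda>y. zt (fst y)) \<longlongrightarrow> 1) ?F"
    proof -
      have "((\<lambda>y. zt (fst y)) \<longlongrightarrow> zt 1) ?F" unfolding zt_def by (intro tendsto_intros t)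
      then show ?thesis by (simp only: z1)
    qed
    have ll: "((\<lambda>y. l1 (snd y)) \<longlongrightarrow> l1 e) ?F" "((\<lambda>y. l2 (snd y)) \<longlongrightarrow> l2 e) ?F"
      unfolding l1_def l2_def by (intro tendsto_intros t)+
    have lS: "((\<lambda>y. S (fst y) (snd y)) \<longlongrightarrow> sS (l1 e) (l2 e) 1) ?F" unfolding S_def sS_def
      by (intro tendsto_intros lz ll)
    have "sS (l1 e) (l2 e) 1 = sqrt ((l1 e - l2 e)\<^sup>2)" unfolding sS_def
      by (rule arg_cong [where f = sqrt]) (simp add: power2_eq_square algebra_simps)
    then have "(l1 e + l2 e - sS (l1 e) (l2 e) 1) / 2 = min (l1 e) (l2 e)" by (simp add: min_def abs_if)
    then have ce: "(l1 e + l2 e - sS (l1 e) (l2 e) 1) / 2 = c e" using c_eq [OF e] by (simp add: l1_def l2_def)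
    have "((\<lambda>y. sqrt 2 * al * ((l1 (snd y) + l2 (snd y) - S (fst y) (snd y)) / 2)) \<longlongrightarrow>
        sqrt 2 * al * ((l1 e + l2 e - sS (l1 e) (l2 e) 1) / 2)) ?F"
      by (intro tendsto_intros ll lS) simp
    then show "((\<lambda>y. w (fst y) (snd y)) \<longlongrightarrow> sqrt 2 * al * c e) ?F"
      unfolding ce by (simp add: w_def sP_def S_def)
    have "((\<lambda>y. S (fst y) (snd y) * (2 * (1 - zt (fst y))) / (sqrt 2 * al * (l1 (snd y) * l2 (snd y)))) \<longlongrightarrow>
        sS (l1 e) (l2 e) 1 * (2 * (1 - 1)) / (sqrt 2 * al * (l1 e * l2 e))) ?F"
      by (intro tendsto_intros lz ll lS) (use l [OF e] al in auto)
    then show "((\<lambda>y. 1 / wp (fst y) (snd y)) \<longlongrightarrow> 0) ?F" by (simp add: wp_def mult.assoc)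
  qed (use al K in simp)
  moreover have "slabs MG - {x. \<exists>p. 0 \<le> p \<and> p < 1 \<and> fst x = (w p (snd (snd x)), 0)} = slabs MGl"
  proof -
    have "(\<exists>p. 0 \<le> p \<and> p < 1 \<and> fst x = (w p (snd (snd x)), 0)) \<longleftrightarrow>
        snd (fst x) = 0 \<and> 0 \<le> fst (fst x)" if x: "x \<in> slabs MG" for x
    proof
      have e: "snd (snd x) \<in> {0<..<1}" using x by (simp add: slabs_def)
      assume "\<exists>p. 0 \<le> p \<and> p < 1 \<and> fst x = (w p (snd (snd x)), 0)"
      then obtain p where p: "0 \<le> p" "p < 1" "fst x = (w p (snd (snd x)), 0)" by blast
      have "0 \<le> w p (snd (snd x))" unfolding w_def
        using sP_nonneg [OF l [OF e] zt_less [OF p(2)] zt_nonneg [OF p(1)]] al by simp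
      then show "snd (fst x) = 0 \<and> 0 \<le> fst (fst x)" using p(3) by simp
    next
      define e where "e = snd (snd x)"
      define P where "P = fst (fst x)"
      assume "snd (fst x) = 0 \<and> 0 \<le> fst (fst x)"
      then have f: "fst x = (P, 0)" "0 \<le> P" by (simp_all add: P_def prod_eq_iff)
      have e: "e \<in> {0<..<1}" using x by (simp add: slabs_def e_def)
      define a b where "a = l1 e" and "b = l2 e"
      note ab = l [OF e, folded a_def b_def]
      have cm: "c e = min a b" using c_eq [OF e] by (simp add: a_def b_def l1_def l2_def)
      have c0: "0 < c e" using c_pos e by simp
      have "MG (P, 0) e" using x by (simp add: slabs_def f e_def)
      then have "P < sqrt 2 * al * c e"
        using MG_axis_pos [of P e] f(2) al c0 by (cases "P = 0") auto
      then have P1: "P / (sqrt 2 * al) < c e" using al by (simp add: pos_divide_less_eq mult_ac)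
      define R where "R = P / (sqrt 2 * al)"
      have R: "0 \<le> R" "R < a" "R < b" using P1 f al by (auto simp: R_def cm)
      \<comment> \<open>This value makes \<open>R\<close> a root of the quadratic equation and its
        discriminant the square of \<open>a + b - 2 * R\<close>; \<open>R\<close> below both
        \<open>a\<close> and \<open>b\<close> makes it the smaller root.\<close>
      define z where "z = R * (a + b - R) / (a * b)"
      have z0: "0 \<le> z" using R ab by (simp add: z_def)
      have "1 - z = (a - R) * (b - R) / (a * b)" using ab by (simp add: z_def field_simps)
      then have "0 < 1 - z" using R ab by simp
      then obtain p where p: "0 \<le> p" "p < 1" "zt p = z" using zt_inverse z0 by (metis diff_gt_0_iff_gt)
      have "a * b * z = R * (a + b - R)" using ab by (simp add: z_def)
      then have "(a + b)\<^sup>2 - 4 * (a * b) * z = (a + b - 2 * R)\<^sup>2" by (simp add: power2_eq_square algebra_simps)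
      then have "sS a b z = a + b - 2 * R" unfolding sS_def using R by simp
      then have "w p e = P" unfolding w_def p(3) a_def [symmetric] b_def [symmetric] using al by (simp add: sP_def R_def)
      then show "\<exists>p. 0 \<le> p \<and> p < 1 \<and> fst x = (w p (snd (snd x)), 0)" using p f by (auto simp: e_def)
    qed
    moreover have "x \<in> slabs MGl \<longleftrightarrow> x \<in> slabs MG \<and> \<not> (snd (fst x) = 0 \<and> 0 \<le> fst (fst x))" for x
      by (simp add: slabs_def MGl_def conj_assoc)
    ultimately show ?thesis by (intro set_eqI) (simp only: Diff_iff mem_Collect_eq cong: conj_cong)
  qed
  ultimately show ?thesis by simp
qed

lemma symp_unfold: "symp (slabs (bx be c)) (slabs (bx 0 c))"
proof -
  have "e * (1 - e) \<le> c e" if "e \<in> {0<..<1}" for e using l_ge [OF that] c_eq [OF that] by simp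
  note 1 = symp_MGu_MG [OF this]
  note 2 = symp_trans [OF symp_sym [OF symp_K1_bx] symp_trans [OF symp_K1_MGl symp_MGl_MG]]
  note 3 = symp_trans [OF symp_sym [OF 1] symp_trans [OF symp_sym [OF symp_HG_MGu] symp_HG_bx]]
  show ?thesis by (rule symp_trans [OF 2 3])
qed

end

section \<open>Products of squares and diamonds\<close>

lemma symp_bx_reflect:
  assumes "continuous_on UNIV c"
  shows "symp (slabs (bx a c)) (slabs (bx (1 - a) c))"
proof (rule symp_slabs_map [where W = UNIV and \<phi> = "\<lambda>w. (1 - fst w, - snd w)"])
  show "smooth_on UNIV (\<lambda>w::r2. (1 - fst w, - snd w))" by (intro smooth_intros open_UNIV)
  show "inj_on (\<lambda>w::r2. (1 - fst w, - snd w)) UNIV" by (rule inj_onI) (simp add: prod_eq_iff)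
  show "area_on UNIV (\<lambda>w. (1 - fst w, - snd w))"
    by (rule area_onI [where a = "\<lambda>_. -1" and b = "\<lambda>_. 0" and c = "\<lambda>_. 0" and d = "\<lambda>_. -1"])
      (auto intro!: derivative_eq_intros)
  show "open (slabs (bx a c))" by (rule open_bx [OF assms])
  show "bx (1 - a) c w e \<longleftrightarrow> (\<exists>v. bx a c v e \<and> w = (1 - fst v, - snd v))" for w e
  proof
    assume "bx (1 - a) c w e"
    then have "bx a c (1 - fst w, - snd w) e" by (auto simp: bx_def algebra_simps)
    moreover have "w = (1 - fst (1 - fst w, - snd w), - snd (1 - fst w, - snd w))" by (simp add: prod_eq_iff)
    ultimately show "\<exists>v. bx a c v e \<and> w = (1 - fst v, - snd v)" by blast
  qed (auto simp: bx_def algebra_simps)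
qed simp_all

text \<open>Folding needs \<open>al = 1 - a\<close> positive and at most \<open>be = a\<close>. A
  half-turn of the fibre exchanges \<open>a\<close> and \<open>1 - a\<close> and so reduces the case
  \<open>a < 1/2\<close> to this one; for \<open>a = 1\<close> it gives the claim by itself.\<close>

lemma symp_bx_zero:
  fixes c :: "real \<Rightarrow> real"
  assumes a: "0 \<le> a" "a \<le> 1" and cont: "continuous_on UNIV c"
    and c: "\<And>e. e \<in> {0<..<1} \<Longrightarrow> c e = min (u1 + v1 * e) (u2 + v2 * e)"
    and l_ge: "\<And>e. e \<in> {0<..<1} \<Longrightarrow> e * (1 - e) \<le> u1 + v1 * e \<and> e * (1 - e) \<le> u2 + v2 * e"
    and l_le: "\<And>e. e \<in> {0<..<1} \<Longrightarrow> u1 + v1 * e \<le> K \<and> u2 + v2 * e \<le> K"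
    and v_le: "\<bar>v1\<bar> \<le> K" "\<bar>v2\<bar> \<le> K" and K: "1 \<le> K"
    and c_le: "\<And>e. e \<in> {0<..<1} \<Longrightarrow> c e \<le> 1"
  shows "symp (slabs (bx a c)) (slabs (bx 0 c))"
proof -
  have pos: "0 < c e" if "0 < e" "e < 1" for e
  proof -
    have "0 < e * (1 - e)" using that by simp
    moreover have "e * (1 - e) \<le> u1 + v1 * e \<and> e * (1 - e) \<le> u2 + v2 * e" using l_ge that by simp
    ultimately have "0 < u1 + v1 * e" "0 < u2 + v2 * e" by linarith+
    then show ?thesis using c [of e] that by simp
  qed
  have main: "symp (slabs (bx a c)) (slabs (bx 0 c))" if "1/2 \<le> a" "a < 1" for a
  proof -
    interpret fold_min "1 - a" a c u1 v1 u2 v2 K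
      by (unfold_locales; (fact cont pos c l_ge l_le v_le K c_le | (use that in linarith)))
    show ?thesis by (rule symp_unfold)
  qed
  consider "a = 0" | "a = 1" | "1/2 \<le> a" "a < 1" | "0 < a" "a < 1/2" using a by linarith
  then show ?thesis
  proof cases
    case 1 then show ?thesis using symp_refl [OF open_bx [OF cont]] by simp
  next
    case 2 then show ?thesis using symp_bx_reflect [OF cont, of 1] by simp
  next
    case 3 then show ?thesis by (rule main)
  next
    case 4 then show ?thesis using symp_trans [OF symp_bx_reflect [OF cont] main [of "1 - a"]] by simp
  qed
qed

text \<open>The width of the diamond \<open>diamond a1 a\<close> at height \<open>e\<close>, for any \<open>a1\<close>.\<close>

definition cc :: "real \<Rightarrow> real \<Rightarrow> real" where
  "cc a e = (if a = 0 then 1 - e else if a = 1 then e else min ((1 - e) / (1 - a)) (e / a))"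

text \<open>The form without divisions treats \<open>a = 0\<close> and \<open>a = 1\<close> together
  with the rest, and shows that \<open>cc a e\<close> is the largest admissible weight in
  \<open>mem_diamond\<close>.\<close>

lemma le_cc:
  assumes "0 \<le> a" "a \<le> 1" "0 < e" "e < 1"
  shows "x \<le> cc a e \<longleftrightarrow> a * x \<le> e \<and> (1 - a) * x \<le> 1 - e"
    and "x < cc a e \<longleftrightarrow> a * x < e \<and> (1 - a) * x < 1 - e"
proof -
  consider "a = 0" | "a = 1" | "0 < a" "0 < 1 - a" using assms by linarith
  note cs = this
  show "x \<le> cc a e \<longleftrightarrow> a * x \<le> e \<and> (1 - a) * x \<le> 1 - e"
    using cs by cases (use assms in \<open>auto simp: cc_def pos_le_divide_eq mult.commute [of x]\<close>)
  show "x < cc a e \<longleftrightarrow> a * x < e \<and> (1 - a) * x < 1 - e"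
    using cs by cases (use assms in \<open>auto simp: cc_def pos_less_divide_eq mult.commute [of x]\<close>)
qed

lemma cc_le_1: assumes "0 \<le> a" "a \<le> 1" "0 < e" "e < 1" shows "cc a e \<le> 1"
proof (rule ccontr)
  assume "\<not> cc a e \<le> 1"
  then have "1 < cc a e" by simp
  then have "a * 1 < e \<and> (1 - a) * 1 < 1 - e" using le_cc(2) [OF assms, of 1] by blast
  then have "a < e" "e < a" by simp_all
  then show False by simp
qed

lemma continuous_cc: "continuous_on UNIV (cc a)"
proof -
  consider "a = 0" | "a = 1" | "a \<noteq> 0" "a \<noteq> 1" by blast
  then show ?thesis
  proof cases
    case 3
    then have "cc a = (\<lambda>e. min ((1 - e) / (1 - a)) (e / a))" by (simp add: cc_def fun_eq_iff)
    then show ?thesis using 3 by (auto intro!: continuous_intros)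
  qed (auto simp: cc_def [abs_def] intro!: continuous_intros)
qed

lemma prod_le_right: "0 < e \<Longrightarrow> e < 1 \<Longrightarrow> e * (1 - e) \<le> (1 - e :: real)"
  "0 < e \<Longrightarrow> e < 1 \<Longrightarrow> e * (1 - e) \<le> (e :: real)"
  by (simp_all add: mult_left_le mult_left_le_one_le)

text \<open>The constant 1 serves as the second of the two affine functions.\<close>

lemma symp_triangle_zero: assumes "0 \<le> a" "a \<le> 1"
  shows "symp (slabs (bx a (\<lambda>e. 1 - e))) (slabs (bx 0 (\<lambda>e. 1 - e)))"
proof (rule symp_bx_zero [OF assms, where ?u1.0 = 1 and ?v1.0 = "-1" and ?u2.0 = 1 and ?v2.0 = 0 and K = 1])
  show "continuous_on UNIV (\<lambda>e::real. 1 - e)" by (intro continuous_intros)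
  fix e :: real assume e: "e \<in> {0<..<1}"
  then show "1 - e = min (1 + - 1 * e) (1 + 0 * e)" "1 - e \<le> 1" "1 + - 1 * e \<le> 1 \<and> 1 + 0 * e \<le> 1" by auto
  have "e * (1 - e) \<le> 1 - e" "1 - e \<le> 1" using prod_le_right(1) [of e] e by auto
  then show "e * (1 - e) \<le> 1 + - 1 * e \<and> e * (1 - e) \<le> 1 + 0 * e" by linarith
qed simp_all

lemma symp_cc_zero: assumes a: "0 \<le> a" "a \<le> 1" and b: "0 \<le> b" "b \<le> 1"
  shows "symp (slabs (bx a (cc b))) (slabs (bx 0 (cc b)))"
proof -
  consider "b = 0" | "b = 1" | "0 < b" "b < 1" using b by linarith
  then show ?thesis
  proof cases
    case 1
    have "cc b = (\<lambda>e. 1 - e)" by (simp add: 1 cc_def fun_eq_iff)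
    then show ?thesis using symp_triangle_zero [OF a] by simp
  next
    case 2
    then have c: "cc b = (\<lambda>e. e)" by (simp add: cc_def fun_eq_iff)
    show ?thesis unfolding c
    proof (rule symp_bx_zero [OF a, where ?u1.0 = 0 and ?v1.0 = 1 and ?u2.0 = 1 and ?v2.0 = 0 and K = 1])
      show "continuous_on UNIV (\<lambda>e::real. e)" by (intro continuous_intros)
      fix e :: real assume e: "e \<in> {0<..<1}"
      then show "e = min (0 + 1 * e) (1 + 0 * e)" "e \<le> 1" "0 + 1 * e \<le> 1 \<and> 1 + 0 * e \<le> 1" by auto
      have "e * (1 - e) \<le> e" "e \<le> 1" using prod_le_right(2) [of e] e by auto
      then show "e * (1 - e) \<le> 0 + 1 * e \<and> e * (1 - e) \<le> 1 + 0 * e" by linarith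
    qed simp_all
  next
    case 3
    define p q where "p = 1 / (1 - b)" and "q = 1 / b"
    have pq: "1 \<le> p" "1 \<le> q" using 3 by (simp_all add: p_def q_def)
    show ?thesis
    proof (rule symp_bx_zero [OF a continuous_cc, where ?u1.0 = p and ?v1.0 = "- p" and ?u2.0 = 0 and ?v2.0 = q and K = "p + q"])
      fix e :: real assume e: "e \<in> {0<..<1}"
      have l: "p + - p * e = p * (1 - e)" by (simp add: algebra_simps)
      show "cc b e = min (p + - p * e) (0 + q * e)" unfolding l using 3 by (simp add: cc_def p_def q_def)
      have "1 * (1 - e) \<le> p * (1 - e)" "1 * e \<le> q * e" using pq e by (auto intro!: mult_right_mono)
      then show "e * (1 - e) \<le> p + - p * e \<and> e * (1 - e) \<le> 0 + q * e"
        unfolding l using prod_le_right [of e] e by auto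
      have "p * (1 - e) \<le> p * 1" "q * e \<le> q * 1" using pq e by (intro mult_left_mono; auto)+
      then have "p * (1 - e) \<le> p + q" "0 + q * e \<le> p + q" using pq by linarith+
      then show "p + - p * e \<le> p + q \<and> 0 + q * e \<le> p + q" unfolding l by blast
      show "cc b e \<le> 1" using cc_le_1 b e by simp
    qed (use pq in auto)
  qed
qed

text \<open>In the coordinates \<open>Y = snd (fst x)\<close> and \<open>e\<close>, the domain is
  the triangle \<open>b * Y < e\<close>, \<open>(1 - b) * Y < 1 - e\<close>, while their conjugates
  range over unit intervals. Read the other way, at height \<open>Y\<close> the coordinate
  \<open>e\<close> runs through an interval of length \<open>1 - Y\<close> which the value
  \<open>b\<close> divides in the ratio \<open>b : 1 - b\<close>.\<close>

lemma symp_swap: assumes b: "0 \<le> b" "b \<le> 1"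
  shows "symp (slabs (bx 0 (cc b))) (slabs (bx b (\<lambda>e. 1 - e)))"
proof (rule sympI [where f = "\<lambda>x. ((fst (snd x), snd (snd x) - b), (fst (fst x), snd (fst x)))"])
  let ?f = "\<lambda>x::r4. ((fst (snd x), snd (snd x) - b), (fst (fst x), snd (fst x)))"
  let ?U = "slabs (bx 0 (cc b))" and ?V = "slabs (bx b (\<lambda>e. 1 - e))"
  show o: "open ?U" by (rule open_bx [OF continuous_cc])
  show "smooth_on ?U ?f" by (intro smooth_intros o)
  show "sympl_on ?U ?f"
    by (rule sympl_onI [where ?d1.0 = "\<lambda>_ v. fst (snd v)" and ?d2.0 = "\<lambda>_ v. snd (snd v)"
          and ?d3.0 = "\<lambda>_ v. fst (fst v)" and ?d4.0 = "\<lambda>_ v. snd (fst v)"])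
      (auto intro!: derivative_eq_intros simp: om_def area_def)
  show "inj_on ?f ?U" by (rule inj_onI) (simp add: prod_eq_iff)
  have key: "x \<in> ?U \<longleftrightarrow> ?f x \<in> ?V" for x
  proof -
    obtain X Y t e where x: "x = ((X, Y), (t, e))" by (metis surj_pair)
    have "0 < Y \<and> Y < cc b e \<and> 0 < e \<and> e < 1 \<longleftrightarrow>
        - b * (1 - Y) < e - b \<and> e - b < (1 - b) * (1 - Y) \<and> 0 < Y \<and> Y < 1" (is "?L \<longleftrightarrow> ?R")
    proof
      assume L: ?L
      then have "b * Y < e" "(1 - b) * Y < 1 - e" using le_cc(2) [OF b, of e Y] by auto
      then show ?R using L by (auto simp: algebra_simps)
    next
      assume R: ?R
      then have r: "b * Y < e" "(1 - b) * Y < 1 - e" by (auto simp: algebra_simps)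
      moreover have "0 \<le> b * Y" "0 \<le> (1 - b) * Y" using R b by auto
      ultimately have "0 < e" "e < 1" by linarith+
      then show ?L using R r le_cc(2) [OF b, of e Y] by auto
    qed
    then show ?thesis
      by (simp only: x slabs_def bx_def mem_Collect_eq fst_conv snd_conv minus_zero mult_zero_left diff_zero mult_1_left)
        blast
  qed
  show "?f ` ?U = ?V"
  proof (intro subset_antisym subsetI)
    fix y assume "y \<in> ?f ` ?U" then show "y \<in> ?V" using key by blast
  next
    fix y assume y: "y \<in> ?V"
    define x where "x = ((fst (snd y), snd (snd y)), (fst (fst y), snd (fst y) + b))"
    have fx: "?f x = y" by (simp add: x_def prod_eq_iff)
    have "x \<in> ?U" by (rule key [THEN iffD2]) (simp only: fx y)
    from imageI [OF this, of ?f] show "y \<in> ?f ` ?U" by (simp only: fx)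
  qed
qed

lemma symp_cc_ball:
  assumes "0 \<le> a" "a \<le> 1" "0 \<le> b" "b \<le> 1"
  shows "symp (slabs (bx a (cc b))) ball4"
  by (rule symp_trans [OF symp_cc_zero [OF assms] symp_trans [OF symp_swap [OF assms(3,4)]
        symp_trans [OF symp_triangle_zero [OF assms(3,4)] symp_triangle_ball]]])

section \<open>Transfer to the coordinates of the statement\<close>

type_synonym v4 = "(real^2) \<times> (real^2)"

definition Lv :: "r4 \<Rightarrow> v4" where
  "Lv x = (vector [fst (fst x), fst (snd x)], vector [snd (fst x), snd (snd x)])"
definition Li :: "v4 \<Rightarrow> r4" where
  "Li z = ((fst z $ 1, snd z $ 1), (fst z $ 2, snd z $ 2))"

lemma Lv_Li [simp]: "Lv (Li z) = z" "Li (Lv x) = x"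
  by (simp_all add: Lv_def Li_def prod_eq_iff vec_eq_iff forall_2)

lemma bounded_linear_Lv: "bounded_linear Lv"
  unfolding linear_conv_bounded_linear [symmetric] Lv_def
  by (rule linearI) (simp_all add: prod_eq_iff vec_eq_iff forall_2)

lemma bounded_linear_Li: "bounded_linear Li"
  unfolding linear_conv_bounded_linear [symmetric] Li_def
  by (rule linearI) (simp_all add: prod_eq_iff)

lemma omega_Lv: "omega (Lv v) (Lv w) = om v w"
  by (simp add: omega_def Lv_def om_def area_def inner_vec_def sum_2)

lemma Lv_image: "Lv ` U = Li -` U"
proof (intro set_eqI iffI)
  fix z assume "z \<in> Li -` U" then show "z \<in> Lv ` U" using imageI [of "Li z" U Lv] by simp
qed auto

lemma Lv_ball4: "Lv ` ball4 = ball 0 (1 / sqrt pi)"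
proof -
  have "z \<in> Li -` ball4 \<longleftrightarrow> norm z < 1 / sqrt pi" for z
  proof -
    define S where "S = nz (fst (Li z)) + nz (snd (Li z))"
    have "norm z = sqrt S" unfolding norm_eq_sqrt_inner
      by (rule arg_cong [where f = sqrt]) (simp add: S_def Li_def nz_def inner_prod_def inner_vec_def sum_2 power2_eq_square)
    moreover have "1 / sqrt pi = sqrt (1 / pi)" by (simp add: real_sqrt_divide)
    moreover have "z \<in> Li -` ball4 \<longleftrightarrow> S < 1 / pi"
      by (simp add: ball4_def S_def pos_less_divide_eq) (simp add: algebra_simps)
    ultimately show ?thesis by (simp only: real_sqrt_less_iff)
  qed
  note key = this
  show ?thesis unfolding Lv_image
  proof (rule set_eqI)
    fix z :: v4 show "z \<in> Li -` ball4 \<longleftrightarrow> z \<in> ball 0 (1 / sqrt pi)" unfolding key by simp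
  qed
qed

lemma symplectomorphicI:
  assumes "open U" "open V" "\<And>x. x \<in> U \<Longrightarrow> f x \<in> V \<and> g (f x) = x" "\<And>y. y \<in> V \<Longrightarrow> g y \<in> U \<and> f (g y) = y"
    "smooth_on U f" "smooth_on V g"
    "\<And>x v w. x \<in> U \<Longrightarrow>
      omega (frechet_derivative f (at x) v) (frechet_derivative f (at x) w) = omega v w"
  shows "symplectomorphic U V"
  unfolding symplectomorphic_def using assms by blast

lemma symp_ball_Lv: assumes "symp U ball4" shows "symp_ball (Lv ` U)"
proof -
  obtain f where f: "open U" "smooth_on U f" "sympl_on U f" "inj_on f U" "f ` U = ball4"
    using assms unfolding symp_def by blast
  define g where "g = inv_into U f"
  have gf: "g (f x) = x" if "x \<in> U" for x using f(4) that by (simp add: g_def)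
  have fg: "f (g y) = y" "g y \<in> U" if "y \<in> ball4" for y
    using that f(5) unfolding g_def by (metis f_inv_into_f, metis inv_into_into)
  have ob: "open ball4" by (rule symp_open(2) [OF assms])
  have sg: "smooth_on ball4 g" using sympl_inverse_smooth [OF f(1-3) gf] f(5) by simp
  note cL = linear_continuous_on [OF bounded_linear_Li]
  have oL: "open (Li -` V)" if "open V" for V by (rule open_vimage [OF that cL])
  have sL: "smooth_on (Li -` V) (\<lambda>z. Lv (h (Li z)))" if "open V" "smooth_on V h" for V h
    by (rule smooth_on_linear_compose [OF oL [OF that(1)] bounded_linear_Lv
          smooth_on_compose [OF oL [OF that(1)] that smooth_on_linear [OF oL [OF that(1)] bounded_linear_Li]]]) simp
  have "symplectomorphic (Li -` U) (Li -` ball4)"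
  proof (rule symplectomorphicI [where f = "\<lambda>z. Lv (f (Li z))" and g = "\<lambda>z. Lv (g (Li z))"])
    show "open (Li -` U)" "open (Li -` ball4)" by (rule oL [OF f(1)], rule oL [OF ob])
    show "Lv (f (Li z)) \<in> Li -` ball4 \<and> Lv (g (Li (Lv (f (Li z))))) = z" if "z \<in> Li -` U" for z
      using that f(5) gf [of "Li z"] imageI [of "Li z" U f] by simp_all
    show "Lv (g (Li z)) \<in> Li -` U \<and> Lv (f (Li (Lv (g (Li z))))) = z" if "z \<in> Li -` ball4" for z
      using that fg [of "Li z"] by simp_all
    show "smooth_on (Li -` U) (\<lambda>z. Lv (f (Li z)))" by (rule sL [OF f(1,2)])
    show "smooth_on (Li -` ball4) (\<lambda>z. Lv (g (Li z)))" by (rule sL [OF ob sg])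
  next
    fix z v w assume z: "z \<in> Li -` U"
    define f' where "f' = frechet_derivative f (at (Li z))"
    have f': "(f has_derivative f') (at (Li z))"
      unfolding f'_def using smooth_on_has_derivative [OF f(1,2)] z by simp
    have "((\<lambda>z. Lv (f (Li z))) has_derivative (\<lambda>v. Lv (f' (Li v)))) (at z)"
      by (rule bounded_linear.has_derivative [OF bounded_linear_Lv
            has_derivative_compose [OF bounded_linear.has_derivative [OF bounded_linear_Li has_derivative_ident] f']])
    from frechet_derivative_at [OF this]
    have e: "frechet_derivative (\<lambda>z. Lv (f (Li z))) (at z) = (\<lambda>v. Lv (f' (Li v)))" by simp
    have "om (f' (Li v)) (f' (Li w)) = om (Li v) (Li w)" using sympl_onD [OF f(3) _ f'] z by simp
    then show "omega (frechet_derivative (\<lambda>z. Lv (f (Li z))) (at z) v)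
        (frechet_derivative (\<lambda>z. Lv (f (Li z))) (at z) w) = omega v w"
      unfolding e omega_Lv by (simp flip: omega_Lv)
  qed
  then show ?thesis
    unfolding symp_ball_def Lv_image [symmetric] Lv_ball4
    by (intro exI [of _ 0] exI [of _ "1 / sqrt pi"]) simp
qed

text \<open>A linear map that multiplies the form by \<open>k\<close> still serves, because scaling
  the ball by \<open>sqrt k\<close> multiplies the form by \<open>k\<close> on the other
  side.\<close>

lemma symp_ball_affine:
  assumes U: "symp_ball U" and A: "linear A" and k: "0 < k"
    and om: "\<And>v w. omega (A v) (A w) = k * omega v w"
  shows "symp_ball ((\<lambda>x. A x + b) ` U)"
proof -
  obtain c r where r: "0 < r" and s: "symplectomorphic U (ball c r)" using U unfolding symp_ball_def by blast
  obtain f g where oU: "open U" and f: "\<And>x. x \<in> U \<Longrightarrow> f x \<in> ball c r \<and> g (f x) = x"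
    and g: "\<And>y. y \<in> ball c r \<Longrightarrow> g y \<in> U \<and> f (g y) = y" and sf: "smooth_on U f" and sg: "smooth_on (ball c r) g"
    and omf: "\<And>x v w. x \<in> U \<Longrightarrow> omega (frechet_derivative f (at x) v) (frechet_derivative f (at x) w) = omega v w"
    using s unfolding symplectomorphic_def by blast
  have "inj A"
  proof (rule linear_injective_0 [THEN iffD2, OF A, rule_format])
    fix v assume "A v = 0"
    then have "k * omega v (- snd v, fst v) = 0" by (simp add: om [symmetric]) (simp add: omega_def)
    then have "fst v \<bullet> fst v + snd v \<bullet> snd v = 0" using k by (simp add: omega_def)
    then show "v = 0" by (simp add: add_nonneg_eq_0_iff prod_eq_iff)
  qed
  then obtain B where B: "linear B" "\<And>x. B (A x) = x"
    using linear_injective_left_inverse [OF A] by (auto simp: fun_eq_iff)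
  have AB: "A (B y) = y" for y
    using linear_injective_imp_surjective [OF A \<open>inj A\<close> refl] B(2) by (metis surjD)
  have blA: "bounded_linear A" and blB: "bounded_linear B" using A B(1) by (simp_all add: linear_conv_bounded_linear)
  define q where "q = sqrt k"
  have q: "0 < q" "q * q = k" using k by (simp_all add: q_def)
  define F where "F y = q *\<^sub>R f (B (y - b))" for y
  define G where "G z = A (g ((1 / q) *\<^sub>R z)) + b" for z
  have im: "(\<lambda>x. A x + b) ` U = (\<lambda>y. B (y - b)) -` U"
  proof (intro set_eqI iffI)
    fix y assume "y \<in> (\<lambda>y. B (y - b)) -` U"
    moreover have "y = A (B (y - b)) + b" by (simp add: AB)
    ultimately show "y \<in> (\<lambda>x. A x + b) ` U" by blast
  qed (auto simp: B(2))
  have bl: "z \<in> ball (q *\<^sub>R c) (q * r) \<longleftrightarrow> (1 / q) *\<^sub>R z \<in> ball c r" for z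
  proof -
    have "q *\<^sub>R c - z = q *\<^sub>R (c - (1 / q) *\<^sub>R z)" using q by (simp add: scaleR_diff_right)
    then have "dist (q *\<^sub>R c) z = q * dist c ((1 / q) *\<^sub>R z)" using q by (simp add: dist_norm)
    then show ?thesis using q by simp
  qed
  let ?V = "(\<lambda>y. B (y - b)) -` U" and ?W = "ball (q *\<^sub>R c) (q * r)"
  have "continuous_on UNIV (\<lambda>y. B (y - b))"
    by (rule continuous_on_compose2 [OF linear_continuous_on [OF blB, of UNIV]]) (auto intro!: continuous_intros)
  then have oV: "open ?V" by (rule open_vimage [OF oU])
  have BD: "((\<lambda>y. B (y - b)) has_derivative B) (at y)" for y
    by (rule bounded_linear.has_derivative [OF blB]) (auto intro!: derivative_eq_intros)
  have "symplectomorphic ?V ?W"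
  proof (rule symplectomorphicI [where f = F and g = G])
    show "open ?V" by (rule oV)
    show "open ?W" by simp
    show "F y \<in> ?W \<and> G (F y) = y" if "y \<in> ?V" for y
      using f [of "B (y - b)"] that q unfolding bl by (simp add: F_def G_def AB)
    show "G z \<in> ?V \<and> F (G z) = z" if "z \<in> ?W" for z
      using g [of "(1 / q) *\<^sub>R z"] that q unfolding bl by (simp add: F_def G_def B(2))
    have "smooth_on ?V (\<lambda>y. B (y - b))"
      by (rule smooth_on_linear_compose [OF oV blB]) (intro smooth_intros oV)
    from smooth_on_compose [OF oV oU sf this]
    show "smooth_on ?V F" unfolding F_def by (intro smooth_intros oV) simp_all
    have "smooth_on ?W (\<lambda>z. (1 / q) *\<^sub>R z)" by (intro smooth_intros open_ball)
    from smooth_on_linear_compose [OF open_ball blA smooth_on_compose [OF open_ball open_ball sg this]]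
    have "smooth_on ?W (\<lambda>z. A (g ((1 / q) *\<^sub>R z)))" by (simp only: bl)
    then show "smooth_on ?W G" unfolding G_def by (intro smooth_intros open_ball)
  next
    fix y v w assume y: "y \<in> ?V"
    define x where "x = B (y - b)"
    define f' where "f' = frechet_derivative f (at x)"
    have x: "x \<in> U" using y by (simp add: x_def)
    have f': "(f has_derivative f') (at x)" unfolding f'_def by (rule smooth_on_has_derivative [OF oU sf x])
    have "(F has_derivative (\<lambda>v. q *\<^sub>R f' (B v))) (at y)"
      unfolding F_def by (rule has_derivative_scaleR_right [OF has_derivative_compose [OF BD f' [unfolded x_def]]])
    from frechet_derivative_at [OF this]
    have e: "frechet_derivative F (at y) = (\<lambda>v. q *\<^sub>R f' (B v))" by simp
    have "omega (q *\<^sub>R f' (B v)) (q *\<^sub>R f' (B w)) = (q * q) * omega (f' (B v)) (f' (B w))"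
      by (simp add: omega_def algebra_simps)
    also have "\<dots> = k * omega (B v) (B w)" using omf [OF x] q by (simp add: f'_def)
    also have "\<dots> = omega v w" by (simp add: om [symmetric] AB)
    finally show "omega (frechet_derivative F (at y) v) (frechet_derivative F (at y) w) = omega v w"
      unfolding e .
  qed
  moreover have "0 < q * r" using q r by simp
  ultimately show ?thesis unfolding im symp_ball_def by blast
qed

section \<open>Diamonds, and images of the product under pairs of dual linear maps\<close>

lemma convex_hull_affine_image:
  assumes "linear f"
  shows "(\<lambda>y. f y + c) ` (convex hull S) = convex hull ((\<lambda>y. f y + c) ` S)"
proof -
  have e: "(\<lambda>y. f y + c) ` X = (\<lambda>y. c + y) ` f ` X" for X by (simp add: image_image add.commute)
  show ?thesis unfolding e convex_hull_linear_image [OF assms] convex_hull_translation ..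
qed

lemma interior_affine_image:
  fixes f :: "'a::euclidean_space \<Rightarrow> 'a"
  assumes "linear f" "inj f"
  shows "interior ((\<lambda>y. f y + c) ` S) = (\<lambda>y. f y + c) ` interior S"
proof -
  have e: "(\<lambda>y. f y + c) ` X = (+) c ` f ` X" for X by (simp add: image_image add.commute)
  show ?thesis unfolding e interior_translation interior_injective_linear_image [OF assms] ..
qed

text \<open>A point of the hull is a combination of one point of each segment, and \<open>k\<close>
  is the weight of the point on the horizontal one. The inequalities say that the free coordinates
  of the two points lie between 0 and 1.\<close>

lemma mem_diamond:
  assumes a: "a1 \<in> {0..1}" "a2 \<in> {0..1}"
  shows "w \<in> diamond a1 a2 \<longleftrightarrow> (\<exists>k\<ge>0. a2 * k \<le> w $ 2 \<and> (1 - a2) * k \<le> 1 - w $ 2 \<and>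
    - a1 * k \<le> w $ 1 - a1 \<and> w $ 1 - a1 \<le> (1 - a1) * k)"
proof
  let ?P = "\<lambda>w::real^2. \<lambda>k. 0 \<le> k \<and> a2 * k \<le> w $ 2 \<and> (1 - a2) * k \<le> 1 - w $ 2 \<and>
    - a1 * k \<le> w $ 1 - a1 \<and> w $ 1 - a1 \<le> (1 - a1) * k"
  have "diamond a1 a2 \<subseteq> {w. \<exists>k. ?P w k}"
    unfolding diamond_def
  proof (rule hull_minimal)
    have "?P v 1" if "0 \<le> v $ 1 \<and> v $ 1 \<le> 1 \<and> v $ 2 = a2" for v using that a by auto
    moreover have "?P v 0" if "v $ 1 = a1 \<and> 0 \<le> v $ 2 \<and> v $ 2 \<le> 1" for v using that a by auto
    ultimately show "{v. 0 \<le> v $ 1 \<and> v $ 1 \<le> 1 \<and> v $ 2 = a2} \<union> {v. v $ 1 = a1 \<and> 0 \<le> v $ 2 \<and> v $ 2 \<le> 1}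
        \<subseteq> {w. \<exists>k. ?P w k}" by blast
    show "convex {w. \<exists>k. ?P w k}"
      unfolding convex_alt
    proof (intro ballI allI impI)
      fix x y :: "real^2" and u :: real
      assume "x \<in> {w. \<exists>k. ?P w k}" "y \<in> {w. \<exists>k. ?P w k}" and u: "0 \<le> u \<and> u \<le> 1"
      then obtain k l where k: "?P x k" and l: "?P y l" by blast
      define t where "t = 1 - u"
      have t: "0 \<le> t" "u = 1 - t" using u by (simp_all add: t_def)
      have comb: "t * p + u * q \<le> t * p' + u * q'" if "p \<le> p'" "q \<le> q'" for p q p' q'
        using that t u by (intro add_mono mult_left_mono) auto
      have "?P (t *\<^sub>R x + u *\<^sub>R y) (t * k + u * l)"
        using comb [of 0 k 0 l] comb [of "a2 * k" "x $ 2" "a2 * l" "y $ 2"]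
          comb [of "(1 - a2) * k" "1 - x $ 2" "(1 - a2) * l" "1 - y $ 2"]
          comb [of "- a1 * k" "x $ 1 - a1" "- a1 * l" "y $ 1 - a1"]
          comb [of "x $ 1 - a1" "(1 - a1) * k" "y $ 1 - a1" "(1 - a1) * l"] k l
        unfolding t(2) by (simp add: algebra_simps)
      then show "(1 - u) *\<^sub>R x + u *\<^sub>R y \<in> {w. \<exists>k. ?P w k}" unfolding t_def by blast
    qed
  qed
  then show "\<exists>k\<ge>0. a2 * k \<le> w $ 2 \<and> (1 - a2) * k \<le> 1 - w $ 2 \<and>
    - a1 * k \<le> w $ 1 - a1 \<and> w $ 1 - a1 \<le> (1 - a1) * k" if "w \<in> diamond a1 a2"
    using that by blast
next
  assume "\<exists>k\<ge>0. a2 * k \<le> w $ 2 \<and> (1 - a2) * k \<le> 1 - w $ 2 \<and>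
    - a1 * k \<le> w $ 1 - a1 \<and> w $ 1 - a1 \<le> (1 - a1) * k"
  then obtain k where k: "0 \<le> k" "a2 * k \<le> w $ 2" "(1 - a2) * k \<le> 1 - w $ 2"
    "- a1 * k \<le> w $ 1 - a1" "w $ 1 - a1 \<le> (1 - a1) * k" by blast
  have "a2 * k + (1 - a2) * k \<le> 1" using k by linarith
  then have k1: "k \<le> 1" by (simp add: algebra_simps)
  \<comment> \<open>The free coordinates of the two points. For \<open>k = 0\<close> or
    \<open>k = 1\<close> one quotient has denominator 0 and value 0; the resulting point is still
    admissible and has weight 0.\<close>
  define x y where "x = a1 + (w $ 1 - a1) / k" and "y = (w $ 2 - a2 * k) / (1 - k)"
  have x: "0 \<le> x" "x \<le> 1" "k * x = k * a1 + (w $ 1 - a1)"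
  proof -
    have "- a1 \<le> (w $ 1 - a1) / k \<and> (w $ 1 - a1) / k \<le> 1 - a1" if "0 < k"
      using k that by (simp add: pos_le_divide_eq pos_divide_le_eq)
    then show "0 \<le> x" "x \<le> 1" using k a by (cases "k = 0"; simp add: x_def)+
    show "k * x = k * a1 + (w $ 1 - a1)" using k by (cases "k = 0"; simp add: x_def distrib_left)
  qed
  have y: "0 \<le> y" "y \<le> 1" "(1 - k) * y = w $ 2 - a2 * k"
  proof -
    have "w $ 2 - a2 * k \<le> 1 - k" using k(3) by (simp add: algebra_simps)
    then show "0 \<le> y" "y \<le> 1" using k k1 by (cases "k = 1"; simp add: y_def)+
    show "(1 - k) * y = w $ 2 - a2 * k"
    proof (cases "k = 1")
      case True then show ?thesis using k by simp
    qed (simp add: y_def)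
  qed
  let ?S = "{v::real^2. 0 \<le> v $ 1 \<and> v $ 1 \<le> 1 \<and> v $ 2 = a2} \<union> {v. v $ 1 = a1 \<and> 0 \<le> v $ 2 \<and> v $ 2 \<le> 1}"
  have "vector [x, a2] \<in> convex hull ?S" "vector [a1, y] \<in> convex hull ?S"
    using x y by (auto intro!: hull_inc)
  then have "(1 - k) *\<^sub>R vector [a1, y] + k *\<^sub>R vector [x, a2] \<in> convex hull ?S"
    using k1 k(1) by (intro convexD [OF convex_convex_hull]) auto
  moreover have "(1 - k) *\<^sub>R vector [a1, y] + k *\<^sub>R vector [x, a2] = w"
    using x(3) y(3) by (simp add: vec_eq_iff forall_2) (simp add: algebra_simps)
  ultimately show "w \<in> diamond a1 a2" by (simp add: diamond_def)
qed

text \<open>At height \<open>w $ 2\<close> the largest admissible weight is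
  \<open>cc a2 (w $ 2)\<close>. Moving an interior point by \<open>r / 2\<close> in the four axis
  directions makes all inequalities strict.\<close>

lemma interior_diamond:
  assumes a: "a1 \<in> {0..1}" "a2 \<in> {0..1}"
  shows "interior (diamond a1 a2) =
    {w. 0 < w $ 2 \<and> w $ 2 < 1 \<and> - a1 * cc a2 (w $ 2) < w $ 1 - a1 \<and> w $ 1 - a1 < (1 - a1) * cc a2 (w $ 2)}"
    (is "_ = ?O")
proof
  have a': "0 \<le> a1" "a1 \<le> 1" "0 \<le> a2" "a2 \<le> 1" using a by auto
  have ccc: "continuous_on UNIV (\<lambda>w::real^2. cc a2 (w $ 2))"
    by (rule continuous_on_compose2 [OF continuous_cc]) (auto intro!: continuous_intros)
  have "?O = {w. 0 < w $ 2} \<inter> {w. w $ 2 < 1} \<inter> {w. - a1 * cc a2 (w $ 2) < w $ 1 - a1} \<inter>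
      {w. w $ 1 - a1 < (1 - a1) * cc a2 (w $ 2)}" by auto
  moreover have "open \<dots>" by (intro open_Int open_Collect_less continuous_intros ccc)
  ultimately have "open ?O" by simp
  moreover have "?O \<subseteq> diamond a1 a2"
  proof
    fix w assume w: "w \<in> ?O"
    have "a2 * cc a2 (w $ 2) \<le> w $ 2 \<and> (1 - a2) * cc a2 (w $ 2) \<le> 1 - w $ 2"
      using le_cc(1) [OF a'(3,4), of "w $ 2" "cc a2 (w $ 2)"] w by auto
    moreover have "0 \<le> cc a2 (w $ 2)" using le_cc(1) [OF a'(3,4), of "w $ 2" 0] w by auto
    ultimately show "w \<in> diamond a1 a2" unfolding mem_diamond [OF a] using w
      by (intro exI [of _ "cc a2 (w $ 2)"]) auto
  qed
  ultimately show "?O \<subseteq> interior (diamond a1 a2)" by (intro interior_maximal)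
  show "interior (diamond a1 a2) \<subseteq> ?O"
  proof
    fix w assume "w \<in> interior (diamond a1 a2)"
    then obtain r where r: "0 < r" "ball w r \<subseteq> diamond a1 a2" unfolding mem_interior by blast
    have sh: "w + vector [x, y] \<in> diamond a1 a2" if "\<bar>x\<bar> + \<bar>y\<bar> < r" for x y
    proof -
      have "norm (vector [x, y] :: real^2) \<le> \<bar>x\<bar> + \<bar>y\<bar>"
        using norm_le_l1_cart [of "vector [x, y] :: real^2"] by (simp add: sum_2)
      then have "w + vector [x, y] \<in> ball w r" using that by (simp add: dist_norm)
      then show ?thesis using r(2) by blast
    qed
    have "w + vector [0, - (r/2)] \<in> diamond a1 a2" by (rule sh) (use r in simp)
    then obtain k where "0 \<le> k" "a2 * k \<le> w $ 2 - r / 2" unfolding mem_diamond [OF a] by auto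
    moreover from this have "0 \<le> a2 * k" using a' by simp
    ultimately have w1: "0 < w $ 2" using r by linarith
    have "w + vector [0, r/2] \<in> diamond a1 a2" by (rule sh) (use r in simp)
    then obtain k where "0 \<le> k" "(1 - a2) * k \<le> 1 - (w $ 2 + r / 2)" unfolding mem_diamond [OF a] by auto
    moreover from this have "0 \<le> (1 - a2) * k" using a' by simp
    ultimately have w2: "w $ 2 < 1" using r by linarith
    note lc = le_cc(1) [OF a'(3,4) w1 w2]
    have "w + vector [r/2, 0] \<in> diamond a1 a2" by (rule sh) (use r in simp)
    then obtain k where k: "a2 * k \<le> w $ 2" "(1 - a2) * k \<le> 1 - w $ 2" "w $ 1 + r / 2 - a1 \<le> (1 - a1) * k"
      unfolding mem_diamond [OF a] by auto
    then have "(1 - a1) * k \<le> (1 - a1) * cc a2 (w $ 2)" using lc [of k] a' by (intro mult_left_mono) auto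
    then have w3: "w $ 1 - a1 < (1 - a1) * cc a2 (w $ 2)" using k r by linarith
    have "w + vector [- (r/2), 0] \<in> diamond a1 a2" by (rule sh) (use r in simp)
    then obtain k where k: "a2 * k \<le> w $ 2" "(1 - a2) * k \<le> 1 - w $ 2" "- (a1 * k) \<le> w $ 1 - r / 2 - a1"
      unfolding mem_diamond [OF a] by auto
    then have "a1 * k \<le> a1 * cc a2 (w $ 2)" using lc [of k] a' by (intro mult_left_mono) auto
    then have "- a1 * cc a2 (w $ 2) < w $ 1 - a1" using k r by linarith
    then show "w \<in> ?O" using w1 w2 w3 by simp
  qed
qed

lemma symp_ball_square_diamond:
  assumes a: "a1 \<in> {0..1}" "a2 \<in> {0..1}"
  shows "symp_ball (interior (cbox 0 (vec 1)) \<times> interior (diamond a1 a2))"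
proof -
  define b :: v4 where "b = (0, vector [a1, 0])"
  have a': "0 \<le> a1" "a1 \<le> 1" "0 \<le> a2" "a2 \<le> 1" using a by auto
  let ?U = "slabs (bx a1 (cc a2))"
  have "symp_ball ((\<lambda>x. (\<lambda>x. x) x + b) ` (Lv ` ?U))"
    by (rule symp_ball_affine [OF symp_ball_Lv [OF symp_cc_ball [OF a']], where k = 1])
      (auto simp: linear_id [unfolded id_def])
  moreover have "(\<lambda>x. (\<lambda>x. x) x + b) ` (Lv ` ?U) = interior (cbox 0 (vec 1)) \<times> interior (diamond a1 a2)"
  proof -
    have "z \<in> (\<lambda>x. x + b) ` Li -` ?U \<longleftrightarrow> z - b \<in> Li -` ?U" for z
      by (auto simp: image_iff intro: bexI [of _ "z - b"])
    moreover have "z - b \<in> Li -` ?U \<longleftrightarrow> z \<in> interior (cbox 0 (vec 1)) \<times> interior (diamond a1 a2)" for z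
      unfolding interior_diamond [OF a] interior_cbox mem_Times_iff mem_box_cart
      by (auto simp: Li_def b_def slabs_def bx_def forall_2)
    ultimately show ?thesis unfolding Lv_image by blast
  qed
  ultimately show ?thesis by simp
qed

text \<open>Exchanging the factors by \<open>(x, y) \<mapsto> (f y, g x)\<close> multiplies the form
  by \<open>- k\<close>, which settles \<open>k < 0\<close>. For \<open>k > 0\<close>,
  \<open>g\<close> is replaced by \<open>- g\<close>: the square is symmetric under
  \<open>x \<mapsto> vec 1 - x\<close>, so a translation restores the image.\<close>

lemma symp_ball_prod:
  fixes f g :: "real^2 \<Rightarrow> real^2"
  assumes lin: "linear f" "linear g" and k: "k \<noteq> 0"
    and adj: "\<And>x y. f y \<bullet> g x = k * (y \<bullet> x)"
    and a: "a1 \<in> {0..1}" "a2 \<in> {0..1}"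
  shows "symp_ball (interior ((\<lambda>y. f y + c) ` diamond a1 a2) \<times> interior ((\<lambda>x. g x + d) ` cbox 0 (vec 1)))"
proof -
  have neg: "symp_ball (interior ((\<lambda>y. f y + c) ` diamond a1 a2) \<times> interior ((\<lambda>x. g x + d) ` cbox 0 (vec 1)))"
    if lg: "linear g" and k: "k < 0" and adj: "\<And>x y. f y \<bullet> g x = k * (y \<bullet> x)" for g d k
  proof -
    have "inj f"
    proof (rule linear_injective_0 [THEN iffD2, OF lin(1), rule_format])
      fix y assume "f y = 0"
      then have "k * (y \<bullet> y) = 0" by (simp add: adj [symmetric])
      then show "y = 0" using k by simp
    qed
    have "inj g"
    proof (rule linear_injective_0 [THEN iffD2, OF lg, rule_format])
      fix x assume "g x = 0"
      then have "k * (x \<bullet> x) = 0" by (simp add: adj [symmetric])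
      then show "x = 0" using k by simp
    qed
    let ?I = "interior (cbox 0 (vec 1)) :: (real^2) set" and ?D = "interior (diamond a1 a2)"
    have "symp_ball ((\<lambda>v. (f (snd v), g (fst v)) + (c, d)) ` (?I \<times> ?D))"
    proof (rule symp_ball_affine [OF symp_ball_square_diamond [OF a], where k = "- k"])
      show "linear (\<lambda>v. (f (snd v), g (fst v)))"
        by (rule linearI) (simp_all add: linear_add [OF lin(1)] linear_add [OF lg]
            linear_scale [OF lin(1)] linear_scale [OF lg])
      show "omega (f (snd v), g (fst v)) (f (snd w), g (fst w)) = - k * omega v w" for v w
        by (simp add: omega_def adj inner_commute algebra_simps)
    qed (use k in simp)
    moreover have "(\<lambda>v. (f (snd v), g (fst v)) + (c, d)) ` (?I \<times> ?D) = (\<lambda>y. f y + c) ` ?D \<times> (\<lambda>x. g x + d) ` ?I"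
    proof (intro subset_antisym subsetI)
      fix z assume "z \<in> (\<lambda>y. f y + c) ` ?D \<times> (\<lambda>x. g x + d) ` ?I"
      then obtain y x where yx: "y \<in> ?D" "x \<in> ?I" "z = (f y + c, g x + d)" by auto
      then show "z \<in> (\<lambda>v. (f (snd v), g (fst v)) + (c, d)) ` (?I \<times> ?D)"
        by (intro image_eqI [of _ _ "(x, y)"]) simp_all
    qed (auto simp del: interior_cbox)
    ultimately show ?thesis
      by (simp only: interior_affine_image [OF lin(1) \<open>inj f\<close>] interior_affine_image [OF lg \<open>inj g\<close>])
  qed
  show ?thesis
  proof (cases "k < 0")
    case True
    show ?thesis by (rule neg [OF lin(2) True adj])
  next
    case False
    have lg: "linear (\<lambda>x. - g x)" by (rule linear_compose_neg [OF lin(2)])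
    have "symp_ball (interior ((\<lambda>y. f y + c) ` diamond a1 a2) \<times>
        interior ((\<lambda>x. - g x + (d + g (vec 1))) ` cbox 0 (vec 1)))"
      by (rule neg [OF lg, of "- k"]) (use False k adj in auto)
    moreover have "(\<lambda>x. - g x + (d + g (vec 1))) ` cbox 0 (vec 1) = (\<lambda>x. g x + d) ` cbox 0 (vec 1)"
    proof -
      have e: "- g x + (d + g (vec 1)) = g (vec 1 - x) + d" for x
        by (simp add: linear_diff [OF lin(2)])
      have m: "vec 1 - x \<in> cbox 0 (vec 1)" if "x \<in> cbox 0 (vec 1)" for x :: "real^2"
        using that by (simp add: mem_box_cart forall_2)
      show ?thesis unfolding e
      proof (intro subset_antisym subsetI)
        fix z assume "z \<in> (\<lambda>x. g x + d) ` cbox 0 (vec 1)"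
        then obtain x where x: "x \<in> cbox 0 (vec 1)" "z = g x + d" by blast
        then show "z \<in> (\<lambda>x. g (vec 1 - x) + d) ` cbox 0 (vec 1)"
          by (intro image_eqI [of _ _ "vec 1 - x"] m) simp_all
      qed (use m in blast)
    qed
    ultimately show ?thesis by simp
  qed
qed

section \<open>Triangles, squares and trapezoids\<close>

lemma J_simps [simp]: "J v $ 1 = v $ 2" "J v $ 2 = - (v $ 1)" by (simp_all add: J_def)

lemma linear_J: "linear J" by (rule linearI) (simp_all add: vec_eq_iff forall_2)

lemma inner_J: "x \<bullet> J y = x $ 1 * y $ 2 - x $ 2 * y $ 1" by (simp add: inner_vec_def sum_2)

lemma parallel_imp_collinear:
  fixes p q r :: "real^2"
  assumes "(p - r) \<bullet> J (q - r) = 0"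
  shows "collinear {p, q, r}"
proof -
  define u v where "u = p - r" and "v = q - r"
  have e: "u $ 1 * v $ 2 = u $ 2 * v $ 1" using assms unfolding inner_J u_def v_def by simp
  have "u = 0 \<or> v = 0 \<or> (\<exists>c. v = c *\<^sub>R u)"
  proof (cases "u $ 1 = 0")
    case False
    then have "v = (v $ 1 / u $ 1) *\<^sub>R u" using e by (simp add: vec_eq_iff forall_2 field_simps)
    then show ?thesis by blast
  next
    case u1: True
    show ?thesis
    proof (cases "u $ 2 = 0")
      case True then show ?thesis using u1 by (simp add: vec_eq_iff forall_2)
    next
      case False
      then have "v = (v $ 2 / u $ 2) *\<^sub>R u" using e u1 by (simp add: vec_eq_iff forall_2 field_simps)
      then show ?thesis by blast
    qed
  qed
  then have "collinear {0, u, v}" by (simp add: collinear_lemma)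
  moreover have "collinear {p, r, q} \<longleftrightarrow> collinear {0, p - r, q - r}"
    by (rule collinear_3) (simp add: NO_MATCH_def)
  ultimately have "collinear {p, r, q}" unfolding u_def v_def by blast
  then show ?thesis by (simp only: insert_commute)
qed

text \<open>Let \<open>z\<close> be the point of the side \<open>p q\<close> with
  \<open>t = - J z\<close>. The triangle is the affine image of \<open>diamond 1 la\<close> whose
  segments go to \<open>r z\<close> and to \<open>p q\<close>. The other hull is a parallelogram
  with sides \<open>J (q - p)\<close> and \<open>- J (z - r)\<close>, and these vectors are dual to
  \<open>z - r\<close> and \<open>q - p\<close> up to the factor \<open>k\<close>.\<close>

lemma symp_ball_triangle_edge:
  fixes p q r :: "real^2"
  assumes nc: "\<not> collinear {p, q, r}" and s: "p + q + r = 0" and la: "0 \<le> la" "la \<le> 1"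
    and t: "t = - J ((1 - la) *\<^sub>R p + la *\<^sub>R q)"
  shows "symp_ball (interior (convex hull {p, q, r}) \<times>
    interior (convex hull (J ` (convex hull {p, q, r}) \<union> (\<lambda>z. - J z + t) ` (convex hull {p, q, r}))))"
proof -
  define z where "z = (1 - la) *\<^sub>R p + la *\<^sub>R q"
  define m1 m2 where "m1 = z - r" and "m2 = q - p"
  define k where "k = m1 \<bullet> J m2"
  define f g where "f y = y $ 1 *\<^sub>R m1 + y $ 2 *\<^sub>R m2" and "g x = x $ 1 *\<^sub>R J m2 + x $ 2 *\<^sub>R (- J m1)"
    for x y :: "real^2"
  define c d where "c = r - la *\<^sub>R m2" and "d = J p"
  let ?T = "convex hull {p, q, r}"
  let ?N = "convex hull (J ` ?T \<union> (\<lambda>z. - J z + t) ` ?T)"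
  have lf: "linear f" "linear g" unfolding f_def g_def
    by (rule linearI; simp add: vec_eq_iff forall_2 algebra_simps)+
  have k0: "k \<noteq> 0"
  proof
    assume "k = 0"
    moreover have "k = (p - r) \<bullet> J (q - r)"
      unfolding k_def m1_def m2_def z_def inner_J by (simp add: algebra_simps)
    ultimately show False using parallel_imp_collinear nc by metis
  qed
  have adj: "f y \<bullet> g x = k * (y \<bullet> x)" for x y
  proof -
    have "m1 \<bullet> J m1 = 0" "m2 \<bullet> J m2 = 0" "m1 \<bullet> J m2 = k" "m2 \<bullet> J m1 = - k" by (simp_all add: k_def inner_J)
    then show ?thesis
      by (simp add: f_def g_def inner_add_left inner_add_right inner_vec_def [of y x] sum_2)
        (simp add: algebra_simps)
  qed
  have zT: "z \<in> ?T" unfolding z_def using la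
    by (intro convexD [OF convex_convex_hull]) (auto intro: hull_inc)
  have D: "(\<lambda>y. f y + c) ` diamond 1 la = ?T"
  proof -
    let ?S = "{v::real^2. 0 \<le> v $ 1 \<and> v $ 1 \<le> 1 \<and> v $ 2 = la} \<union> {v. v $ 1 = 1 \<and> 0 \<le> v $ 2 \<and> v $ 2 \<le> 1}"
    have h: "f v + c = (1 - v $ 1) *\<^sub>R r + v $ 1 *\<^sub>R z" if "v $ 2 = la" for v
      using that by (simp add: f_def c_def m1_def algebra_simps)
    have v: "f v + c = (1 - v $ 2) *\<^sub>R p + v $ 2 *\<^sub>R q" if "v $ 1 = 1" for v
      using that by (simp add: f_def c_def m1_def m2_def z_def algebra_simps)
    have "(\<lambda>y. f y + c) ` ?S \<subseteq> ?T"
    proof (intro image_subsetI)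
      fix v assume "v \<in> ?S"
      then consider "0 \<le> v $ 1 \<and> v $ 1 \<le> 1 \<and> v $ 2 = la" | "v $ 1 = 1 \<and> 0 \<le> v $ 2 \<and> v $ 2 \<le> 1" by blast
      then show "f v + c \<in> ?T"
      proof cases
        case 1
        then have "(1 - v $ 1) *\<^sub>R r + v $ 1 *\<^sub>R z \<in> ?T"
          by (intro convexD [OF convex_convex_hull] zT) (auto intro: hull_inc)
        then show ?thesis using h [of v] 1 by simp
      next
        case 2
        then have "(1 - v $ 2) *\<^sub>R p + v $ 2 *\<^sub>R q \<in> ?T"
          by (intro convexD [OF convex_convex_hull]) (auto intro: hull_inc)
        then show ?thesis using v [of v] 2 by simp
      qed
    qed
    then have h1: "convex hull ((\<lambda>y. f y + c) ` ?S) \<subseteq> ?T" by (intro hull_minimal convex_convex_hull)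
    have hp: "p \<in> (\<lambda>y. f y + c) ` ?S" using v [of "vector [1, 0]"] by (intro image_eqI [of _ _ "vector [1, 0]"]) auto
    have hq: "q \<in> (\<lambda>y. f y + c) ` ?S" using v [of "vector [1, 1]"] by (intro image_eqI [of _ _ "vector [1, 1]"]) auto
    have hr: "r \<in> (\<lambda>y. f y + c) ` ?S" using h [of "vector [0, la]"] by (intro image_eqI [of _ _ "vector [0, la]"]) auto
    have "{p, q, r} \<subseteq> (\<lambda>y. f y + c) ` ?S" using hp hq hr by (simp only: insert_subset empty_subsetI simp_thms)
    then have "?T \<subseteq> convex hull ((\<lambda>y. f y + c) ` ?S)" by (rule hull_mono)
    with h1 have "convex hull ((\<lambda>y. f y + c) ` ?S) = ?T" by (rule subset_antisym)
    then show ?thesis unfolding diamond_def convex_hull_affine_image [OF lf(1)] .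
  qed
  have sq: "(\<lambda>x. g x + d) ` cbox 0 (vec 1) = ?N"
  proof
    have r: "r = - p - q" using s by (simp add: eq_neg_iff_add_eq_0 add.commute algebra_simps)
    have Jr: "J r = - J p - J q" by (simp add: r vec_eq_iff forall_2)
    have tt: "t = - ((1 - la) *\<^sub>R J p) - la *\<^sub>R J q" by (simp add: t vec_eq_iff forall_2)
    have gd: "g x + d = (1 - x $ 2) *\<^sub>R ((1 - x $ 1) *\<^sub>R J p + x $ 1 *\<^sub>R J q) +
        x $ 2 *\<^sub>R ((1 - x $ 1) *\<^sub>R (- J q + t) + x $ 1 *\<^sub>R (- J p + t))" for x
      unfolding g_def d_def tt m1_def m2_def z_def r by (simp add: vec_eq_iff forall_2 algebra_simps)
    have N: "J ` {p, q, r} \<union> (\<lambda>z. - J z + t) ` {p, q, r} \<subseteq> ?N"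
      by (intro order_trans [OF _ hull_subset] Un_mono image_mono hull_subset)
    show "(\<lambda>x. g x + d) ` cbox 0 (vec 1) \<subseteq> ?N"
    proof (intro image_subsetI)
      fix x :: "real^2" assume "x \<in> cbox 0 (vec 1)"
      then have x: "0 \<le> x $ 1" "x $ 1 \<le> 1" "0 \<le> x $ 2" "x $ 2 \<le> 1" by (auto simp: mem_box_cart)
      show "g x + d \<in> ?N" unfolding gd
        using x N by (intro convexD [OF convex_convex_hull]) auto
    qed
    let ?B = "(\<lambda>x. g x + d) ` cbox 0 (vec 1)"
    have mB: "y \<in> ?B" if "g (vector [x1, x2]) + d = y" "0 \<le> x1" "x1 \<le> 1" "0 \<le> x2" "x2 \<le> 1" for y x1 x2
      by (rule image_eqI [of _ _ "vector [x1, x2]"]) (use that in \<open>auto simp: mem_box_cart forall_2\<close>)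
    have cB: "convex ?B"
    proof -
      have "convex ((\<lambda>x. g x + d) ` (convex hull cbox 0 (vec 1)))"
        by (simp only: convex_hull_affine_image [OF lf(2)] convex_convex_hull)
      moreover have "convex hull cbox 0 (vec 1 :: real^2) = cbox 0 (vec 1)" by (simp add: convex_hull_eq)
      ultimately show ?thesis by simp
    qed
    have P: "J p \<in> ?B" "J q \<in> ?B" "J r \<in> ?B" "- J q + t \<in> ?B" "- J p + t \<in> ?B" "- J r + t \<in> ?B"
    proof -
      show "J p \<in> ?B" by (rule mB [of 0 0]) (simp_all add: gd)
      show "J q \<in> ?B" by (rule mB [of 1 0]) (simp_all add: gd)
      show "- J q + t \<in> ?B" by (rule mB [of 0 1]) (simp_all add: gd)
      show "- J p + t \<in> ?B" by (rule mB [of 1 1]) (simp_all add: gd)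
      \<comment> \<open>Since \<open>p + q + r = 0\<close>, the third vertices of the two triangles
        fall on opposite sides of the parallelogram, so the hull of the six points has only four
        vertices.\<close>
      have gr: "g (vector [la, 1]) + d = J r" "g (vector [1 - la, 0]) + d = - J r + t"
        unfolding gd tt Jr by (simp_all add: vec_eq_iff forall_2 algebra_simps)
      show "J r \<in> ?B" by (rule mB [OF gr(1)]) (use la in simp_all)
      show "- J r + t \<in> ?B" by (rule mB [OF gr(2)]) (use la in simp_all)
    qed
    have "J ` ?T = convex hull (J ` {p, q, r})" by (rule convex_hull_linear_image [OF linear_J])
    also have "\<dots> \<subseteq> ?B" by (rule hull_minimal) (use P cB in auto)
    finally have 1: "J ` ?T \<subseteq> ?B" .
    have "(\<lambda>z. - J z + t) ` ?T = convex hull ((\<lambda>z. - J z + t) ` {p, q, r})"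
      by (rule convex_hull_affine_image [OF linear_compose_neg [OF linear_J]])
    also have "\<dots> \<subseteq> ?B" by (rule hull_minimal) (use P cB in auto)
    finally have 2: "(\<lambda>z. - J z + t) ` ?T \<subseteq> ?B" .
    show "?N \<subseteq> ?B" by (rule hull_minimal) (use 1 2 cB in auto)
  qed
  have "symp_ball (interior ((\<lambda>y. f y + c) ` diamond 1 la) \<times> interior ((\<lambda>x. g x + d) ` cbox 0 (vec 1)))"
    by (rule symp_ball_prod [OF lf k0 adj]) (use la in auto)
  then show ?thesis unfolding D sq .
qed

text \<open>On the frontier one barycentric coordinate vanishes; renaming the vertices puts the
  point on the side \<open>p' q'\<close>.\<close>

lemma frontier_triangle:
  fixes p q r :: "real^2"
  assumes "\<not> collinear {p, q, r}" "z \<in> frontier (convex hull {p, q, r})"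
  obtains p' q' r' la where "{p', q', r'} = {p, q, r}" "p' + q' + r' = p + q + r" "0 \<le> la" "la \<le> 1"
    "z = (1 - la) *\<^sub>R p' + la *\<^sub>R q'"
proof -
  have cl: "closed (convex hull {p, q, r})" by (intro compact_imp_closed finite_imp_compact_convex_hull) auto
  have z: "z \<in> convex hull {p, q, r}" "z \<notin> interior (convex hull {p, q, r})"
    using assms(2) cl by (auto simp: frontier_def)
  then obtain u v w where uvw: "0 \<le> u" "0 \<le> v" "0 \<le> w" "u + v + w = 1" "z = u *\<^sub>R p + v *\<^sub>R q + w *\<^sub>R r"
    unfolding convex_hull_3 by blast
  have "\<not> (0 < u \<and> 0 < v \<and> 0 < w)"
    using z(2) uvw(4,5) unfolding interior_convex_hull_3_minimal [OF assms(1), simplified] by blast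
  then consider "u = 0" | "v = 0" | "w = 0" using uvw by linarith
  then show thesis
  proof cases
    case 1
    then have "v = 1 - w" using uvw by simp
    then show ?thesis using 1 uvw by (intro that [of q r p w]) auto
  next
    case 2
    then have "u = 1 - w" using uvw by simp
    then show ?thesis using 2 uvw by (intro that [of p r q w]) auto
  next
    case 3
    then have "u = 1 - v" using uvw by simp
    then show ?thesis using 3 uvw by (intro that [of p q r v]) auto
  qed
qed

lemma symp_ball_triangle:
  fixes p q r :: "real^2"
  assumes nc: "\<not> collinear {p, q, r}" and s: "p + q + r = 0"
    and t: "t \<in> (\<lambda>z. - J z) ` frontier (convex hull {p, q, r})"
  shows "symp_ball (interior (convex hull {p, q, r}) \<times>
    interior (convex hull (J ` (convex hull {p, q, r}) \<union> (\<lambda>z. - J z + t) ` (convex hull {p, q, r}))))"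
proof -
  obtain z where z: "z \<in> frontier (convex hull {p, q, r})" "t = - J z" using t by blast
  obtain p' q' r' la where e: "{p', q', r'} = {p, q, r}" "p' + q' + r' = p + q + r" "0 \<le> la" "la \<le> 1"
    "z = (1 - la) *\<^sub>R p' + la *\<^sub>R q'" by (rule frontier_triangle [OF nc z(1)])
  show ?thesis
    using symp_ball_triangle_edge [of p' q' r' la t] nc s e z(2) unfolding e(1) by simp
qed

text \<open>Stretching the \<open>x\<close>-plane alone by \<open>s\<close> multiplies the form by
  \<open>s\<close>.\<close>

lemma symp_ball_square:
  assumes "0 < s" "a1 \<in> {0..1}" "a2 \<in> {0..1}"
  shows "symp_ball (interior (cbox a (a + vector [s, s])) \<times> interior (diamond a1 a2))"
proof -
  let ?I = "interior (cbox 0 (vec 1)) :: (real^2) set" and ?D = "interior (diamond a1 a2)"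
  have "symp_ball ((\<lambda>v. (s *\<^sub>R fst v, snd v) + (a, 0)) ` (?I \<times> ?D))"
  proof (rule symp_ball_affine [OF symp_ball_square_diamond [OF assms(2,3)] _ assms(1)])
    show "linear (\<lambda>v::v4. (s *\<^sub>R fst v, snd v))" by (rule linearI) (simp_all add: algebra_simps)
    show "omega (s *\<^sub>R fst v, snd v) (s *\<^sub>R fst w, snd w) = s * omega v w" for v w
      by (simp add: omega_def algebra_simps)
  qed
  moreover have "(\<lambda>v. (s *\<^sub>R fst v, snd v) + (a, 0)) ` (?I \<times> ?D) = interior (cbox a (a + vector [s, s])) \<times> ?D"
  proof (intro subset_antisym subsetI)
    fix z assume "z \<in> (\<lambda>v. (s *\<^sub>R fst v, snd v) + (a, 0)) ` (?I \<times> ?D)"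
    then obtain x where x: "x \<in> ?I \<times> ?D" "z = (s *\<^sub>R fst x, snd x) + (a, 0)" by blast
    then show "z \<in> interior (cbox a (a + vector [s, s])) \<times> ?D"
      using assms(1) by (simp add: mem_Times_iff mem_box_cart forall_2)
  next
    fix z assume z: "z \<in> interior (cbox a (a + vector [s, s])) \<times> ?D"
    define x where "x = ((1 / s) *\<^sub>R (fst z - a), snd z)"
    have "x \<in> ?I \<times> ?D" using z assms(1)
      by (simp add: x_def mem_Times_iff mem_box_cart forall_2 pos_divide_less_eq)
    moreover have "z = (s *\<^sub>R fst x, snd x) + (a, 0)" using assms(1) by (simp add: x_def prod_eq_iff)
    ultimately show "z \<in> (\<lambda>v. (s *\<^sub>R fst v, snd v) + (a, 0)) ` (?I \<times> ?D)" by blast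
  qed
  ultimately show ?thesis by simp
qed

text \<open>\<open>M\<close> and the inverse of its transpose preserve the pairing of the two
  planes, so \<open>symp_ball_prod\<close> applies with factor 1.\<close>

lemma symp_ball_trapezoid:
  fixes M :: "real^2^2"
  assumes M: "invertible M" and a: "a1 \<in> {0..1}" "a2 \<in> {0..1}"
  shows "symp_ball (interior ((\<lambda>v. M *v v + c) ` diamond a1 a2) \<times>
    interior ((\<lambda>v. matrix_inv (transpose M) *v v) ` cbox 0 (vec 1)))"
proof -
  have "invertible (transpose M)" by (rule transpose_invertible [OF M])
  then have "\<exists>A'. transpose M ** A' = mat 1 \<and> A' ** transpose M = mat 1" by (simp add: invertible_def)
  then have inv: "transpose M ** matrix_inv (transpose M) = mat 1"
    unfolding matrix_inv_def by (rule someI2_ex) blast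
  have adj: "(M *v y) \<bullet> (matrix_inv (transpose M) *v x) = 1 * (y \<bullet> x)" for x y
  proof -
    define w where "w = matrix_inv (transpose M) *v x"
    have "(M *v y) \<bullet> w = w \<bullet> (M *v y)" by (rule inner_commute)
    also have "\<dots> = (w v* M) \<bullet> y" by (rule dot_lmul_matrix [symmetric])
    also have "w v* M = (transpose M ** matrix_inv (transpose M)) *v x"
      by (simp only: w_def transpose_matrix_vector [symmetric] matrix_vector_mul_assoc)
    also have "\<dots> = x" by (simp add: inv)
    finally show ?thesis by (simp add: w_def inner_commute)
  qed
  have "symp_ball (interior ((\<lambda>v. M *v v + c) ` diamond a1 a2) \<times>
      interior ((\<lambda>v. matrix_inv (transpose M) *v v + 0) ` cbox 0 (vec 1)))"
    by (rule symp_ball_prod [OF matrix_vector_mul_linear matrix_vector_mul_linear _ adj a]) simp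
  then show ?thesis by simp
qed

theorem theorem1p3:
  shows "(\<forall>(p::real^2) q r t. \<not> collinear {p, q, r} \<and> p + q + r = 0 \<and>
            t \<in> (\<lambda>z. - J z) ` frontier (convex hull {p, q, r}) \<longrightarrow>
            symp_ball (interior (convex hull {p, q, r}) \<times>
              interior (convex hull (J ` (convex hull {p, q, r}) \<union>
                                     (\<lambda>z. - J z + t) ` (convex hull {p, q, r})))))
   \<and> (\<forall>(a::real^2) s a1 a2. s > 0 \<and> a1 \<in> {0..1} \<and> a2 \<in> {0..1} \<longrightarrow>
            symp_ball (interior (cbox a (a + vector [s, s])) \<times> interior (diamond a1 a2)))
   \<and> (\<forall>(Q::(real^2) set) (M::real^2^2) (c::real^2) a1 a2.
          is_trapezoid Q \<and> \<not> is_triangle Q \<and> \<not> is_parallelogram Q \<and>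
          invertible M \<and> a1 \<in> {0..1} \<and> a2 \<in> {0..1} \<and>
          Q = (\<lambda>v. M *v v + c) ` diamond a1 a2 \<longrightarrow>
          symp_ball (interior Q \<times>
             interior ((\<lambda>v. matrix_inv (transpose M) *v v) ` cbox 0 (vec 1))))"
  by (intro conjI allI impI; elim conjE;
    ((rule symp_ball_triangle; assumption) | (rule symp_ball_square; assumption) | (simp only: symp_ball_trapezoid)))

end
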